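(* Let $T,\beta,r>0$, $\delta\ge0$, $\alpha\in\mathbb{R}$, $u_0\in L^2(0,L)$, let $\ell=\ell(x,y;r)$ be the smooth backstepping kernel described in the context, and let $$g_0(t)=\int_0^L\ell(0,y)\,u(y,t)\,dy.$$ Then the closed-loop problem $$\begin{cases} iu_t+i\beta u_{xxx}+\alpha u_{xx}+i\delta u_x=0,& x\in(0,L),\ t\in(0,T),\\ u(0,t)=g_0(t),\ u_x(L,t)=0,\ u_{xx}(L,t)=0,\\ u(x,0)=u_0(x)\end{cases}$$ has a unique mild solution $u\in C([0,T];L^2(0,L))\cap L^2(0,T;H^1(0,L))$ with $u_x(0,\cdot)\in L^2(0,T)$ that satisfies $$|u(\cdot,t)|_2\le c_\ell\,|u_0|_2\,e^{-rt},\qquad t\ge0,$$ where $c_\ell\ge0$ depends only on $\ell$ and is given by $c_\ell=\left|(I-\Upsilon_\ell)^{-1}\right|_{2\to2}\left(1+|\ell|_{L^2(\Delta_{x,y})}\right)$.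
   Context: $L>0$ is fixed, functions are complex valued, $|\cdot|_2$ is the $L^2(0,L)$ norm, and $|\cdot|_{2\to2}$ is the operator norm on $L^2(0,L)$. Put $\tilde\alpha=\alpha/\beta$, $\tilde\delta=\delta/\beta$, $\tilde r=r/\beta$ and $\Delta_{x,y}=\{(x,y):0<x<L,\ x<y<L\}$. Backstepping kernel: $\ell$ is the $C^\infty$ solution (smooth up to the boundary of $\Delta_{x,y}$) of $$\ell_{xxx}+\ell_{yyy}-i\tilde\alpha(\ell_{xx}-\ell_{yy})+\tilde\delta(\ell_x+\ell_y)+\tilde r\ell=0\ \text{ in }\Delta_{x,y},$$ $$\left(\ell_{yy}+i\tilde\alpha\ell_y+\tilde\delta\ell\right)(x,L)=0,\quad \ell(x,x)=0,\quad \ell_x(x,x)=\frac{\tilde r(L-x)}{3},$$ given by $\ell(x,y)=G(y-x,L-y)$, where $G$ is the limit (uniform with all derivatives on $0\le s\le L$, $0\le t\le L-s$) of $G^0=0$, $G^{n+1}(s,t)=-\frac{\tilde r}{3}st+(QG^n)(s,t)$ with $$(QG)(s,t)=\int_0^s(2G_t-i\tilde\alpha G)(\omega,t)\,d\omega+\int_0^s\!\int_0^\omega(-G_{tt}+i\tilde\alpha G_t-\tilde\delta G)(\xi,t)\,d\xi\,d\omega$$ $$\qquad+\frac13\int_0^s\!\int_0^\omega\!\int_0^t\left(-3G_{tts}+2G_{ttt}+i\tilde\alpha(G_{ts}-2G_{tt})+2\tilde\delta G_t+\tilde rG\right)(\xi,\eta)\,d\eta\,d\xi\,d\omega.$$ $(\Upsilon_\ell\varphi)(x)=\int_x^L\ell(x,y)\varphi(y)\,dy$;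 $I-\Upsilon_\ell$ is boundedly invertible on $H^l(0,L)$, $l\ge0$. Mild solution: let $S(t)$ be the $C_0$-semigroup on $L^2(0,L)$ generated by $A\varphi=-\beta\varphi'''+i\alpha\varphi''-\delta\varphi'$, $D(A)=\{\varphi\in H^3(0,L):\varphi(0)=\varphi'(L)=\varphi''(L)=0\}$. A mild solution of the closed-loop problem is a function $u$ such that $w=(I-\Upsilon_\ell)u$ is the mild solution $w(t)=e^{-rt}S(t)w_0$, $w_0=(I-\Upsilon_\ell)u_0$, of $iw_t+i\beta w_{xxx}+\alpha w_{xx}+i\delta w_x+irw=0$, $w(0,t)=w_x(L,t)=w_{xx}(L,t)=0$, $w(x,0)=w_0(x)$. *)

theory Defs
  imports "HOL-Analysis.Analysis"
begin

text \<open>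
  Elements of \<open>L\<^sup>2(0,L)\<close> are represented by functions on the reals, of which only the values
  almost everywhere on \<open>(0,L)\<close> matter. A time-dependent \<open>u\<close> is curried with time first, so that
  \<open>u t x\<close> stands for $u(x,t)$ and \<open>u t\<close> is an element of \<open>L\<^sup>2(0,L)\<close>.
\<close>

subsection \<open>The spaces \<open>L\<^sup>2(0,L)\<close> and \<open>H\<^sup>k(0,L)\<close>\<close>

abbreviation leb :: "real \<Rightarrow> real measure" where
  "leb L \<equiv> lebesgue_on {0<..<L}"

definition L2 :: "real \<Rightarrow> (real \<Rightarrow> complex) set" where
  "L2 L = {f. f \<in> borel_measurable (leb L) \<and> integrable (leb L) (\<lambda>x. (cmod (f x))\<^sup>2)}"

definition L2_norm :: "real \<Rightarrow> (real \<Rightarrow> complex) \<Rightarrow> real" where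
  "L2_norm L f = sqrt (LINT x|leb L. (cmod (f x))\<^sup>2)"

text \<open>Real-valued test functions suffice, by linearity, for complex-valued \<open>f\<close>.\<close>

definition test_function :: "real \<Rightarrow> (real \<Rightarrow> real) \<Rightarrow> bool" where
  "test_function L \<psi> \<longleftrightarrow>
     (\<forall>n x. (deriv ^^ n) \<psi> differentiable (at x)) \<and>
     (\<exists>a b. 0 < a \<and> b < L \<and> (\<forall>x. x \<notin> {a..b} \<longrightarrow> \<psi> x = 0))"

definition weak_deriv :: "real \<Rightarrow> nat \<Rightarrow> (real \<Rightarrow> complex) \<Rightarrow> (real \<Rightarrow> complex) \<Rightarrow> bool" where
  "weak_deriv L k f g \<longleftrightarrow>
     (\<forall>\<psi>. test_function L \<psi> \<longrightarrow>
        (LINT x|leb L. f x * of_real ((deriv ^^ k) \<psi> x))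
          = (- 1) ^ k * (LINT x|leb L. g x * of_real (\<psi> x)))"

definition sobolev :: "real \<Rightarrow> nat \<Rightarrow> (real \<Rightarrow> complex) set" where
  "sobolev L k = {f \<in> L2 L. \<forall>j\<le>k. \<exists>g\<in>L2 L. weak_deriv L j f g}"

text \<open>The chosen derivative is determined up to a null set whenever it exists.\<close>

definition wderiv :: "real \<Rightarrow> nat \<Rightarrow> (real \<Rightarrow> complex) \<Rightarrow> real \<Rightarrow> complex" where
  "wderiv L k f = (SOME g. g \<in> L2 L \<and> weak_deriv L k f g)"

definition H1_norm :: "real \<Rightarrow> (real \<Rightarrow> complex) \<Rightarrow> real" where
  "H1_norm L f = sqrt ((L2_norm L f)\<^sup>2 + (L2_norm L (wderiv L 1 f))\<^sup>2)"

text \<open>Value at \<open>a \<in> [0,L]\<close> of the representative of \<open>f\<close> that is continuous on \<open>[0,L]\<close>.\<close>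

definition has_trace :: "real \<Rightarrow> (real \<Rightarrow> complex) \<Rightarrow> real \<Rightarrow> complex \<Rightarrow> bool" where
  "has_trace L f a c \<longleftrightarrow>
     (\<exists>g. continuous_on {0..L} g \<and> (AE x in leb L. f x = g x) \<and> g a = c)"

text \<open>The spaces \<open>C([0,T]; L\<^sup>2(0,L))\<close> and, in the sense of Bochner, \<open>L\<^sup>2(0,T; H\<^sup>1(0,L))\<close>.\<close>

definition C_L2 :: "real \<Rightarrow> real \<Rightarrow> (real \<Rightarrow> real \<Rightarrow> complex) set" where
  "C_L2 T L = {u. \<forall>t\<in>{0..T}. u t \<in> L2 L \<and>
     ((\<lambda>\<tau>. L2_norm L (\<lambda>x. u \<tau> x - u t x)) \<longlongrightarrow> 0) (at t within {0..T})}"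

definition L2_H1 :: "real \<Rightarrow> real \<Rightarrow> (real \<Rightarrow> real \<Rightarrow> complex) set" where
  "L2_H1 T L = {u.
     (AE t in leb T. u t \<in> sobolev L 1) \<and>
     (\<exists>s :: nat \<Rightarrow> real \<Rightarrow> real \<Rightarrow> complex.
        (\<forall>n. simple_function (leb T) (s n) \<and> (\<forall>t. s n t \<in> sobolev L 1)) \<and>
        (AE t in leb T. (\<lambda>n. H1_norm L (\<lambda>x. s n t x - u t x)) \<longlonglongrightarrow> 0)) \<and>
     integrable (leb T) (\<lambda>t. (H1_norm L (u t))\<^sup>2)}"


subsection \<open>The semigroup generated by \<open>A\<close>\<close>

definition bounded_operator :: "real \<Rightarrow> ((real \<Rightarrow> complex) \<Rightarrow> real \<Rightarrow> complex) \<Rightarrow> bool" where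
  "bounded_operator L B \<longleftrightarrow>
     (\<forall>f\<in>L2 L. B f \<in> L2 L) \<and>
     (\<forall>f\<in>L2 L. \<forall>g\<in>L2 L. \<forall>a b.
        AE x in leb L. B (\<lambda>x. a * f x + b * g x) x = a * B f x + b * B g x) \<and>
     (\<exists>C. \<forall>f\<in>L2 L. L2_norm L (B f) \<le> C * L2_norm L f)"

definition op_norm :: "real \<Rightarrow> ((real \<Rightarrow> complex) \<Rightarrow> real \<Rightarrow> complex) \<Rightarrow> real" where
  "op_norm L B = (SUP f\<in>{f \<in> L2 L. L2_norm L f \<le> 1}. L2_norm L (B f))"

definition C0_semigroup :: "real \<Rightarrow> (real \<Rightarrow> (real \<Rightarrow> complex) \<Rightarrow> real \<Rightarrow> complex) \<Rightarrow> bool" where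
  "C0_semigroup L S \<longleftrightarrow>
     (\<forall>t\<ge>0. bounded_operator L (S t)) \<and>
     (\<forall>f\<in>L2 L. AE x in leb L. S 0 f x = f x) \<and>
     (\<forall>s\<ge>0. \<forall>t\<ge>0. \<forall>f\<in>L2 L. AE x in leb L. S (s + t) f x = S s (S t f) x) \<and>
     (\<forall>f\<in>L2 L. ((\<lambda>t. L2_norm L (\<lambda>x. S t f x - f x)) \<longlongrightarrow> 0) (at_right 0))"

definition in_generator ::
  "real \<Rightarrow> (real \<Rightarrow> (real \<Rightarrow> complex) \<Rightarrow> real \<Rightarrow> complex) \<Rightarrow>
    (real \<Rightarrow> complex) \<Rightarrow> (real \<Rightarrow> complex) \<Rightarrow> bool" where
  "in_generator L S f g \<longleftrightarrow> f \<in> L2 L \<and> g \<in> L2 L \<and>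
     ((\<lambda>h. L2_norm L (\<lambda>x. (S h f x - f x) / of_real h - g x)) \<longlongrightarrow> 0) (at_right 0)"

definition op_A :: "real \<Rightarrow> real \<Rightarrow> real \<Rightarrow> real \<Rightarrow> (real \<Rightarrow> complex) \<Rightarrow> real \<Rightarrow> complex" where
  "op_A L \<alpha> \<beta> \<delta> \<phi> x =
     - of_real \<beta> * wderiv L 3 \<phi> x + \<i> * of_real \<alpha> * wderiv L 2 \<phi> x - of_real \<delta> * wderiv L 1 \<phi> x"

definition dom_A :: "real \<Rightarrow> (real \<Rightarrow> complex) set" where
  "dom_A L = {\<phi> \<in> sobolev L 3.
     has_trace L \<phi> 0 0 \<and> has_trace L (wderiv L 1 \<phi>) L 0 \<and> has_trace L (wderiv L 2 \<phi>) L 0}"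

definition semigroup_generated_by_A ::
  "real \<Rightarrow> real \<Rightarrow> real \<Rightarrow> real \<Rightarrow> (real \<Rightarrow> (real \<Rightarrow> complex) \<Rightarrow> real \<Rightarrow> complex) \<Rightarrow> bool" where
  "semigroup_generated_by_A L \<alpha> \<beta> \<delta> S \<longleftrightarrow>
     C0_semigroup L S \<and>
     (\<forall>f\<in>L2 L. \<forall>g\<in>L2 L.
        in_generator L S f g \<longleftrightarrow> f \<in> dom_A L \<and> (AE x in leb L. g x = op_A L \<alpha> \<beta> \<delta> f x))"


subsection \<open>The backstepping kernel\<close>

text \<open>
  \<open>f\<close> is smooth up to the boundary of \<open>K\<close>, and \<open>D a b\<close> is the partial derivative of order \<open>a\<close> in
  the first and \<open>b\<close> in the second variable, extended continuously to \<open>K\<close>. When \<open>K\<close> is a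
  nondegenerate closed triangle, \<open>D\<close> is determined on \<open>K\<close> by \<open>f\<close>.
\<close>

definition smooth_with_partials ::
  "(real \<times> real) set \<Rightarrow> (real \<times> real \<Rightarrow> complex) \<Rightarrow>
    (nat \<Rightarrow> nat \<Rightarrow> real \<times> real \<Rightarrow> complex) \<Rightarrow> bool" where
  "smooth_with_partials K f D \<longleftrightarrow>
     (\<forall>p\<in>K. D 0 0 p = f p) \<and>
     (\<forall>a b. continuous_on K (D a b)) \<and>
     (\<forall>a b x y. (x, y) \<in> interior K \<longrightarrow>
        ((\<lambda>\<xi>. D a b (\<xi>, y)) has_vector_derivative D (Suc a) b (x, y)) (at x) \<and>
        ((\<lambda>\<eta>. D a b (x, \<eta>)) has_vector_derivative D a (Suc b) (x, y)) (at y))"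

definition Delta_xy :: "real \<Rightarrow> (real \<times> real) set" where
  "Delta_xy L = {(x, y). 0 < x \<and> x < L \<and> x < y \<and> y < L}"

definition Delta_st :: "real \<Rightarrow> (real \<times> real) set" where
  "Delta_st L = {(s, t). 0 \<le> s \<and> s \<le> L \<and> 0 \<le> t \<and> t \<le> L - s}"

text \<open>In \<open>op_Q\<close> the argument \<open>D\<close> is the family of partial derivatives of \<open>G\<close>: for instance
  \<open>D 1 2\<close> is $G_{tts}$. The parameters \<open>a\<close>, \<open>d\<close>, \<open>r\<close> of the definitions below are
  $\tilde\alpha$, $\tilde\delta$, $\tilde r$.\<close>

definition op_Q ::
  "real \<Rightarrow> real \<Rightarrow> real \<Rightarrow> (nat \<Rightarrow> nat \<Rightarrow> real \<times> real \<Rightarrow> complex) \<Rightarrow> real \<Rightarrow> real \<Rightarrow> complex" where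
  "op_Q a d r D s t =
     integral {0..s} (\<lambda>\<omega>. 2 * D 0 1 (\<omega>, t) - \<i> * of_real a * D 0 0 (\<omega>, t)) +
     integral {0..s} (\<lambda>\<omega>. integral {0..\<omega>} (\<lambda>\<xi>.
       - D 0 2 (\<xi>, t) + \<i> * of_real a * D 0 1 (\<xi>, t) - of_real d * D 0 0 (\<xi>, t))) +
     1 / 3 * integral {0..s} (\<lambda>\<omega>. integral {0..\<omega>} (\<lambda>\<xi>. integral {0..t} (\<lambda>\<eta>.
       - 3 * D 1 2 (\<xi>, \<eta>) + 2 * D 0 3 (\<xi>, \<eta>)
       + \<i> * of_real a * (D 1 1 (\<xi>, \<eta>) - 2 * D 0 2 (\<xi>, \<eta>))
       + 2 * of_real d * D 0 1 (\<xi>, \<eta>) + of_real r * D 0 0 (\<xi>, \<eta>))))"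

definition is_iteration_limit ::
  "real \<Rightarrow> real \<Rightarrow> real \<Rightarrow> real \<Rightarrow> (real \<times> real \<Rightarrow> complex) \<Rightarrow> bool" where
  "is_iteration_limit L a d r G \<longleftrightarrow>
     (\<exists>(Gn :: nat \<Rightarrow> real \<times> real \<Rightarrow> complex) (Dn :: nat \<Rightarrow> nat \<Rightarrow> nat \<Rightarrow> real \<times> real \<Rightarrow> complex) D.
        (\<forall>n. smooth_with_partials (Delta_st L) (Gn n) (Dn n)) \<and>
        (\<forall>p\<in>Delta_st L. Gn 0 p = 0) \<and>
        (\<forall>n. \<forall>(s, t)\<in>Delta_st L.
           Gn (Suc n) (s, t) = - of_real (r / 3 * s * t) + op_Q a d r (Dn n) s t) \<and>
        smooth_with_partials (Delta_st L) G D \<and>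
        (\<forall>j k. uniform_limit (Delta_st L) (\<lambda>n. Dn n j k) (D j k) sequentially))"

definition backstepping_kernel ::
  "real \<Rightarrow> real \<Rightarrow> real \<Rightarrow> real \<Rightarrow> (real \<Rightarrow> real \<Rightarrow> complex) \<Rightarrow> bool" where
  "backstepping_kernel L a d r ell \<longleftrightarrow>
     (\<exists>D. smooth_with_partials (closure (Delta_xy L)) (\<lambda>(x, y). ell x y) D \<and>
        (\<forall>p\<in>Delta_xy L.
           D 3 0 p + D 0 3 p - \<i> * of_real a * (D 2 0 p - D 0 2 p)
           + of_real d * (D 1 0 p + D 0 1 p) + of_real r * D 0 0 p = 0) \<and>
        (\<forall>x\<in>{0..L}. D 0 2 (x, L) + \<i> * of_real a * D 0 1 (x, L) + of_real d * D 0 0 (x, L) = 0) \<and>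
        (\<forall>x\<in>{0..L}. ell x x = 0) \<and>
        (\<forall>x\<in>{0..L}. D 1 0 (x, x) = of_real (r * (L - x) / 3))) \<and>
     (\<exists>G. is_iteration_limit L a d r G \<and>
        (\<forall>(x, y)\<in>closure (Delta_xy L). ell x y = G (y - x, L - y)))"


subsection \<open>The backstepping transformation and mild solutions\<close>

definition Upsilon ::
  "real \<Rightarrow> (real \<Rightarrow> real \<Rightarrow> complex) \<Rightarrow> (real \<Rightarrow> complex) \<Rightarrow> real \<Rightarrow> complex" where
  "Upsilon L ell \<phi> x = (LINT y|lebesgue_on {x<..<L}. ell x y * \<phi> y)"

definition I_minus_Upsilon ::
  "real \<Rightarrow> (real \<Rightarrow> real \<Rightarrow> complex) \<Rightarrow> (real \<Rightarrow> complex) \<Rightarrow> real \<Rightarrow> complex" where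
  "I_minus_Upsilon L ell \<phi> x = \<phi> x - Upsilon L ell \<phi> x"

text \<open>The inverse on \<open>L\<^sup>2(0,L)\<close>; its value is determined up to a null set.\<close>

definition inv_I_minus_Upsilon ::
  "real \<Rightarrow> (real \<Rightarrow> real \<Rightarrow> complex) \<Rightarrow> (real \<Rightarrow> complex) \<Rightarrow> real \<Rightarrow> complex" where
  "inv_I_minus_Upsilon L ell f =
     (SOME \<phi>. \<phi> \<in> L2 L \<and> (AE x in leb L. I_minus_Upsilon L ell \<phi> x = f x))"

definition c_kernel :: "real \<Rightarrow> (real \<Rightarrow> real \<Rightarrow> complex) \<Rightarrow> real" where
  "c_kernel L ell = op_norm L (inv_I_minus_Upsilon L ell) *
     (1 + sqrt (LINT p|lebesgue_on (Delta_xy L). (cmod (ell (fst p) (snd p)))\<^sup>2))"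

text \<open>Mild solution, for times in \<open>J\<close>, of the closed-loop problem with initial datum \<open>u0\<close>; here \<open>r\<close>
  is the decay rate itself, not $\tilde r$.\<close>

definition mild_solution ::
  "real \<Rightarrow> real \<Rightarrow> (real \<Rightarrow> (real \<Rightarrow> complex) \<Rightarrow> real \<Rightarrow> complex) \<Rightarrow> (real \<Rightarrow> real \<Rightarrow> complex) \<Rightarrow>
    real set \<Rightarrow> (real \<Rightarrow> complex) \<Rightarrow> (real \<Rightarrow> real \<Rightarrow> complex) \<Rightarrow> bool" where
  "mild_solution L r S ell J u0 u \<longleftrightarrow>
     (\<forall>t\<in>J. u t \<in> L2 L \<and>
        (AE x in leb L. I_minus_Upsilon L ell (u t) x
           = of_real (exp (- r * t)) * S t (I_minus_Upsilon L ell u0) x))"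

definition feedback :: "real \<Rightarrow> (real \<Rightarrow> real \<Rightarrow> complex) \<Rightarrow> (real \<Rightarrow> real \<Rightarrow> complex) \<Rightarrow> real \<Rightarrow> complex" where
  "feedback L ell u t = (LINT y|leb L. ell 0 y * u t y)"

end

theory Submission
  imports Defs
begin

text \<open>
  The transformation \<open>I - \<Upsilon>\<close> reduces everything to \<open>w(t) = exp(-rt) S(t) w\<^sub>0\<close> and to a Volterra
  operator, which is inverted by its Neumann series in a weighted supremum norm. The kernel vanishes
  on the diagonal, so \<open>\<Upsilon>\<close> maps \<open>L\<^sup>2\<close> into \<open>C\<^sup>1\<close>, and \<open>u = w + \<Upsilon>u\<close> inherits the regularity of \<open>w\<close> and
  has the trace \<open>(\<Upsilon>u)(0)\<close>, which is the feedback. Decay is contractivity of \<open>S\<close>, with the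
  Hilbert--Schmidt norm of \<open>\<Upsilon>\<close> bounding \<open>w\<^sub>0\<close> by \<open>u\<^sub>0\<close>.

  The regularity of \<open>w\<close> is Kato's: testing with \<open>(1 + x) w\<close> bounds the integral over \<open>(0,T)\<close> of
  \<open>\<beta>|w\<^sub>x|\<^sup>2 + \<beta>/2 |w\<^sub>x(0)|\<^sup>2\<close>. To apply this to every \<open>w\<^sub>0\<close> in \<open>L\<^sup>2\<close>, one shows that \<open>S(t) w\<^sub>0\<close> lies in the
  domain of \<open>A\<close> for \<open>t > 0\<close>: the same energy estimate, applied to both \<open>f\<close> and \<open>A f\<close>, and an interpolation
  inequality bound \<open>s\<^sup>3 |A S(s) f|\<close> by \<open>|f|\<close> for regular \<open>f\<close>, and regular \<open>f\<close> are dense.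
\<close>

subsection \<open>The space \<open>L\<^sup>2(0,L)\<close>\<close>

text \<open>The hypotheses give a generator and strong continuity, but no bound on \<open>S\<close>
  uniform in time and no regularity at positive times, while the energy estimates make sense only on
  \<open>dom_A\<close>. Approximation by smooth data alone would give the integral bounds, but
  Bochner measurability in \<open>H\<^sup>1\<close> and the trace of the derivative at almost every
  time would have to be extracted from limits. Membership in the domain at every positive time
  settles both: differences of two points of an orbit obey the same estimates, so the orbit and the
  trace of its derivative are continuous for \<open>t > 0\<close>, hence measurable, and only the
  singularity at 0 is left to monotone convergence. The smoothing bound looks circular, as it
  controls \<open>A S(s) f\<close> by \<open>A S(s/2) f\<close>; it closes because the latter enters
  with a lower power than the former. \<open>A\<close> maps test functions to test functions, so
  these supply \<open>f\<close>, \<open>A f\<close> and \<open>A A f\<close> at once.\<close>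

lemma finite_measure_leb: "finite_measure (leb L)"
  by (rule finite_measure_lebesgue_on) simp

lemma L2_measurable: "f \<in> L2 L \<Longrightarrow> f \<in> borel_measurable (leb L)"
  by (simp add: L2_def)

lemma L2_square_integrable: "f \<in> L2 L \<Longrightarrow> integrable (leb L) (\<lambda>x. (cmod (f x))\<^sup>2)"
  by (simp add: L2_def)

lemma L2_norm_nonneg [simp]: "0 \<le> L2_norm L f"
  by (simp add: L2_norm_def)

lemma L2_norm_power2: "(L2_norm L f)\<^sup>2 = (LINT x|leb L. (cmod (f x))\<^sup>2)"
  by (simp add: L2_norm_def)

lemma L2_norm_cong_AE:
  assumes "f \<in> borel_measurable (leb L)" "g \<in> borel_measurable (leb L)"
    and "AE x in leb L. f x = g x"
  shows "L2_norm L f = L2_norm L g"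
proof -
  have "(LINT x|leb L. (cmod (f x))\<^sup>2) = (LINT x|leb L. (cmod (g x))\<^sup>2)"
    using assms by (intro integral_cong_AE) auto
  then show ?thesis by (simp add: L2_norm_def)
qed

lemma L2_bound:
  assumes "g \<in> L2 L" "f \<in> borel_measurable (leb L)"
    and "AE x in leb L. cmod (f x) \<le> C * cmod (g x)"
  shows "f \<in> L2 L" "0 \<le> C \<Longrightarrow> L2_norm L f \<le> C * L2_norm L g"
proof -
  have *: "AE x in leb L. (cmod (f x))\<^sup>2 \<le> C\<^sup>2 * (cmod (g x))\<^sup>2"
    using assms(3) by eventually_elim (metis norm_ge_zero power_mono power_mult_distrib)
  have i: "integrable (leb L) (\<lambda>x. C\<^sup>2 * (cmod (g x))\<^sup>2)"
    using L2_square_integrable[OF assms(1)] by simp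
  have "integrable (leb L) (\<lambda>x. (cmod (f x))\<^sup>2)"
    by (rule Bochner_Integration.integrable_bound[OF i]) (use assms(2) * in auto)
  then show f: "f \<in> L2 L" using assms(2) by (simp add: L2_def)
  assume C: "0 \<le> C"
  have "(L2_norm L f)\<^sup>2 \<le> (C * L2_norm L g)\<^sup>2"
    unfolding L2_norm_power2 power_mult_distrib
    using integral_mono_AE[OF L2_square_integrable[OF f] i *] by simp
  then show "L2_norm L f \<le> C * L2_norm L g"
    by (rule power2_le_imp_le) (use C in auto)
qed

lemma L2_bounded:
  assumes "f \<in> borel_measurable (leb L)" "AE x in leb L. cmod (f x) \<le> C" "0 \<le> L"
  shows "f \<in> L2 L" "0 \<le> C \<Longrightarrow> L2_norm L f \<le> C * sqrt L"
proof -
  interpret finite_measure "leb L" by (rule finite_measure_leb)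
  have one: "(\<lambda>x. 1) \<in> L2 L" by (simp add: L2_def)
  have n: "L2_norm L (\<lambda>x. 1) = sqrt L" using assms(3) by (simp add: L2_norm_def measure_restrict_space)
  show "f \<in> L2 L" "0 \<le> C \<Longrightarrow> L2_norm L f \<le> C * sqrt L"
    using L2_bound[OF one assms(1), of C] assms(2) n by auto
qed

lemma L2_prod_integrable:
  assumes "f \<in> L2 L" "g \<in> L2 L"
  shows "integrable (leb L) (\<lambda>x. cmod (f x) * cmod (g x))"
proof -
  have [measurable]: "f \<in> borel_measurable (leb L)" "g \<in> borel_measurable (leb L)"
    using assms by (auto intro: L2_measurable)
  have i: "integrable (leb L) (\<lambda>x. (cmod (f x))\<^sup>2 + (cmod (g x))\<^sup>2)"
    using assms by (auto dest: L2_square_integrable)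
  have "norm (cmod (f x) * cmod (g x)) \<le> norm ((cmod (f x))\<^sup>2 + (cmod (g x))\<^sup>2)" for x
  proof -
    have "0 \<le> cmod (f x) * cmod (g x)" "2 * (cmod (f x) * cmod (g x)) \<le> (cmod (f x))\<^sup>2 + (cmod (g x))\<^sup>2"
      using sum_squares_bound[of "cmod (f x)" "cmod (g x)"] by (simp_all add: mult.assoc)
    then have "cmod (f x) * cmod (g x) \<le> (cmod (f x))\<^sup>2 + (cmod (g x))\<^sup>2" by linarith
    then show ?thesis by simp
  qed
  then show ?thesis by (intro Bochner_Integration.integrable_bound[OF i]) auto
qed

text \<open>The inequality is taken for nonnegative extended integrals and read back as one between
  reals through the integrable squares.\<close>

lemma L2_Cauchy_Schwarz:
  assumes "f \<in> L2 L" "g \<in> L2 L"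
  shows "(LINT x|leb L. cmod (f x) * cmod (g x)) \<le> L2_norm L f * L2_norm L g"
proof -
  have [measurable]: "f \<in> borel_measurable (leb L)" "g \<in> borel_measurable (leb L)"
    using assms by (auto intro: L2_measurable)
  let ?I = "LINT x|leb L. cmod (f x) * cmod (g x)"
  have I: "0 \<le> ?I" by simp
  have "(\<integral>\<^sup>+x. ennreal (cmod (f x)) * ennreal (cmod (g x)) \<partial>leb L)\<^sup>2
    \<le> (\<integral>\<^sup>+x. (ennreal (cmod (f x)))\<^sup>2 \<partial>leb L) * (\<integral>\<^sup>+x. (ennreal (cmod (g x)))\<^sup>2 \<partial>leb L)"
    by (rule Cauchy_Schwarz_nn_integral) auto
  also have "(\<integral>\<^sup>+x. ennreal (cmod (f x)) * ennreal (cmod (g x)) \<partial>leb L) = ennreal ?I"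
    using nn_integral_eq_integral[OF L2_prod_integrable[OF assms]] by (simp add: ennreal_mult)
  also have "(\<integral>\<^sup>+x. (ennreal (cmod (f x)))\<^sup>2 \<partial>leb L) = ennreal ((L2_norm L f)\<^sup>2)"
    using nn_integral_eq_integral[OF L2_square_integrable[OF assms(1)]]
    by (simp add: ennreal_power L2_norm_power2)
  also have "(\<integral>\<^sup>+x. (ennreal (cmod (g x)))\<^sup>2 \<partial>leb L) = ennreal ((L2_norm L g)\<^sup>2)"
    using nn_integral_eq_integral[OF L2_square_integrable[OF assms(2)]]
    by (simp add: ennreal_power L2_norm_power2)
  finally have "?I\<^sup>2 \<le> (L2_norm L f * L2_norm L g)\<^sup>2"
    using I by (simp add: ennreal_power flip: ennreal_mult add: power_mult_distrib)
  then show ?thesis by (rule power2_le_imp_le) auto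
qed

lemma L2_mult_integrable:
  assumes "f \<in> L2 L" "g \<in> L2 L"
  shows "integrable (leb L) (\<lambda>x. f x * g x)" "integrable (leb L) (\<lambda>x. f x \<bullet> g x)"
proof -
  have [measurable]: "f \<in> borel_measurable (leb L)" "g \<in> borel_measurable (leb L)"
    using assms by (auto intro: L2_measurable)
  show "integrable (leb L) (\<lambda>x. f x * g x)" "integrable (leb L) (\<lambda>x. f x \<bullet> g x)"
    by (rule Bochner_Integration.integrable_bound[OF L2_prod_integrable[OF assms]];
        auto simp: norm_mult Cauchy_Schwarz_ineq2)+
qed

lemma L2_mult_le:
  assumes "f \<in> L2 L" "g \<in> L2 L"
  shows "cmod (LINT x|leb L. f x * g x) \<le> L2_norm L f * L2_norm L g"
proof -
  have "cmod (LINT x|leb L. f x * g x) \<le> (LINT x|leb L. cmod (f x) * cmod (g x))"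
    using integral_norm_bound[of "leb L" "\<lambda>x. f x * g x"] by (simp add: norm_mult)
  then show ?thesis using L2_Cauchy_Schwarz[OF assms] by linarith
qed

lemma L2_const [simp]: "(\<lambda>x. c) \<in> L2 L"
proof -
  interpret finite_measure "leb L" by (rule finite_measure_leb)
  show ?thesis by (simp add: L2_def)
qed

lemma L2_integrable: "f \<in> L2 L \<Longrightarrow> integrable (leb L) f"
  using L2_mult_integrable(1)[of f L "\<lambda>x. 1"] by simp

lemma L2_integral_le:
  assumes "f \<in> L2 L" "0 \<le> L"
  shows "(LINT x|leb L. cmod (f x)) \<le> sqrt L * L2_norm L f"
proof -
  have n: "L2_norm L (\<lambda>x. 1) = sqrt L" using assms(2) by (simp add: L2_norm_def measure_restrict_space)
  show ?thesis using L2_Cauchy_Schwarz[OF assms(1), of "\<lambda>x. 1"] n by (simp add: mult.commute)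
qed

lemma L2_scale: "f \<in> L2 L \<Longrightarrow> (\<lambda>x. c * f x) \<in> L2 L"
  by (rule L2_bound(1)[where g = f and C = "cmod c"]) (auto simp: norm_mult intro!: borel_measurable_times dest: L2_measurable)

lemma L2_norm_scale: "L2_norm L (\<lambda>x. c * f x) = cmod c * L2_norm L f"
  by (simp add: L2_norm_def norm_mult power_mult_distrib real_sqrt_mult)

lemma L2_add: 
  assumes "f \<in> L2 L" "g \<in> L2 L" shows "(\<lambda>x. f x + g x) \<in> L2 L"
proof -
  have [measurable]: "f \<in> borel_measurable (leb L)" "g \<in> borel_measurable (leb L)"
    using assms by (auto intro: L2_measurable)
  have i: "integrable (leb L) (\<lambda>x. 2 * (cmod (f x))\<^sup>2 + 2 * (cmod (g x))\<^sup>2)"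
    using L2_square_integrable[OF assms(1)] L2_square_integrable[OF assms(2)] by simp
  have "norm ((cmod (f x + g x))\<^sup>2) \<le> norm (2 * (cmod (f x))\<^sup>2 + 2 * (cmod (g x))\<^sup>2)" for x
  proof -
    have "(cmod (f x + g x))\<^sup>2 \<le> (cmod (f x) + cmod (g x))\<^sup>2"
      by (rule power_mono[OF norm_triangle_ineq]) simp
    then show ?thesis using sum_squares_bound[of "cmod (f x)" "cmod (g x)"] 
      by (simp add: power2_sum)
  qed
  then have "integrable (leb L) (\<lambda>x. (cmod (f x + g x))\<^sup>2)"
    by (intro Bochner_Integration.integrable_bound[OF i]) auto
  then show ?thesis by (simp add: L2_def)
qed

lemma L2_diff: "f \<in> L2 L \<Longrightarrow> g \<in> L2 L \<Longrightarrow> (\<lambda>x. f x - g x) \<in> L2 L"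
  using L2_add[of f L "\<lambda>x. -1 * g x"] L2_scale[of g L "-1"] by simp

lemma L2_uminus: "f \<in> L2 L \<Longrightarrow> (\<lambda>x. - f x) \<in> L2 L"
  using L2_scale[of f L "-1"] by simp

lemma L2_cnj: "f \<in> L2 L \<Longrightarrow> (\<lambda>x. cnj (f x)) \<in> L2 L"
  by (rule L2_bound(1)[where g = f and C = 1])
    (auto intro: L2_measurable measurable_compose[OF L2_measurable borel_measurable_continuous_onI]
      simp: continuous_on_cnj)

lemma L2_norm_triangle:
  assumes "f \<in> L2 L" "g \<in> L2 L"
  shows "L2_norm L (\<lambda>x. f x + g x) \<le> L2_norm L f + L2_norm L g"
proof -
  have "(L2_norm L (\<lambda>x. f x + g x))\<^sup>2 \<le>
    (LINT x|leb L. (cmod (f x))\<^sup>2 + 2 * (cmod (f x) * cmod (g x)) + (cmod (g x))\<^sup>2)"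
    unfolding L2_norm_power2
  proof (rule integral_mono)
    show "(cmod (f x + g x))\<^sup>2 \<le> (cmod (f x))\<^sup>2 + 2 * (cmod (f x) * cmod (g x)) + (cmod (g x))\<^sup>2" for x
    proof -
      have "(cmod (f x + g x))\<^sup>2 \<le> (cmod (f x) + cmod (g x))\<^sup>2"
        by (rule power_mono[OF norm_triangle_ineq]) simp
      then show ?thesis by (simp add: power2_sum)
    qed
  qed (use L2_square_integrable[OF L2_add[OF assms]] assms[THEN L2_square_integrable] L2_prod_integrable[OF assms] in auto)
  also have "\<dots> = (L2_norm L f)\<^sup>2 + 2 * (LINT x|leb L. cmod (f x) * cmod (g x)) + (L2_norm L g)\<^sup>2"
    using assms[THEN L2_square_integrable] L2_prod_integrable[OF assms] by (simp add: L2_norm_power2)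
  also have "\<dots> \<le> (L2_norm L f + L2_norm L g)\<^sup>2"
    using L2_Cauchy_Schwarz[OF assms] by (simp add: power2_sum)
  finally show ?thesis by (rule power2_le_imp_le) simp
qed

lemma L2_norm_minus_commute: "L2_norm L (\<lambda>x. f x - g x) = L2_norm L (\<lambda>x. g x - f x)"
  by (simp add: L2_norm_def norm_minus_commute)

lemma L2_norm_triangle_diff:
  assumes "f \<in> L2 L" "g \<in> L2 L" "h \<in> L2 L"
  shows "L2_norm L (\<lambda>x. f x - h x) \<le> L2_norm L (\<lambda>x. f x - g x) + L2_norm L (\<lambda>x. g x - h x)"
  using L2_norm_triangle[OF L2_diff[OF assms(1,2)] L2_diff[OF assms(2,3)]] by simp

lemma L2_norm_triangle_sub:
  assumes "f \<in> L2 L" "g \<in> L2 L"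
  shows "L2_norm L (\<lambda>x. f x - g x) \<le> L2_norm L f + L2_norm L g"
  using L2_norm_triangle[OF assms(1) L2_uminus[OF assms(2)]] by (simp add: L2_norm_def)

lemma L2_norm_diff_ge:
  assumes "f \<in> L2 L" "g \<in> L2 L"
  shows "\<bar>L2_norm L f - L2_norm L g\<bar> \<le> L2_norm L (\<lambda>x. f x - g x)"
  using L2_norm_triangle[OF L2_diff[OF assms] assms(2)]
    L2_norm_triangle[OF L2_diff[OF assms(2,1)] assms(1)] L2_norm_minus_commute[of L f g] by simp

lemma L2_norm_zero: "L2_norm L (\<lambda>x. 0) = 0"
  by (simp add: L2_norm_def)

lemma L2_norm_eq_0_AE:
  assumes "f \<in> L2 L" "L2_norm L f = 0"
  shows "AE x in leb L. f x = 0"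
proof -
  have "(LINT x|leb L. (cmod (f x))\<^sup>2) = 0" using assms(2) L2_norm_power2[of L f] by simp
  then have "AE x in leb L. (cmod (f x))\<^sup>2 = 0"
    using integral_nonneg_eq_0_iff_AE[OF L2_square_integrable[OF assms(1)]] by simp
  then show ?thesis by simp
qed

lemma L2_norm_AE_zero:
  assumes "AE x in leb L. f x = 0"
  shows "L2_norm L f = 0"
proof -
  have "(LINT x|leb L. (cmod (f x))\<^sup>2) = 0"
    by (rule integral_eq_zero_AE) (use assms in auto)
  then show ?thesis by (simp add: L2_norm_def)
qed

text \<open>Riesz-Fischer: the increments have summable integrals, so the sequence converges almost
  everywhere, and Fatou turns the tail estimates into norm estimates for the limit. The geometric
  rate suits the two sequences fed to it, which are constructed with that rate, and it makes the
  speed of convergence explicit.\<close>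

theorem L2_complete:
  assumes x: "\<And>k. x k \<in> L2 L"
    and r: "\<And>k. L2_norm L (\<lambda>t. x (Suc k) t - x k t) \<le> (1/2) ^ k"
    and L: "0 \<le> L"
  obtains y where "y \<in> L2 L" "\<And>k. L2_norm L (\<lambda>t. x k t - y t) \<le> 2 * (1/2) ^ k"
proof -
  have [measurable]: "x k \<in> borel_measurable (leb L)" for k using x by (rule L2_measurable)
  have d: "(\<lambda>t. x (Suc k) t - x k t) \<in> L2 L" for k by (intro L2_diff x)
  have "(\<integral>\<^sup>+t. (\<Sum>k. ennreal (cmod (x (Suc k) t - x k t))) \<partial>leb L)
      = (\<Sum>k. \<integral>\<^sup>+t. ennreal (cmod (x (Suc k) t - x k t)) \<partial>leb L)"
    by (rule nn_integral_suminf) simp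
  also have "\<dots> \<le> (\<Sum>k. ennreal (sqrt L * (1/2) ^ k))"
  proof (rule suminf_le)
    fix k
    have "(\<integral>\<^sup>+t. ennreal (cmod (x (Suc k) t - x k t)) \<partial>leb L) = ennreal (LINT t|leb L. cmod (x (Suc k) t - x k t))"
      by (rule nn_integral_eq_integral) (use L2_integrable[OF d] in auto)
    also have "\<dots> \<le> ennreal (sqrt L * (1/2) ^ k)"
      using L2_integral_le[OF d L, of k] mult_left_mono[OF r, of "sqrt L" k] L
      by (intro ennreal_leI) simp
    finally show "(\<integral>\<^sup>+t. ennreal (cmod (x (Suc k) t - x k t)) \<partial>leb L) \<le> ennreal (sqrt L * (1/2) ^ k)" .
  qed auto
  also have "\<dots> < top"
    using L by (subst suminf_ennreal2) (auto intro!: summable_mult summable_geometric simp: less_top)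
  finally have "AE t in leb L. (\<Sum>k. ennreal (cmod (x (Suc k) t - x k t))) \<noteq> \<infinity>"
    by (intro nn_integral_PInf_AE) (auto simp: less_top)
  then have ae: "AE t in leb L. (\<lambda>k. x k t) \<longlonglongrightarrow> lim (\<lambda>k. x k t)"
  proof eventually_elim
    case (elim t)
    have "summable (\<lambda>k. norm (x (Suc k) t - x k t))"
      by (rule summable_suminf_not_top) (use elim in auto)
    then have "summable (\<lambda>k. x (Suc k) t - x k t)" by (rule summable_norm_cancel)
    then have "convergent (\<lambda>n. \<Sum>k<n. x (Suc k) t - x k t)" by (simp add: summable_iff_convergent)
    then have "convergent (\<lambda>n. x n t - x 0 t)" using sum_lessThan_telescope[of "\<lambda>k. x k t"] by simp
    then have "convergent (\<lambda>n. x n t - x 0 t + x 0 t)" by (intro convergent_add convergent_const)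
    then show ?case by (simp add: convergent_LIMSEQ_iff)
  qed
  define y where "y t = lim (\<lambda>k. x k t)" for t
  have [measurable]: "y \<in> borel_measurable (leb L)" unfolding y_def[abs_def] by (rule borel_measurable_lim_metric) simp
  \<comment> \<open>The subtracted term makes the induction telescope; it is dropped when the
    estimate is used.\<close>
  have tail: "L2_norm L (\<lambda>t. x (k + j) t - x k t) \<le> 2 * (1/2) ^ k - 2 * (1/2) ^ (k + j)" for k j
  proof (induction j)
    case 0 then show ?case by (simp add: L2_norm_zero)
  next
    case (Suc j)
    have "L2_norm L (\<lambda>t. x (k + Suc j) t - x k t) \<le> L2_norm L (\<lambda>t. x (Suc (k + j)) t - x (k + j) t) + L2_norm L (\<lambda>t. x (k + j) t - x k t)"
      using L2_norm_triangle_diff[OF x x x, of "k + Suc j" k "k + j"] by simp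
    also have "\<dots> \<le> (1/2) ^ (k + j) + (2 * (1/2) ^ k - 2 * (1/2) ^ (k + j))"
      using Suc.IH r[of "k + j"] by linarith
    finally show ?case by simp
  qed
  \<comment> \<open>Fatou along \<open>j\<close>: the distance to the limit is at most the lower
    limit of the distances inside the sequence.\<close>
  have fin: "(\<integral>\<^sup>+t. ennreal ((cmod (y t - x k t))\<^sup>2) \<partial>leb L) \<le> ennreal ((2 * (1/2) ^ k)\<^sup>2)" for k
  proof -
    have "(\<integral>\<^sup>+t. ennreal ((cmod (y t - x k t))\<^sup>2) \<partial>leb L)
      = (\<integral>\<^sup>+t. liminf (\<lambda>j. ennreal ((cmod (x (k + j) t - x k t))\<^sup>2)) \<partial>leb L)"
    proof (rule nn_integral_cong_AE)
      show "AE t in leb L. ennreal ((cmod (y t - x k t))\<^sup>2) = liminf (\<lambda>j. ennreal ((cmod (x (k + j) t - x k t))\<^sup>2))"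
        using ae
      proof eventually_elim
        case (elim t)
        then have "(\<lambda>j. x (k + j) t) \<longlonglongrightarrow> y t"
          using LIMSEQ_ignore_initial_segment[of "\<lambda>j. x j t" "y t" k] by (simp add: y_def add.commute)
        then have "(\<lambda>j. ennreal ((cmod (x (k + j) t - x k t))\<^sup>2)) \<longlonglongrightarrow> ennreal ((cmod (y t - x k t))\<^sup>2)"
          by (intro tendsto_ennrealI tendsto_intros)
        then show ?case by (rule lim_imp_Liminf[OF trivial_limit_sequentially, symmetric])
      qed
    qed
    also have "\<dots> \<le> liminf (\<lambda>j. \<integral>\<^sup>+t. ennreal ((cmod (x (k + j) t - x k t))\<^sup>2) \<partial>leb L)"
      by (rule nn_integral_liminf) simp
    also have "\<dots> \<le> ennreal ((2 * (1/2) ^ k)\<^sup>2)"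
    proof (rule order_trans[OF Liminf_le_Limsup Limsup_bounded], simp, rule always_eventually, rule allI)
      fix j
      have "(\<integral>\<^sup>+t. ennreal ((cmod (x (k + j) t - x k t))\<^sup>2) \<partial>leb L) = ennreal ((L2_norm L (\<lambda>t. x (k + j) t - x k t))\<^sup>2)"
        unfolding L2_norm_power2 
        by (rule nn_integral_eq_integral) (use L2_square_integrable[OF L2_diff[OF x x]] in auto)
      also have "\<dots> \<le> ennreal ((2 * (1/2) ^ k)\<^sup>2)"
      proof (intro ennreal_leI power_mono)
        have "0 \<le> (1/2 :: real) ^ (k + j)" by simp
        then show "L2_norm L (\<lambda>t. x (k + j) t - x k t) \<le> 2 * (1/2) ^ k" using tail[of k j] by linarith
      qed simp
      finally show "(\<integral>\<^sup>+t. ennreal ((cmod (x (k + j) t - x k t))\<^sup>2) \<partial>leb L) \<le> ennreal ((2 * (1/2) ^ k)\<^sup>2)" .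
    qed
    finally show ?thesis .
  qed
  have in1: "(\<lambda>t. y t - x k t) \<in> L2 L" for k
    unfolding L2_def using fin[of k]
    by (auto intro!: integrableI_bounded simp: le_less_trans[OF _ ennreal_less_top])
  have "L2_norm L (\<lambda>t. x k t - y t) \<le> 2 * (1/2) ^ k" for k
  proof -
    have "ennreal ((L2_norm L (\<lambda>t. y t - x k t))\<^sup>2) \<le> ennreal ((2 * (1/2) ^ k)\<^sup>2)"
      using fin[of k] nn_integral_eq_integral[OF L2_square_integrable[OF in1]] by (simp add: L2_norm_power2)
    then have "(L2_norm L (\<lambda>t. y t - x k t))\<^sup>2 \<le> (2 * (1/2) ^ k)\<^sup>2" by simp
    then have "L2_norm L (\<lambda>t. y t - x k t) \<le> 2 * (1/2) ^ k" by (rule power2_le_imp_le) simp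
    then show ?thesis by (simp add: L2_norm_minus_commute)
  qed
  moreover have "y \<in> L2 L" using L2_add[OF in1[of 0] x[of 0]] by simp
  ultimately show ?thesis using that by blast
qed

subsection \<open>Test functions\<close>

definition smooth :: "(real \<Rightarrow> real) \<Rightarrow> bool" where
  "smooth f \<longleftrightarrow> (\<forall>n x. (deriv ^^ n) f differentiable (at x))"

text \<open>A class closed under differentiation consists of functions with derivatives of all
  orders. Exhibiting such a class replaces formulas for the n-th derivative; each closure property
  below names its own class.\<close>

lemma smooth_coinduct:
  assumes "f \<in> C" and C: "\<And>g. g \<in> C \<Longrightarrow> \<exists>g'\<in>C. \<forall>x. (g has_real_derivative g' x) (at x)"
  shows "smooth f"
proof -
  have d: "deriv g \<in> C" if gC: "g \<in> C" for g
  proof -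
    obtain g' where g': "g' \<in> C" "\<And>x. (g has_real_derivative g' x) (at x)" using C[OF gC] by blast
    then have "deriv g = g'" by (auto intro: DERIV_imp_deriv)
    with g' show ?thesis by simp
  qed
  have "(deriv ^^ n) f \<in> C" for n by (induction n) (auto simp: assms(1) d)
  then show ?thesis unfolding smooth_def
    using C real_differentiable_def by blast
qed

lemma smooth_deriv: "smooth f \<Longrightarrow> smooth (deriv f)"
  unfolding smooth_def by (metis comp_apply funpow_Suc_right)

lemma smooth_DERIV: "smooth f \<Longrightarrow> (f has_real_derivative deriv f x) (at x)"
  unfolding smooth_def using DERIV_deriv_iff_real_differentiable by (metis funpow_0)

lemma smooth_continuous: "smooth f \<Longrightarrow> continuous_on A f"
  by (meson DERIV_isCont continuous_at_imp_continuous_on smooth_DERIV)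

lemma smooth_affine:
  assumes "smooth f" shows "smooth (\<lambda>x. f (a * x + b))"
proof (rule smooth_coinduct)
  show "(\<lambda>x. f (a * x + b)) \<in> {\<lambda>x. c * g (a * x + b) | c g. smooth g}"
    using assms by (intro CollectI exI[of _ 1] exI[of _ f]) simp
  fix h assume "h \<in> {\<lambda>x. c * g (a * x + b) | c g. smooth g}"
  then obtain c g where h: "h = (\<lambda>x. c * g (a * x + b))" "smooth g" by blast
  have "(h has_real_derivative (c * a) * deriv g (a * x + b)) (at x)" for x
  proof -
    have "((\<lambda>x. a * x + b) has_real_derivative a) (at x)" by (auto intro!: derivative_eq_intros)
    from DERIV_cmult[OF DERIV_chain2[OF smooth_DERIV[OF h(2)] this], of c]
    show ?thesis unfolding h by (simp add: mult_ac)
  qed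
  moreover have "(\<lambda>x. (c * a) * deriv g (a * x + b)) \<in> {\<lambda>x. c * g (a * x + b) | c g. smooth g}"
    using smooth_deriv[OF h(2)] by (intro CollectI exI[of _ "c * a"] exI[of _ "deriv g"]) simp
  ultimately show "\<exists>h'\<in>{\<lambda>x. c * g (a * x + b) | c g. smooth g}. \<forall>x. (h has_real_derivative h' x) (at x)"
    by (intro bexI allI)
qed

lemma smooth_add: "smooth f \<Longrightarrow> smooth g \<Longrightarrow> smooth (\<lambda>x. f x + g x)"
proof (rule smooth_coinduct[of _ "{\<lambda>x. f x + g x | f g. smooth f \<and> smooth g}"], blast)
  fix h assume "h \<in> {\<lambda>x. f x + g x | f g. smooth f \<and> smooth g}"
  then obtain f g where h: "h = (\<lambda>x. f x + g x)" "smooth f" "smooth g" by blast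
  have "(h has_real_derivative deriv f x + deriv g x) (at x)" for x
    unfolding h by (intro DERIV_add smooth_DERIV h)
  moreover have "(\<lambda>x. deriv f x + deriv g x) \<in> {\<lambda>x. f x + g x | f g. smooth f \<and> smooth g}"
    using smooth_deriv[OF h(2)] smooth_deriv[OF h(3)] by (intro CollectI exI[of _ "deriv f"] exI[of _ "deriv g"]) simp
  ultimately show "\<exists>h'\<in>{\<lambda>x. f x + g x | f g. smooth f \<and> smooth g}. \<forall>x. (h has_real_derivative h' x) (at x)"
    by (intro bexI allI)
qed

text \<open>Sums of products of two smooth functions: by Leibniz' rule they are closed under
  differentiation, which the products alone are not. This is the class for
  \<open>smooth_mult\<close>.\<close>

inductive_set products :: "(real \<Rightarrow> real) set" where
  prod: "smooth f \<Longrightarrow> smooth g \<Longrightarrow> (\<lambda>x. f x * g x) \<in> products"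
| plus: "f \<in> products \<Longrightarrow> g \<in> products \<Longrightarrow> (\<lambda>x. f x + g x) \<in> products"

lemma smooth_mult: 
  assumes "smooth f" "smooth g" shows "smooth (\<lambda>x. f x * g x)"
proof (rule smooth_coinduct)
  show "(\<lambda>x. f x * g x) \<in> products" using assms by (rule prod)
  fix h assume "h \<in> products"
  then show "\<exists>h'\<in>products. \<forall>x. (h has_real_derivative h' x) (at x)"
  proof induction
    case (prod f g)
    have "((\<lambda>x. f x * g x) has_real_derivative deriv f x * g x + deriv g x * f x) (at x)" for x
      by (intro DERIV_mult smooth_DERIV prod)
    moreover have "(\<lambda>x. deriv f x * g x + deriv g x * f x) \<in> products"
      using prod by (intro products.intros smooth_deriv)
    ultimately show ?case by (intro bexI allI)
  next
    case (plus f g)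
    then obtain f' g' where *: "f' \<in> products" "g' \<in> products"
      "\<And>x. (f has_real_derivative f' x) (at x)" "\<And>x. (g has_real_derivative g' x) (at x)" by blast
    have "((\<lambda>x. f x + g x) has_real_derivative f' x + g' x) (at x)" for x
      by (intro DERIV_add *)
    then show ?case using products.plus[OF *(1,2)] by (intro bexI allI)
  qed
qed

lemma smooth_const: "smooth (\<lambda>x. c)"
proof (rule smooth_coinduct)
  fix g :: "real \<Rightarrow> real" assume "g \<in> range (\<lambda>c x. c)"
  then have "\<forall>x. (g has_real_derivative 0) (at x)" by auto
  then show "\<exists>g'\<in>range (\<lambda>c x. c). \<forall>x. (g has_real_derivative g' x) (at x)"
    by (intro bexI[of _ "\<lambda>x. 0"]) auto
qed auto

section \<open>The flat function and smooth cut-offs of intervals\<close>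

definition flat :: "real \<Rightarrow> real" where
  "flat x = (if 0 < x then exp (- (1 / x)) else 0)"

lemma poly_exp_tendsto_0: "((\<lambda>y::real. poly p y * exp (- y)) \<longlongrightarrow> 0) at_top"
proof -
  \<comment> \<open>The extra power \<open>y ^ k\<close> absorbs the factor \<open>y\<close> that
    appears when the lowest coefficient is split off.\<close>
  have "((\<lambda>y::real. y ^ k * poly p y * exp (- y)) \<longlongrightarrow> 0) at_top" for k
  proof (induction p arbitrary: k)
    case 0 then show ?case by simp
  next
    case (pCons a p)
    have "((\<lambda>y::real. a * (y ^ k / exp y) + y ^ Suc k * poly p y * exp (- y)) \<longlongrightarrow> a * 0 + 0) at_top"
      by (intro tendsto_intros tendsto_power_div_exp_0 pCons.IH)
    then show ?case by (simp add: exp_minus field_simps)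
  qed
  from this[of 0] show ?thesis by simp
qed

text \<open>The class consists of the functions \<open>poly p (1 / x) * exp (- (1 / x))\<close> on
  \<open>x > 0\<close>, extended by 0. At the origin the substitution \<open>y = 1 / x\<close>
  reduces differentiability to the exponential beating every polynomial.\<close>

lemma smooth_flat: "smooth flat"
proof (rule smooth_coinduct)
  let ?F = "\<lambda>p x::real. if 0 < x then poly p (1 / x) * exp (- (1 / x)) else 0"
  show "flat \<in> range ?F"
    by (rule image_eqI[of _ _ 1]) (auto simp: flat_def fun_eq_iff)
  fix g assume "g \<in> range ?F"
  then obtain p where g: "g = ?F p" by blast
  \<comment> \<open>With \<open>y = 1 / x\<close>, hence \<open>dy/dx = - y^2\<close>, the
    derivative of \<open>p(y) exp(-y)\<close> is \<open>y^2 (p - p')(y) exp(-y)\<close>.\<close>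
  let ?q = "[:0, 0, 1:] * (p - pderiv p)"
  have "(g has_real_derivative ?F ?q x) (at x)" for x
  proof (cases x "0::real" rule: linorder_cases)
    case greater
    have "((\<lambda>x. poly p (1 / x) * exp (- (1 / x))) has_real_derivative ?F ?q x) (at x)"
    proof -
      have 1: "((\<lambda>x. 1 / x) has_real_derivative - (1 / x\<^sup>2)) (at x)"
        using greater by (auto intro!: derivative_eq_intros simp: power2_eq_square)
      have 2: "((\<lambda>x. poly p (1 / x)) has_real_derivative poly (pderiv p) (1 / x) * - (1 / x\<^sup>2)) (at x)"
        by (rule DERIV_chain2[OF poly_DERIV 1])
      have 3: "((\<lambda>x. exp (- (1 / x))) has_real_derivative exp (- (1 / x)) * - (- (1 / x\<^sup>2))) (at x)"
        by (rule DERIV_chain2[OF DERIV_exp DERIV_minus[OF 1]])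
      have "?F ?q x = poly (pderiv p) (1 / x) * - (1 / x\<^sup>2) * exp (- (1 / x)) + exp (- (1 / x)) * - (- (1 / x\<^sup>2)) * poly p (1 / x)"
        using greater by (simp add: power2_eq_square algebra_simps)
      then show ?thesis using DERIV_mult[OF 2 3] by simp
    qed
    moreover have "\<forall>\<^sub>F y in nhds x. g y = poly p (1 / y) * exp (- (1 / y))"
      using eventually_nhds_in_open[of "{0<..}" x] greater by (auto elim!: eventually_mono simp: g)
    ultimately show ?thesis by (subst DERIV_cong_ev[OF refl _ refl]) auto
  next
    case less
    have "\<forall>\<^sub>F y in nhds x. g y = 0"
      using eventually_nhds_in_open[of "{..<0}" x] less by (auto elim!: eventually_mono simp: g)
    then show ?thesis using less by (subst DERIV_cong_ev[OF refl _ refl]) auto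
  next
    case equal
    have "((\<lambda>y. g y / y) \<longlongrightarrow> 0) (at 0)"
    proof (rule filterlim_split_at)
      have "\<forall>\<^sub>F y in at_left 0. g y / y = 0"
        by (auto simp: eventually_at_filter g)
      then show "((\<lambda>y. g y / y) \<longlongrightarrow> 0) (at_left 0)" by (rule tendsto_eventually)
      have "((\<lambda>y. g (inverse y) / inverse y) \<longlongrightarrow> 0) at_top"
      proof (rule Lim_transform_eventually[OF poly_exp_tendsto_0[of "[:0, 1:] * p"]])
        show "\<forall>\<^sub>F y in at_top. poly ([:0, 1:] * p) y * exp (- y) = g (inverse y) / inverse y"
          using eventually_gt_at_top[of "0::real"] by eventually_elim (auto simp: g divide_inverse mult_ac)
      qed
      then show "((\<lambda>y. g y / y) \<longlongrightarrow> 0) (at_right 0)" by (simp add: filterlim_at_right_to_top)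
    qed
    then show ?thesis using equal by (simp add: has_field_derivative_iff g)
  qed
  then show "\<exists>g'\<in>range ?F. \<forall>x. (g has_real_derivative g' x) (at x)"
    by (intro bexI[of _ "?F ?q"]) auto
qed

lemma test_function_iff: "test_function L \<psi> \<longleftrightarrow> smooth \<psi> \<and> (\<exists>a b. 0 < a \<and> b < L \<and> (\<forall>x. x \<notin> {a..b} \<longrightarrow> \<psi> x = 0))"
  by (simp add: test_function_def smooth_def)

lemma test_functionE:
  assumes "test_function L \<psi>"
  obtains a b where "0 < a" "b < L" "\<And>x. x < a \<Longrightarrow> \<psi> x = 0" "\<And>x. b < x \<Longrightarrow> \<psi> x = 0"
  using assms unfolding test_function_iff by (auto 4 3)

lemma test_function_outside:
  assumes "test_function L \<psi>" "x \<notin> {0<..<L}" shows "\<psi> x = 0"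
  using assms by (elim test_functionE) (auto simp: not_less)

lemma test_function_deriv:
  assumes "test_function L \<psi>" shows "test_function L (deriv \<psi>)"
proof -
  obtain a b where ab: "0 < a" "b < L" "\<And>x. x \<notin> {a..b} \<Longrightarrow> \<psi> x = 0"
    using assms unfolding test_function_iff by blast
  have "deriv \<psi> x = 0" if "x \<notin> {a..b}" for x
  proof -
    have "\<forall>\<^sub>F y in nhds x. y \<in> - {a..b}"
      using that by (intro eventually_nhds_in_open open_Compl) auto
    then have "\<forall>\<^sub>F y in nhds x. \<psi> y = 0" by eventually_elim (auto intro!: ab)
    then have "(\<psi> has_real_derivative 0) (at x)" by (subst DERIV_cong_ev[OF refl _ refl]) auto
    then show ?thesis by (rule DERIV_imp_deriv)
  qed
  then show ?thesis using assms ab(1,2) smooth_deriv unfolding test_function_iff by blast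
qed

lemma test_function_add:
  assumes "test_function L f" "test_function L g" shows "test_function L (\<lambda>x. f x + g x)"
proof -
  obtain a b where ab: "0 < a" "b < L" "\<And>x. x \<notin> {a..b} \<Longrightarrow> f x = 0"
    using assms unfolding test_function_iff by blast
  obtain c d where cd: "0 < c" "d < L" "\<And>x. x \<notin> {c..d} \<Longrightarrow> g x = 0"
    using assms unfolding test_function_iff by blast
  have "\<forall>x. x \<notin> {min a c..max b d} \<longrightarrow> f x + g x = 0"
    using ab(3) cd(3) by (auto simp: min_def max_def split: if_splits)
  moreover have "0 < min a c" "max b d < L" using ab cd by auto
  ultimately show ?thesis using assms smooth_add unfolding test_function_iff by blast
qed

lemma test_function_scale:
  assumes "test_function L f" shows "test_function L (\<lambda>x. c * f x)"
  using assms smooth_mult[OF smooth_const[of c], of f] unfolding test_function_iff by fastforce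

lemma test_function_zero: assumes "0 < L" shows "test_function L (\<lambda>x. 0)"
  unfolding test_function_iff using smooth_const[of 0] assms by (auto intro!: exI[of _ "L/2"])

text \<open>A smooth approximation of the indicator of \<open>(a, b)\<close> with values in
  \<open>[0, 1]\<close>: each factor is positive only at distance more than \<open>1 / Suc n\<close>
  from its endpoint, so the support is compact in the open interval, and both factors tend to 1
  inside. Pointwise convergence under a constant bound is what dominated convergence asks
  for.\<close>

definition bump :: "real \<Rightarrow> real \<Rightarrow> nat \<Rightarrow> real \<Rightarrow> real" where
  "bump a b n x = flat (real (Suc n) * (x - a) - 1) * flat (real (Suc n) * (b - x) - 1)"

lemma test_function_bump:
  assumes "0 \<le> a" "b \<le> L" shows "test_function L (bump a b n)"
proof -
  have "smooth (\<lambda>x. flat (real (Suc n) * x + (- real (Suc n) * a - 1)) * flat (- real (Suc n) * x + (real (Suc n) * b - 1)))"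
    by (intro smooth_mult smooth_affine smooth_flat)
  then have "smooth (bump a b n)" by (simp add: bump_def[abs_def] algebra_simps)
  moreover have "bump a b n x = 0" if "x \<notin> {a + 1 / real (Suc n)..b - 1 / real (Suc n)}" for x
  proof -
    have "real (Suc n) * (x - a) < 1 \<or> real (Suc n) * (b - x) < 1"
    proof (cases "x - a < 1 / real (Suc n)")
      case True then show ?thesis by (simp add: pos_less_divide_eq mult.commute)
    next
      case False
      then have "b - x < 1 / real (Suc n)" using that by (simp add: not_le) 
      then show ?thesis by (simp add: pos_less_divide_eq mult.commute)
    qed
    then show ?thesis by (auto simp: bump_def flat_def)
  qed
  moreover have "0 < a + 1 / real (Suc n)" "b - 1 / real (Suc n) < L" proof -
    have "0 < 1 / real (Suc n)" by simp
    then show "0 < a + 1 / real (Suc n)" "b - 1 / real (Suc n) < L" using assms by linarith+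
  qed
  ultimately show ?thesis unfolding test_function_iff by blast
qed

lemma flat_bounds: "0 \<le> flat x" "flat x \<le> 1"
  by (auto simp: flat_def)

lemma bump_bounds: "0 \<le> bump a b n x" "bump a b n x \<le> 1"
  using flat_bounds by (auto simp: bump_def mult_le_one)

lemma flat_limit: assumes "0 < c" shows "(\<lambda>n. flat (real (Suc n) * c - 1)) \<longlonglongrightarrow> 1"
proof -
  have t: "filterlim (\<lambda>n. real (Suc n) * c - 1) at_top sequentially"
    using filterlim_tendsto_add_at_top[OF tendsto_const[of "-1"] filterlim_tendsto_pos_mult_at_top[OF tendsto_const assms
      filterlim_compose[OF filterlim_real_sequentially filterlim_Suc]]] by (simp add: algebra_simps)
  have "((\<lambda>y::real. exp (- (1 / y))) \<longlongrightarrow> exp (- 0)) at_top"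
    by (intro tendsto_intros tendsto_divide_0[OF tendsto_const] filterlim_at_top_imp_at_infinity filterlim_ident)
  then have "((\<lambda>y::real. exp (- (1 / y))) \<longlongrightarrow> 1) at_top" by simp
  then have "(flat \<longlongrightarrow> 1) at_top"
    by (rule Lim_transform_eventually)
      (use eventually_gt_at_top[of "0::real"] in \<open>eventually_elim, auto simp: flat_def\<close>)
  then show ?thesis using t by (rule filterlim_compose)
qed


text \<open>Approximants in a complex space have to be complex, while \<open>test_function\<close>
  is real; hence the two real components.\<close>

definition ctest :: "real \<Rightarrow> (real \<Rightarrow> complex) \<Rightarrow> bool" where
  "ctest L \<phi> \<longleftrightarrow> (\<exists>p q. test_function L p \<and> test_function L q \<and> \<phi> = (\<lambda>x. Complex (p x) (q x)))"

lemma ctestI: "test_function L p \<Longrightarrow> test_function L q \<Longrightarrow> (\<And>x. \<phi> x = Complex (p x) (q x)) \<Longrightarrow> ctest L \<phi>"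
  unfolding ctest_def by blast

lemma ctest_add:
  assumes "ctest L f" "ctest L g" shows "ctest L (\<lambda>x. f x + g x)"
proof -
  obtain p q where f: "test_function L p" "test_function L q" "f = (\<lambda>x. Complex (p x) (q x))"
    using assms(1) unfolding ctest_def by blast
  obtain p' q' where g: "test_function L p'" "test_function L q'" "g = (\<lambda>x. Complex (p' x) (q' x))"
    using assms(2) unfolding ctest_def by blast
  show ?thesis
    by (rule ctestI[OF test_function_add[OF f(1) g(1)] test_function_add[OF f(2) g(2)]])
      (simp add: f g complex_eq_iff)
qed

lemma ctest_scale:
  assumes "ctest L f" shows "ctest L (\<lambda>x. c * f x)"
proof -
  obtain p q where f: "test_function L p" "test_function L q" "f = (\<lambda>x. Complex (p x) (q x))"
    using assms(1) unfolding ctest_def by blast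
  show ?thesis
    by (rule ctestI[OF test_function_add[OF test_function_scale[OF f(1), of "Re c"] test_function_scale[OF f(2), of "- Im c"]]
          test_function_add[OF test_function_scale[OF f(2), of "Re c"] test_function_scale[OF f(1), of "Im c"]]])
      (simp add: f complex_eq_iff)
qed

lemma ctest_of_real:
  assumes "0 < L" "test_function L p" shows "ctest L (\<lambda>x. of_real (p x))"
  by (rule ctestI[OF assms(2) test_function_zero[OF assms(1)]]) (simp add: complex_eq_iff)

lemma ctest_continuous: "ctest L f \<Longrightarrow> continuous_on A f"
  unfolding ctest_def Complex_eq test_function_iff by (auto intro!: continuous_intros smooth_continuous)

lemma continuous_L2:
  assumes "continuous_on {0..L} f" shows "f \<in> L2 L"
proof (cases "0 \<le> L")
  case True
  have m: "f \<in> borel_measurable (leb L)"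
    by (rule continuous_imp_measurable_on_sets_lebesgue) (auto intro: continuous_on_subset[OF assms])
  obtain C where C: "\<And>x. x \<in> {0..L} \<Longrightarrow> cmod (f x) \<le> C"
    using compact_imp_bounded[OF compact_continuous_image[OF assms]] unfolding bounded_iff by blast
  show ?thesis
    by (rule L2_bounded(1)[OF m _ True, of C]) (auto intro!: AE_I2 C)
next
  case False then show ?thesis by (simp add: L2_def measurable_def)
qed

lemma ctest_L2: "ctest L f \<Longrightarrow> f \<in> L2 L"
  by (intro continuous_L2 ctest_continuous)

section \<open>Density of test functions\<close>

lemma L2_dominated:
  assumes f: "\<And>n. f n \<in> borel_measurable (leb L)" "g \<in> borel_measurable (leb L)" and w: "w \<in> L2 L"
    and le: "\<And>n. AE x in leb L. cmod (f n x) \<le> cmod (w x)"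
    and lim: "AE x in leb L. (\<lambda>n. f n x) \<longlonglongrightarrow> g x"
  shows "g \<in> L2 L" "(\<lambda>n. L2_norm L (\<lambda>x. f n x - g x)) \<longlonglongrightarrow> 0"
proof -
  note f[measurable] 
  have le': "AE x in leb L. \<forall>n. cmod (f n x) \<le> cmod (w x)" using le by (simp add: AE_all_countable)
  have leg: "AE x in leb L. cmod (g x) \<le> cmod (w x)"
    using le' lim
  proof eventually_elim
    case (elim x)
    show ?case by (rule LIMSEQ_le_const2[OF tendsto_norm[OF elim(2)]]) (use elim(1) in auto)
  qed
  show g: "g \<in> L2 L" using L2_bound(1)[OF w f(2), of 1] leg by simp
  have "(\<lambda>n. LINT x|leb L. (cmod (f n x - g x))\<^sup>2) \<longlonglongrightarrow> (LINT x|leb L. (0::real))"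
  proof (rule integral_dominated_convergence[where w = "\<lambda>x. 4 * (cmod (w x))\<^sup>2"])
    show "integrable (leb L) (\<lambda>x. 4 * (cmod (w x))\<^sup>2)" using L2_square_integrable[OF w] by simp
    show "AE x in leb L. (\<lambda>n. (cmod (f n x - g x))\<^sup>2) \<longlonglongrightarrow> 0"
      using lim
    proof eventually_elim
      case (elim x)
      then have "(\<lambda>n. (cmod (f n x - g x))\<^sup>2) \<longlonglongrightarrow> (cmod (g x - g x))\<^sup>2" by (intro tendsto_intros)
      then show ?case by simp
    qed
    show "AE x in leb L. norm ((cmod (f n x - g x))\<^sup>2) \<le> 4 * (cmod (w x))\<^sup>2" for n
      using le[of n] leg
    proof eventually_elim
      case (elim x)
      then have "cmod (f n x - g x) \<le> 2 * cmod (w x)" using norm_triangle_ineq4[of "f n x" "g x"] by linarith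
      then have "(cmod (f n x - g x))\<^sup>2 \<le> (2 * cmod (w x))\<^sup>2" by (intro power_mono) auto
      then show ?case by (simp add: power_mult_distrib)
    qed
  qed auto
  then have "(\<lambda>n. sqrt (LINT x|leb L. (cmod (f n x - g x))\<^sup>2)) \<longlonglongrightarrow> sqrt 0"
    by (intro tendsto_real_sqrt) simp
  then show "(\<lambda>n. L2_norm L (\<lambda>x. f n x - g x)) \<longlonglongrightarrow> 0" by (simp add: L2_norm_def)
qed

definition approximable :: "real \<Rightarrow> (real \<Rightarrow> complex) \<Rightarrow> bool" where
  "approximable L f \<longleftrightarrow> f \<in> L2 L \<and> (\<forall>e>0. \<exists>\<phi>. ctest L \<phi> \<and> L2_norm L (\<lambda>x. f x - \<phi> x) < e)"

lemma approximable_limit: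
  assumes "\<And>n. approximable L (f n)" "g \<in> L2 L" "(\<lambda>n. L2_norm L (\<lambda>x. f n x - g x)) \<longlonglongrightarrow> 0"
  shows "approximable L g"
  unfolding approximable_def
proof (intro conjI assms allI impI)
  fix e :: real assume e: "0 < e"
  have "\<forall>\<^sub>F n in sequentially. L2_norm L (\<lambda>x. f n x - g x) < e / 2"
    using order_tendstoD(2)[OF assms(3), of "e/2"] e by simp
  then obtain n where n: "L2_norm L (\<lambda>x. f n x - g x) < e / 2" 
    using eventually_happens trivial_limit_sequentially by blast
  obtain \<phi> where \<phi>: "ctest L \<phi>" "L2_norm L (\<lambda>x. f n x - \<phi> x) < e / 2"
    using assms(1)[of n] e unfolding approximable_def by (meson half_gt_zero)
  have "L2_norm L (\<lambda>x. g x - \<phi> x) \<le> L2_norm L (\<lambda>x. g x - f n x) + L2_norm L (\<lambda>x. f n x - \<phi> x)"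
    by (rule L2_norm_triangle_diff[OF assms(2) _ ctest_L2[OF \<phi>(1)]]) (use assms(1)[of n] in \<open>simp add: approximable_def\<close>)
  then show "\<exists>\<phi>. ctest L \<phi> \<and> L2_norm L (\<lambda>x. g x - \<phi> x) < e"
    using \<phi> n L2_norm_minus_commute[of L "f n" g] by (intro exI[of _ \<phi>]) auto
qed

lemma approximable_cong_AE:
  assumes "approximable L f" "g \<in> borel_measurable (leb L)" "AE x in leb L. f x = g x"
  shows "approximable L g"
proof (rule approximable_limit[OF assms(1)])
  have f: "f \<in> L2 L" using assms(1) by (simp add: approximable_def)
  show "g \<in> L2 L" by (rule L2_bound(1)[OF f assms(2), of 1]) (use assms(3) in auto)
  have "L2_norm L (\<lambda>x. f x - g x) = 0" by (rule L2_norm_AE_zero) (use assms(3) in auto)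
  then show "(\<lambda>n. L2_norm L (\<lambda>x. f x - g x)) \<longlonglongrightarrow> 0" by simp
qed

lemma approximable_add:
  assumes "approximable L f" "approximable L g" shows "approximable L (\<lambda>x. f x + g x)"
  unfolding approximable_def
proof (intro conjI allI impI)
  have fg: "f \<in> L2 L" "g \<in> L2 L" using assms by (simp_all add: approximable_def)
  then show "(\<lambda>x. f x + g x) \<in> L2 L" by (rule L2_add)
  fix e :: real assume e: "0 < e"
  obtain \<phi> where \<phi>: "ctest L \<phi>" "L2_norm L (\<lambda>x. f x - \<phi> x) < e / 2"
    using assms(1) e unfolding approximable_def by (meson half_gt_zero)
  obtain \<psi> where \<psi>: "ctest L \<psi>" "L2_norm L (\<lambda>x. g x - \<psi> x) < e / 2"
    using assms(2) e unfolding approximable_def by (meson half_gt_zero)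
  have "L2_norm L (\<lambda>x. (f x - \<phi> x) + (g x - \<psi> x)) \<le> L2_norm L (\<lambda>x. f x - \<phi> x) + L2_norm L (\<lambda>x. g x - \<psi> x)"
    by (intro L2_norm_triangle L2_diff fg ctest_L2 \<phi> \<psi>)
  moreover have "(\<lambda>x. (f x - \<phi> x) + (g x - \<psi> x)) = (\<lambda>x. f x + g x - (\<phi> x + \<psi> x))" by (auto simp: fun_eq_iff)
  ultimately show "\<exists>\<phi>. ctest L \<phi> \<and> L2_norm L (\<lambda>x. f x + g x - \<phi> x) < e"
    using \<phi>(2) \<psi>(2) by (intro exI[of _ "\<lambda>x. \<phi> x + \<psi> x"] conjI ctest_add \<phi> \<psi>) simp
qed

lemma approximable_scale:
  assumes "approximable L f" shows "approximable L (\<lambda>x. c * f x)"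
  unfolding approximable_def
proof (intro conjI allI impI)
  have f: "f \<in> L2 L" using assms by (simp add: approximable_def)
  then show "(\<lambda>x. c * f x) \<in> L2 L" by (rule L2_scale)
  fix e :: real assume e: "0 < e"
  obtain \<phi> where \<phi>: "ctest L \<phi>" "L2_norm L (\<lambda>x. f x - \<phi> x) < e / (cmod c + 1)"
    using assms(1) e unfolding approximable_def by (meson divide_pos_pos norm_ge_zero add_nonneg_pos zero_less_one)
  have "L2_norm L (\<lambda>x. c * f x - c * \<phi> x) = cmod c * L2_norm L (\<lambda>x. f x - \<phi> x)"
    using L2_norm_scale[of L c "\<lambda>x. f x - \<phi> x"] by (simp add: right_diff_distrib)
  also have "\<dots> \<le> (cmod c + 1) * L2_norm L (\<lambda>x. f x - \<phi> x)" by (intro mult_right_mono) auto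
  also have "\<dots> < (cmod c + 1) * (e / (cmod c + 1))" using \<phi>(2) by (intro mult_strict_left_mono) (auto intro: add_nonneg_pos)
  also have "\<dots> = e" using norm_ge_zero[of c] by (simp add: add_nonneg_eq_0_iff)
  finally show "\<exists>\<phi>. ctest L \<phi> \<and> L2_norm L (\<lambda>x. c * f x - \<phi> x) < e"
    by (intro exI[of _ "\<lambda>x. c * \<phi> x"] conjI ctest_scale \<phi>)
qed

lemma bump_limit:
  "(\<lambda>n. bump a b n x) \<longlonglongrightarrow> indicator {a<..<b} x"
proof (cases "a < x \<and> x < b")
  case True
  then have "(\<lambda>n. bump a b n x) \<longlonglongrightarrow> 1 * 1"
    unfolding bump_def by (intro tendsto_mult flat_limit) auto
  with True show ?thesis by simp
next
  case False
  have "bump a b n x = 0" for n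
  proof -
    have "real (Suc n) * (x - a) \<le> 0 \<or> real (Suc n) * (b - x) \<le> 0"
      using False by (auto simp: mult_le_0_iff not_less)
    then show ?thesis by (auto simp: bump_def flat_def)
  qed
  with False show ?thesis by auto
qed

lemma sets_borel_leb: "A \<in> sets borel \<Longrightarrow> (indicator A :: real \<Rightarrow> complex) \<in> borel_measurable (leb L)"
  by (intro measurable_restrict_space1 borel_measurable_indicator) auto

lemma approximable_interval:
  assumes "0 < L" shows "approximable L (indicator {a<..<b})"
proof -
  let ?a = "max a 0" and ?b = "min b L"
  let ?f = "\<lambda>n x. complex_of_real (bump ?a ?b n x)"
  have c: "ctest L (?f n)" for n by (intro ctest_of_real test_function_bump assms) auto
  have lim: "AE x in leb L. (\<lambda>n. ?f n x) \<longlonglongrightarrow> indicator {a<..<b} x"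
  proof (rule AE_I2)
    fix x assume x: "x \<in> space (leb L)"
    have "(\<lambda>n. ?f n x) \<longlonglongrightarrow> of_real (indicator {?a<..<?b} x)"
      by (intro tendsto_of_real bump_limit)
    moreover have "of_real (indicator {?a<..<?b} x) = (indicator {a<..<b} x :: complex)"
      using x by (auto simp: indicator_def)
    ultimately show "(\<lambda>n. ?f n x) \<longlonglongrightarrow> indicator {a<..<b} x" by simp
  qed
  have m: "(indicator {a<..<b} :: real \<Rightarrow> complex) \<in> borel_measurable (leb L)"
    by (intro sets_borel_leb) simp
  show ?thesis
  proof (rule approximable_limit)
    show "approximable L (?f n)" for n
      unfolding approximable_def using c[of n] ctest_L2[OF c] by (auto intro!: exI[of _ "?f n"] simp: L2_norm_zero)
    have fm: "?f n \<in> borel_measurable (leb L)" for n using c by (intro L2_measurable ctest_L2)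
    have "AE x in leb L. cmod (?f n x) \<le> cmod 1" for n using bump_bounds by (intro AE_I2) simp
    note dom = L2_dominated[OF fm m L2_const[of 1] this lim]
    show "indicator {a<..<b} \<in> L2 L" by (rule dom(1))
    show "(\<lambda>n. L2_norm L (\<lambda>x. ?f n x - indicator {a<..<b} x)) \<longlonglongrightarrow> 0" by (rule dom(2))
  qed
qed

text \<open>Dynkin's lemma: the open intervals form an intersection-stable generator of the Borel
  sets, and the sets with approximable indicator are closed under complements and countable disjoint
  unions, the latter by dominated convergence.\<close>

lemma approximable_borel:
  assumes L: "0 < L" and B: "B \<in> sets borel" shows "approximable L (indicator B)"
proof -
  have m: "(indicator A :: real \<Rightarrow> complex) \<in> borel_measurable (leb L)" if "A \<in> sets borel" for A
    using that by (intro sets_borel_leb)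
  let ?G = "range (\<lambda>(a::real, b). {a<..<b})"
  have borel: "sets borel = sigma_sets UNIV ?G"
    unfolding borel_eq_box[where 'a = real] box_real by simp
  have int: "Int_stable ?G"
  proof (rule Int_stableI)
    fix A B assume "A \<in> ?G" "B \<in> ?G"
    then obtain a b c d where "A = {a<..<b}" "B = {c<..<d}" by auto
    then have "A \<inter> B = (\<lambda>(a, b). {a<..<b}) (max a c, min b d)" by auto
    then show "A \<inter> B \<in> ?G" by blast
  qed
  have sub: "?G \<subseteq> Pow UNIV" by simp
  have empty: "approximable L (\<lambda>x. 0)"
    using approximable_scale[OF approximable_interval[OF L, of 0 0], of 0] by simp
  from B[unfolded borel] show ?thesis
  proof (induction rule: sigma_sets_induct_disjoint[OF int sub])
    case 1 show ?case by (rule B[unfolded borel])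
  next
    case (2 A) then show ?case by (auto intro: approximable_interval[OF L])
  next
    case 3 show ?case using empty by (simp add: indicator_def[abs_def])
  next
    case (4 A)
    \<comment> \<open>The interval \<open>(-1, L + 1)\<close> plays the whole space: its indicator
      is 1 on \<open>(0, L)\<close>.\<close>
    have "approximable L (\<lambda>x. indicator {-1<..<L+1} x + (-1) * indicator A x)"
      by (intro approximable_add approximable_scale 4 approximable_interval L)
    then show ?case
    proof (rule approximable_cong_AE)
      have "A \<in> sets borel" using 4(1) by (simp only: borel)
      then show "(indicator (UNIV - A) :: real \<Rightarrow> complex) \<in> borel_measurable (leb L)" by (intro m) auto
      show "AE x in leb L. indicator {- 1<..<L + 1} x + (- 1) * indicator A x = (indicator (UNIV - A) x :: complex)"
        by (intro AE_I2) (auto simp: indicator_def)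
    qed
  next
    case (5 A)
    have A: "A i \<in> sets borel" for i unfolding borel using 5(2) by blast
    let ?f = "\<lambda>n x. \<Sum>i<n. (indicator (A i) x :: complex)"
    have f: "approximable L (?f n)" for n
    proof (induction n)
      case 0 then show ?case using empty by simp
    next
      case (Suc n) then show ?case using 5 by (auto intro!: approximable_add)
    qed
    have fe: "?f n x = indicator (\<Union>i<n. A i) x" for n x
      using 5(1) by (subst indicator_UN_disjoint) (auto simp: disjoint_family_on_def)
    have lim: "AE x in leb L. (\<lambda>n. ?f n x) \<longlonglongrightarrow> indicator (\<Union>i. A i) x"
      unfolding fe by (intro AE_I2 LIMSEQ_indicator_UN)
    have fm: "?f n \<in> borel_measurable (leb L)" for n using f[of n] L2_measurable by (auto simp: approximable_def)
    have "(indicator (\<Union>i. A i) :: real \<Rightarrow> complex) \<in> borel_measurable (leb L)" using A by (intro m) auto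
    note dom = L2_dominated[OF fm this L2_const[of 1] _ lim]
    have le: "AE x in leb L. cmod (?f n x) \<le> cmod 1" for n unfolding fe by (intro AE_I2) (simp add: indicator_def)
    show ?case by (rule approximable_limit[OF f dom(1)[OF le] dom(2)[OF le]])
  qed
qed

text \<open>Lebesgue sets are reduced to Borel sets by their main part, which differs by a null set;
  linearity gives simple functions, and dominated convergence gives \<open>f\<close>.\<close>

theorem ctest_dense:
  assumes L: "0 < L" and f: "f \<in> L2 L" shows "approximable L f"
proof -
  interpret finite_measure "leb L" by (rule finite_measure_leb)
  have ind: "approximable L (indicator A)" if A: "A \<in> sets (leb L)" for A
  proof -
    have A': "A \<in> sets (completion lborel)" using A by (auto simp: sets_restrict_space)
    let ?B = "main_part lborel A"
    have B: "?B \<in> sets borel" using A' by (metis main_part_sets sets_lborel)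
    have "AE x in lebesgue. x \<notin> null_part lborel A"
      using null_part_null_sets[OF A'] by (rule AE_not_in)
    then have "AE x in lebesgue. indicator ?B x = (indicator A x :: complex)"
    proof eventually_elim
      case (elim x)
      then show ?case using main_part_null_part_Un[OF A'] by (auto simp: indicator_def)
    qed
    then have "AE x in leb L. indicator ?B x = (indicator A x :: complex)"
      by (subst AE_restrict_space_iff) auto
    then show ?thesis
      using approximable_cong_AE[OF approximable_borel[OF L B]] A by auto
  qed
  have simp: "approximable L g" if "simple_function (leb L) g" for g :: "real \<Rightarrow> complex"
  proof -
    have "emeasure (leb L) {y \<in> space (leb L). g y \<noteq> 0} \<noteq> \<infinity>"
      using emeasure_finite by (simp add: infinity_ennreal_def)
    with that show ?thesis
  proof (induction rule: integrable_simple_function_induct)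
    case (cong f g)
    show ?case using cong(5) by (intro approximable_cong_AE[OF cong(6)] AE_I2 borel_measurable_simple_function cong(3))
  next
    case (indicator A y)
    have "approximable L (\<lambda>x. y * indicator A x)" by (intro approximable_scale ind indicator)
    moreover have "(\<lambda>x. y * indicator A x) = (\<lambda>x. indicat_real A x *\<^sub>R y)"
      by (auto simp: indicator_def)
    ultimately show ?case by simp
  next
    case (add f g) then show ?case by (intro approximable_add)
  qed
  qed
  obtain F where F: "\<And>i. simple_function (leb L) (F i)" "\<And>x. x \<in> space (leb L) \<Longrightarrow> (\<lambda>i. F i x) \<longlonglongrightarrow> f x"
    "\<And>i x. x \<in> space (leb L) \<Longrightarrow> dist (F i x) 0 \<le> 2 * dist (f x) 0"
    using borel_measurable_implies_sequence_metric[OF L2_measurable[OF f], of 0] by blast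
  have "(\<lambda>n. L2_norm L (\<lambda>x. F n x - f x)) \<longlonglongrightarrow> 0"
  proof (rule L2_dominated(2)[of _ _ _ "\<lambda>x. 2 * f x"])
    show "AE x in leb L. cmod (F n x) \<le> cmod (2 * f x)" for n
      using F(3)[of _ n] by (intro AE_I2) (simp add: norm_mult)
    show "AE x in leb L. (\<lambda>n. F n x) \<longlonglongrightarrow> f x" using F(2) by (intro AE_I2)
  qed (intro L2_scale f L2_measurable[OF f] borel_measurable_simple_function F)+
  then show ?thesis by (rule approximable_limit[OF simp[OF F(1)] f])
qed

text \<open>\<open>f\<close> is orthogonal to every complex test function \<phi>, so
  \<open>|f|^2 = <f, f - \<phi>>\<close> is at most \<open>|f| |f - \<phi>|\<close>, and density
  makes the last factor arbitrarily small.\<close>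

lemma fundamental_lemma:
  assumes L: "0 < L" and f: "f \<in> L2 L"
    and z: "\<And>\<psi>. test_function L \<psi> \<Longrightarrow> (LINT x|leb L. f x * of_real (\<psi> x)) = 0"
  shows "AE x in leb L. f x = 0"
proof -
  have zero: "(LINT x|leb L. f x * cnj (\<phi> x)) = 0" if \<phi>: "ctest L \<phi>" for \<phi>
  proof -
    obtain p q where p: "test_function L p" "test_function L q" "\<phi> = (\<lambda>x. Complex (p x) (q x))"
      using \<phi> unfolding ctest_def by blast
    have i: "integrable (leb L) (\<lambda>x. f x * of_real (p x))" "integrable (leb L) (\<lambda>x. f x * of_real (q x))"
      using L2_mult_integrable(1)[OF f ctest_L2[OF ctest_of_real[OF L]]] p by blast+
    have "(LINT x|leb L. f x * cnj (\<phi> x)) = (LINT x|leb L. f x * of_real (p x) - \<i> * (f x * of_real (q x)))"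
      by (intro Bochner_Integration.integral_cong) (auto simp: p Complex_eq algebra_simps)
    also have "\<dots> = 0" using i z[OF p(1)] z[OF p(2)] by simp
    finally show ?thesis .
  qed
  have "(L2_norm L f)\<^sup>2 \<le> e * L2_norm L f" if e: "0 < e" for e
  proof -
    obtain \<phi> where \<phi>: "ctest L \<phi>" "L2_norm L (\<lambda>x. f x - \<phi> x) < e"
      using ctest_dense[OF L f] e unfolding approximable_def by blast
    have l: "(\<lambda>x. cnj (f x)) \<in> L2 L" "(\<lambda>x. cnj (\<phi> x)) \<in> L2 L" "(\<lambda>x. f x - \<phi> x) \<in> L2 L"
      using f ctest_L2[OF \<phi>(1)] by (auto intro: L2_cnj L2_diff)
    have "complex_of_real ((L2_norm L f)\<^sup>2) = (LINT x|leb L. f x * cnj (f x))"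
      unfolding L2_norm_power2 by (subst integral_complex_of_real[symmetric]) (simp only: complex_norm_square)
    also have "\<dots> = (LINT x|leb L. f x * cnj (f x - \<phi> x))"
      using zero[OF \<phi>(1)] L2_mult_integrable(1)[OF f l(1)] L2_mult_integrable(1)[OF f l(2)]
      by (simp add: right_diff_distrib)
    finally have "(L2_norm L f)\<^sup>2 = cmod (LINT x|leb L. f x * cnj (f x - \<phi> x))"
      by (metis norm_of_real abs_of_nonneg zero_le_power2)
    also have "\<dots> \<le> L2_norm L f * L2_norm L (\<lambda>x. cnj (f x - \<phi> x))"
      by (intro L2_mult_le f L2_cnj l)
    also have "L2_norm L (\<lambda>x. cnj (f x - \<phi> x)) = L2_norm L (\<lambda>x. f x - \<phi> x)" 
      unfolding L2_norm_def complex_mod_cnj ..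
    also have "L2_norm L f * L2_norm L (\<lambda>x. f x - \<phi> x) \<le> L2_norm L f * e"
      using \<phi>(2) by (intro mult_left_mono) auto
    finally show ?thesis by (simp add: mult.commute)
  qed
  \<comment> \<open>For \<open>e = |f| / 2\<close> the inequality reads
    \<open>|f|^2 \<le> |f|^2 / 2\<close>.\<close>
  from this[of "L2_norm L f / 2"] have "\<not> 0 < L2_norm L f"
    by (auto simp: power2_eq_square)
  then show ?thesis using L2_norm_eq_0_AE[OF f] L2_norm_nonneg[of L f] by linarith
qed

subsection \<open>Absolutely continuous functions and weak derivatives\<close>

text \<open>Primitives are gauge integrals over \<open>{0..x}\<close>, norms and pairings Lebesgue
  integrals over \<open>(0, L)\<close>. Truncating the integrand instead of the domain keeps
  everything in the single space \<open>L2 L\<close>.\<close>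

lemma LINT_cut:
  fixes f :: "real \<Rightarrow> complex"
  assumes f: "integrable (leb L) f" and x: "x \<in> {0..L}"
  shows "f integrable_on {0..x}" "integral {0..x} f = (LINT y|leb L. (if y < x then f y else 0))"
proof -
  have S: "{0<..<x} \<in> sets lebesgue" "{0<..<L} \<in> sets lebesgue" by auto
  have "integrable (leb x) f"
  proof (rule iffD1[OF Lebesgue_Measure.integrable_restrict_UNIV[OF S(1)]])
    have "integrable lebesgue (\<lambda>y. if y \<in> {0<..<L} then f y else 0)" using f Lebesgue_Measure.integrable_restrict_UNIV[OF S(2)] by blast
    then have "integrable lebesgue (\<lambda>y. indicator {0<..<x} y *\<^sub>R (if y \<in> {0<..<L} then f y else 0))"
      by (rule integrable_mult_indicator[OF S(1)])
    moreover have "(\<lambda>y. indicator {0<..<x} y *\<^sub>R (if y \<in> {0<..<L} then f y else 0)) = (\<lambda>y. if y \<in> {0<..<x} then f y else 0)"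
      using x by (auto simp: indicator_def fun_eq_iff)
    ultimately show "integrable lebesgue (\<lambda>y. if y \<in> {0<..<x} then f y else 0)" by simp
  qed
  then have h: "(f has_integral (LINT y|leb x. f y)) {0<..<x}"
    by (rule has_integral_integral_lebesgue_on) simp
  then have h: "(f has_integral (LINT y|leb x. f y)) {0..x}" by (simp only: has_integral_Icc_iff_Ioo)
  then show "f integrable_on {0..x}" by blast
  have "(LINT y|leb x. f y) = (LINT y|lebesgue. (if y \<in> {0<..<x} then f y else 0))"
    by (simp only: Lebesgue_Measure.integral_restrict_UNIV[OF S(1)])
  also have "\<dots> = (LINT y|lebesgue. (if y \<in> {0<..<L} then (if y < x then f y else 0) else 0))"
    by (rule Bochner_Integration.integral_cong) (use x in auto)
  also have "\<dots> = (LINT y|leb L. (if y < x then f y else 0))"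
    by (simp only: Lebesgue_Measure.integral_restrict_UNIV[OF S(2)])
  finally show "integral {0..x} f = (LINT y|leb L. (if y < x then f y else 0))"
    using h by (simp add: integral_unique)
qed

lemma LINT_full:
  fixes f :: "real \<Rightarrow> complex"
  assumes f: "integrable (leb L) f" and x: "0 \<le> L"
  shows "integral {0..L} f = (LINT y|leb L. f y)"
proof -
  have "integral {0..L} f = (LINT y|leb L. (if y < L then f y else 0))" using x by (intro LINT_cut(2) f) auto
  also have "\<dots> = (LINT y|leb L. f y)" by (rule Bochner_Integration.integral_cong) auto
  finally show ?thesis .
qed

lemma L2_cut:
  assumes "f \<in> L2 L"
  shows "(\<lambda>y. if y < x then f y else 0) \<in> L2 L" "L2_norm L (\<lambda>y. if y < x then f y else 0) \<le> L2_norm L f"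
proof -
  have [measurable]: "f \<in> borel_measurable (leb L)" using assms by (rule L2_measurable)
  have "{y \<in> space (leb L). y < x} \<in> sets (leb L)"
    by (rule borel_measurable_less) (auto simp: borel_measurable_const id_borel_measurable_lebesgue_on[unfolded id_def])
  then have "(\<lambda>y. if y < x then f y else 0) \<in> borel_measurable (leb L)"
    by (intro measurable_If) auto
  from L2_bound[OF assms this, of 1]
  show "(\<lambda>y. if y < x then f y else 0) \<in> L2 L" "L2_norm L (\<lambda>y. if y < x then f y else 0) \<le> L2_norm L f"
    by auto
qed

lemma integral_L2_le:
  assumes "f \<in> L2 L" "x \<in> {0..L}"
  shows "cmod (integral {0..x} f) \<le> sqrt L * L2_norm L f"
proof -
  have "cmod (integral {0..x} f) \<le> (LINT y|leb L. cmod (if y < x then f y else 0))"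
    unfolding LINT_cut(2)[OF L2_integrable[OF assms(1)] assms(2)] by (rule integral_norm_bound)
  also have "\<dots> \<le> sqrt L * L2_norm L (\<lambda>y. if y < x then f y else 0)"
    using assms by (intro L2_integral_le L2_cut) auto
  also have "\<dots> \<le> sqrt L * L2_norm L f" using assms by (intro mult_left_mono L2_cut) auto
  finally show ?thesis .
qed

text \<open>An element of \<open>H\<^sup>1\<close> as its continuous representative together with an
  \<open>L2\<close> derivative. The integral identity serves as definition, so \<open>f'\<close>
  matters only up to null sets and no differentiation at points is involved.\<close>

definition ac :: "real \<Rightarrow> (real \<Rightarrow> complex) \<Rightarrow> (real \<Rightarrow> complex) \<Rightarrow> bool" where
  "ac L f f' \<longleftrightarrow> f' \<in> L2 L \<and> (\<forall>x\<in>{0..L}. f x = f 0 + integral {0..x} f')"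

lemma ac_L2: "ac L f f' \<Longrightarrow> f' \<in> L2 L"
  by (simp add: ac_def)

lemma L2_integrable_on: "f \<in> L2 L \<Longrightarrow> x \<in> {0..L} \<Longrightarrow> f integrable_on {0..x}"
  by (intro LINT_cut L2_integrable)

lemma ac_eq: "ac L f f' \<Longrightarrow> x \<in> {0..L} \<Longrightarrow> f x = f 0 + integral {0..x} f'"
  by (simp only: ac_def)

lemma ac_continuous: assumes "ac L f f'" shows "continuous_on {0..L} f"
proof (cases "0 \<le> L")
  case True
  have "continuous_on {0..L} (\<lambda>x. f 0 + integral {0..x} f')"
    using True by (intro continuous_intros indefinite_integral_continuous_1 L2_integrable_on[OF ac_L2[OF assms]]) simp
  then show ?thesis by (rule continuous_on_eq) (rule ac_eq[OF assms, symmetric])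
qed auto

lemma ac_self_L2: "ac L f f' \<Longrightarrow> f \<in> L2 L"
  by (intro continuous_L2 ac_continuous)

lemma ac_const: "ac L (\<lambda>x. c) (\<lambda>x. 0)"
  by (simp add: ac_def)

lemma ac_add: "ac L f f' \<Longrightarrow> ac L g g' \<Longrightarrow> ac L (\<lambda>x. f x + g x) (\<lambda>x. f' x + g' x)"
  unfolding ac_def
proof (intro conjI ballI; elim conjE)
  fix x assume *: "f' \<in> L2 L" "g' \<in> L2 L" and x: "x \<in> {0..L}"
    and f: "\<forall>x\<in>{0..L}. f x = f 0 + integral {0..x} f'" and g: "\<forall>x\<in>{0..L}. g x = g 0 + integral {0..x} g'"
  have "integral {0..x} (\<lambda>x. f' x + g' x) = integral {0..x} f' + integral {0..x} g'"
    using * x by (intro Henstock_Kurzweil_Integration.integral_add L2_integrable_on)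
  then show "f x + g x = f 0 + g 0 + integral {0..x} (\<lambda>x. f' x + g' x)"
    using bspec[OF f x] bspec[OF g x] by (simp only: add_ac)
qed (rule L2_add)

lemma ac_scale: "ac L f f' \<Longrightarrow> ac L (\<lambda>x. c * f x) (\<lambda>x. c * f' x)"
  unfolding ac_def
proof (intro conjI ballI; elim conjE)
  fix x assume x: "x \<in> {0..L}" and f: "\<forall>x\<in>{0..L}. f x = f 0 + integral {0..x} f'"
  show "c * f x = c * f 0 + integral {0..x} (\<lambda>x. c * f' x)"
    by (subst bspec[OF f x]) (simp only: distrib_left integral_mult_right)
qed (rule L2_scale)

lemma ac_diff: "ac L f f' \<Longrightarrow> ac L g g' \<Longrightarrow> ac L (\<lambda>x. f x - g x) (\<lambda>x. f' x - g' x)"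
  using ac_add[of L f f' "\<lambda>x. -1 * g x" "\<lambda>x. -1 * g' x"] ac_scale[of L g g' "-1"] by simp

lemma ac_cnj: "ac L f f' \<Longrightarrow> ac L (\<lambda>x. cnj (f x)) (\<lambda>x. cnj (f' x))"
  unfolding ac_def
proof (intro conjI ballI; elim conjE)
  fix x assume x: "x \<in> {0..L}" and f: "\<forall>x\<in>{0..L}. f x = f 0 + integral {0..x} f'"
  show "cnj (f x) = cnj (f 0) + integral {0..x} (\<lambda>x. cnj (f' x))"
    by (subst bspec[OF f x]) (simp only: complex_cnj_add integral_cnj)
qed (rule L2_cnj)

lemma ac_C1:
  assumes "continuous_on {0..L} f'" "\<And>x. x \<in> {0..L} \<Longrightarrow> (f has_vector_derivative f' x) (at x within {0..L})"
  shows "ac L f f'"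
  unfolding ac_def
proof (intro conjI ballI)
  show "f' \<in> L2 L" by (rule continuous_L2[OF assms(1)])
  fix x assume x: "x \<in> {0..L}"
  have "(f' has_integral (f x - f 0)) {0..x}"
    by (rule fundamental_theorem_of_calculus)
      (use x in \<open>auto intro!: has_vector_derivative_within_subset[OF assms(2)]\<close>)
  then show "f x = f 0 + integral {0..x} f'" by (simp add: integral_unique)
qed

lemma ac_endpoints: "ac L f f' \<Longrightarrow> 0 \<le> L \<Longrightarrow> f L - f 0 = (LINT x|leb L. f' x)"
proof -
  assume a: "ac L f f'" "0 \<le> L"
  have "f L = f 0 + integral {0..L} f'" using a by (intro ac_eq) auto
  then show "f L - f 0 = (LINT x|leb L. f' x)"
    using LINT_full[OF L2_integrable[OF ac_L2[OF a(1)]] a(2)] by simp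
qed

lemma ac_sub_le: "ac L f f' \<Longrightarrow> x \<in> {0..L} \<Longrightarrow> cmod (f x - f 0) \<le> sqrt L * L2_norm L f'"
proof -
  assume a: "ac L f f'" "x \<in> {0..L}"
  have "f x - f 0 = integral {0..x} f'" using ac_eq[OF a] by simp
  then show "cmod (f x - f 0) \<le> sqrt L * L2_norm L f'"
    using integral_L2_le[OF ac_L2[OF a(1)] a(2)] by simp
qed

section \<open>The product rule for absolutely continuous functions\<close>

lemma tendsto_zero_le:
  fixes f g :: "'a \<Rightarrow> real"
  assumes "(g \<longlongrightarrow> 0) F" "\<And>x. 0 \<le> f x" "\<And>x. f x \<le> g x"
  shows "(f \<longlongrightarrow> 0) F"
  by (rule tendsto_sandwich[OF _ _ tendsto_const assms(1)]) (simp_all add: assms)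

lemma LINT_mult_tendsto:
  assumes "\<And>n::nat. f n \<in> L2 L" "\<And>n. g n \<in> L2 L" "F \<in> L2 L" "G \<in> L2 L"
    and f: "(\<lambda>n. L2_norm L (\<lambda>x. f n x - F x)) \<longlonglongrightarrow> 0" and g: "(\<lambda>n. L2_norm L (\<lambda>x. g n x - G x)) \<longlonglongrightarrow> 0"
  shows "(\<lambda>n. LINT x|leb L. f n x * g n x) \<longlonglongrightarrow> (LINT x|leb L. F x * G x)"
proof -
  let ?a = "\<lambda>n. L2_norm L (\<lambda>x. f n x - F x)" and ?b = "\<lambda>n. L2_norm L (\<lambda>x. g n x - G x)"
  have le: "cmod ((LINT x|leb L. f n x * g n x) - (LINT x|leb L. F x * G x)) \<le> ?a n * (L2_norm L G + ?b n) + L2_norm L F * ?b n" for n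
  proof -
    have d: "(\<lambda>x. f n x - F x) \<in> L2 L" "(\<lambda>x. g n x - G x) \<in> L2 L" by (intro L2_diff assms)+
    have "(LINT x|leb L. f n x * g n x) - (LINT x|leb L. F x * G x) = (LINT x|leb L. f n x * g n x - F x * G x)"
      by (intro Bochner_Integration.integral_diff[symmetric] L2_mult_integrable assms)
    also have "\<dots> = (LINT x|leb L. (f n x - F x) * g n x + F x * (g n x - G x))"
      by (simp add: algebra_simps)
    also have "\<dots> = (LINT x|leb L. (f n x - F x) * g n x) + (LINT x|leb L. F x * (g n x - G x))"
      by (intro Bochner_Integration.integral_add L2_mult_integrable d assms)
    finally have "cmod ((LINT x|leb L. f n x * g n x) - (LINT x|leb L. F x * G x)) \<le> 
        cmod (LINT x|leb L. (f n x - F x) * g n x) + cmod (LINT x|leb L. F x * (g n x - G x))"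
      using norm_triangle_ineq by simp
    also have "\<dots> \<le> ?a n * L2_norm L (g n) + L2_norm L F * ?b n"
      by (intro add_mono L2_mult_le d assms)
    also have "L2_norm L (g n) \<le> L2_norm L G + ?b n"
      using L2_norm_triangle[OF d(2) assms(4)] by simp
    finally show ?thesis by (simp add: mult_left_mono)
  qed
  have "(\<lambda>n. ?a n * (L2_norm L G + ?b n) + L2_norm L F * ?b n) \<longlonglongrightarrow> 0 * (L2_norm L G + 0) + L2_norm L F * 0"
    by (intro tendsto_intros f g)
  then have "(\<lambda>n. ?a n * (L2_norm L G + ?b n) + L2_norm L F * ?b n) \<longlonglongrightarrow> 0" by simp
  then have "(\<lambda>n. cmod ((LINT x|leb L. f n x * g n x) - (LINT x|leb L. F x * G x))) \<longlonglongrightarrow> 0"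
    by (rule tendsto_zero_le) (simp_all only: le norm_ge_zero)
  then show ?thesis by (rule LIM_zero_cancel[OF tendsto_norm_zero_cancel])
qed

lemma L2_seq:
  assumes "0 < L" "f \<in> L2 L" "\<And>n. (0::real) < e n"
  obtains \<phi> where "\<And>n::nat. ctest L (\<phi> n)" "\<And>n. L2_norm L (\<lambda>x. \<phi> n x - f x) < e n"
proof -
  have "\<forall>n. \<exists>\<phi>. ctest L \<phi> \<and> L2_norm L (\<lambda>x. f x - \<phi> x) < e n"
    using ctest_dense[OF assms(1,2)] assms(3) by (auto simp: approximable_def)
  then obtain \<phi> where "\<forall>n. ctest L (\<phi> n) \<and> L2_norm L (\<lambda>x. f x - \<phi> n x) < e n" by metis
  then show ?thesis using that[of \<phi>] by (simp add: L2_norm_minus_commute)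
qed

lemma L2_seq_tendsto:
  assumes "0 < L" "f \<in> L2 L"
  obtains \<phi> where "\<And>n::nat. ctest L (\<phi> n)" "(\<lambda>n. L2_norm L (\<lambda>x. \<phi> n x - f x)) \<longlonglongrightarrow> 0"
proof -
  obtain \<phi> where \<phi>: "\<And>n::nat. ctest L (\<phi> n)" "\<And>n. L2_norm L (\<lambda>x. \<phi> n x - f x) < inverse (real (Suc n))"
    by (rule L2_seq[OF assms, of "\<lambda>n. inverse (real (Suc n))"], simp, blast)
  moreover have "(\<lambda>n. L2_norm L (\<lambda>x. \<phi> n x - f x)) \<longlonglongrightarrow> 0"
    by (rule tendsto_zero_le[OF LIMSEQ_inverse_real_of_nat L2_norm_nonneg less_imp_le[OF \<phi>(2)]])
  ultimately show ?thesis using that by blast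
qed

lemma continuous_bounded:
  assumes "continuous_on {0..L} (f :: real \<Rightarrow> complex)"
  obtains C where "0 \<le> C" "\<And>x. x \<in> {0..L} \<Longrightarrow> cmod (f x) \<le> C"
proof -
  obtain C where C: "\<And>x. x \<in> {0..L} \<Longrightarrow> cmod (f x) \<le> C"
    using compact_imp_bounded[OF compact_continuous_image[OF assms]] unfolding bounded_iff by blast
  have "cmod (f x) \<le> \<bar>C\<bar>" if "x \<in> {0..L}" for x using C[OF that] by linarith
  then show ?thesis using that[of "\<bar>C\<bar>"] by simp
qed

lemma L2_mult_bounded:
  assumes "f \<in> L2 L" "g \<in> borel_measurable (leb L)" "\<And>x. x \<in> {0<..<L} \<Longrightarrow> cmod (g x) \<le> C"
  shows "(\<lambda>x. f x * g x) \<in> L2 L" "0 \<le> C \<Longrightarrow> L2_norm L (\<lambda>x. f x * g x) \<le> C * L2_norm L f"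
proof -
  have [measurable]: "f \<in> borel_measurable (leb L)" "g \<in> borel_measurable (leb L)" using assms L2_measurable by auto
  have "AE x in leb L. cmod (f x * g x) \<le> C * cmod (f x)"
    using mult_left_mono[OF assms(3) norm_ge_zero] by (intro AE_I2) (simp add: norm_mult mult.commute)
  from L2_bound[OF assms(1) _ this]
  show "(\<lambda>x. f x * g x) \<in> L2 L" "0 \<le> C \<Longrightarrow> L2_norm L (\<lambda>x. f x * g x) \<le> C * L2_norm L f" by auto
qed

lemma L2_mult_continuous:
  assumes "f \<in> L2 L" "continuous_on {0..L} g"
  shows "(\<lambda>x. f x * g x) \<in> L2 L" "(\<lambda>x. g x * f x) \<in> L2 L"
proof -
  obtain C where "0 \<le> C" "\<And>x. x \<in> {0..L} \<Longrightarrow> cmod (g x) \<le> C" using continuous_bounded[OF assms(2)] by metis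
  then show "(\<lambda>x. f x * g x) \<in> L2 L"
    using L2_mult_bounded(1)[OF assms(1) L2_measurable[OF continuous_L2[OF assms(2)]], of C] by auto
  then show "(\<lambda>x. g x * f x) \<in> L2 L" by (simp add: mult.commute)
qed

text \<open>The rule is classical for the primitives \<open>P\<close>, \<open>Q\<close> of test
  functions close to \<open>f'\<close>, \<open>g'\<close> in \<open>L2\<close>. The identity between
  values and integral passes to the limit, since the factors converge uniformly and the derivatives
  in \<open>L2\<close>.\<close>

theorem ac_mult:
  assumes L: "0 < L" and f: "ac L f f'" and g: "ac L g g'"
  shows "ac L (\<lambda>x. f x * g x) (\<lambda>x. f' x * g x + f x * g' x)"
  unfolding ac_def
proof (intro conjI ballI)
  have fg: "continuous_on {0..L} f" "continuous_on {0..L} g" "f' \<in> L2 L" "g' \<in> L2 L"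
    using f g by (auto intro: ac_continuous ac_L2)
  show "(\<lambda>x. f' x * g x + f x * g' x) \<in> L2 L"
    by (intro L2_add L2_mult_continuous fg)
  fix x assume x: "x \<in> {0..L}"
  obtain p where p: "\<And>n::nat. ctest L (p n)" "(\<lambda>n. L2_norm L (\<lambda>x. p n x - f' x)) \<longlonglongrightarrow> 0"
    using L2_seq_tendsto[OF L fg(3)] by blast
  obtain q where q: "\<And>n::nat. ctest L (q n)" "(\<lambda>n. L2_norm L (\<lambda>x. q n x - g' x)) \<longlonglongrightarrow> 0"
    using L2_seq_tendsto[OF L fg(4)] by blast
  \<comment> \<open>Starting at \<open>f 0\<close> makes the error \<open>P n - f\<close> a
    primitive of the error of the derivatives, which \<open>ac_sub_le\<close> bounds uniformly in
    \<open>x\<close>.\<close>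
  define P where "P n x = f 0 + integral {0..x} (p n)" for n x
  define Q where "Q n x = g 0 + integral {0..x} (q n)" for n x
  have prim: "(P n has_vector_derivative p n x) (at x within {0..L})" "(Q n has_vector_derivative q n x) (at x within {0..L})"
    if "x \<in> {0..L}" for n x
    unfolding P_def[abs_def] Q_def[abs_def] using that
    by (auto intro!: derivative_eq_intros integral_has_vector_derivative ctest_continuous p q)
  have PQc: "continuous_on {0..L} (P n)" "continuous_on {0..L} (Q n)" for n
    unfolding continuous_on_eq_continuous_within using prim has_vector_derivative_continuous by blast+
  have PQ2: "p n \<in> L2 L" "q n \<in> L2 L" "P n \<in> L2 L" "Q n \<in> L2 L" for n
    using p q PQc by (auto intro: ctest_L2 continuous_L2)
  have PQac: "ac L (\<lambda>x. P n x * Q n x) (\<lambda>x. p n x * Q n x + P n x * q n x)" for n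
  proof (rule ac_C1)
    show "continuous_on {0..L} (\<lambda>x. p n x * Q n x + P n x * q n x)"
      by (intro continuous_intros PQc ctest_continuous[OF p(1)] ctest_continuous[OF q(1)])
    show "((\<lambda>x. P n x * Q n x) has_vector_derivative p n x * Q n x + P n x * q n x) (at x within {0..L})" if "x \<in> {0..L}" for x
      using has_vector_derivative_mult[OF prim[OF that, of n]] by (simp add: add.commute)
  qed
  have acP: "ac L (P n) (p n)" "ac L (Q n) (q n)" for n
    by (rule ac_C1[OF ctest_continuous[OF p(1)] prim(1)], assumption) (rule ac_C1[OF ctest_continuous[OF q(1)] prim(2)])
  have bP: "cmod (P n x - f x) \<le> sqrt L * L2_norm L (\<lambda>x. p n x - f' x)" if "x \<in> {0..L}" for n x
    using ac_sub_le[OF ac_diff[OF acP(1) f] that, of n] by (simp add: P_def)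
  have bQ: "cmod (Q n x - g x) \<le> sqrt L * L2_norm L (\<lambda>x. q n x - g' x)" if "x \<in> {0..L}" for n x
    using ac_sub_le[OF ac_diff[OF acP(2) g] that, of n] by (simp add: Q_def)
  have conv: "(\<lambda>n. L2_norm L (\<lambda>x. P n x - f x)) \<longlonglongrightarrow> 0" "(\<lambda>n. P n x) \<longlonglongrightarrow> f x"
    "(\<lambda>n. L2_norm L (\<lambda>x. Q n x - g x)) \<longlonglongrightarrow> 0" "(\<lambda>n. Q n x) \<longlonglongrightarrow> g x"
  proof -
    have m: "(\<lambda>x. P n x - f x) \<in> borel_measurable (leb L)" "(\<lambda>x. Q n x - g x) \<in> borel_measurable (leb L)" for n
      by (intro L2_measurable L2_diff PQ2 continuous_L2 fg)+
    have "(\<lambda>n. sqrt L * L2_norm L (\<lambda>x. p n x - f' x) * sqrt L) \<longlonglongrightarrow> sqrt L * 0 * sqrt L"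
      by (intro tendsto_intros p)
    then have "(\<lambda>n. sqrt L * L2_norm L (\<lambda>x. p n x - f' x) * sqrt L) \<longlonglongrightarrow> 0" by simp
    moreover have "L2_norm L (\<lambda>x. P n x - f x) \<le> sqrt L * L2_norm L (\<lambda>x. p n x - f' x) * sqrt L" for n
      by (rule L2_bounded(2)[OF m(1)]) (use L bP in \<open>auto intro!: AE_I2\<close>)
    ultimately show "(\<lambda>n. L2_norm L (\<lambda>x. P n x - f x)) \<longlonglongrightarrow> 0"
      by (rule tendsto_zero_le[OF _ L2_norm_nonneg])
    have "(\<lambda>n. sqrt L * L2_norm L (\<lambda>x. q n x - g' x) * sqrt L) \<longlonglongrightarrow> sqrt L * 0 * sqrt L"
      by (intro tendsto_intros q)
    then have "(\<lambda>n. sqrt L * L2_norm L (\<lambda>x. q n x - g' x) * sqrt L) \<longlonglongrightarrow> 0" by simp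
    moreover have "L2_norm L (\<lambda>x. Q n x - g x) \<le> sqrt L * L2_norm L (\<lambda>x. q n x - g' x) * sqrt L" for n
      by (rule L2_bounded(2)[OF m(2)]) (use L bQ in \<open>auto intro!: AE_I2\<close>)
    ultimately show "(\<lambda>n. L2_norm L (\<lambda>x. Q n x - g x)) \<longlonglongrightarrow> 0"
      by (rule tendsto_zero_le[OF _ L2_norm_nonneg])
    have "(\<lambda>n. sqrt L * L2_norm L (\<lambda>x. p n x - f' x)) \<longlonglongrightarrow> sqrt L * 0"
      by (intro tendsto_intros p)
    then have "(\<lambda>n. cmod (P n x - f x)) \<longlonglongrightarrow> 0"
      by (intro tendsto_zero_le[OF _ norm_ge_zero bP[OF x]]) simp
    then show "(\<lambda>n. P n x) \<longlonglongrightarrow> f x" by (rule LIM_zero_cancel[OF tendsto_norm_zero_cancel])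
    have "(\<lambda>n. sqrt L * L2_norm L (\<lambda>x. q n x - g' x)) \<longlonglongrightarrow> sqrt L * 0"
      by (intro tendsto_intros q)
    then have "(\<lambda>n. cmod (Q n x - g x)) \<longlonglongrightarrow> 0"
      by (intro tendsto_zero_le[OF _ norm_ge_zero bQ[OF x]]) simp
    then show "(\<lambda>n. Q n x) \<longlonglongrightarrow> g x" by (rule LIM_zero_cancel[OF tendsto_norm_zero_cancel])
  qed
  \<comment> \<open>Only one factor of each product is truncated: the integral over
    \<open>{0..x}\<close> becomes a pairing on \<open>(0, L)\<close>, and
    \<open>LINT_mult_tendsto\<close> applies.\<close>
  let ?c = "\<lambda>h y. if y < x then h y else (0::complex)"
  have cut: "(\<lambda>n. L2_norm L (\<lambda>y. ?c (h n) y - ?c H y)) \<longlonglongrightarrow> 0"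
    if "\<And>n. h n \<in> L2 L" "H \<in> L2 L" "(\<lambda>n. L2_norm L (\<lambda>y. h n y - H y)) \<longlonglongrightarrow> 0" for h H
  proof (rule tendsto_sandwich[OF _ _ tendsto_const that(3)])
    have "(\<lambda>y. ?c (h n) y - ?c H y) = ?c (\<lambda>y. h n y - H y)" for n by auto
    then show "\<forall>\<^sub>F n in sequentially. L2_norm L (\<lambda>y. ?c (h n) y - ?c H y) \<le> L2_norm L (\<lambda>y. h n y - H y)"
      using L2_cut(2)[OF L2_diff[OF that(1,2)]] by simp
  qed auto
  have int: "integral {0..x} (\<lambda>y. a y * b y + c y * d y) = (LINT y|leb L. ?c a y * b y) + (LINT y|leb L. ?c c y * d y)"
    if "a \<in> L2 L" "b \<in> L2 L" "c \<in> L2 L" "d \<in> L2 L" for a b c d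
  proof -
    have "integral {0..x} (\<lambda>y. a y * b y + c y * d y) = (LINT y|leb L. ?c (\<lambda>y. a y * b y + c y * d y) y)"
      by (intro LINT_cut(2) x Bochner_Integration.integrable_add L2_mult_integrable that)
    also have "\<dots> = (LINT y|leb L. ?c a y * b y + ?c c y * d y)"
      by (intro Bochner_Integration.integral_cong) auto
    also have "\<dots> = (LINT y|leb L. ?c a y * b y) + (LINT y|leb L. ?c c y * d y)"
      by (intro Bochner_Integration.integral_add L2_mult_integrable L2_cut that)
    finally show ?thesis .
  qed
  note c2 = continuous_L2[OF fg(1)] continuous_L2[OF fg(2)]
  have "(\<lambda>n. P n 0 * Q n 0 + ((LINT y|leb L. ?c (p n) y * Q n y) + (LINT y|leb L. ?c (P n) y * q n y))) \<longlonglongrightarrow>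
     f 0 * g 0 + ((LINT y|leb L. ?c f' y * g y) + (LINT y|leb L. ?c f y * g' y))"
    by (intro tendsto_add LINT_mult_tendsto cut L2_cut conv p(2) q(2) PQ2 fg c2) (simp add: P_def Q_def)
  moreover have "P n x * Q n x = P n 0 * Q n 0 + ((LINT y|leb L. ?c (p n) y * Q n y) + (LINT y|leb L. ?c (P n) y * q n y))" for n
    using ac_eq[OF PQac[of n] x] int[OF PQ2(1) PQ2(4) PQ2(3) PQ2(2), of n n n n] by simp
  ultimately have "(\<lambda>n. P n x * Q n x) \<longlonglongrightarrow> f 0 * g 0 + integral {0..x} (\<lambda>x. f' x * g x + f x * g' x)"
    using int[OF fg(3) c2(2) c2(1) fg(4)] by simp
  moreover have "(\<lambda>n. P n x * Q n x) \<longlonglongrightarrow> f x * g x" by (intro tendsto_mult conv)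
  ultimately show "f x * g x = f 0 * g 0 + integral {0..x} (\<lambda>x. f' x * g x + f x * g' x)"
    using LIMSEQ_unique by blast
qed

section \<open>Weak derivatives and absolutely continuous representatives\<close>

lemma ac_test_function:
  assumes "test_function L \<psi>" shows "ac L (\<lambda>x. of_real (\<psi> x)) (\<lambda>x. of_real (deriv \<psi> x))"
proof (rule ac_C1)
  show "continuous_on {0..L} (\<lambda>x. complex_of_real (deriv \<psi> x))"
    using test_function_deriv[OF assms] by (intro continuous_intros smooth_continuous) (simp add: test_function_iff)
  show "((\<lambda>x. complex_of_real (\<psi> x)) has_vector_derivative of_real (deriv \<psi> x)) (at x within {0..L})" for x
    using assms by (intro has_vector_derivative_of_real has_vector_derivative_at_within)
      (simp add: test_function_iff smooth_DERIV flip: has_real_derivative_iff_has_vector_derivative)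
qed

lemma test_function_L2: "test_function L \<psi> \<Longrightarrow> (\<lambda>x. complex_of_real (\<psi> x)) \<in> L2 L"
  using ac_self_L2[OF ac_test_function] .

lemma ac_weak_deriv:
  assumes L: "0 < L" and F: "ac L F g" and f: "f \<in> L2 L" "AE x in leb L. f x = F x"
  shows "weak_deriv L 1 f g"
  unfolding weak_deriv_def
proof (intro allI impI)
  fix \<psi> assume \<psi>: "test_function L \<psi>"
  note t = test_function_L2[OF \<psi>] test_function_L2[OF test_function_deriv[OF \<psi>]]
  have "(LINT x|leb L. f x * of_real (deriv \<psi> x)) = (LINT x|leb L. F x * of_real (deriv \<psi> x))"
  proof (rule integral_cong_AE)
    show "(\<lambda>x. f x * of_real (deriv \<psi> x)) \<in> borel_measurable (leb L)"
      using L2_mult_integrable(1)[OF f(1) t(2)] by (rule borel_measurable_integrable)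
    show "(\<lambda>x. F x * of_real (deriv \<psi> x)) \<in> borel_measurable (leb L)"
      using L2_mult_integrable(1)[OF ac_self_L2[OF F] t(2)] by (rule borel_measurable_integrable)
  qed (use f(2) in auto)
  also have "\<dots> = - (LINT x|leb L. g x * of_real (\<psi> x))"
  proof -
    have "0 = (LINT x|leb L. g x * of_real (\<psi> x) + F x * of_real (deriv \<psi> x))"
      using ac_endpoints[OF ac_mult[OF L F ac_test_function[OF \<psi>]]] L test_function_outside[OF \<psi>] by simp
    also have "\<dots> = (LINT x|leb L. g x * of_real (\<psi> x)) + (LINT x|leb L. F x * of_real (deriv \<psi> x))"
      by (intro Bochner_Integration.integral_add L2_mult_integrable t ac_L2[OF F] ac_self_L2[OF F])
    finally show ?thesis by (simp add: eq_neg_iff_add_eq_0 add.commute)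
  qed
  finally show "(LINT x|leb L. f x * of_real ((deriv ^^ 1) \<psi> x)) = (- 1) ^ 1 * (LINT x|leb L. g x * of_real (\<psi> x))" by simp
qed

text \<open>The zero mean makes the primitive vanish to the right of the support. This characterises
  the derivatives of test functions and is the key to recognising constants.\<close>

lemma test_function_antiderivative:
  assumes L: "0 < L" and \<eta>: "test_function L \<eta>" and z: "(LINT x|leb L. complex_of_real (\<eta> x)) = 0"
  obtains \<psi> where "test_function L \<psi>" "deriv \<psi> = \<eta>"
proof -
  obtain a b where ab: "0 < a" "b < L" "\<And>x. x < a \<Longrightarrow> \<eta> x = 0" "\<And>x. b < x \<Longrightarrow> \<eta> x = 0"
    using test_functionE[OF \<eta>] by metis
  have s: "smooth \<eta>" using \<eta> by (simp add: test_function_iff)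
  define \<psi> where "\<psi> x = integral {0..x} \<eta>" for x
  have i: "\<eta> integrable_on {x..y}" for x y by (intro integrable_continuous_real smooth_continuous s)
  have left: "\<psi> x = 0" if "x < a" for x
  proof -
    have "\<psi> x = integral {0..x} (\<lambda>x. 0)" unfolding \<psi>_def by (intro integral_cong) (use that ab in auto)
    then show ?thesis by simp
  qed
  have full: "\<psi> L = 0"
  proof -
    have "((\<lambda>x. complex_of_real (\<eta> x)) has_integral of_real (\<psi> L)) {0..L}"
      unfolding \<psi>_def using has_integral_linear[OF integrable_integral[OF i] bounded_linear_of_real] by (simp add: o_def)
    then have "complex_of_real (\<psi> L) = integral {0..L} (\<lambda>x. complex_of_real (\<eta> x))"
      by (rule integral_unique[symmetric])
    also have "\<dots> = 0" using LINT_full[OF L2_integrable[OF test_function_L2[OF \<eta>]]] L z by simp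
    finally show ?thesis by simp
  qed
  have zero: "integral {x..y} \<eta> = 0" if "b < x" for x y
  proof -
    have "integral {x..y} \<eta> = integral {x..y} (\<lambda>x. 0)" by (intro integral_cong) (use that ab in auto)
    then show ?thesis by simp
  qed
  \<comment> \<open>\<open>b\<close> may be negative when \<eta> is zero, whereas the primitive
    starts at 0; hence \<open>max 0 b\<close>.\<close>
  have right: "\<psi> x = 0" if "max 0 b < x" for x
  proof (cases "x \<le> L")
    case True
    then show ?thesis using Henstock_Kurzweil_Integration.integral_combine[of 0 x L \<eta>] i zero[of x L] that full by (simp add: \<psi>_def)
  next
    case False
    then show ?thesis using Henstock_Kurzweil_Integration.integral_combine[of 0 L x \<eta>] i zero[of L x] L ab full by (simp add: \<psi>_def)
  qed
  have d: "(\<psi> has_real_derivative \<eta> x) (at x)" for x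
  proof (cases "0 < x")
    case True
    have "(\<psi> has_vector_derivative \<eta> x) (at x within {0..x+1})"
      unfolding \<psi>_def[abs_def] by (rule integral_has_vector_derivative) (use True in \<open>auto intro: smooth_continuous s\<close>)
    moreover have "at x within {0..x+1} = at x" using True by (intro at_within_interior) auto
    ultimately show ?thesis by (simp add: has_real_derivative_iff_has_vector_derivative)
  next
    case False
    have "\<forall>\<^sub>F y in nhds x. y \<in> {..<a}" using False ab by (intro eventually_nhds_in_open) auto
    then have "\<forall>\<^sub>F y in nhds x. \<psi> y = 0" by eventually_elim (auto intro!: left)
    then show ?thesis using False ab by (subst DERIV_cong_ev[OF refl _ refl]) auto
  qed
  have "smooth \<psi>"
  proof (rule smooth_coinduct[of _ "insert \<psi> {g. smooth g}"])
    fix g assume g: "g \<in> insert \<psi> {g. smooth g}"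
    then consider "g = \<psi>" | "smooth g" by blast
    then show "\<exists>g'\<in>insert \<psi> {g. smooth g}. \<forall>x. (g has_real_derivative g' x) (at x)"
    proof cases
      case 1 with d s show ?thesis by (intro bexI[of _ \<eta>]) auto
    next
      case 2 then show ?thesis by (intro bexI[of _ "deriv g"]) (auto intro: smooth_DERIV smooth_deriv)
    qed
  qed simp
  moreover have "\<forall>x. x \<notin> {a..max 0 b} \<longrightarrow> \<psi> x = 0" using left right by (metis atLeastAtMost_iff not_le)
  ultimately have "test_function L \<psi>" unfolding test_function_iff using ab L by (intro conjI exI[of _ a] exI[of _ "max 0 b"]) auto
  moreover have "deriv \<psi> = \<eta>" using d by (auto intro: DERIV_imp_deriv)
  ultimately show ?thesis by (rule that)
qed

text \<open>Du Bois-Reymond: \<open>f\<close> minus the primitive of \<open>g\<close> is orthogonal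
  to all derivatives of test functions and is therefore constant almost everywhere.\<close>

theorem weak_deriv_ac:
  assumes L: "0 < L" and f: "f \<in> L2 L" and g: "g \<in> L2 L" and w: "weak_deriv L 1 f g"
  obtains F where "ac L F g" "AE x in leb L. f x = F x"
proof -
  define G where "G x = integral {0..x} g" for x
  have G: "ac L G g" using g by (simp add: ac_def G_def)
  have G2: "G \<in> L2 L" by (rule ac_self_L2[OF G])
  define H where "H x = f x - G x" for x
  have H: "H \<in> L2 L" unfolding H_def by (intro L2_diff f G2)
  have H0: "(LINT x|leb L. H x * of_real (deriv \<psi> x)) = 0" if \<psi>: "test_function L \<psi>" for \<psi>
  proof -
    note t = test_function_L2[OF test_function_deriv[OF \<psi>]]
    have "(LINT x|leb L. H x * of_real (deriv \<psi> x)) = (LINT x|leb L. f x * of_real (deriv \<psi> x)) - (LINT x|leb L. G x * of_real (deriv \<psi> x))"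
      unfolding H_def left_diff_distrib by (intro Bochner_Integration.integral_diff L2_mult_integrable t f G2)
    then show ?thesis using w ac_weak_deriv[OF L G G2] \<psi> by (auto simp: weak_deriv_def)
  qed
  \<comment> \<open>If every test function had integral 0, the constant 1 would vanish almost
    everywhere by \<open>fundamental_lemma\<close>.\<close>
  obtain \<zeta> where \<zeta>: "test_function L \<zeta>" "(LINT x|leb L. complex_of_real (\<zeta> x)) \<noteq> 0"
  proof (rule ccontr)
    assume n: "\<not> thesis"
    have "AE x in leb L. (1::complex) = 0"
      by (rule fundamental_lemma[OF L L2_const]) (use n that in auto)
    then have "AE x in leb L. False" by simp
    then have "emeasure (leb L) (space (leb L)) = 0" by (simp add: eventually_False ae_filter_eq_bot_iff)
    then show False using L by (simp add: emeasure_restrict_space)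
  qed
  define m where "m = (LINT x|leb L. \<zeta> x)"
  have LR: "(LINT x|leb L. complex_of_real (p x)) = of_real (LINT x|leb L. p x)" for p :: "real \<Rightarrow> real" by simp
  have m: "m \<noteq> 0" using \<zeta>(2) by (auto simp: m_def)
  \<comment> \<open>The value that the constant must take, obtained by testing with \<zeta>. Any
    other test function becomes a derivative once the multiple \<open>k\<close> of \<zeta> with the
    same integral is subtracted.\<close>
  define c where "c = (LINT x|leb L. H x * of_real (\<zeta> x)) / of_real m"
  have "(LINT x|leb L. (H x - c) * of_real (\<psi> x)) = 0" if \<psi>: "test_function L \<psi>" for \<psi>
  proof -
    define k where "k = (LINT x|leb L. \<psi> x) / m"
    let ?\<eta> = "\<lambda>x. \<psi> x + (- k) * \<zeta> x"
    have t: "test_function L ?\<eta>" by (intro test_function_add test_function_scale \<psi> \<zeta>)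
    have r: "integrable (leb L) \<psi>" "integrable (leb L) \<zeta>"
      using L2_integrable[OF test_function_L2[OF \<psi>], THEN integrable_Re] L2_integrable[OF test_function_L2[OF \<zeta>(1)], THEN integrable_Re] by simp_all
    have "(LINT x|leb L. ?\<eta> x) = 0" using r m by (simp add: k_def m_def)
    then have "(LINT x|leb L. complex_of_real (?\<eta> x)) = 0" unfolding LR by simp
    from test_function_antiderivative[OF L t this] obtain \<theta> where "test_function L \<theta>" "deriv \<theta> = ?\<eta>" by blast
    then have "0 = (LINT x|leb L. H x * of_real (?\<eta> x))" using H0 by metis
    also have "\<dots> = (LINT x|leb L. H x * of_real (\<psi> x) - of_real k * (H x * of_real (\<zeta> x)))"
      by (simp add: algebra_simps)
    also have "\<dots> = (LINT x|leb L. H x * of_real (\<psi> x)) - of_real k * (LINT x|leb L. H x * of_real (\<zeta> x))"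
      using L2_mult_integrable(1)[OF H test_function_L2[OF \<psi>]] L2_mult_integrable(1)[OF H test_function_L2[OF \<zeta>(1)]] by simp
    also have "of_real k * (LINT x|leb L. H x * of_real (\<zeta> x)) = c * of_real (LINT x|leb L. \<psi> x)"
      by (simp add: k_def c_def)
    finally have "(LINT x|leb L. H x * of_real (\<psi> x)) - c * of_real (LINT x|leb L. \<psi> x) = 0" by simp
    moreover have "(LINT x|leb L. (H x - c) * of_real (\<psi> x)) = (LINT x|leb L. H x * of_real (\<psi> x)) - (LINT x|leb L. c * of_real (\<psi> x))"
      unfolding left_diff_distrib by (intro Bochner_Integration.integral_diff L2_mult_integrable test_function_L2 \<psi> H L2_const)
    ultimately show ?thesis by simp
  qed
  then have "AE x in leb L. H x - c = 0" by (intro fundamental_lemma L L2_diff H L2_const)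
  then have "AE x in leb L. f x = G x + c" by eventually_elim (simp add: H_def algebra_simps)
  moreover have "ac L (\<lambda>x. G x + c) g" using ac_add[OF G ac_const] by simp
  ultimately show ?thesis using that by blast
qed

lemma weak_deriv_unique:
  assumes L: "0 < L" and g: "g \<in> L2 L" "h \<in> L2 L" and w: "weak_deriv L k f g" "weak_deriv L k f h"
  shows "AE x in leb L. g x = h x"
proof -
  have "(LINT x|leb L. (g x - h x) * of_real (\<psi> x)) = 0" if \<psi>: "test_function L \<psi>" for \<psi>
  proof -
    have "(LINT x|leb L. (g x - h x) * of_real (\<psi> x)) = (LINT x|leb L. g x * of_real (\<psi> x)) - (LINT x|leb L. h x * of_real (\<psi> x))"
      unfolding left_diff_distrib by (intro Bochner_Integration.integral_diff L2_mult_integrable test_function_L2 \<psi> g)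
    moreover have "(-1) ^ k * (LINT x|leb L. g x * of_real (\<psi> x)) = (-1) ^ k * (LINT x|leb L. h x * of_real (\<psi> x))"
      using w(1)[unfolded weak_deriv_def, rule_format, OF \<psi>] w(2)[unfolded weak_deriv_def, rule_format, OF \<psi>] by (rule trans[OF sym])
    ultimately show ?thesis by simp
  qed
  then have "AE x in leb L. g x - h x = 0" by (intro fundamental_lemma L L2_diff g)
  then show ?thesis by simp
qed

subsection \<open>Energy estimates for \<open>A\<close>\<close>

lemma ac_cong:
  assumes "ac L f f'" "\<And>x. f x = g x" "\<And>x. f' x = g' x" shows "ac L g g'"
proof -
  have "f = g" "f' = g'" using assms by auto
  with assms(1) show ?thesis by simp
qed

text \<open>Testing with \<open>deriv \<psi>\<close> in place of \<psi> compares the orders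
  \<open>j\<close> and \<open>Suc j\<close>. \<open>sobolev\<close> asks for each order directly,
  and this recovers the chain of first derivatives.\<close>

lemma weak_deriv_step:
  assumes "weak_deriv L j f g" "weak_deriv L (Suc j) f h" shows "weak_deriv L 1 g h"
  unfolding weak_deriv_def
proof (intro allI impI)
  fix \<psi> assume \<psi>: "test_function L \<psi>"
  have "(-1) ^ j * (LINT x|leb L. g x * of_real (deriv \<psi> x)) = (LINT x|leb L. f x * of_real ((deriv ^^ j) (deriv \<psi>) x))"
    using assms(1) test_function_deriv[OF \<psi>] by (simp add: weak_deriv_def)
  also have "\<dots> = (LINT x|leb L. f x * of_real ((deriv ^^ Suc j) \<psi> x))"
    by (simp only: funpow_Suc_right comp_apply)
  also have "\<dots> = (-1) ^ Suc j * (LINT x|leb L. h x * of_real (\<psi> x))"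
    using assms(2) \<psi> by (simp only: weak_deriv_def)
  finally have "(-1) ^ j * (LINT x|leb L. g x * of_real (deriv \<psi> x)) = (-1) ^ j * (- (LINT x|leb L. h x * of_real (\<psi> x)))"
    by simp
  then have "(LINT x|leb L. g x * of_real (deriv \<psi> x)) = - (LINT x|leb L. h x * of_real (\<psi> x))"
    by (rule mult_left_cancel[THEN iffD1, rotated]) simp
  then show "(LINT x|leb L. g x * of_real ((deriv ^^ 1) \<psi> x)) = (- 1) ^ 1 * (LINT x|leb L. h x * of_real (\<psi> x))"
    by simp
qed

lemma weak_deriv_comp:
  assumes "weak_deriv L j f g" "weak_deriv L 1 g h" shows "weak_deriv L (Suc j) f h"
  unfolding weak_deriv_def
proof (intro allI impI)
  fix \<psi> assume \<psi>: "test_function L \<psi>"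
  have "(LINT x|leb L. f x * of_real ((deriv ^^ Suc j) \<psi> x)) = (LINT x|leb L. f x * of_real ((deriv ^^ j) (deriv \<psi>) x))"
    by (simp only: funpow_Suc_right comp_apply)
  also have "\<dots> = (-1) ^ j * (LINT x|leb L. g x * of_real (deriv \<psi> x))"
    using assms(1) test_function_deriv[OF \<psi>] by (simp add: weak_deriv_def)
  also have "\<dots> = (-1) ^ Suc j * (LINT x|leb L. h x * of_real (\<psi> x))"
    using assms(2) \<psi> by (simp add: weak_deriv_def)
  finally show "(LINT x|leb L. f x * of_real ((deriv ^^ Suc j) \<psi> x)) = (-1) ^ Suc j * (LINT x|leb L. h x * of_real (\<psi> x))" .
qed

lemma weak_deriv_0: "weak_deriv L 0 f f"
  by (simp add: weak_deriv_def)

lemma wderivI: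
  assumes "g \<in> L2 L" "weak_deriv L k f g"
  shows "wderiv L k f \<in> L2 L" "weak_deriv L k f (wderiv L k f)"
  using someI[of "\<lambda>g. g \<in> L2 L \<and> weak_deriv L k f g" g] assms unfolding wderiv_def by auto

lemma wderiv_AE:
  assumes "0 < L" "g \<in> L2 L" "weak_deriv L k f g"
  shows "AE x in leb L. wderiv L k f x = g x"
  using weak_deriv_unique[OF assms(1) wderivI(1)[OF assms(2,3)] assms(2) wderivI(2)[OF assms(2,3)] assms(3)] .

text \<open>The set in \<open>(0, L)\<close> where the two functions differ is open and null, hence
  empty; the endpoints follow by continuity. Traces are thereby well defined.\<close>

lemma continuous_AE_eq:
  fixes f g :: "real \<Rightarrow> complex"
  assumes L: "0 < L" and f: "continuous_on {0..L} f" and g: "continuous_on {0..L} g"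
    and ae: "AE x in leb L. f x = g x" and x: "x \<in> {0..L}"
  shows "f x = g x"
proof -
  define h where "h y = f y - g y" for y
  have h: "continuous_on {0..L} h" unfolding h_def by (intro continuous_intros f g)
  have h': "continuous_on {0<..<L} h" by (rule continuous_on_subset[OF h]) auto
  have op: "open ({0<..<L} \<inter> h -` (- {0}))"
    using continuous_on_open_vimage[of "{0<..<L}" h] h' by (metis inf_commute open_Compl closed_singleton open_greaterThanLessThan)
  have "AE y in lebesgue. y \<in> {0<..<L} \<longrightarrow> h y = 0"
    using ae by (subst (asm) AE_restrict_space_iff) (auto simp: h_def)
  then have "AE y in lebesgue. y \<notin> ({0<..<L} \<inter> h -` (- {0}))" by eventually_elim auto
  then have "negligible ({0<..<L} \<inter> h -` (- {0}))"
    using op by (subst negligible_iff_null_sets) (auto simp: AE_iff_null_sets[OF borel_open[THEN sets_completionI_sets]] intro!: AE_iff_null_sets[THEN iffD2])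
  then have e: "{0<..<L} \<inter> h -` (- {0}) = {}"
    using op open_not_negligible by blast
  have "closure {0<..<L} = {0..L}" using L by simp
  then have cl: "continuous_on (closure {0<..<L}) h" "x \<in> closure {0<..<L}" using h x by simp_all
  have "h y = 0" if "y \<in> {0<..<L}" for y
    using e that by blast
  then have "h x = 0" by (rule continuous_constant_on_closure[OF cl(1) _ cl(2)])
  then show ?thesis by (simp add: h_def)
qed

lemma has_trace_unique:
  assumes "0 < L" "has_trace L f a c" "continuous_on {0..L} p" "AE x in leb L. f x = p x" "a \<in> {0..L}"
  shows "p a = c"
proof -
  obtain g where g: "continuous_on {0..L} g" "AE x in leb L. f x = g x" "g a = c" using assms(2) by (auto simp: has_trace_def)
  have "AE x in leb L. p x = g x" using assms(4) g(2) by eventually_elim simp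
  from continuous_AE_eq[OF assms(1,3) g(1) this assms(5)] g(3) show ?thesis by simp
qed

lemma has_traceI:
  assumes "continuous_on {0..L} p" "AE x in leb L. f x = p x" "p a = c" shows "has_trace L f a c"
  using assms by (auto simp: has_trace_def)

section \<open>Inequalities between real numbers\<close>

lemma Young_weighted:
  fixes \<beta> k a b :: real
  assumes "0 < \<beta>" shows "k * (a * b) \<le> \<beta> / 2 * a\<^sup>2 + k\<^sup>2 / (2 * \<beta>) * b\<^sup>2"
proof -
  have "2 * (\<beta> * a) * (k * b) \<le> (\<beta> * a)\<^sup>2 + (k * b)\<^sup>2" by (rule sum_squares_bound)
  then have "k * (a * b) * (2 * \<beta>) \<le> \<beta>\<^sup>2 * a\<^sup>2 + k\<^sup>2 * b\<^sup>2" by (simp add: power_mult_distrib mult_ac)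
  then have "k * (a * b) \<le> (\<beta>\<^sup>2 * a\<^sup>2 + k\<^sup>2 * b\<^sup>2) / (2 * \<beta>)"
    using assms by (intro mult_imp_le_div_pos) auto
  also have "\<dots> = \<beta> / 2 * a\<^sup>2 + k\<^sup>2 / (2 * \<beta>) * b\<^sup>2"
    using assms by (simp add: add_divide_distrib power2_eq_square)
  finally show ?thesis .
qed

text \<open>Eliminates \<open>b\<close> and \<open>c\<close>, the norms of second and third
  derivative, in favour of \<open>a\<close> and \<open>d\<close>, the norms of the first derivatives
  of a function and of its image under \<open>A\<close>; \<open>n\<close> is the norm of the image.
  The two alternatives are the cases where \<open>n\<close> or the lower-order part
  \<open>k * b\<close> dominates the bound for \<open>c\<close>.\<close>

lemma interpolation_real:
  fixes a b c n d k q :: real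
  assumes q: "0 < q" and nn: "0 \<le> a" "0 \<le> b" "0 \<le> c" "0 \<le> n" "0 \<le> d" "0 \<le> k" "0 \<le> M"
    and 1: "n\<^sup>2 \<le> M * (d * b)" and 2: "q * c \<le> n + k * b" and 3: "b\<^sup>2 \<le> 6 * (a * c)"
  shows "n ^ 3 \<le> 12 / q * M\<^sup>2 * (d\<^sup>2 * a) \<or> n\<^sup>2 \<le> 12 / q * k * M * (d * a)"
proof -
  have "q * b\<^sup>2 \<le> 6 * a * (q * c)" using mult_left_mono[OF 3, of q] q by (simp add: mult_ac)
  also have "\<dots> \<le> 6 * a * (n + k * b)" using 2 nn by (intro mult_left_mono) auto
  finally have b2: "q * b\<^sup>2 \<le> 6 * a * (n + k * b)" .
  show ?thesis
  proof (cases "k * b \<le> n")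
    case True
    have "q * b\<^sup>2 \<le> 12 * a * n" using b2 mult_left_mono[OF True, of "6 * a"] nn by (simp add: algebra_simps)
    then have b3: "b\<^sup>2 \<le> 12 / q * (a * n)" using q by (simp add: field_simps)
    have "n ^ 3 \<le> 12 / q * M\<^sup>2 * (d\<^sup>2 * a)"
    proof (cases "n = 0")
      case False
      have "n * n ^ 3 = (n\<^sup>2)\<^sup>2" by (simp add: power2_eq_square power3_eq_cube)
      also have "\<dots> \<le> (M * (d * b))\<^sup>2" using 1 by (intro power_mono) auto
      also have "\<dots> = M\<^sup>2 * d\<^sup>2 * b\<^sup>2" by (simp add: power_mult_distrib)
      also have "\<dots> \<le> M\<^sup>2 * d\<^sup>2 * (12 / q * (a * n))" using b3 by (intro mult_left_mono) auto
      also have "\<dots> = n * (12 / q * M\<^sup>2 * (d\<^sup>2 * a))" by simp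
      finally show ?thesis by (rule mult_left_le_imp_le) (use False nn in simp)
    qed (use nn q in auto)
    then show ?thesis ..
  next
    case False
    then have b: "0 < b" using nn by (metis less_eq_real_def mult_zero_right not_le)
    have "q * b\<^sup>2 \<le> 12 * a * (k * b)" using b2 mult_left_mono[of n "k * b" "6 * a"] False nn by (simp add: algebra_simps)
    then have "b * (q * b) \<le> b * (12 * (k * a))" by (simp add: power2_eq_square mult_ac)
    then have "q * b \<le> 12 * (k * a)" using b by simp
    then have b3: "b \<le> 12 / q * (k * a)" using q by (simp add: field_simps)
    have "n\<^sup>2 \<le> M * d * b" using 1 by (simp add: mult_ac)
    also have "\<dots> \<le> M * d * (12 / q * (k * a))" using b3 nn by (intro mult_left_mono) auto
    finally show ?thesis by (simp add: mult_ac)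
  qed
qed

section \<open>The domain of \<open>A\<close> through continuous representatives\<close>

locale kdv =
  fixes L \<alpha> \<beta> \<delta> :: real
  assumes L: "0 < L" and \<beta>: "0 < \<beta>" and \<delta>: "0 \<le> \<delta>"
begin

text \<open>An element of the domain with its derivatives, the first three functions continuous and
  chosen to match exactly. Boundary conditions become plain values, and products can be integrated
  by parts without exceptional null sets.\<close>

definition dom_rep :: "(real \<Rightarrow> complex) \<Rightarrow> (real \<Rightarrow> complex) \<Rightarrow> (real \<Rightarrow> complex) \<Rightarrow> (real \<Rightarrow> complex) \<Rightarrow> bool" where
  "dom_rep p0 p1 p2 p3 \<longleftrightarrow> ac L p0 p1 \<and> ac L p1 p2 \<and> ac L p2 p3 \<and> p0 0 = 0 \<and> p1 L = 0 \<and> p2 L = 0"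

definition Ap :: "(real \<Rightarrow> complex) \<Rightarrow> (real \<Rightarrow> complex) \<Rightarrow> (real \<Rightarrow> complex) \<Rightarrow> real \<Rightarrow> complex" where
  "Ap p1 p2 p3 x = - of_real \<beta> * p3 x + \<i> * of_real \<alpha> * p2 x - of_real \<delta> * p1 x"

lemma dom_rep_L2:
  assumes "dom_rep p0 p1 p2 p3"
  shows "p0 \<in> L2 L" "p1 \<in> L2 L" "p2 \<in> L2 L" "p3 \<in> L2 L" "Ap p1 p2 p3 \<in> L2 L"
proof -
  show l: "p0 \<in> L2 L" "p1 \<in> L2 L" "p2 \<in> L2 L" "p3 \<in> L2 L"
    using assms by (auto simp: dom_rep_def intro: ac_self_L2 ac_L2)
  show "Ap p1 p2 p3 \<in> L2 L"
    unfolding Ap_def[abs_def] by (intro L2_add L2_diff L2_scale l)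
qed

lemma dom_rep_diff:
  assumes "dom_rep p0 p1 p2 p3" "dom_rep q0 q1 q2 q3"
  shows "dom_rep (\<lambda>x. p0 x - q0 x) (\<lambda>x. p1 x - q1 x) (\<lambda>x. p2 x - q2 x) (\<lambda>x. p3 x - q3 x)"
    "Ap (\<lambda>x. p1 x - q1 x) (\<lambda>x. p2 x - q2 x) (\<lambda>x. p3 x - q3 x) x = Ap p1 p2 p3 x - Ap q1 q2 q3 x"
proof -
  show "dom_rep (\<lambda>x. p0 x - q0 x) (\<lambda>x. p1 x - q1 x) (\<lambda>x. p2 x - q2 x) (\<lambda>x. p3 x - q3 x)"
    using assms unfolding dom_rep_def by (simp add: ac_diff)
qed (simp add: Ap_def algebra_simps)

lemma dom_A_rep:
  assumes "\<phi> \<in> dom_A L"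
  obtains p0 p1 p2 p3 where "dom_rep p0 p1 p2 p3" "AE x in leb L. \<phi> x = p0 x" "AE x in leb L. op_A L \<alpha> \<beta> \<delta> \<phi> x = Ap p1 p2 p3 x"
proof -
  have s: "\<phi> \<in> L2 L" "\<And>j. j \<le> 3 \<Longrightarrow> \<exists>g\<in>L2 L. weak_deriv L j \<phi> g"
    using assms by (auto simp: dom_A_def sobolev_def)
  let ?w = "\<lambda>j. wderiv L j \<phi>"
  have w: "?w j \<in> L2 L" "weak_deriv L j \<phi> (?w j)" if "j \<le> 3" for j
    using s(2)[OF that] wderivI by blast+
  obtain p0 where p0: "ac L p0 (?w 1)" "AE x in leb L. \<phi> x = p0 x"
    using weak_deriv_ac[OF L s(1) w(1) w(2)] by auto
  have w12: "weak_deriv L 1 (?w 1) (?w 2)" "weak_deriv L 1 (?w 2) (?w 3)"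
    using weak_deriv_step[OF w(2), of 1 "?w 2"] weak_deriv_step[OF w(2), of 2 "?w 3"] w(2)[of 2] w(2)[of 3]
    by (simp_all add: numeral_2_eq_2 numeral_3_eq_3)
  obtain p1 where p1: "ac L p1 (?w 2)" "AE x in leb L. ?w 1 x = p1 x"
    using weak_deriv_ac[OF L w(1) w(1) w12(1)] by auto
  obtain p2 where p2: "ac L p2 (?w 3)" "AE x in leb L. ?w 2 x = p2 x"
    using weak_deriv_ac[OF L w(1) w(1) w12(2)] by auto
  \<comment> \<open>Each \<open>wderiv\<close> agrees only almost everywhere with the next
    representative; the derivative in \<open>ac\<close> may be exchanged on a null set.\<close>
  have swap: "ac L f h" if "ac L f g" "AE x in leb L. g x = h x" "h \<in> L2 L" for f g h
    unfolding ac_def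
  proof (intro conjI ballI that(3))
    fix x assume x: "x \<in> {0..L}"
    have "integral {0..x} g = integral {0..x} h"
      unfolding LINT_cut(2)[OF L2_integrable[OF ac_L2[OF that(1)]] x] LINT_cut(2)[OF L2_integrable[OF that(3)] x]
    proof (rule integral_cong_AE)
      show "AE y in leb L. (if y < x then g y else 0) = (if y < x then h y else 0)" using that(2) by eventually_elim simp
    qed (auto intro: L2_measurable L2_cut(1) ac_L2[OF that(1)] that(3))
    then show "f x = f 0 + integral {0..x} h" using ac_eq[OF that(1) x] by simp
  qed
  have p: "ac L p0 p1" "ac L p1 p2" "ac L p2 (?w 3)"
    using swap[OF p0(1) p1(2) ac_self_L2[OF p1(1)]] swap[OF p1(1) p2(2) ac_self_L2[OF p2(1)]] p2 by auto
  have tr: "has_trace L \<phi> 0 0" "has_trace L (?w 1) L 0" "has_trace L (?w 2) L 0"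
    using assms by (auto simp: dom_A_def)
  have "dom_rep p0 p1 p2 (?w 3)"
    unfolding dom_rep_def using p has_trace_unique[OF L tr(1) ac_continuous[OF p(1)] p0(2)]
      has_trace_unique[OF L tr(2) ac_continuous[OF p(2)] p1(2)]
      has_trace_unique[OF L tr(3) ac_continuous[OF p(3)] p2(2)] L by auto
  moreover have "AE x in leb L. op_A L \<alpha> \<beta> \<delta> \<phi> x = Ap p1 p2 (?w 3) x"
    using p1(2) p2(2) by eventually_elim (simp add: op_A_def Ap_def)
  ultimately show ?thesis using p0(2) by (intro that)
qed

lemma rep_dom_A:
  assumes r: "dom_rep p0 p1 p2 p3" and \<phi>: "\<phi> \<in> L2 L" "AE x in leb L. \<phi> x = p0 x"
  shows "\<phi> \<in> dom_A L" "AE x in leb L. op_A L \<alpha> \<beta> \<delta> \<phi> x = Ap p1 p2 p3 x"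
    "weak_deriv L 1 \<phi> p1"
proof -
  note l = dom_rep_L2[OF r]
  have a: "ac L p0 p1" "ac L p1 p2" "ac L p2 p3" and b: "p0 0 = 0" "p1 L = 0" "p2 L = 0"
    using r by (auto simp: dom_rep_def)
  show w1: "weak_deriv L 1 \<phi> p1" by (rule ac_weak_deriv[OF L a(1) \<phi>])
  have "weak_deriv L 1 p1 p2" "weak_deriv L 1 p2 p3"
    using ac_weak_deriv[OF L a(2) l(2)] ac_weak_deriv[OF L a(3) l(3)] by auto
  then have w: "weak_deriv L 2 \<phi> p2" "weak_deriv L 3 \<phi> p3"
    using weak_deriv_comp[OF w1] weak_deriv_comp[of L 2 \<phi> p2 p3] by (auto simp: numeral_2_eq_2 numeral_3_eq_3)
  note wd = wderiv_AE[OF L l(2) w1] wderiv_AE[OF L l(3) w(1)] wderiv_AE[OF L l(4) w(2)]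
  have "\<exists>g\<in>L2 L. weak_deriv L j \<phi> g" if "j \<le> 3" for j
  proof -
    consider "j = 0" | "j = 1" | "j = 2" | "j = 3" using \<open>j \<le> 3\<close> by linarith
    then show ?thesis using w1 w l \<phi>(1) weak_deriv_0[of L \<phi>] by cases blast+
  qed
  moreover have "has_trace L \<phi> 0 0" "has_trace L (wderiv L 1 \<phi>) L 0" "has_trace L (wderiv L 2 \<phi>) L 0"
    using has_traceI[OF ac_continuous[OF a(1)] \<phi>(2) b(1)] has_traceI[OF ac_continuous[OF a(2)] wd(1) b(2)]
      has_traceI[OF ac_continuous[OF a(3)] wd(2) b(3)] by auto
  ultimately show "\<phi> \<in> dom_A L" using \<phi>(1) by (simp add: dom_A_def sobolev_def)
  show "AE x in leb L. op_A L \<alpha> \<beta> \<delta> \<phi> x = Ap p1 p2 p3 x"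
    using wd by eventually_elim (simp add: op_A_def Ap_def)
qed

lemma ctest_ac:
  assumes "ctest L \<phi>" obtains \<phi>' where "ctest L \<phi>'" "ac L \<phi> \<phi>'"
proof -
  obtain p q where pq: "test_function L p" "test_function L q" "\<phi> = (\<lambda>x. Complex (p x) (q x))"
    using assms unfolding ctest_def by blast
  have "ctest L (\<lambda>x. Complex (deriv p x) (deriv q x))"
    by (rule ctestI) (auto intro: test_function_deriv pq)
  moreover have "ac L \<phi> (\<lambda>x. Complex (deriv p x) (deriv q x))"
    by (rule ac_cong[OF ac_add[OF ac_test_function[OF pq(1)] ac_scale[OF ac_test_function[OF pq(2)], of \<i>]]])
      (simp_all add: pq Complex_eq)
  ultimately show ?thesis using that by blast
qed

lemma ctest_outside: "ctest L \<phi> \<Longrightarrow> x \<notin> {0<..<L} \<Longrightarrow> \<phi> x = 0"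
  by (auto simp: ctest_def test_function_outside complex_eq_iff)

text \<open>\<open>A\<close> has constant coefficients and so preserves test functions; by iteration
  they lie in the domain of every power of \<open>A\<close>.\<close>

lemma ctest_dom:
  assumes "ctest L \<phi>"
  obtains p1 p2 p3 where "dom_rep \<phi> p1 p2 p3" "ctest L (Ap p1 p2 p3)"
proof -
  obtain p1 where p1: "ctest L p1" "ac L \<phi> p1" using ctest_ac[OF assms] .
  obtain p2 where p2: "ctest L p2" "ac L p1 p2" using ctest_ac[OF p1(1)] .
  obtain p3 where p3: "ctest L p3" "ac L p2 p3" using ctest_ac[OF p2(1)] .
  have "dom_rep \<phi> p1 p2 p3"
    using p1 p2 p3 ctest_outside[OF assms, of 0] ctest_outside[OF p1(1), of L] ctest_outside[OF p2(1), of L]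
    by (simp add: dom_rep_def)
  moreover have "ctest L (\<lambda>x. - of_real \<beta> * p3 x + \<i> * of_real \<alpha> * p2 x + - of_real \<delta> * p1 x)"
    by (intro ctest_add ctest_scale p1 p2 p3)
  then have "ctest L (Ap p1 p2 p3)" by (simp add: Ap_def[abs_def])
  ultimately show ?thesis using that by blast
qed

text \<open>For the weight \<open>1 + \<kappa> x\<close> the density on the left is the real part of
  the derivative of \<open>\<Phi>\<close>, up to quadratic terms carrying the factor \<kappa>. The
  boundary conditions leave only \<open>p1 0\<close> and \<open>p0 L\<close> in the end values of
  \<open>\<Phi>\<close>. The choice \<kappa> = 0 gives dissipativity, \<kappa> = 1 Kato's gain of
  one derivative.\<close>

lemma energy_identity:
  assumes r: "dom_rep p0 p1 p2 p3"
  shows "(LINT x|leb L. (1 + \<kappa> * x) * (Ap p1 p2 p3 x \<bullet> p0 x)) =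
    - \<beta> / 2 * (cmod (p1 0))\<^sup>2 - \<delta> / 2 * (1 + \<kappa> * L) * (cmod (p0 L))\<^sup>2
    - 3 * \<beta> * \<kappa> / 2 * (L2_norm L p1)\<^sup>2 + \<delta> * \<kappa> / 2 * (L2_norm L p0)\<^sup>2
    - \<kappa> * \<alpha> * (LINT x|leb L. Re (\<i> * (p1 x * cnj (p0 x))))"
proof -
  note l = dom_rep_L2[OF r]
  have a: "ac L p0 p1" "ac L p1 p2" "ac L p2 p3" and b: "p0 0 = 0" "p1 L = 0" "p2 L = 0"
    using r by (auto simp: dom_rep_def)
  note c = a[THEN ac_cnj]
  let ?\<rho> = "\<lambda>x. complex_of_real (1 + \<kappa> * x)"
  have \<rho>: "ac L ?\<rho> (\<lambda>x. of_real \<kappa>)"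
    by (rule ac_C1) (auto intro!: continuous_intros derivative_eq_intros has_vector_derivative_of_real
        simp flip: has_real_derivative_iff_has_vector_derivative)
  note m = ac_mult[OF L]
  \<comment> \<open>Found by integrating the terms of \<open>A\<close> by parts against the
    conjugate of \<open>p0\<close>: the first three summands stem from the third derivative, the
    fourth from \<alpha>, the last from \<delta>.\<close>
  define \<Phi> where "\<Phi> x = - of_real \<beta> * (?\<rho> x * (p2 x * cnj (p0 x))) + of_real (\<beta> / 2) * (?\<rho> x * (p1 x * cnj (p1 x)))
    + of_real (\<beta> * \<kappa>) * (p1 x * cnj (p0 x)) + \<i> * of_real \<alpha> * (?\<rho> x * (p1 x * cnj (p0 x)))
    - of_real (\<delta> / 2) * (?\<rho> x * (p0 x * cnj (p0 x)))" for x
  define \<Phi>' where "\<Phi>' x = - of_real \<beta> * (of_real \<kappa> * (p2 x * cnj (p0 x)) + ?\<rho> x * (p3 x * cnj (p0 x) + p2 x * cnj (p1 x)))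
      + of_real (\<beta> / 2) * (of_real \<kappa> * (p1 x * cnj (p1 x)) + ?\<rho> x * (p2 x * cnj (p1 x) + p1 x * cnj (p2 x)))
      + of_real (\<beta> * \<kappa>) * (p2 x * cnj (p0 x) + p1 x * cnj (p1 x))
      + \<i> * of_real \<alpha> * (of_real \<kappa> * (p1 x * cnj (p0 x)) + ?\<rho> x * (p2 x * cnj (p0 x) + p1 x * cnj (p1 x)))
      - of_real (\<delta> / 2) * (of_real \<kappa> * (p0 x * cnj (p0 x)) + ?\<rho> x * (p1 x * cnj (p0 x) + p0 x * cnj (p1 x)))" for x
  have \<Phi>': "ac L \<Phi> \<Phi>'"
    unfolding \<Phi>_def[abs_def] \<Phi>'_def[abs_def] by (intro ac_add ac_diff ac_scale m \<rho> a c)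
  have eq: "Re (\<Phi>' x) = (1 + \<kappa> * x) * (Ap p1 p2 p3 x \<bullet> p0 x)
      + 3 * \<beta> * \<kappa> / 2 * (cmod (p1 x))\<^sup>2 + \<kappa> * \<alpha> * Re (\<i> * (p1 x * cnj (p0 x))) - \<delta> * \<kappa> / 2 * (cmod (p0 x))\<^sup>2" for x
    unfolding \<Phi>'_def Ap_def inner_complex_def cmod_power2 by (simp add: algebra_simps power2_eq_square add_divide_distrib)
  have i1: "integrable (leb L) (\<lambda>x. (1 + \<kappa> * x) * (Ap p1 p2 p3 x \<bullet> p0 x))"
  proof -
    have "(\<lambda>x. ?\<rho> x * p0 x) \<in> L2 L" by (intro L2_mult_continuous(2) l ac_continuous[OF \<rho>])
    from L2_mult_integrable(2)[OF l(5) this] show ?thesis by (simp add: inner_complex_def algebra_simps)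
  qed
  have i2: "integrable (leb L) (\<lambda>x. (cmod (p1 x))\<^sup>2)" "integrable (leb L) (\<lambda>x. (cmod (p0 x))\<^sup>2)"
    by (intro L2_square_integrable l)+
  have i3: "integrable (leb L) (\<lambda>x. Re (\<i> * (p1 x * cnj (p0 x))))"
    by (intro integrable_Re integrable_mult_right L2_mult_integrable l L2_cnj)
  have "Re (\<Phi> L) - Re (\<Phi> 0) = (LINT x|leb L. Re (\<Phi>' x))"
  proof -
    have "\<Phi> L - \<Phi> 0 = (LINT x|leb L. \<Phi>' x)" using ac_endpoints[OF \<Phi>'] L by simp
    then have "Re (\<Phi> L - \<Phi> 0) = Re (LINT x|leb L. \<Phi>' x)" by simp
    then show ?thesis using integral_Re[OF L2_integrable[OF ac_L2[OF \<Phi>']]] by simp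
  qed
  also have "\<dots> = (LINT x|leb L. (1 + \<kappa> * x) * (Ap p1 p2 p3 x \<bullet> p0 x)) + 3 * \<beta> * \<kappa> / 2 * (L2_norm L p1)\<^sup>2 
     + \<kappa> * \<alpha> * (LINT x|leb L. Re (\<i> * (p1 x * cnj (p0 x)))) - \<delta> * \<kappa> / 2 * (L2_norm L p0)\<^sup>2"
    unfolding eq L2_norm_power2 using i1 i2 i3 by simp
  also have "Re (\<Phi> L) = - \<delta> / 2 * (1 + \<kappa> * L) * (cmod (p0 L))\<^sup>2"
    unfolding \<Phi>_def b cmod_power2 by (simp add: power2_eq_square algebra_simps add_divide_distrib)
  also have "Re (\<Phi> 0) = \<beta> / 2 * (cmod (p1 0))\<^sup>2"
    unfolding \<Phi>_def b cmod_power2 by (simp add: power2_eq_square algebra_simps add_divide_distrib)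
  finally show ?thesis by simp
qed

text \<open>\<open>\<alpha>\<^sup>2 / (2 * \<beta>)\<close> is the price of absorbing the
  \<alpha>-term into \<open>\<beta> / 2\<close> times the squared norm of the derivative;
  \<open>\<delta> / 2\<close> comes from differentiating the weight in the transport term.\<close>

definition K where "K = \<alpha>\<^sup>2 / (2 * \<beta>) + \<delta> / 2"

lemma K_nonneg: "0 \<le> K"
  using \<beta> \<delta> by (simp add: K_def)

lemma dissipative:
  assumes r: "dom_rep p0 p1 p2 p3"
  shows "(LINT x|leb L. Ap p1 p2 p3 x \<bullet> p0 x) \<le> - \<beta> / 2 * (cmod (p1 0))\<^sup>2"
  using energy_identity[OF r, of 0] \<delta> by simp

text \<open>With \<kappa> = 1 the identity yields \<open>3 / 2 * \<beta>\<close> times the squared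
  norm of the derivative; \<open>\<beta> / 2\<close> of it pays for the \<alpha>-term and \<beta>
  remains.\<close>

lemma Kato:
  assumes r: "dom_rep p0 p1 p2 p3"
  shows "(LINT x|leb L. (1 + x) * (Ap p1 p2 p3 x \<bullet> p0 x)) \<le>
    - \<beta> / 2 * (cmod (p1 0))\<^sup>2 - \<beta> * (L2_norm L p1)\<^sup>2 + K * (L2_norm L p0)\<^sup>2"
proof -
  note l = dom_rep_L2[OF r]
  let ?a = "L2_norm L p1" and ?b = "L2_norm L p0"
  let ?J = "LINT x|leb L. Re (\<i> * (p1 x * cnj (p0 x)))"
  have i: "integrable (leb L) (\<lambda>x. \<i> * (p1 x * cnj (p0 x)))"
    by (intro integrable_mult_right L2_mult_integrable l L2_cnj)
  have "\<bar>?J\<bar> = \<bar>Re (LINT x|leb L. \<i> * (p1 x * cnj (p0 x)))\<bar>" using integral_Re[OF i] by simp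
  also have "\<dots> \<le> cmod (LINT x|leb L. \<i> * (p1 x * cnj (p0 x)))" by (rule abs_Re_le_cmod)
  also have "\<dots> = cmod (LINT x|leb L. p1 x * cnj (p0 x))" by (simp add: norm_mult)
  also have "\<dots> \<le> ?a * L2_norm L (\<lambda>x. cnj (p0 x))" by (intro L2_mult_le l L2_cnj)
  finally have J: "\<bar>?J\<bar> \<le> ?a * ?b" by (simp add: L2_norm_def)
  have "- \<alpha> * ?J \<le> \<bar>- \<alpha> * ?J\<bar>" by (rule abs_ge_self)
  also have "\<dots> = \<bar>\<alpha>\<bar> * \<bar>?J\<bar>" by (simp add: abs_mult)
  also have "\<dots> \<le> \<bar>\<alpha>\<bar> * (?a * ?b)" using J by (intro mult_left_mono) auto
  also have "\<dots> \<le> \<beta> / 2 * ?a\<^sup>2 + \<alpha>\<^sup>2 / (2 * \<beta>) * ?b\<^sup>2"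
    using Young_weighted[OF \<beta>, of "\<bar>\<alpha>\<bar>" ?a ?b] by simp
  finally have "- \<alpha> * ?J \<le> \<beta> / 2 * ?a\<^sup>2 + \<alpha>\<^sup>2 / (2 * \<beta>) * ?b\<^sup>2" .
  moreover have "0 \<le> \<delta> / 2 * (1 + L) * (cmod (p0 L))\<^sup>2" using \<delta> L by simp
  moreover have "(LINT x|leb L. (1 + x) * (Ap p1 p2 p3 x \<bullet> p0 x)) =
      - \<beta> / 2 * (cmod (p1 0))\<^sup>2 - \<delta> / 2 * (1 + L) * (cmod (p0 L))\<^sup>2
      - 3 * (\<beta> / 2 * ?a\<^sup>2) + \<delta> / 2 * ?b\<^sup>2 + - \<alpha> * ?J"
    using energy_identity[OF r, of 1] by simp
  moreover have "K * ?b\<^sup>2 = \<alpha>\<^sup>2 / (2 * \<beta>) * ?b\<^sup>2 + \<delta> / 2 * ?b\<^sup>2" "\<beta> * ?a\<^sup>2 = 2 * (\<beta> / 2 * ?a\<^sup>2)"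
    by (simp_all add: K_def distrib_right)
  ultimately show ?thesis by linarith
qed


section \<open>Bounds for the derivative and its trace, and interpolation\<close>

lemma LINT_inner_le:
  assumes "f \<in> L2 L" "g \<in> L2 L"
  shows "\<bar>LINT x|leb L. f x \<bullet> g x\<bar> \<le> L2_norm L f * L2_norm L g"
proof -
  have "(LINT x|leb L. f x \<bullet> g x) = (LINT x|leb L. Re (f x * cnj (g x)))"
    by (simp add: inner_complex_def)
  also have "\<dots> = Re (LINT x|leb L. f x * cnj (g x))"
    by (intro integral_Re L2_mult_integrable assms L2_cnj)
  finally have "\<bar>LINT x|leb L. f x \<bullet> g x\<bar> \<le> cmod (LINT x|leb L. f x * cnj (g x))"
    using abs_Re_le_cmod by simp
  also have "\<dots> \<le> L2_norm L f * L2_norm L (\<lambda>x. cnj (g x))" by (intro L2_mult_le assms L2_cnj)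
  finally show ?thesis by (simp add: L2_norm_def)
qed

lemma weighted_inner_le:
  assumes f: "f \<in> L2 L" and g: "g \<in> L2 L"
  shows "integrable (leb L) (\<lambda>x. (1 + x) * (f x \<bullet> g x))"
    "\<bar>LINT x|leb L. (1 + x) * (f x \<bullet> g x)\<bar> \<le> (1 + L) * L2_norm L f * L2_norm L g"
proof -
  let ?h = "\<lambda>x. f x * of_real (1 + x)"
  have c: "continuous_on {0..L} (\<lambda>x. complex_of_real (1 + x))" by (intro continuous_intros)
  have m: "(\<lambda>x. complex_of_real (1 + x)) \<in> borel_measurable (leb L)"
    by (rule L2_measurable[OF continuous_L2[OF c]])
  have h: "?h \<in> L2 L" "L2_norm L ?h \<le> (1 + L) * L2_norm L f"
    using L2_mult_bounded[OF f m, of "1 + L"] L by (auto simp: norm_of_real simp del: of_real_add)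
  have e: "(1 + x) * (f x \<bullet> g x) = ?h x \<bullet> g x" for x by (simp add: inner_complex_def algebra_simps)
  show "integrable (leb L) (\<lambda>x. (1 + x) * (f x \<bullet> g x))" unfolding e by (rule L2_mult_integrable(2)[OF h(1) g])
  have "\<bar>LINT x|leb L. (1 + x) * (f x \<bullet> g x)\<bar> \<le> L2_norm L ?h * L2_norm L g"
    unfolding e by (rule LINT_inner_le[OF h(1) g])
  also have "\<dots> \<le> (1 + L) * L2_norm L f * L2_norm L g" using h(2) by (intro mult_right_mono) auto
  finally show "\<bar>LINT x|leb L. (1 + x) * (f x \<bullet> g x)\<bar> \<le> (1 + L) * L2_norm L f * L2_norm L g" .
qed

text \<open>Meant for differences of two points of an orbit: the right-hand side tends to 0 when
  both the points and their images under \<open>A\<close> converge in \<open>L2\<close>, so the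
  derivatives converge too. \<open>trace_bound\<close> does the same for the value of the derivative
  at 0.\<close>

lemma H1_bound:
  assumes r: "dom_rep p0 p1 p2 p3"
  shows "\<beta> * (L2_norm L p1)\<^sup>2 \<le> K * (L2_norm L p0)\<^sup>2 + (1 + L) * L2_norm L (Ap p1 p2 p3) * L2_norm L p0"
proof -
  note l = dom_rep_L2[OF r]
  have "0 \<le> \<beta> / 2 * (cmod (p1 0))\<^sup>2" using \<beta> by simp
  then show ?thesis using Kato[OF r] weighted_inner_le(2)[OF l(5) l(1)] by linarith
qed

lemma trace_bound:
  assumes r: "dom_rep p0 p1 p2 p3"
  shows "\<beta> / 2 * (cmod (p1 0))\<^sup>2 \<le> L2_norm L (Ap p1 p2 p3) * L2_norm L p0"
  using dissipative[OF r] LINT_inner_le[OF dom_rep_L2(5)[OF r] dom_rep_L2(1)[OF r]] by linarith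

text \<open>The value at \<open>x\<close> is reached from the endpoint where \<open>f\<close>
  vanishes, in the case of \<open>L\<close> by way of 0; the factor 2 serves both cases.\<close>

lemma Poincare:
  assumes "ac L f f'" "f 0 = 0 \<or> f L = 0" shows "L2_norm L f \<le> 2 * L * L2_norm L f'"
proof -
  have le: "cmod (f x) \<le> 2 * sqrt L * L2_norm L f'" if x: "x \<in> {0..L}" for x
  proof -
    have "cmod (f x) \<le> cmod (f x - f 0) + cmod (f L - f 0)"
      using assms(2) norm_triangle_ineq[of "f x - f 0" "f 0"] by (auto simp: norm_minus_commute)
    then show ?thesis
      using ac_sub_le[OF assms(1) x] ac_sub_le[OF assms(1), of L] L by simp
  qed
  have "L2_norm L f \<le> 2 * sqrt L * L2_norm L f' * sqrt L"
    by (rule L2_bounded(2)[OF L2_measurable[OF ac_self_L2[OF assms(1)]]]) (use le L in \<open>auto intro!: AE_I2\<close>)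
  also have "\<dots> = 2 * (sqrt L * sqrt L) * L2_norm L f'" by (simp only: mult_ac)
  finally show ?thesis using L by simp
qed

text \<open>The squared modulus at 0 is minus the integral of its derivative, because
  \<open>f\<close> vanishes at \<open>L\<close>.\<close>

lemma trace_interpolation:
  assumes "ac L f f'" "f L = 0" shows "(cmod (f 0))\<^sup>2 \<le> 2 * (L2_norm L f * L2_norm L f')"
proof -
  have l: "f \<in> L2 L" "f' \<in> L2 L" using assms(1) by (auto intro: ac_L2 ac_self_L2)
  have n: "L2_norm L (\<lambda>x. cnj (g x)) = L2_norm L g" for g by (simp add: L2_norm_def)
  have "(cmod (f 0))\<^sup>2 = cmod (f L * cnj (f L) - f 0 * cnj (f 0))"
    by (simp add: assms norm_mult power2_eq_square)
  also have "\<dots> = cmod (LINT x|leb L. f' x * cnj (f x) + f x * cnj (f' x))"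
    using ac_endpoints[OF ac_mult[OF L assms(1) ac_cnj[OF assms(1)]]] L by simp
  also have "\<dots> = cmod ((LINT x|leb L. f' x * cnj (f x)) + (LINT x|leb L. f x * cnj (f' x)))"
    by (subst Bochner_Integration.integral_add) (intro L2_mult_integrable l L2_cnj refl)+
  also have "\<dots> \<le> cmod (LINT x|leb L. f' x * cnj (f x)) + cmod (LINT x|leb L. f x * cnj (f' x))"
    by (rule norm_triangle_ineq)
  also have "\<dots> \<le> L2_norm L f' * L2_norm L (\<lambda>x. cnj (f x)) + L2_norm L f * L2_norm L (\<lambda>x. cnj (f' x))"
    by (intro add_mono L2_mult_le l L2_cnj)
  finally show ?thesis by (simp add: n mult.commute)
qed

text \<open>The second bound solves the formula for \<open>A\<close> for the third derivative. The
  third comes from the derivative of \<open>p1\<close> times the conjugate of \<open>p2\<close>,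
  whose value at 0 is controlled by \<open>trace_interpolation\<close>. The first pairs
  \<open>z0\<close> with \<open>Ap\<close> and moves one derivative from \<open>p3\<close> to
  \<open>z0\<close>; the end values vanish by \<open>z0 0 = 0\<close> and \<open>p2 L = 0\<close>,
  so it matters that the image lies in the domain as well.\<close>

lemma interpolation:
  assumes r: "dom_rep p0 p1 p2 p3" and s: "dom_rep z0 z1 z2 z3" and z: "AE x in leb L. Ap p1 p2 p3 x = z0 x"
  defines "a \<equiv> L2_norm L p1" and "b \<equiv> L2_norm L p2" and "c \<equiv> L2_norm L p3" 
    and "n \<equiv> L2_norm L z0" and "d \<equiv> L2_norm L z1" and "k \<equiv> \<bar>\<alpha>\<bar> + 2 * L * \<delta>"
  shows "n\<^sup>2 \<le> (\<beta> + 2 * L * k) * (d * b)" "\<beta> * c \<le> n + k * b" "b\<^sup>2 \<le> 6 * (a * c)"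
proof -
  note l = dom_rep_L2[OF r] and lz = dom_rep_L2[OF s]
  have a: "ac L p0 p1" "ac L p1 p2" "ac L p2 p3" and bd: "p0 0 = 0" "p1 L = 0" "p2 L = 0"
    using r by (auto simp: dom_rep_def)
  have az: "ac L z0 z1" and bz: "z0 0 = 0" using s by (auto simp: dom_rep_def)
  have cn: "L2_norm L (\<lambda>x. cnj (g x)) = L2_norm L g" for g by (simp add: L2_norm_def)
  have nn: "0 \<le> a" "0 \<le> b" "0 \<le> c" "0 \<le> n" "0 \<le> d" "0 \<le> k"
    using L \<delta> by (auto simp: a_def b_def c_def n_def d_def k_def)
  have ab: "a \<le> 2 * L * b" unfolding a_def b_def using Poincare[OF a(2)] bd by auto
  have nd: "n \<le> 2 * L * d" unfolding n_def d_def using Poincare[OF az] bz by auto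
  have n_eq: "n = L2_norm L (Ap p1 p2 p3)"
    unfolding n_def by (rule L2_norm_cong_AE[symmetric]) (use z in \<open>auto intro: L2_measurable l lz\<close>)
  have kb: "\<bar>\<alpha>\<bar> * b + \<delta> * a \<le> k * b"
    using mult_left_mono[OF ab \<delta>] by (simp add: k_def algebra_simps)
  show "\<beta> * c \<le> n + k * b"
  proof -
    have e: "\<beta> * c = L2_norm L (\<lambda>x. of_real \<beta> * p3 x)" using \<beta> by (simp add: L2_norm_scale c_def)
    have "(\<lambda>x. of_real \<beta> * p3 x) = (\<lambda>x. (\<i> * of_real \<alpha> * p2 x - of_real \<delta> * p1 x) - Ap p1 p2 p3 x)"
      by (auto simp: Ap_def)
    then have "\<beta> * c \<le> L2_norm L (\<lambda>x. \<i> * of_real \<alpha> * p2 x - of_real \<delta> * p1 x) + n"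
      unfolding e n_eq using L2_norm_triangle_sub[of "\<lambda>x. \<i> * of_real \<alpha> * p2 x - of_real \<delta> * p1 x" L "Ap p1 p2 p3"]
      by (simp add: L2_diff L2_scale l)
    also have "L2_norm L (\<lambda>x. \<i> * of_real \<alpha> * p2 x - of_real \<delta> * p1 x) \<le> L2_norm L (\<lambda>x. \<i> * of_real \<alpha> * p2 x) + L2_norm L (\<lambda>x. of_real \<delta> * p1 x)"
      by (intro L2_norm_triangle_sub L2_scale l)
    also have "\<dots> = \<bar>\<alpha>\<bar> * b + \<delta> * a" using \<delta> by (simp add: L2_norm_scale a_def b_def norm_mult)
    finally show ?thesis using kb by simp
  qed
  show "b\<^sup>2 \<le> 6 * (a * c)"
  proof -
    have "- (p1 0 * cnj (p2 0)) = (LINT x|leb L. p2 x * cnj (p2 x) + p1 x * cnj (p3 x))"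
      using ac_endpoints[OF ac_mult[OF L a(2) ac_cnj[OF a(3)]]] L bd by simp
    also have "\<dots> = (LINT x|leb L. p2 x * cnj (p2 x)) + (LINT x|leb L. p1 x * cnj (p3 x))"
      by (intro Bochner_Integration.integral_add L2_mult_integrable l L2_cnj)
    also have "(LINT x|leb L. p2 x * cnj (p2 x)) = of_real (b\<^sup>2)"
      unfolding b_def L2_norm_power2 by (subst integral_complex_of_real[symmetric]) (simp only: complex_norm_square)
    finally have e: "complex_of_real (b\<^sup>2) = - (p1 0 * cnj (p2 0)) - (LINT x|leb L. p1 x * cnj (p3 x))" by simp
    have "b\<^sup>2 = cmod (complex_of_real (b\<^sup>2))" by (simp only: norm_of_real abs_of_nonneg zero_le_power2)
    also have "\<dots> \<le> cmod (p1 0) * cmod (p2 0) + cmod (LINT x|leb L. p1 x * cnj (p3 x))"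
      unfolding e using norm_triangle_ineq4[of "- (p1 0 * cnj (p2 0))" "LINT x|leb L. p1 x * cnj (p3 x)"] by (simp add: norm_mult)
    also have "cmod (LINT x|leb L. p1 x * cnj (p3 x)) \<le> a * c"
      using L2_mult_le[OF l(2) L2_cnj[OF l(4)]] by (simp add: cn a_def c_def)
    finally have 1: "b\<^sup>2 \<le> cmod (p1 0) * cmod (p2 0) + a * c" by simp
    have "(cmod (p1 0) * cmod (p2 0))\<^sup>2 \<le> (2 * (a * b)) * (2 * (b * c))"
      unfolding power_mult_distrib
      by (intro mult_mono) (use trace_interpolation[OF a(2)] trace_interpolation[OF a(3)] bd nn in \<open>auto simp: a_def b_def c_def\<close>)
    also have "\<dots> = b\<^sup>2 * (4 * (a * c))" by (simp add: power2_eq_square)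
    finally have 2: "(cmod (p1 0) * cmod (p2 0))\<^sup>2 \<le> b\<^sup>2 * (4 * (a * c))" .
    \<comment> \<open>If \<open>b\<^sup>2\<close> exceeded \<open>6 a c\<close>, the end value would
      be at least \<open>5/6 b\<^sup>2\<close>, so its square at least \<open>25/36\<close> of
      \<open>b^4\<close>, whereas the preceding bound allows \<open>24/36\<close>.\<close>
    show ?thesis
    proof (rule ccontr)
      assume "\<not> b\<^sup>2 \<le> 6 * (a * c)"
      then have 3: "6 * (a * c) < b\<^sup>2" by simp
      have "0 \<le> a * c" using nn by simp
      then have "5 / 6 * b\<^sup>2 \<le> cmod (p1 0) * cmod (p2 0)" using 1 3 by linarith
      then have "(5 / 6 * b\<^sup>2)\<^sup>2 \<le> (cmod (p1 0) * cmod (p2 0))\<^sup>2" by (intro power_mono) auto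
      also have "\<dots> \<le> b\<^sup>2 * (4 * (a * c))" by (rule 2)
      also have "\<dots> \<le> b\<^sup>2 * (4 / 6 * b\<^sup>2)" using 3 by (intro mult_left_mono) auto
      finally have "25 / 36 * (b\<^sup>2 * b\<^sup>2) \<le> 24 / 36 * (b\<^sup>2 * b\<^sup>2)" by (simp add: power2_eq_square)
      moreover have "0 < b\<^sup>2 * b\<^sup>2" using 3 \<open>0 \<le> a * c\<close> by (intro mult_pos_pos) auto
      ultimately show False by simp
    qed
  qed
  show "n\<^sup>2 \<le> (\<beta> + 2 * L * k) * (d * b)"
  proof -
    have "0 = (LINT x|leb L. z1 x * cnj (p2 x) + z0 x * cnj (p3 x))"
      using ac_endpoints[OF ac_mult[OF L az ac_cnj[OF a(3)]]] L bd bz by simp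
    also have "\<dots> = (LINT x|leb L. z1 x * cnj (p2 x)) + (LINT x|leb L. z0 x * cnj (p3 x))"
      by (intro Bochner_Integration.integral_add L2_mult_integrable l lz L2_cnj)
    finally have I3: "(LINT x|leb L. z0 x * cnj (p3 x)) = - (LINT x|leb L. z1 x * cnj (p2 x))"
      by (simp add: eq_neg_iff_add_eq_0 add.commute)
    have "complex_of_real (n\<^sup>2) = (LINT x|leb L. z0 x * cnj (z0 x))"
      unfolding n_def L2_norm_power2 by (subst integral_complex_of_real[symmetric]) (simp only: complex_norm_square)
    also have "\<dots> = (LINT x|leb L. z0 x * cnj (Ap p1 p2 p3 x))"
      by (rule integral_cong_AE)
        (use z L2_mult_integrable(1)[OF lz(1) L2_cnj[OF lz(1)]] L2_mult_integrable(1)[OF lz(1) L2_cnj[OF l(5)]] in auto)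
    also have "\<dots> = (LINT x|leb L. - of_real \<beta> * (z0 x * cnj (p3 x)) + (- \<i> * of_real \<alpha> * (z0 x * cnj (p2 x)) + - of_real \<delta> * (z0 x * cnj (p1 x))))"
      by (intro Bochner_Integration.integral_cong) (auto simp: Ap_def algebra_simps)
    also have "\<dots> = - of_real \<beta> * (LINT x|leb L. z0 x * cnj (p3 x)) + (- \<i> * of_real \<alpha> * (LINT x|leb L. z0 x * cnj (p2 x)) + - of_real \<delta> * (LINT x|leb L. z0 x * cnj (p1 x)))"
      by (subst Bochner_Integration.integral_add integral_mult_right_zero;
          (intro Bochner_Integration.integrable_add integrable_mult_right L2_mult_integrable lz l L2_cnj)?)+ simp
    finally have e: "complex_of_real (n\<^sup>2) = of_real \<beta> * (LINT x|leb L. z1 x * cnj (p2 x)) + (- \<i> * of_real \<alpha> * (LINT x|leb L. z0 x * cnj (p2 x)) + - of_real \<delta> * (LINT x|leb L. z0 x * cnj (p1 x)))"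
      unfolding I3 by simp
    have "n\<^sup>2 = cmod (complex_of_real (n\<^sup>2))" by (simp only: norm_of_real abs_of_nonneg zero_le_power2)
    also have "\<dots> \<le> cmod (of_real \<beta> * (LINT x|leb L. z1 x * cnj (p2 x))) + (cmod (- \<i> * of_real \<alpha> * (LINT x|leb L. z0 x * cnj (p2 x))) + cmod (- of_real \<delta> * (LINT x|leb L. z0 x * cnj (p1 x))))"
      unfolding e by (intro order_trans[OF norm_triangle_ineq] add_left_mono norm_triangle_ineq)
    also have "\<dots> = \<beta> * cmod (LINT x|leb L. z1 x * cnj (p2 x)) + (\<bar>\<alpha>\<bar> * cmod (LINT x|leb L. z0 x * cnj (p2 x)) + \<delta> * cmod (LINT x|leb L. z0 x * cnj (p1 x)))"
      using \<beta> \<delta> by (simp add: norm_mult)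
    also have "\<dots> \<le> \<beta> * (d * b) + (\<bar>\<alpha>\<bar> * (n * b) + \<delta> * (n * a))"
      using L2_mult_le[OF dom_rep_L2(2)[OF s] L2_cnj[OF l(3)]] L2_mult_le[OF lz(1) L2_cnj[OF l(3)]] L2_mult_le[OF lz(1) L2_cnj[OF l(2)]] \<beta> \<delta>
      by (intro add_mono mult_left_mono) (auto simp: cn a_def b_def n_def d_def)
    also have "\<dots> = \<beta> * (d * b) + n * (\<bar>\<alpha>\<bar> * b + \<delta> * a)" by (simp add: algebra_simps)
    also have "\<dots> \<le> \<beta> * (d * b) + (2 * L * d) * (k * b)"
      using nd kb nn L \<delta> by (intro add_left_mono mult_mono) auto
    also have "\<dots> = (\<beta> + 2 * L * k) * (d * b)" by (simp add: algebra_simps)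
    finally show ?thesis .
  qed
qed

end

subsection \<open>Bounded operators and derivatives in \<open>L\<^sup>2\<close>\<close>

lemma bounded_operator_L2: "bounded_operator L B \<Longrightarrow> f \<in> L2 L \<Longrightarrow> B f \<in> L2 L"
  by (simp add: bounded_operator_def)

lemma bounded_operator_bound:
  assumes "bounded_operator L B" obtains C where "0 \<le> C" "\<And>f. f \<in> L2 L \<Longrightarrow> L2_norm L (B f) \<le> C * L2_norm L f"
proof -
  obtain C where C: "\<And>f. f \<in> L2 L \<Longrightarrow> L2_norm L (B f) \<le> C * L2_norm L f"
    using assms unfolding bounded_operator_def by blast
  have "L2_norm L (B f) \<le> \<bar>C\<bar> * L2_norm L f" if "f \<in> L2 L" for f
    by (rule order_trans[OF C[OF that] mult_right_mono[OF abs_ge_self L2_norm_nonneg]])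
  then show ?thesis using that[of "\<bar>C\<bar>"] by simp
qed

lemma bounded_operator_comb:
  assumes "bounded_operator L B" "f \<in> L2 L" "g \<in> L2 L"
  shows "AE x in leb L. B (\<lambda>x. a * f x + b * g x) x = a * B f x + b * B g x"
  using assms by (simp add: bounded_operator_def)

lemma bounded_operator_diff:
  assumes "bounded_operator L B" "f \<in> L2 L" "g \<in> L2 L"
  shows "AE x in leb L. B (\<lambda>x. f x - g x) x = B f x - B g x"
  using bounded_operator_comb[OF assms, of 1 "-1"] by simp

lemma bounded_operator_diff_norm:
  assumes "bounded_operator L B" "f \<in> L2 L" "g \<in> L2 L"
  shows "L2_norm L (\<lambda>x. B f x - B g x) = L2_norm L (B (\<lambda>x. f x - g x))"
proof (rule L2_norm_cong_AE)
  show "AE x in leb L. B f x - B g x = B (\<lambda>x. f x - g x) x"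
    using bounded_operator_diff[OF assms] by eventually_elim simp
qed (intro L2_measurable bounded_operator_L2[OF assms(1)] L2_diff assms)+

lemma bounded_operator_AE:
  assumes B: "bounded_operator L B" and f: "f \<in> L2 L" "g \<in> L2 L" "AE x in leb L. f x = g x"
  shows "AE x in leb L. B f x = B g x"
proof -
  obtain C where C: "0 \<le> C" "\<And>f. f \<in> L2 L \<Longrightarrow> L2_norm L (B f) \<le> C * L2_norm L f"
    using bounded_operator_bound[OF B] by metis
  have "L2_norm L (\<lambda>x. f x - g x) = 0" using f(3) by (intro L2_norm_AE_zero) auto
  then have "L2_norm L (\<lambda>x. B f x - B g x) = 0"
    using C(2)[OF L2_diff[OF f(1,2)]] L2_norm_nonneg[of L "B (\<lambda>x. f x - g x)"]
    by (simp add: bounded_operator_diff_norm[OF B f(1,2)])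
  then have "AE x in leb L. B f x - B g x = 0"
    by (intro L2_norm_eq_0_AE L2_diff bounded_operator_L2[OF B] f)
  then show ?thesis by simp
qed

text \<open>Baire's argument by nested balls: if no common bound existed, every ball would contain a
  smaller one throughout which a single \<open>T n\<close> exceeds \<open>k\<close>, and the point
  common to all these balls would violate the pointwise bound.\<close>

theorem uniform_boundedness:
  assumes L: "0 \<le> L" and T: "\<And>n::nat. bounded_operator L (T n)"
    and pw: "\<And>f. f \<in> L2 L \<Longrightarrow> \<exists>C. \<forall>n. L2_norm L (T n f) \<le> C"
  shows "\<exists>C. \<forall>n. \<forall>f\<in>L2 L. L2_norm L (T n f) \<le> C * L2_norm L f"
proof (rule ccontr)
  assume neg: "\<not> ?thesis"
  have unb: "\<exists>n f. f \<in> L2 L \<and> C * L2_norm L f < L2_norm L (T n f)" for C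
  proof (rule ccontr)
    assume b: "\<not> (\<exists>n f. f \<in> L2 L \<and> C * L2_norm L f < L2_norm L (T n f))"
    have "\<forall>n. \<forall>f\<in>L2 L. L2_norm L (T n f) \<le> C * L2_norm L f"
    proof (intro allI ballI leI notI)
      fix n f assume "f \<in> L2 L" "C * L2_norm L f < L2_norm L (T n f)"
      with b show False by blast
    qed
    with neg show False by blast
  qed
  define good where "good = (\<lambda>(k::nat) y s. y \<in> L2 L \<and> (\<exists>n. \<forall>z\<in>L2 L. L2_norm L (\<lambda>t. z t - y t) \<le> s \<longrightarrow> real k < L2_norm L (T n z)))"
  have step: "\<exists>y s. good k y s \<and> 0 < s \<and> s \<le> r / 2 \<and> L2_norm L (\<lambda>t. y t - x t) \<le> r / 2"
    if x: "x \<in> L2 L" and r: "0 < r" for k x r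
  proof -
    obtain n e where e: "e \<in> L2 L" "4 * (real k + 1) / r * L2_norm L e < L2_norm L (T n e)" using unb by blast
    obtain D where D: "0 \<le> D" "\<And>f. f \<in> L2 L \<Longrightarrow> L2_norm L (T n f) \<le> D * L2_norm L f"
      using bounded_operator_bound[OF T, of n] by metis
    have "0 < L2_norm L e"
    proof (rule ccontr)
      assume "\<not> 0 < L2_norm L e"
      then have "L2_norm L e = 0" using L2_norm_nonneg[of L e] by linarith
      then show False using e(2) D(2)[OF e(1)] by simp
    qed
    \<comment> \<open>Scales the bad direction \<open>e\<close> to length \<open>r / 2\<close>, so
      that \<open>x + c e\<close> and \<open>x - c e\<close> stay in the ball. Their images differ
      by \<open>2 c T e\<close>, hence one of them is large whatever the image of \<open>x\<close>
      is.\<close>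
    define c where "c = r / (2 * L2_norm L e)"
    have c: "0 < c" "c * L2_norm L e = r / 2" using r \<open>0 < L2_norm L e\<close> by (auto simp: c_def)
    have "4 * (real k + 1) / r * (r / 2) < c * L2_norm L (T n e)"
    proof -
      have "4 * (real k + 1) / r * (r / 2) = c * (4 * (real k + 1) / r * L2_norm L e)"
        unfolding c(2)[symmetric] by (simp only: mult_ac)
      then show ?thesis using mult_strict_left_mono[OF e(2) c(1)] by simp
    qed
    then have big: "2 * (real k + 1) < c * L2_norm L (T n e)" using r by simp
    let ?u = "\<lambda>t. 1 * x t + of_real c * e t" and ?v = "\<lambda>t. 1 * x t + (- of_real c) * e t"
    have uv: "?u \<in> L2 L" "?v \<in> L2 L" by (intro L2_add L2_scale x e)+
    have "L2_norm L (\<lambda>t. T n ?u t - T n ?v t) = L2_norm L (\<lambda>t. of_real (2 * c) * T n e t)"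
    proof (rule L2_norm_cong_AE)
      show "AE t in leb L. T n ?u t - T n ?v t = of_real (2 * c) * T n e t"
        using bounded_operator_comb[OF T x e(1), of n 1 "of_real c"] bounded_operator_comb[OF T x e(1), of n 1 "- of_real c"]
        by eventually_elim (simp add: algebra_simps)
    qed (intro L2_measurable L2_diff L2_scale bounded_operator_L2[OF T] uv e)+
    also have "\<dots> = 2 * c * L2_norm L (T n e)" using c by (simp add: L2_norm_scale)
    finally have "4 * (real k + 1) < L2_norm L (\<lambda>t. T n ?u t - T n ?v t)" using big by simp
    also have "\<dots> \<le> L2_norm L (T n ?u) + L2_norm L (T n ?v)"
      by (intro L2_norm_triangle_sub bounded_operator_L2[OF T] uv)
    finally have uv': "4 * (real k + 1) < L2_norm L (T n ?u) + L2_norm L (T n ?v)" .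
    have "\<exists>y. (y = ?u \<or> y = ?v) \<and> real k + 1 < L2_norm L (T n y)"
    proof (cases "real k + 1 < L2_norm L (T n ?u)")
      case True then show ?thesis by (intro exI[of _ ?u] conjI disjI1 refl)
    next
      case False
      have "c + 1 < b" if "\<not> c + 1 < a" "4 * (c + 1) < a + b" "0 \<le> c" for a b c :: real using that by auto
      from this[OF False uv' of_nat_0_le_iff] have "real k + 1 < L2_norm L (T n ?v)" .
      then show ?thesis by (intro exI[of _ ?v] conjI disjI2 refl)
    qed
    then obtain y where y: "y = ?u \<or> y = ?v" "real k + 1 < L2_norm L (T n y)" by (elim exE conjE)
    have yL: "y \<in> L2 L" using y(1) uv by (elim disjE) (simp_all only:)
    have "L2_norm L (\<lambda>t. y t - x t) = c * L2_norm L e"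
    proof -
      have "(\<lambda>t. y t - x t) = (\<lambda>t. of_real c * e t) \<or> (\<lambda>t. y t - x t) = (\<lambda>t. of_real (- c) * e t)"
        using y(1) by auto
      then show ?thesis using c(1) L2_norm_scale[of L "of_real c" e] L2_norm_scale[of L "of_real (- c)" e] by auto
    qed
    then have yx: "L2_norm L (\<lambda>t. y t - x t) \<le> r / 2" using c by simp
    \<comment> \<open>Within distance \<open>1 / (D + 1)\<close> the norm of the image under
      \<open>T n\<close> changes by at most 1, which the margin in \<open>k + 1\<close> allows
      for.\<close>
    define s where "s = min (r / 2) (1 / (D + 1))"
    have s: "0 < s" "s \<le> r / 2" "s \<le> 1 / (D + 1)" using r D(1) by (auto simp: s_def)
    have "real k < L2_norm L (T n z)" if z: "z \<in> L2 L" "L2_norm L (\<lambda>t. z t - y t) \<le> s" for z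
    proof -
      have "L2_norm L (T n y) - L2_norm L (T n z) \<le> L2_norm L (\<lambda>t. T n y t - T n z t)"
        using L2_norm_diff_ge[OF bounded_operator_L2[OF T yL] bounded_operator_L2[OF T z(1)], of n n] by simp
      also have "\<dots> \<le> D * L2_norm L (\<lambda>t. y t - z t)"
        unfolding bounded_operator_diff_norm[OF T yL z(1)] by (intro D L2_diff yL z)
      also have "\<dots> \<le> D * (1 / (D + 1))"
        using z(2) s D(1) L2_norm_minus_commute[of L y z] by (intro mult_left_mono) auto
      also have "\<dots> \<le> 1" using D(1) by simp
      finally show ?thesis using y(2) by simp
    qed
    then have "good k y s" using yL unfolding good_def by (intro conjI exI[of _ n] ballI impI)
    then show ?thesis using s yx by (intro exI[of _ y] exI[of _ s] conjI)
  qed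
  let ?P = "\<lambda>k (p :: (real \<Rightarrow> complex) \<times> real). fst p \<in> L2 L \<and> 0 < snd p \<and> snd p \<le> (1/2) ^ k"
  let ?Q = "\<lambda>k (p :: (real \<Rightarrow> complex) \<times> real) q. good k (fst q) (snd q) \<and> snd q \<le> snd p / 2 \<and> L2_norm L (\<lambda>t. fst q t - fst p t) \<le> snd p / 2"
  have "\<exists>X. \<forall>k. ?P k (X k) \<and> ?Q k (X k) (X (Suc k))"
  proof (rule dependent_nat_choice)
    show "\<exists>p. ?P 0 p" by (intro exI[of _ "(\<lambda>x. 0, 1)"]) simp
    fix p k assume p: "?P k p"
    obtain y s where ys: "good k y s" "0 < s" "s \<le> snd p / 2" "L2_norm L (\<lambda>t. y t - fst p t) \<le> snd p / 2"
      using step[of "fst p" "snd p" k, OF conjunct1[OF p] conjunct1[OF conjunct2[OF p]]] by (elim conjE exE) (rule that)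
    then have "?P (Suc k) (y, s)" using p by (auto simp: good_def)
    then show "\<exists>q. ?P (Suc k) q \<and> ?Q k p q" using ys by (intro exI[of _ "(y, s)"]) auto
  qed
  then obtain X where X: "\<forall>k. ?P k (X k) \<and> ?Q k (X k) (X (Suc k))" by (elim exE)
  define x where "x k = fst (X k)" for k
  define r where "r k = snd (X k)" for k
  have x: "x k \<in> L2 L" and r: "0 < r k" "r k \<le> (1/2) ^ k" "r (Suc k) \<le> r k / 2" and xx: "L2_norm L (\<lambda>t. x (Suc k) t - x k t) \<le> r k / 2"
    and g: "good k (x (Suc k)) (r (Suc k))" for k
    using X[rule_format, of k] by (simp_all add: x_def r_def)
  have "L2_norm L (\<lambda>t. x (Suc k) t - x k t) \<le> (1/2) ^ k" for k using xx[of k] r[of k] by linarith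
  from L2_complete[of x, OF x this L]
  obtain y where y: "y \<in> L2 L" "\<And>k. L2_norm L (\<lambda>t. x k t - y t) \<le> 2 * (1/2) ^ k" by metis
  \<comment> \<open>Each step is at most the drop of the radius, so the steps telescope and the
    limit lies in every ball.\<close>
  have tail: "L2_norm L (\<lambda>t. x (k + j) t - x k t) \<le> r k - r (k + j)" for k j
  proof (induction j)
    case 0 then show ?case by (simp add: L2_norm_zero)
  next
    case (Suc j)
    have "L2_norm L (\<lambda>t. x (k + Suc j) t - x k t) \<le> L2_norm L (\<lambda>t. x (Suc (k + j)) t - x (k + j) t) + L2_norm L (\<lambda>t. x (k + j) t - x k t)"
      using L2_norm_triangle_diff[OF x x x, of "k + Suc j" k "k + j"] by simp
    then show ?case using Suc.IH xx[of "k + j"] r(3)[of "k + j"] by simp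
  qed
  have ball: "L2_norm L (\<lambda>t. y t - x k t) \<le> r k" for k
  proof (rule LIMSEQ_le_const)
    have "(\<lambda>j. (1/2::real) ^ (j + k)) \<longlonglongrightarrow> 0"
      by (rule LIMSEQ_ignore_initial_segment[OF LIMSEQ_realpow_zero]) auto
    then have "(\<lambda>j. r k + 2 * (1/2::real) ^ (j + k)) \<longlonglongrightarrow> r k + 2 * 0"
      by (rule tendsto_add[OF tendsto_const tendsto_mult[OF tendsto_const]])
    then show "(\<lambda>j. r k + 2 * (1/2::real) ^ (k + j)) \<longlonglongrightarrow> r k" by (simp add: add.commute)
    have "L2_norm L (\<lambda>t. y t - x k t) \<le> r k + 2 * (1/2) ^ (k + j)" for j
      using L2_norm_triangle_diff[OF y(1) x x, of k "k + j"] y(2)[of "k + j"] tail[of k j] r(1)[of "k + j"] L2_norm_minus_commute[of L y "x (k + j)"]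
      by linarith
    then show "\<exists>N. \<forall>n\<ge>N. L2_norm L (\<lambda>t. y t - x k t) \<le> r k + 2 * (1/2) ^ (k + n)" by blast
  qed
  obtain C where C: "\<And>n. L2_norm L (T n y) \<le> C" using pw[OF y(1)] by blast
  obtain k where "C \<le> real k" using real_arch_simple by blast
  moreover obtain n where n: "\<forall>z\<in>L2 L. L2_norm L (\<lambda>t. z t - x (Suc k) t) \<le> r (Suc k) \<longrightarrow> real k < L2_norm L (T n z)"
    using g[of k] unfolding good_def by (elim conjE exE) (rule that)
  moreover have "real k < L2_norm L (T n y)" by (rule n[rule_format, OF y(1) ball])
  ultimately show False using C[of n] by simp
qed

section \<open>Differentiation of curves in \<open>L2\<close>\<close>

definition has_L2_deriv :: "real \<Rightarrow> (real \<Rightarrow> real \<Rightarrow> complex) \<Rightarrow> (real \<Rightarrow> complex) \<Rightarrow> real \<Rightarrow> real set \<Rightarrow> bool" where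
  "has_L2_deriv L w d t I \<longleftrightarrow> ((\<lambda>s. L2_norm L (\<lambda>x. (w s x - w t x) / of_real (s - t) - d x)) \<longlongrightarrow> 0) (at t within I)"

lemma has_L2_deriv_continuous:
  assumes w: "\<And>s. s \<in> I \<Longrightarrow> w s \<in> L2 L" "t \<in> I" "d \<in> L2 L" and h: "has_L2_deriv L w d t I"
  shows "((\<lambda>s. L2_norm L (\<lambda>x. w s x - w t x)) \<longlongrightarrow> 0) (at t within I)"
proof (rule Lim_null_comparison)
  let ?q = "\<lambda>s x. (w s x - w t x) / of_real (s - t) - d x"
  have "((\<lambda>s. \<bar>s - t\<bar> * (L2_norm L (?q s) + L2_norm L d)) \<longlongrightarrow> \<bar>t - t\<bar> * (0 + L2_norm L d)) (at t within I)"
    using h unfolding has_L2_deriv_def by (intro tendsto_intros)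
  then show "((\<lambda>s. \<bar>s - t\<bar> * (L2_norm L (?q s) + L2_norm L d)) \<longlongrightarrow> 0) (at t within I)" by simp
  show "\<forall>\<^sub>F s in at t within I. norm (L2_norm L (\<lambda>x. w s x - w t x)) \<le> \<bar>s - t\<bar> * (L2_norm L (?q s) + L2_norm L d)"
  proof (rule eventually_at_filter[THEN iffD2], rule always_eventually, intro allI impI)
    fix s assume s: "s \<noteq> t" "s \<in> I"
    have q: "?q s \<in> L2 L"
      using L2_diff[OF L2_scale[OF L2_diff[OF w(1)[OF s(2)] w(1)[OF w(2)]], of "1 / of_real (s - t)"] w(3)] by simp
    have "(\<lambda>x. w s x - w t x) = (\<lambda>x. of_real (s - t) * (?q s x + d x))" using s(1) by (auto simp: fun_eq_iff)
    then have "L2_norm L (\<lambda>x. w s x - w t x) = \<bar>s - t\<bar> * L2_norm L (\<lambda>x. ?q s x + d x)"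
      by (simp only: L2_norm_scale norm_of_real)
    also have "\<dots> \<le> \<bar>s - t\<bar> * (L2_norm L (?q s) + L2_norm L d)" by (intro mult_left_mono L2_norm_triangle q w) auto
    finally show "norm (L2_norm L (\<lambda>x. w s x - w t x)) \<le> \<bar>s - t\<bar> * (L2_norm L (?q s) + L2_norm L d)" by simp
  qed
qed

text \<open>Bounded symmetric real bilinear forms, so that one product rule for curves covers the
  inner product, used for contractivity, and the form weighted by \<open>1 + x\<close>, used for
  Kato's estimate. Real scalars suffice, since only difference quotients in time are scaled.\<close>

locale bform =
  fixes L :: real and B :: "(real \<Rightarrow> complex) \<Rightarrow> (real \<Rightarrow> complex) \<Rightarrow> real" and C :: real
  assumes B_diff: "\<And>f g h. f \<in> L2 L \<Longrightarrow> g \<in> L2 L \<Longrightarrow> h \<in> L2 L \<Longrightarrow> B (\<lambda>x. f x - g x) h = B f h - B g h"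
    and B_scale: "\<And>c f h. B (\<lambda>x. of_real c * f x) h = c * B f h"
    and B_sym: "\<And>f g. B f g = B g f"
    and C_nonneg: "0 \<le> C"
    and B_le: "\<And>f g. f \<in> L2 L \<Longrightarrow> g \<in> L2 L \<Longrightarrow> \<bar>B f g\<bar> \<le> C * L2_norm L f * L2_norm L g"
begin

lemma deriv:
  assumes w: "\<And>s. s \<in> I \<Longrightarrow> w s \<in> L2 L" "t \<in> I" "d \<in> L2 L" and v: "\<And>s. s \<in> I \<Longrightarrow> v s \<in> L2 L" "e \<in> L2 L"
    and h: "has_L2_deriv L w d t I" "has_L2_deriv L v e t I"
  shows "((\<lambda>s. B (w s) (v s)) has_real_derivative (B d (v t) + B e (w t))) (at t within I)"
proof -
  let ?q = "\<lambda>s x. (w s x - w t x) / of_real (s - t)" and ?p = "\<lambda>s x. (v s x - v t x) / of_real (s - t)"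
  let ?r = "\<lambda>s. C * L2_norm L (\<lambda>x. ?q s x - d x) * (L2_norm L (v t) + L2_norm L (\<lambda>x. v s x - v t x)) 
      + C * L2_norm L d * L2_norm L (\<lambda>x. v s x - v t x) + C * L2_norm L (\<lambda>x. ?p s x - e x) * L2_norm L (w t)"
  have "((\<lambda>s. (B (w s) (v s) - B (w t) (v t)) / (s - t) - (B d (v t) + B e (w t))) \<longlongrightarrow> 0) (at t within I)"
  proof (rule Lim_null_comparison)
    have "(?r \<longlongrightarrow> C * 0 * (L2_norm L (v t) + 0) + C * L2_norm L d * 0 + C * 0 * L2_norm L (w t)) (at t within I)"
      using h[unfolded has_L2_deriv_def] has_L2_deriv_continuous[OF v(1) w(2) v(2) h(2)]
      by (intro tendsto_intros)
    then show "(?r \<longlongrightarrow> 0) (at t within I)" by simp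
    show "\<forall>\<^sub>F s in at t within I. norm ((B (w s) (v s) - B (w t) (v t)) / (s - t) - (B d (v t) + B e (w t))) \<le> ?r s"
    proof (rule eventually_at_filter[THEN iffD2], rule always_eventually, intro allI impI)
      fix s assume s: "s \<noteq> t" "s \<in> I"
      have ws: "w s \<in> L2 L" "w t \<in> L2 L" "v s \<in> L2 L" "v t \<in> L2 L" using w v s by auto
      have q: "?q s \<in> L2 L" "?p s \<in> L2 L"
        using L2_scale[OF L2_diff[OF ws(1,2)], of "1 / of_real (s - t)"] L2_scale[OF L2_diff[OF ws(3,4)], of "1 / of_real (s - t)"] by simp_all
      have Bq: "B (?q s) g = (B (w s) g - B (w t) g) / (s - t)" if "g \<in> L2 L" for g
        using B_scale[of "1 / (s - t)" "\<lambda>x. w s x - w t x" g] B_diff[OF ws(1,2) that] by simp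
      have Bp: "B (?p s) g = (B (v s) g - B (v t) g) / (s - t)" if "g \<in> L2 L" for g
        using B_scale[of "1 / (s - t)" "\<lambda>x. v s x - v t x" g] B_diff[OF ws(3,4) that] by simp
      have "(B (w s) (v s) - B (w t) (v t)) / (s - t) = B (?q s) (v s) + B (?p s) (w t)"
        unfolding Bq[OF ws(3)] Bp[OF ws(2)] B_sym[of "v s" "w t"] B_sym[of "v t" "w t"] by (simp add: diff_divide_distrib)
      then have "(B (w s) (v s) - B (w t) (v t)) / (s - t) - (B d (v t) + B e (w t)) 
          = B (\<lambda>x. ?q s x - d x) (v s) + B (\<lambda>x. v s x - v t x) d + B (\<lambda>x. ?p s x - e x) (w t)"
        unfolding B_diff[OF q(1) w(3) ws(3)] B_diff[OF ws(3,4) w(3)] B_diff[OF q(2) v(2) ws(2)] B_sym[of "v s" d] B_sym[of "v t" d] by simp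
      moreover have "\<bar>B (\<lambda>x. ?q s x - d x) (v s)\<bar> \<le> C * L2_norm L (\<lambda>x. ?q s x - d x) * L2_norm L (v s)"
        by (rule B_le[OF L2_diff[OF q(1) w(3)] ws(3)])
      moreover have "C * L2_norm L (\<lambda>x. ?q s x - d x) * L2_norm L (v s) \<le> C * L2_norm L (\<lambda>x. ?q s x - d x) * (L2_norm L (v t) + L2_norm L (\<lambda>x. v s x - v t x))"
      proof (rule mult_left_mono)
        show "L2_norm L (v s) \<le> L2_norm L (v t) + L2_norm L (\<lambda>x. v s x - v t x)"
          using L2_norm_triangle[OF ws(4) L2_diff[OF ws(3,4)]] by simp
        show "0 \<le> C * L2_norm L (\<lambda>x. ?q s x - d x)" using C_nonneg by simp
      qed
      moreover have "\<bar>B (\<lambda>x. v s x - v t x) d\<bar> \<le> C * L2_norm L d * L2_norm L (\<lambda>x. v s x - v t x)"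
        unfolding B_sym[of "\<lambda>x. v s x - v t x" d] by (rule B_le[OF w(3) L2_diff[OF ws(3,4)]])
      moreover have "\<bar>B (\<lambda>x. ?p s x - e x) (w t)\<bar> \<le> C * L2_norm L (\<lambda>x. ?p s x - e x) * L2_norm L (w t)"
        by (rule B_le[OF L2_diff[OF q(2) v(2)] ws(2)])
      ultimately show "norm ((B (w s) (v s) - B (w t) (v t)) / (s - t) - (B d (v t) + B e (w t))) \<le> ?r s"
        unfolding real_norm_def by linarith
    qed
  qed
  then have "((\<lambda>s. (B (w s) (v s) - B (w t) (v t)) / (s - t)) \<longlongrightarrow> B d (v t) + B e (w t)) (at t within I)"
    by (rule LIM_zero_cancel)
  then show ?thesis by (simp add: has_field_derivative_iff)
qed

end

text \<open>Energies at two times are compared through one intermediate time rather than by an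
  integral: nothing has to be known about how the derivative depends on time.\<close>

lemma DERIV_le_imp:
  fixes f :: "real \<Rightarrow> real"
  assumes "a < b" "\<And>t. t \<in> {a..b} \<Longrightarrow> (f has_real_derivative f' t) (at t within {a..b})"
  obtains t where "a < t" "t < b" "f b - f a = (b - a) * f' t"
proof -
  have "\<exists>x\<in>{a<..<b}. f b - f a = f' x * (b - a)"
    by (rule mvt_simple[OF assms(1)]) (use assms(2) in \<open>auto simp: has_field_derivative_def\<close>)
  then show ?thesis using that by (auto simp: mult.commute)
qed

subsection \<open>Contractivity of the semigroup\<close>

lemma L2_seq_limit_norm:
  assumes "\<And>n::nat. f n \<in> L2 L" "g \<in> L2 L" "(\<lambda>n. L2_norm L (\<lambda>x. f n x - g x)) \<longlonglongrightarrow> 0"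
  shows "(\<lambda>n. L2_norm L (f n)) \<longlonglongrightarrow> L2_norm L g"
proof (rule LIM_zero_cancel, rule tendsto_norm_zero_cancel)
  show "(\<lambda>n. norm (L2_norm L (f n) - L2_norm L g)) \<longlonglongrightarrow> 0"
    by (rule tendsto_zero_le[OF assms(3)]) (use L2_norm_diff_ge assms in auto)
qed

context kdv begin

lemma bform_plain: "bform L (\<lambda>f g. LINT x|leb L. f x \<bullet> g x) 1"
proof
  fix f g h :: "real \<Rightarrow> complex" and c :: real
  show "(LINT x|leb L. (f x - g x) \<bullet> h x) = (LINT x|leb L. f x \<bullet> h x) - (LINT x|leb L. g x \<bullet> h x)"
    if "f \<in> L2 L" "g \<in> L2 L" "h \<in> L2 L"
    unfolding inner_diff_left by (intro Bochner_Integration.integral_diff L2_mult_integrable that)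
  have "(LINT x|leb L. (of_real c * f x) \<bullet> h x) = (LINT x|leb L. c * (f x \<bullet> h x))"
    by (simp add: inner_complex_def algebra_simps)
  then show "(LINT x|leb L. (of_real c * f x) \<bullet> h x) = c * (LINT x|leb L. f x \<bullet> h x)" by simp
  show "(LINT x|leb L. f x \<bullet> g x) = (LINT x|leb L. g x \<bullet> f x)" by (simp add: inner_commute)
  show "(0::real) \<le> 1" by simp
  show "\<bar>LINT x|leb L. f x \<bullet> g x\<bar> \<le> 1 * L2_norm L f * L2_norm L g" if "f \<in> L2 L" "g \<in> L2 L"
    using LINT_inner_le[OF that] by simp
qed

definition B1 :: "(real \<Rightarrow> complex) \<Rightarrow> (real \<Rightarrow> complex) \<Rightarrow> real" where
  "B1 f g = (LINT x|leb L. (1 + x) * (f x \<bullet> g x))"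

lemma bform_B1: "bform L B1 (1 + L)"
proof
  fix f g h :: "real \<Rightarrow> complex" and c :: real
  show "B1 (\<lambda>x. f x - g x) h = B1 f h - B1 g h" if "f \<in> L2 L" "g \<in> L2 L" "h \<in> L2 L"
    unfolding B1_def inner_diff_left right_diff_distrib
    by (intro Bochner_Integration.integral_diff weighted_inner_le that)
  have "B1 (\<lambda>x. of_real c * f x) h = (LINT x|leb L. c * ((1 + x) * (f x \<bullet> h x)))"
    unfolding B1_def by (simp add: inner_complex_def algebra_simps)
  then show "B1 (\<lambda>x. of_real c * f x) h = c * B1 f h" by (simp add: B1_def)
  show "B1 f g = B1 g f" by (simp add: B1_def inner_commute)
  show "0 \<le> 1 + L" using L by simp
  show "\<bar>B1 f g\<bar> \<le> (1 + L) * L2_norm L f * L2_norm L g" if "f \<in> L2 L" "g \<in> L2 L"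
    unfolding B1_def by (rule weighted_inner_le[OF that])
qed

lemma B1_nonneg: "0 \<le> B1 f f"
  unfolding B1_def by (rule integral_nonneg_AE) (auto intro!: AE_I2 mult_nonneg_nonneg)

lemma LINT_inner_self: "(LINT x|leb L. f x \<bullet> f x) = (L2_norm L f)\<^sup>2"
  by (simp add: L2_norm_power2 power2_norm_eq_inner)

end

section \<open>The semigroup and its generator\<close>

locale kdv_semigroup = kdv +
  fixes S :: "real \<Rightarrow> (real \<Rightarrow> complex) \<Rightarrow> real \<Rightarrow> complex"
  assumes gen: "semigroup_generated_by_A L \<alpha> \<beta> \<delta> S"
begin

abbreviation generates :: "(real \<Rightarrow> complex) \<Rightarrow> (real \<Rightarrow> complex) \<Rightarrow> bool" where
  "generates f g \<equiv> in_generator L S f g"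

abbreviation quot :: "real \<Rightarrow> (real \<Rightarrow> complex) \<Rightarrow> (real \<Rightarrow> complex) \<Rightarrow> real \<Rightarrow> complex" where
  "quot h f g x \<equiv> (S h f x - f x) / of_real h - g x"

lemma S_bounded_operator: "0 \<le> t \<Longrightarrow> bounded_operator L (S t)"
  using gen by (simp add: semigroup_generated_by_A_def C0_semigroup_def)

lemma S_L2: "0 \<le> t \<Longrightarrow> f \<in> L2 L \<Longrightarrow> S t f \<in> L2 L"
  by (rule bounded_operator_L2[OF S_bounded_operator])

lemma S_0: "f \<in> L2 L \<Longrightarrow> AE x in leb L. S 0 f x = f x"
  using gen by (simp add: semigroup_generated_by_A_def C0_semigroup_def)

lemma S_add: "0 \<le> s \<Longrightarrow> 0 \<le> t \<Longrightarrow> f \<in> L2 L \<Longrightarrow> AE x in leb L. S (s + t) f x = S s (S t f) x"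
  using gen by (simp add: semigroup_generated_by_A_def C0_semigroup_def)

lemma S_right_continuous: "f \<in> L2 L \<Longrightarrow> ((\<lambda>t. L2_norm L (\<lambda>x. S t f x - f x)) \<longlongrightarrow> 0) (at_right 0)"
  using gen by (simp add: semigroup_generated_by_A_def C0_semigroup_def)

lemma generates_iff: "f \<in> L2 L \<Longrightarrow> g \<in> L2 L \<Longrightarrow> generates f g \<longleftrightarrow> f \<in> dom_A L \<and> (AE x in leb L. g x = op_A L \<alpha> \<beta> \<delta> f x)"
  using gen by (simp add: semigroup_generated_by_A_def)

lemma generates_L2: assumes "generates f g" shows "f \<in> L2 L" "g \<in> L2 L"
  using assms by (auto simp: in_generator_def)

lemma generates_rep:
  assumes "generates f g"
  obtains p0 p1 p2 p3 where "dom_rep p0 p1 p2 p3" "AE x in leb L. f x = p0 x" "AE x in leb L. g x = Ap p1 p2 p3 x"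
proof -
  have *: "f \<in> dom_A L" "AE x in leb L. g x = op_A L \<alpha> \<beta> \<delta> f x"
    using generates_iff[OF generates_L2[OF assms]] assms by auto
  obtain p0 p1 p2 p3 where p: "dom_rep p0 p1 p2 p3" "AE x in leb L. f x = p0 x" "AE x in leb L. op_A L \<alpha> \<beta> \<delta> f x = Ap p1 p2 p3 x"
    using dom_A_rep[OF *(1)] .
  moreover have "AE x in leb L. g x = Ap p1 p2 p3 x" using *(2) p(3) by eventually_elim simp
  ultimately show ?thesis using that by blast
qed

lemma ctest_generates:
  assumes "ctest L \<phi>" obtains g where "generates \<phi> g" "ctest L g"
proof -
  obtain p1 p2 p3 where p: "dom_rep \<phi> p1 p2 p3" "ctest L (Ap p1 p2 p3)" using ctest_dom[OF assms] .
  note l = ctest_L2[OF assms] ctest_L2[OF p(2)]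
  have "\<phi> \<in> dom_A L" "AE x in leb L. op_A L \<alpha> \<beta> \<delta> \<phi> x = Ap p1 p2 p3 x"
    using rep_dom_A[OF p(1) l(1)] by auto
  then have "generates \<phi> (Ap p1 p2 p3)" unfolding generates_iff[OF l] by auto
  then show ?thesis using p(2) that by blast
qed

lemma S_shift_diff:
  assumes t: "0 \<le> t" and h: "0 < h" and f: "f \<in> L2 L" "g \<in> L2 L"
  shows "AE x in leb L. (S (t + h) f x - S t f x) / of_real h - S t g x = S t (\<lambda>x. quot h f g x) x"
proof -
  note b = S_bounded_operator[OF t]
  have Sh: "S h f \<in> L2 L" using S_L2 h f by simp
  have "AE x in leb L. S t (\<lambda>x. (1 / of_real h) * (S h f x - f x) + (-1) * g x) x = (1 / of_real h) * S t (\<lambda>x. S h f x - f x) x + (-1) * S t g x"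
    by (rule bounded_operator_comb[OF b L2_diff[OF Sh f(1)] f(2)])
  moreover have "AE x in leb L. S t (\<lambda>x. S h f x - f x) x = S t (S h f) x - S t f x"
    by (rule bounded_operator_diff[OF b Sh f(1)])
  moreover have "AE x in leb L. S (t + h) f x = S t (S h f) x" using S_add[OF t _ f(1), of h] h by simp
  ultimately show ?thesis by eventually_elim (simp add: diff_divide_distrib)
qed

lemma quot_L2: "0 < h \<Longrightarrow> f \<in> L2 L \<Longrightarrow> g \<in> L2 L \<Longrightarrow> (\<lambda>x. quot h f g x) \<in> L2 L"
  using L2_diff[OF L2_scale[OF L2_diff[OF S_L2], of h f f "1 / of_real h"], of g] by simp

text \<open>The difference quotient of \<open>S t f\<close> is the image under \<open>S t\<close> of
  that of \<open>f\<close>; thus the domain is invariant and \<open>A\<close> commutes with the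
  semigroup.\<close>

lemma generates_S:
  assumes g: "generates f g" and t: "0 \<le> t" shows "generates (S t f) (S t g)"
proof -
  note l = generates_L2[OF g] and b = S_bounded_operator[OF t]
  obtain C where C: "0 \<le> C" "\<And>f. f \<in> L2 L \<Longrightarrow> L2_norm L (S t f) \<le> C * L2_norm L f" using bounded_operator_bound[OF b] by metis
  have "((\<lambda>h. C * L2_norm L (\<lambda>x. quot h f g x)) \<longlongrightarrow> C * 0) (at_right 0)"
    using g by (intro tendsto_intros) (simp add: in_generator_def)
  then have "((\<lambda>h. C * L2_norm L (\<lambda>x. quot h f g x)) \<longlongrightarrow> 0) (at_right 0)" by simp
  moreover have "\<forall>\<^sub>F h in at_right 0. norm (L2_norm L (\<lambda>x. quot h (S t f) (S t g) x)) \<le> C * L2_norm L (\<lambda>x. quot h f g x)"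
  proof (rule eventually_at_right_less[THEN eventually_mono])
    fix h :: real assume h: "0 < h"
    have "L2_norm L (\<lambda>x. quot h (S t f) (S t g) x) = L2_norm L (S t (\<lambda>x. quot h f g x))"
    proof (rule L2_norm_cong_AE)
      have "AE x in leb L. S (h + t) f x = S h (S t f) x" using S_add[OF _ t l(1), of h] h by simp
      then show "AE x in leb L. quot h (S t f) (S t g) x = S t (\<lambda>x. quot h f g x) x"
        using S_shift_diff[OF t h l] by eventually_elim (simp add: add.commute)
    qed (intro L2_measurable quot_L2 S_L2 h l t)+
    then show "norm (L2_norm L (\<lambda>x. quot h (S t f) (S t g) x)) \<le> C * L2_norm L (\<lambda>x. quot h f g x)"
      using C(2)[OF quot_L2[OF h l]] by simp
  qed
  ultimately have "((\<lambda>h. L2_norm L (\<lambda>x. quot h (S t f) (S t g) x)) \<longlongrightarrow> 0) (at_right 0)"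
    by (rule Lim_null_comparison[rotated])
  then show ?thesis using S_L2 t l by (simp add: in_generator_def)
qed

text \<open>Carries both energy estimates from representatives over to pairs in the graph of the
  generator, and hands out the \<open>p1\<close> whose norm and trace they control.\<close>

lemma generates_inner:
  assumes g: "generates f g"
  obtains p0 p1 p2 p3 where "dom_rep p0 p1 p2 p3" "AE x in leb L. f x = p0 x" "AE x in leb L. g x = Ap p1 p2 p3 x"
    "(LINT x|leb L. g x \<bullet> f x) \<le> - \<beta> / 2 * (cmod (p1 0))\<^sup>2"
    "B1 g f \<le> - \<beta> / 2 * (cmod (p1 0))\<^sup>2 - \<beta> * (L2_norm L p1)\<^sup>2 + K * (L2_norm L f)\<^sup>2"
proof -
  note l = generates_L2[OF g]
  obtain p0 p1 p2 p3 where p: "dom_rep p0 p1 p2 p3" "AE x in leb L. f x = p0 x" "AE x in leb L. g x = Ap p1 p2 p3 x"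
    using generates_rep[OF g] .
  note lp = dom_rep_L2[OF p(1)]
  have e1: "(LINT x|leb L. g x \<bullet> f x) = (LINT x|leb L. Ap p1 p2 p3 x \<bullet> p0 x)"
  proof (rule integral_cong_AE)
    show "AE x in leb L. g x \<bullet> f x = Ap p1 p2 p3 x \<bullet> p0 x" using p(2,3) by eventually_elim simp
  qed (intro borel_measurable_integrable L2_mult_integrable l lp)+
  have e2: "B1 g f = (LINT x|leb L. (1 + x) * (Ap p1 p2 p3 x \<bullet> p0 x))"
    unfolding B1_def
  proof (rule integral_cong_AE)
    show "AE x in leb L. (1 + x) * (g x \<bullet> f x) = (1 + x) * (Ap p1 p2 p3 x \<bullet> p0 x)" using p(2,3) by eventually_elim simp
  qed (intro borel_measurable_integrable weighted_inner_le l lp)+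
  have "L2_norm L f = L2_norm L p0" by (rule L2_norm_cong_AE[OF L2_measurable[OF l(1)] L2_measurable[OF lp(1)] p(2)])
  then show ?thesis using that[OF p] dissipative[OF p(1)] Kato[OF p(1)] by (simp add: e1 e2)
qed

text \<open>Strong continuity bounds each single orbit near 0. If the operators were unbounded near
  0, there would be times tending to 0 along which the orbits are bounded and the operators are not,
  against the uniform boundedness theorem.\<close>

lemma S_locally_bounded:
  obtains \<eta> M where "0 < \<eta>" "0 \<le> M" "\<And>t f. t \<in> {0..\<eta>} \<Longrightarrow> f \<in> L2 L \<Longrightarrow> L2_norm L (S t f) \<le> M * L2_norm L f"
proof (rule ccontr)
  assume no: "\<not> thesis"
  have "\<exists>t f. t \<in> {0..1 / real (Suc n)} \<and> f \<in> L2 L \<and> real n * L2_norm L f < L2_norm L (S t f)" for n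
  proof (rule ccontr)
    assume "\<not> ?thesis"
    then have "\<And>t f. t \<in> {0..1 / real (Suc n)} \<Longrightarrow> f \<in> L2 L \<Longrightarrow> L2_norm L (S t f) \<le> real n * L2_norm L f" by (meson not_le)
    then show False using no that[of "1 / real (Suc n)" "real n"] by simp
  qed
  then obtain t where t: "\<And>n. t n \<in> {0..1 / real (Suc n)}"
    and unb: "\<And>n. \<exists>f\<in>L2 L. real n * L2_norm L f < L2_norm L (S (t n) f)" by metis
  have "\<exists>C. \<forall>n. L2_norm L (S (t n) f) \<le> C" if f: "f \<in> L2 L" for f
  proof -
    have "\<forall>\<^sub>F h in at_right 0. L2_norm L (\<lambda>x. S h f x - f x) < 1"
      using order_tendstoD(2)[OF S_right_continuous[OF f], of 1] by simp
    then obtain b where b: "0 < b" "\<And>h. 0 < h \<Longrightarrow> h < b \<Longrightarrow> L2_norm L (\<lambda>x. S h f x - f x) < 1"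
      unfolding eventually_at_right_field by blast
    have z: "L2_norm L (\<lambda>x. S 0 f x - f x) = 0" using S_0[OF f] by (intro L2_norm_AE_zero) auto
    have "\<forall>\<^sub>F n in sequentially. 1 / real (Suc n) < b"
      using order_tendstoD(2)[OF LIMSEQ_inverse_real_of_nat b(1)] by (simp add: inverse_eq_divide)
    then have "\<forall>\<^sub>F n in sequentially. norm (L2_norm L (S (t n) f)) \<le> L2_norm L f + 1"
    proof eventually_elim
      case (elim n)
      have "L2_norm L (\<lambda>x. S (t n) f x - f x) < 1"
        using z b(2)[of "t n"] t[of n] elim by (cases "t n = 0") auto
      then show ?case using L2_norm_diff_ge[OF S_L2[of "t n", OF _ f] f] t[of n] by auto
    qed
    moreover have "0 < L2_norm L f + 1" using L2_norm_nonneg[of L f] by linarith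
    ultimately have "Bseq (\<lambda>n. L2_norm L (S (t n) f))" unfolding Bfun_def by blast
    then show ?thesis by (elim BseqE) (auto intro: order_trans[OF abs_ge_self])
  qed
  then obtain C where C: "\<And>n f. f \<in> L2 L \<Longrightarrow> L2_norm L (S (t n) f) \<le> C * L2_norm L f"
    using uniform_boundedness[of L "\<lambda>n. S (t n)"] S_bounded_operator t L by (metis atLeastAtMost_iff less_imp_le)
  obtain n where "C \<le> real n" using real_arch_simple by blast
  moreover obtain f where "f \<in> L2 L" "real n * L2_norm L f < L2_norm L (S (t n) f)" using unb by blast
  ultimately show False using C[of f n] mult_right_mono[of C "real n" "L2_norm L f"] by simp
qed

text \<open>To the right of \<open>t\<close> the quotient is \<open>S t\<close> applied to the
  quotient at 0. To the left it is \<open>S s\<close> applied to that quotient, minus the correction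
  \<open>S s (S h g - g)\<close>, because the derivative is sought at the later time
  \<open>s + h\<close>. The operator bound is a parameter: it is the local one before contractivity
  is known and 1 afterwards.\<close>

lemma S_has_L2_deriv_aux:
  assumes M: "0 \<le> M" "\<And>t f. t \<in> {0..\<eta>} \<Longrightarrow> f \<in> L2 L \<Longrightarrow> L2_norm L (S t f) \<le> M * L2_norm L f"
    and g: "generates f g" and t: "t \<in> {0..\<eta>}"
  shows "has_L2_deriv L (\<lambda>s. S s f) (S t g) t {0..\<eta>}"
  unfolding has_L2_deriv_def
proof (rule Lim_null_comparison)
  note l = generates_L2[OF g]
  let ?D = "\<lambda>h. L2_norm L (\<lambda>x. quot h f g x)" and ?G = "\<lambda>h. L2_norm L (\<lambda>x. S h g x - g x)"
  have abs: "filterlim (\<lambda>s. \<bar>s - t\<bar>) (at_right 0) (at t within {0..\<eta>})"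
    unfolding filterlim_at
  proof
    have "((\<lambda>s. \<bar>s - t\<bar>) \<longlongrightarrow> \<bar>t - t\<bar>) (at t within {0..\<eta>})" by (intro tendsto_intros)
    then show "((\<lambda>s. \<bar>s - t\<bar>) \<longlongrightarrow> 0) (at t within {0..\<eta>})" by simp
    show "\<forall>\<^sub>F s in at t within {0..\<eta>}. \<bar>s - t\<bar> \<in> {0<..} \<and> \<bar>s - t\<bar> \<noteq> 0"
      by (auto simp: eventually_at_filter)
  qed
  have "((\<lambda>h. M * (?D h + ?G h)) \<longlongrightarrow> M * (0 + 0)) (at_right 0)"
    using g S_right_continuous[OF l(2)] unfolding in_generator_def by (intro tendsto_intros) auto
  then have "((\<lambda>h. M * (?D h + ?G h)) \<longlongrightarrow> 0) (at_right 0)" by simp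
  from filterlim_compose[OF this abs]
  show "((\<lambda>s. M * (?D \<bar>s - t\<bar> + ?G \<bar>s - t\<bar>)) \<longlongrightarrow> 0) (at t within {0..\<eta>})" .
  show "\<forall>\<^sub>F s in at t within {0..\<eta>}. norm (L2_norm L (\<lambda>x. (S s f x - S t f x) / of_real (s - t) - S t g x)) \<le> M * (?D \<bar>s - t\<bar> + ?G \<bar>s - t\<bar>)"
  proof (rule eventually_at_filter[THEN iffD2], rule always_eventually, intro allI impI)
    fix s assume s: "s \<noteq> t" "s \<in> {0..\<eta>}"
    have st: "0 \<le> s" "0 \<le> t" using s t by auto
    have q: "(\<lambda>x. (S s f x - S t f x) / of_real (s - t) - S t g x) \<in> L2 L"
      using L2_diff[OF L2_scale[OF L2_diff[OF S_L2[OF st(1) l(1)] S_L2[OF st(2) l(1)]], of "1 / of_real (s - t)"] S_L2[OF st(2) l(2)]] by simp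
    consider "t < s" | "s < t" using s by linarith
    then have "L2_norm L (\<lambda>x. (S s f x - S t f x) / of_real (s - t) - S t g x) \<le> M * (?D \<bar>s - t\<bar> + ?G \<bar>s - t\<bar>)"
    proof cases
      case 1
      define h where "h = s - t"
      have h: "0 < h" "s = t + h" "\<bar>s - t\<bar> = h" using 1 by (auto simp: h_def)
      have "L2_norm L (\<lambda>x. (S s f x - S t f x) / of_real (s - t) - S t g x) = L2_norm L (S t (\<lambda>x. quot h f g x))"
      proof (rule L2_norm_cong_AE)
        show "AE x in leb L. (S s f x - S t f x) / of_real (s - t) - S t g x = S t (\<lambda>x. quot h f g x) x"
          using S_shift_diff[OF st(2) h(1) l] by (simp add: h(2))
      qed (intro L2_measurable q S_L2 quot_L2 h l st)+
      also have "\<dots> \<le> M * ?D h" by (intro M t quot_L2 h l)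
      also have "\<dots> \<le> M * (?D h + ?G h)" using M(1) by (intro mult_left_mono) auto
      finally show ?thesis by (simp only: h(3))
    next
      case 2
      define h where "h = t - s"
      have h: "0 < h" "t = s + h" "\<bar>s - t\<bar> = h" using 2 by (auto simp: h_def)
      note b = S_bounded_operator[OF st(1)]
      have Sg: "S h g \<in> L2 L" using S_L2 l h by simp
      have "L2_norm L (\<lambda>x. (S s f x - S t f x) / of_real (s - t) - S t g x) = 
          L2_norm L (\<lambda>x. S s (\<lambda>x. quot h f g x) x - S s (\<lambda>x. S h g x - g x) x)"
      proof (rule L2_norm_cong_AE)
        have "AE x in leb L. S t g x = S s (S h g) x" using S_add[OF st(1) _ l(2), of h] h by simp
        then show "AE x in leb L. (S s f x - S t f x) / of_real (s - t) - S t g x = S s (\<lambda>x. quot h f g x) x - S s (\<lambda>x. S h g x - g x) x"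
          using S_shift_diff[OF st(1) h(1) l] bounded_operator_diff[OF b Sg l(2)]
        proof eventually_elim
          case (elim x)
          have "(S s f x - S t f x) / of_real (s - t) = (S (s + h) f x - S s f x) / of_real h"
            using h(1) unfolding h(2) by (simp add: divide_simps)
          then show ?case using elim by (simp add: algebra_simps)
        qed
      qed (intro L2_measurable q S_L2 quot_L2 h l st L2_diff Sg)+
      also have "\<dots> \<le> L2_norm L (S s (\<lambda>x. quot h f g x)) + L2_norm L (S s (\<lambda>x. S h g x - g x))"
        by (intro L2_norm_triangle_sub S_L2 quot_L2 h l st L2_diff Sg)
      also have "\<dots> \<le> M * ?D h + M * ?G h" by (intro add_mono M s quot_L2 h l L2_diff Sg)
      finally show ?thesis by (simp only: h(3) distrib_left)
    qed
    then show "norm (L2_norm L (\<lambda>x. (S s f x - S t f x) / of_real (s - t) - S t g x)) \<le> M * (?D \<bar>s - t\<bar> + ?G \<bar>s - t\<bar>)" by simp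
  qed
qed

text \<open>On the domain of the generator the energy decreases by dissipativity. For general data
  and short times the local bound \<open>M\<close> multiplies only the approximation error and
  disappears in the limit; the semigroup law then reaches all times.\<close>

theorem S_contraction:
  assumes t: "0 \<le> t" and f: "f \<in> L2 L" shows "L2_norm L (S t f) \<le> L2_norm L f"
proof -
  obtain \<eta> M where \<eta>: "0 < \<eta>" and M: "0 \<le> M" "\<And>t f. t \<in> {0..\<eta>} \<Longrightarrow> f \<in> L2 L \<Longrightarrow> L2_norm L (S t f) \<le> M * L2_norm L f"
    using S_locally_bounded by metis
  have dom: "L2_norm L (S t f) \<le> L2_norm L f" if g: "generates f g" and t: "t \<in> {0..\<eta>}" for f g t
  proof (cases "t = 0")
    case True
    note l = generates_L2[OF g]
    show ?thesis unfolding True using L2_norm_cong_AE[OF L2_measurable[OF S_L2[OF _ l(1)]] L2_measurable[OF l(1)] S_0[OF l(1)]] by simp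
  next
    case False
    note l = generates_L2[OF g]
    let ?B = "\<lambda>f g. LINT x|leb L. f x \<bullet> g x"
    interpret bform L ?B 1 by (rule bform_plain)
    have d: "((\<lambda>s. ?B (S s f) (S s f)) has_real_derivative (?B (S s g) (S s f) + ?B (S s g) (S s f))) (at s within {0..t})"
      if s: "s \<in> {0..t}" for s
    proof -
      have "has_L2_deriv L (\<lambda>s. S s f) (S s g) s {0..\<eta>}"
        by (rule S_has_L2_deriv_aux[OF M g]) (use s t in auto)
      then have "((\<lambda>s. ?B (S s f) (S s f)) has_real_derivative (?B (S s g) (S s f) + ?B (S s g) (S s f))) (at s within {0..\<eta>})"
        by (intro deriv) (use s t l in \<open>auto intro: S_L2\<close>)
      then show ?thesis by (rule DERIV_subset) (use t in auto)
    qed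
    have t0: "0 < t" using False t by simp
    obtain s where s: "0 < s" "s < t" "?B (S t f) (S t f) - ?B (S 0 f) (S 0 f) = (t - 0) * (?B (S s g) (S s f) + ?B (S s g) (S s f))"
      by (rule DERIV_le_imp[OF t0 d])
    have "?B (S s g) (S s f) \<le> 0"
    proof -
      obtain p1 where "?B (S s g) (S s f) \<le> - \<beta> / 2 * (cmod (p1 (0::real)))\<^sup>2"
        by (rule generates_inner[OF generates_S[OF g less_imp_le[OF s(1)]]], rule that, assumption)
      moreover have "0 \<le> \<beta> / 2 * (cmod (p1 0))\<^sup>2" using \<beta> by simp
      ultimately show ?thesis by linarith
    qed
    then have "?B (S t f) (S t f) \<le> ?B (S 0 f) (S 0 f)"
      using s(3) mult_nonneg_nonpos[of t "?B (S s g) (S s f) + ?B (S s g) (S s f)"] t by auto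
    then have "(L2_norm L (S t f))\<^sup>2 \<le> (L2_norm L (S 0 f))\<^sup>2" by (simp only: LINT_inner_self)
    then have "L2_norm L (S t f) \<le> L2_norm L (S 0 f)" by (rule power2_le_imp_le) simp
    also have "\<dots> = L2_norm L f"
      by (rule L2_norm_cong_AE[OF L2_measurable[OF S_L2[OF _ l(1)]] L2_measurable[OF l(1)] S_0[OF l(1)]]) simp
    finally show ?thesis .
  qed
  have small: "L2_norm L (S t f) \<le> L2_norm L f" if t: "t \<in> {0..\<eta>}" and f: "f \<in> L2 L" for t f
  proof -
    obtain \<phi> where \<phi>: "\<And>n::nat. ctest L (\<phi> n)" "(\<lambda>n. L2_norm L (\<lambda>x. \<phi> n x - f x)) \<longlonglongrightarrow> 0"
      using L2_seq_tendsto[OF L f] by blast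
    have t0: "0 \<le> t" using t by simp
    note l = ctest_L2[OF \<phi>(1)]
    have "L2_norm L (S t f) \<le> L2_norm L (\<phi> n) + M * L2_norm L (\<lambda>x. \<phi> n x - f x)" for n
    proof -
      obtain g where g: "generates (\<phi> n) g" using ctest_generates[OF \<phi>(1)] by metis
      have "L2_norm L (S t f) \<le> L2_norm L (S t (\<phi> n)) + L2_norm L (\<lambda>x. S t (\<phi> n) x - S t f x)"
        using L2_norm_diff_ge[OF S_L2[OF t0 l] S_L2[OF t0 f], of n] by linarith
      also have "L2_norm L (\<lambda>x. S t (\<phi> n) x - S t f x) \<le> M * L2_norm L (\<lambda>x. \<phi> n x - f x)"
        unfolding bounded_operator_diff_norm[OF S_bounded_operator[OF t0] l f] by (intro M t L2_diff l f)
      also have "L2_norm L (S t (\<phi> n)) \<le> L2_norm L (\<phi> n)" by (rule dom[OF g t])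
      finally show ?thesis by simp
    qed
    moreover have "(\<lambda>n. L2_norm L (\<phi> n) + M * L2_norm L (\<lambda>x. \<phi> n x - f x)) \<longlonglongrightarrow> L2_norm L f + M * 0"
      by (intro tendsto_intros \<phi> L2_seq_limit_norm l f)
    ultimately show ?thesis by (intro LIMSEQ_le_const[of _ "L2_norm L f"]) auto
  qed
  obtain n :: nat where n: "t / \<eta> < real n" "0 < n" using reals_Archimedean2[of "max (t / \<eta>) 0"] by auto
  define h where "h = t / real n"
  have h: "h \<in> {0..\<eta>}" "t = real n * h" using n t \<eta> by (auto simp: h_def field_simps)
  have "L2_norm L (S (real k * h) f) \<le> L2_norm L f" for k
  proof (induction k)
    case 0
    show ?case using small[of 0 f] \<eta> f by simp
  next
    case (Suc k)
    have kh: "0 \<le> real k * h" "0 \<le> h" using h by auto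
    have "L2_norm L (S (real (Suc k) * h) f) = L2_norm L (S h (S (real k * h) f))"
    proof (rule L2_norm_cong_AE)
      show "AE x in leb L. S (real (Suc k) * h) f x = S h (S (real k * h) f) x"
        using S_add[OF kh(2,1) f] by (simp add: algebra_simps)
    qed (use kh in \<open>auto intro!: L2_measurable S_L2 f mult_nonneg_nonneg\<close>)
    also have "\<dots> \<le> L2_norm L (S (real k * h) f)" by (intro small h S_L2 kh f)
    finally show ?case using Suc.IH by simp
  qed
  from this[of n] show ?thesis by (simp add: h(2))
qed

lemma S_has_L2_deriv:
  assumes "generates f g" "t \<in> {0..\<eta>}"
  shows "has_L2_deriv L (\<lambda>s. S s f) (S t g) t {0..\<eta>}"
  by (rule S_has_L2_deriv_aux[OF _ _ assms, of 1]) (auto intro: S_contraction)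

lemma S_norm_antimono:
  assumes "0 \<le> s" "s \<le> t" "f \<in> L2 L" shows "L2_norm L (S t f) \<le> L2_norm L (S s f)"
proof -
  have "L2_norm L (S t f) = L2_norm L (S (t - s) (S s f))"
    using S_add[of "t - s" s f] assms by (intro L2_norm_cong_AE L2_measurable S_L2) auto
  also have "\<dots> \<le> L2_norm L (S s f)" using assms by (intro S_contraction S_L2) auto
  finally show ?thesis .
qed

end

subsection \<open>Smoothing\<close>

text \<open>\<open>N s\<close> stands for the norm of \<open>A S(s) f\<close>. The supremum
  \<open>M\<close> of \<open>s ^ 3 * N s\<close> over \<open>(0, 1]\<close> is finite by the crude
  bound \<open>b\<close>, and the step inequality bounds \<open>M ^ 3\<close> by a multiple of
  \<open>F * M\<^sup>2\<close>, or \<open>M\<^sup>2\<close> by a multiple of \<open>F * M\<close>;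
  the resulting bound for \<open>M\<close> is free of \<open>b\<close>. The exponent 3 is the one
  for which both sides of the cubic alternative scale alike in \<open>s\<close>.\<close>

lemma self_improving_bound:
  fixes N :: "real \<Rightarrow> real"
  assumes nn: "\<And>s. 0 < s \<Longrightarrow> 0 \<le> N s" and b: "\<And>s. 0 < s \<Longrightarrow> N s \<le> b" and anti: "\<And>s. 0 < s \<Longrightarrow> N s \<le> N (s / 2)"
    and PQ: "0 \<le> P" "0 \<le> Q" "0 < F"
    and step: "\<And>s. 0 < s \<Longrightarrow> s \<le> 1 \<Longrightarrow> 0 < N (s / 2) \<Longrightarrow> (s * N s) ^ 3 \<le> P * F * (N (s / 2))\<^sup>2 \<or> (s * N s)\<^sup>2 \<le> Q * F * N (s / 2)"
    and s: "0 < s" "s \<le> 1"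
  shows "s ^ 3 * N s \<le> (512 * P + 32 * Q) * F"
proof -
  define y where "y s = s ^ 3 * N s" for s
  define M where "M = (SUP s\<in>{0<..1}. y s)"
  have "y s \<le> b" if "0 < s" "s \<le> 1" for s
  proof -
    have "s ^ 3 * N s \<le> 1 * b" using that nn b by (intro mult_mono power_le_one) auto
    then show ?thesis by (simp add: y_def)
  qed
  then have bdd: "bdd_above (y ` {0<..1})" by (auto intro!: bdd_aboveI[of _ b])
  have le: "y s \<le> M" if "0 < s" "s \<le> 1" for s
    unfolding M_def using that by (intro cSUP_upper bdd) auto
  have CF: "0 \<le> (512 * P + 32 * Q) * F" using PQ by simp
  have "M \<le> (512 * P + 32 * Q) * F"
  proof (cases "0 < M")
    case True
    then have "M / 2 < M" by simp
    then obtain s where s: "0 < s" "s \<le> 1" "M / 2 < y s"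
      unfolding M_def using less_cSUP_iff[OF _ bdd, of "M / 2"] by (auto simp: M_def)
    define G where "G = N (s / 2)"
    \<comment> \<open>Halving the time costs \<open>2 ^ 3 = 8\<close>. Together with the factor 2 in
      \<open>M / 2 < y s\<close> this gives \<open>512 = 2 ^ 3 * 8\<^sup>2\<close> and
      \<open>32 = 2\<^sup>2 * 8\<close>.\<close>
    have G: "s ^ 3 * G \<le> 8 * M"
      using le[of "s / 2"] s by (simp add: y_def G_def power_divide)
    have "0 < s ^ 3 * N s" using s(3) True by (simp add: y_def)
    then have "0 < N s" by (rule zero_less_mult_pos) (use s(1) in simp)
    then have "0 < G" using anti[OF s(1)] by (simp add: G_def)
    from step[OF s(1,2) this[unfolded G_def]] show ?thesis
    proof
      assume *: "(s * N s) ^ 3 \<le> P * F * (N (s / 2))\<^sup>2"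
      have "(M / 2) ^ 3 \<le> (y s) ^ 3" using s True by (intro power_mono) auto
      also have "\<dots> = s ^ 6 * (s * N s) ^ 3" by (simp add: y_def power_mult_distrib flip: power_add power_mult)
      also have "\<dots> \<le> s ^ 6 * (P * F * G\<^sup>2)" using * s by (intro mult_left_mono) (auto simp: G_def)
      also have "\<dots> = P * F * (s ^ 3 * G)\<^sup>2" by (simp add: power_mult_distrib flip: power_mult)
      also have "\<dots> \<le> P * F * (8 * M)\<^sup>2" using G s \<open>0 < G\<close> PQ by (intro mult_left_mono power_mono) auto
      finally have "M\<^sup>2 * M \<le> M\<^sup>2 * (512 * P * F)" by (simp add: power2_eq_square power3_eq_cube mult_ac)
      then have "M \<le> 512 * P * F" using True by simp
      moreover have "0 \<le> 32 * Q * F" using PQ by simp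
      ultimately show ?thesis unfolding distrib_right by linarith
    next
      assume *: "(s * N s)\<^sup>2 \<le> Q * F * N (s / 2)"
      have "(M / 2)\<^sup>2 \<le> (y s)\<^sup>2" using s True by (intro power_mono) auto
      also have "\<dots> = s ^ 4 * (s * N s)\<^sup>2" by (simp add: y_def power_mult_distrib flip: power_add power_mult)
      also have "\<dots> \<le> s ^ 4 * (Q * F * G)" using * s by (intro mult_left_mono) (auto simp: G_def)
      \<comment> \<open>The quadratic alternative leaves a spare factor \<open>s\<close>, which
        \<open>s \<le> 1\<close> removes.\<close>
      also have "\<dots> = (Q * F * (s ^ 3 * G)) * s" by (simp add: power_numeral_reduce)
      also have "\<dots> \<le> (Q * F * (s ^ 3 * G)) * 1" using s \<open>0 < G\<close> PQ by (intro mult_left_mono) auto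
      also have "\<dots> \<le> Q * F * (8 * M)" using G PQ by (simp add: mult_left_mono)
      finally have "M * M \<le> M * (32 * Q * F)" by (simp add: power2_eq_square mult_ac)
      then have "M \<le> 32 * Q * F" using True by simp
      moreover have "0 \<le> 512 * P * F" using PQ by simp
      ultimately show ?thesis unfolding distrib_right by linarith
    qed
  next
    case False with CF show ?thesis by linarith
  qed
  then show ?thesis using le[OF s] by (simp add: y_def)
qed

context kdv_semigroup begin

text \<open>\<open>g = A f\<close> and \<open>k = A g\<close>. The mean value theorem for the sum of the energies of \<open>S(t)f\<close> and
  \<open>S(t)g\<close>, weighted so that both are of the same size at \<open>s/2\<close>, gives one time \<open>t \<in> (s/2, s)\<close> at
  which the first derivatives of both are controlled; \<open>S(t)g\<close> is then interpolated between them.\<close>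

lemma smoothing_step:
  "\<exists>P Q. 0 \<le> P \<and> 0 \<le> Q \<and> (\<forall>f g k s F. generates f g \<longrightarrow> generates g k \<longrightarrow> 0 < s \<longrightarrow> s \<le> 1 \<longrightarrow> 0 < F \<longrightarrow> L2_norm L f \<le> F \<longrightarrow>
      0 < L2_norm L (S (s / 2) g) \<longrightarrow> (s * L2_norm L (S s g)) ^ 3 \<le> P * F * (L2_norm L (S (s / 2) g))\<^sup>2 \<or>
      (s * L2_norm L (S s g))\<^sup>2 \<le> Q * F * L2_norm L (S (s / 2) g))"
proof -
  define \<kappa> where "\<kappa> = \<bar>\<alpha>\<bar> + 2 * L * \<delta>"
  define m where "m = \<beta> + 2 * L * \<kappa>"
  \<comment> \<open>Collects the initial energy, at most
    \<open>2 (1 + L) F\<^sup>2 G\<^sup>2\<close>, and the growth over the interval, at most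
    \<open>2 K F\<^sup>2 G\<^sup>2\<close>.\<close>
  define c where "c = 2 * (1 + L + K) / \<beta>"
  have nn: "0 \<le> \<kappa>" "0 \<le> m" "0 \<le> c" using L \<delta> \<beta> K_nonneg by (auto simp: \<kappa>_def m_def c_def)
  have main: "(s * L2_norm L (S s g)) ^ 3 \<le> (12 / \<beta> * m\<^sup>2 * (1 + c) ^ 3) * F * (L2_norm L (S (s / 2) g))\<^sup>2 \<or> 
      (s * L2_norm L (S s g))\<^sup>2 \<le> (12 / \<beta> * \<kappa> * m * (1 + c)\<^sup>2) * F * L2_norm L (S (s / 2) g)"
    if fg: "generates f g" and gk: "generates g k" and s: "0 < s" "s \<le> 1" and F: "0 < F" "L2_norm L f \<le> F" and G: "0 < L2_norm L (S (s / 2) g)"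
    for f g k s F
  proof -
    define G where "G = L2_norm L (S (s / 2) g)"
    note lf = generates_L2[OF fg] and lk = generates_L2(2)[OF gk]
    have G0: "0 < G" using G by (simp add: G_def)
    interpret bform L B1 "1 + L" by (rule bform_B1)
    define E where "E t = G\<^sup>2 * B1 (S t f) (S t f) + F\<^sup>2 * B1 (S t g) (S t g)" for t
    have d: "(E has_real_derivative (G\<^sup>2 * (B1 (S t g) (S t f) + B1 (S t g) (S t f)) + F\<^sup>2 * (B1 (S t k) (S t g) + B1 (S t k) (S t g)))) (at t within {s / 2..s})"
      if t: "t \<in> {s / 2..s}" for t
    proof -
      have t': "t \<in> {0..s}" using t s by auto
      have "((\<lambda>t. B1 (S t f) (S t f)) has_real_derivative (B1 (S t g) (S t f) + B1 (S t g) (S t f))) (at t within {0..s})"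
        by (rule deriv[OF S_L2[OF _ lf(1)] t' S_L2[OF _ lf(2)] S_L2[OF _ lf(1)] S_L2[OF _ lf(2)] S_has_L2_deriv[OF fg t'] S_has_L2_deriv[OF fg t']])
          (use t' in auto)
      moreover have "((\<lambda>t. B1 (S t g) (S t g)) has_real_derivative (B1 (S t k) (S t g) + B1 (S t k) (S t g))) (at t within {0..s})"
        by (rule deriv[OF S_L2[OF _ lf(2)] t' S_L2[OF _ lk] S_L2[OF _ lf(2)] S_L2[OF _ lk] S_has_L2_deriv[OF gk t'] S_has_L2_deriv[OF gk t']])
          (use t' in auto)
      ultimately have "(E has_real_derivative (G\<^sup>2 * (B1 (S t g) (S t f) + B1 (S t g) (S t f)) + F\<^sup>2 * (B1 (S t k) (S t g) + B1 (S t k) (S t g)))) (at t within {0..s})"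
        unfolding E_def[abs_def] by (intro DERIV_add DERIV_cmult)
      then show ?thesis by (rule DERIV_subset) (use s in auto)
    qed
    have "s / 2 < s" using s by simp
    then obtain t where t: "s / 2 < t" "t < s" 
      and E: "E s - E (s / 2) = (s - s / 2) * (G\<^sup>2 * (B1 (S t g) (S t f) + B1 (S t g) (S t f)) + F\<^sup>2 * (B1 (S t k) (S t g) + B1 (S t k) (S t g)))"
      by (rule DERIV_le_imp[OF _ d])
    have t0: "0 \<le> t" using t s by simp
    obtain p0 p1 p2 p3 where p: "dom_rep p0 p1 p2 p3" "AE x in leb L. S t g x = Ap p1 p2 p3 x"
      "B1 (S t g) (S t f) \<le> - \<beta> / 2 * (cmod (p1 0))\<^sup>2 - \<beta> * (L2_norm L p1)\<^sup>2 + K * (L2_norm L (S t f))\<^sup>2"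
      by (rule generates_inner[OF generates_S[OF fg t0]], rule that, assumption+)
    obtain z0 z1 z2 z3 where z: "dom_rep z0 z1 z2 z3" "AE x in leb L. S t g x = z0 x"
      "B1 (S t k) (S t g) \<le> - \<beta> / 2 * (cmod (z1 0))\<^sup>2 - \<beta> * (L2_norm L z1)\<^sup>2 + K * (L2_norm L (S t g))\<^sup>2"
      by (rule generates_inner[OF generates_S[OF gk t0]], rule that, assumption+)
    define a where "a = L2_norm L p1" 
    define e where "e = L2_norm L z1"
    define n where "n = L2_norm L z0"
    have ae: "0 \<le> a" "0 \<le> e" "0 \<le> n" by (auto simp: a_def e_def n_def)
    have Az: "AE x in leb L. Ap p1 p2 p3 x = z0 x" using p(2) z(2) by eventually_elim simp
    have n: "n = L2_norm L (S t g)"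
      unfolding n_def by (rule L2_norm_cong_AE[OF L2_measurable L2_measurable, OF dom_rep_L2(1)[OF z(1)] S_L2[OF t0 lf(2)]]) (use z(2) in auto)
    have nG: "L2_norm L (S t g) \<le> G" unfolding G_def using t s by (intro S_norm_antimono lf) auto
    have Nn: "L2_norm L (S s g) \<le> n" unfolding n using t t0 by (intro S_norm_antimono lf) auto
    have fF: "L2_norm L (S t f) \<le> F" using S_contraction[OF t0 lf(1)] F(2) by simp
    have b1: "B1 (S t g) (S t f) \<le> - \<beta> * a\<^sup>2 + K * F\<^sup>2"
    proof -
      have "K * (L2_norm L (S t f))\<^sup>2 \<le> K * F\<^sup>2" using fF K_nonneg by (intro mult_left_mono power_mono) auto
      moreover have "0 \<le> \<beta> / 2 * (cmod (p1 0))\<^sup>2" using \<beta> by simp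
      ultimately show ?thesis using p(3) by (simp add: a_def)
    qed
    have b2: "B1 (S t k) (S t g) \<le> - \<beta> * e\<^sup>2 + K * G\<^sup>2"
    proof -
      have "K * (L2_norm L (S t g))\<^sup>2 \<le> K * G\<^sup>2" using nG K_nonneg by (intro mult_left_mono power_mono) auto
      moreover have "0 \<le> \<beta> / 2 * (cmod (z1 0))\<^sup>2" using \<beta> by simp
      ultimately show ?thesis using z(3) by (simp add: e_def)
    qed
    have E0: "0 \<le> E s" unfolding E_def by (intro add_nonneg_nonneg mult_nonneg_nonneg B1_nonneg) auto
    have E1: "E (s / 2) \<le> 2 * (1 + L) * (F\<^sup>2 * G\<^sup>2)"
    proof -
      have s2: "0 \<le> s / 2" using s by simp
      have "B1 (S (s/2) f) (S (s/2) f) \<le> (1 + L) * L2_norm L (S (s/2) f) * L2_norm L (S (s/2) f)"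
        using B_le[OF S_L2[OF s2 lf(1)] S_L2[OF s2 lf(1)]] by linarith
      also have "\<dots> \<le> (1 + L) * F * F"
        using S_contraction[OF s2 lf(1)] F L by (intro mult_mono) auto
      finally have 1: "B1 (S (s/2) f) (S (s/2) f) \<le> (1 + L) * F\<^sup>2" by (simp add: power2_eq_square)
      have 2: "B1 (S (s/2) g) (S (s/2) g) \<le> (1 + L) * G\<^sup>2"
        using B_le[OF S_L2[OF s2 lf(2)] S_L2[OF s2 lf(2)]] by (simp add: G_def power2_eq_square)
      have "E (s / 2) \<le> G\<^sup>2 * ((1 + L) * F\<^sup>2) + F\<^sup>2 * ((1 + L) * G\<^sup>2)"
        unfolding E_def by (intro add_mono mult_left_mono 1 2) auto
      then show ?thesis by (simp add: algebra_simps)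
    qed
    have "E s - E (s / 2) = s * (G\<^sup>2 * B1 (S t g) (S t f) + F\<^sup>2 * B1 (S t k) (S t g))"
      using E by (simp add: algebra_simps)
    also have "\<dots> \<le> s * (G\<^sup>2 * (- \<beta> * a\<^sup>2 + K * F\<^sup>2) + F\<^sup>2 * (- \<beta> * e\<^sup>2 + K * G\<^sup>2))"
      using s b1 b2 by (intro mult_left_mono add_mono) auto
    also have "\<dots> = 2 * s * (K * (F\<^sup>2 * G\<^sup>2)) - \<beta> * (s * (G\<^sup>2 * a\<^sup>2 + F\<^sup>2 * e\<^sup>2))"
      by (simp add: algebra_simps)
    also have "\<dots> \<le> 2 * (K * (F\<^sup>2 * G\<^sup>2)) - \<beta> * (s * (G\<^sup>2 * a\<^sup>2 + F\<^sup>2 * e\<^sup>2))"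
      using s K_nonneg mult_right_mono[of s 1 "K * (F\<^sup>2 * G\<^sup>2)"] by simp
    finally have "\<beta> * (s * (G\<^sup>2 * a\<^sup>2 + F\<^sup>2 * e\<^sup>2)) \<le> 2 * (1 + L) * (F\<^sup>2 * G\<^sup>2) + 2 * (K * (F\<^sup>2 * G\<^sup>2))"
      using E0 E1 by linarith
    also have "\<dots> = \<beta> * (c * (F\<^sup>2 * G\<^sup>2))" using \<beta> by (simp add: c_def field_simps)
    finally have "s * (G\<^sup>2 * a\<^sup>2 + F\<^sup>2 * e\<^sup>2) \<le> c * (F\<^sup>2 * G\<^sup>2)" by (rule mult_left_le_imp_le[OF _ \<beta>])
    then have sum: "s * (G\<^sup>2 * a\<^sup>2) + s * (F\<^sup>2 * e\<^sup>2) \<le> c * (F\<^sup>2 * G\<^sup>2)" by (simp only: distrib_left)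
    have c1: "c * X\<^sup>2 \<le> ((1 + c) * X)\<^sup>2" for X
    proof -
      have "c \<le> (1 + c)\<^sup>2" using nn(3) by (simp add: power2_sum) 
      then show ?thesis by (simp add: power_mult_distrib mult_right_mono)
    qed
    \<comment> \<open>Roots are avoided by using \<open>s\<close> and \<open>1 + c\<close> where the
      square roots of \<open>s\<close> and \<open>c\<close> would do. The weaker power of
      \<open>s\<close> is why the smoothing bound comes out with exponent 3 instead of 3/2.\<close>
    have sq: "s * X \<le> (1 + c) * Y" if "0 \<le> X" "0 \<le> Y" "s * X\<^sup>2 \<le> c * Y\<^sup>2" for X Y
    proof -
      have "(s * X)\<^sup>2 = s * (s * X\<^sup>2)" by (simp add: power2_eq_square)
      also have "\<dots> \<le> 1 * (s * X\<^sup>2)" using s by (intro mult_right_mono) auto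
      also have "\<dots> \<le> ((1 + c) * Y)\<^sup>2" using that(3) c1[of Y] by simp
      finally show ?thesis using that nn(3) by (intro power2_le_imp_le[of "s * X"]) auto
    qed
    have "G\<^sup>2 * (s * a\<^sup>2) \<le> G\<^sup>2 * (c * F\<^sup>2)"
    proof -
      have "0 \<le> s * (F\<^sup>2 * e\<^sup>2)" using s by simp
      then show ?thesis using sum by (simp add: mult_ac)
    qed
    then have sa: "s * a \<le> (1 + c) * F" using G0 F ae by (intro sq) auto
    have "F\<^sup>2 * (s * e\<^sup>2) \<le> F\<^sup>2 * (c * G\<^sup>2)"
    proof -
      have "0 \<le> s * (G\<^sup>2 * a\<^sup>2)" using s by simp
      then show ?thesis using sum by (simp add: mult_ac)
    qed
    then have se: "s * e \<le> (1 + c) * G" using G0 F ae by (intro sq) auto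
    have "n ^ 3 \<le> 12 / \<beta> * m\<^sup>2 * (e\<^sup>2 * a) \<or> n\<^sup>2 \<le> 12 / \<beta> * \<kappa> * m * (e * a)"
      using interpolation_real[OF \<beta> _ _ _ _ _ nn(1,2) 
        interpolation[OF p(1) z(1) Az, folded \<kappa>_def, folded m_def a_def e_def n_def]] ae by (simp add: a_def e_def n_def)
    then show ?thesis
    proof
      assume *: "n ^ 3 \<le> 12 / \<beta> * m\<^sup>2 * (e\<^sup>2 * a)"
      have "(s * L2_norm L (S s g)) ^ 3 \<le> (s * n) ^ 3" using Nn s by (intro power_mono mult_left_mono) auto
      also have "\<dots> = s ^ 3 * n ^ 3" by (rule power_mult_distrib)
      also have "\<dots> \<le> s ^ 3 * (12 / \<beta> * m\<^sup>2 * (e\<^sup>2 * a))" using * s by (intro mult_left_mono) auto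
      also have "\<dots> = 12 / \<beta> * m\<^sup>2 * ((s * e)\<^sup>2 * (s * a))" by (simp add: power2_eq_square power3_eq_cube)
      also have "\<dots> \<le> 12 / \<beta> * m\<^sup>2 * (((1 + c) * G)\<^sup>2 * ((1 + c) * F))"
        using mult_mono[OF power_mono[OF se, of 2] sa] s ae \<beta> nn F by (intro mult_left_mono) auto
      also have "\<dots> = (12 / \<beta> * m\<^sup>2 * (1 + c) ^ 3) * F * G\<^sup>2" by (simp add: power_mult_distrib power2_eq_square power3_eq_cube)
      finally show ?thesis by (simp add: G_def)
    next
      assume *: "n\<^sup>2 \<le> 12 / \<beta> * \<kappa> * m * (e * a)"
      have "(s * L2_norm L (S s g))\<^sup>2 \<le> (s * n)\<^sup>2" using Nn s by (intro power_mono mult_left_mono) auto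
      also have "\<dots> = s\<^sup>2 * n\<^sup>2" by (rule power_mult_distrib)
      also have "\<dots> \<le> s\<^sup>2 * (12 / \<beta> * \<kappa> * m * (e * a))" using * s by (intro mult_left_mono) auto
      also have "\<dots> = 12 / \<beta> * \<kappa> * m * ((s * e) * (s * a))" by (simp add: power2_eq_square)
      also have "\<dots> \<le> 12 / \<beta> * \<kappa> * m * (((1 + c) * G) * ((1 + c) * F))"
        using mult_mono[OF se sa] s ae \<beta> nn F G0 by (intro mult_left_mono) auto
      also have "\<dots> = (12 / \<beta> * \<kappa> * m * (1 + c)\<^sup>2) * F * G" by (simp add: power2_eq_square)
      finally show ?thesis by (simp add: G_def)
    qed
  qed
  have pos: "0 \<le> 12 / \<beta> * m\<^sup>2 * (1 + c) ^ 3" "0 \<le> 12 / \<beta> * \<kappa> * m * (1 + c)\<^sup>2" using nn \<beta> by auto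
  show ?thesis
    by (rule exI, rule exI, rule conjI[OF pos(1) conjI[OF pos(2)]], intro allI impI, rule main)
qed

text \<open>The right-hand side involves \<open>f\<close> alone, although \<open>f\<close> is taken
  from the domain of the square of \<open>A\<close>; this is what survives the passage from test
  functions to all of \<open>L2\<close>.\<close>

lemma smoothing:
  "\<exists>C\<ge>0. \<forall>f g k s. generates f g \<longrightarrow> generates g k \<longrightarrow> 0 < s \<longrightarrow> s \<le> 1 \<longrightarrow> s ^ 3 * L2_norm L (S s g) \<le> C * L2_norm L f"
proof -
  obtain P Q where PQ: "0 \<le> P" "0 \<le> Q"
    and st: "\<forall>f g k s F. generates f g \<longrightarrow> generates g k \<longrightarrow> 0 < s \<longrightarrow> s \<le> 1 \<longrightarrow> 0 < F \<longrightarrow> L2_norm L f \<le> F \<longrightarrow>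
      0 < L2_norm L (S (s / 2) g) \<longrightarrow> (s * L2_norm L (S s g)) ^ 3 \<le> P * F * (L2_norm L (S (s / 2) g))\<^sup>2 \<or>
      (s * L2_norm L (S s g))\<^sup>2 \<le> Q * F * L2_norm L (S (s / 2) g)"
    using smoothing_step by (elim exE conjE) (rule that)
  define C where "C = 512 * P + 32 * Q"
  have C: "0 \<le> C" using PQ by (simp add: C_def)
  have "s ^ 3 * L2_norm L (S s g) \<le> C * L2_norm L f" if fg: "generates f g" and gk: "generates g k" and s: "0 < s" "s \<le> 1" for f g k s
  proof (rule field_le_epsilon)
    fix e :: real assume e: "0 < e"
    \<comment> \<open>\<open>F\<close> has to be positive although \<open>f\<close> may vanish; the
      excess costs at most \<open>e\<close> after multiplication by \<open>C\<close>.\<close>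
    define F where "F = L2_norm L f + e / (C + 1)"
    have F: "0 < F" "L2_norm L f \<le> F" using e C by (auto simp: F_def intro: add_nonneg_pos)
    note l = generates_L2[OF fg]
    have "s ^ 3 * L2_norm L (S s g) \<le> (512 * P + 32 * Q) * F"
    proof (rule self_improving_bound[where b = "L2_norm L g", OF _ _ _ PQ F(1) _ s])
      show "L2_norm L (S s g) \<le> L2_norm L g" if "0 < s" for s using S_contraction[of s g] that l by simp
      show "L2_norm L (S s g) \<le> L2_norm L (S (s / 2) g)" if "0 < s" for s using S_norm_antimono[of "s / 2" s g] that l by simp
      show "(s * L2_norm L (S s g)) ^ 3 \<le> P * F * (L2_norm L (S (s / 2) g))\<^sup>2 \<or> (s * L2_norm L (S s g))\<^sup>2 \<le> Q * F * L2_norm L (S (s / 2) g)"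
        if "0 < s" "s \<le> 1" "0 < L2_norm L (S (s / 2) g)" for s
        by (rule st[rule_format, OF fg gk that(1,2) F that(3)])
    qed simp
    also have "\<dots> = C * L2_norm L f + C / (C + 1) * e" by (simp add: C_def F_def distrib_left)
    also have "\<dots> \<le> C * L2_norm L f + 1 * e" using e C by (intro add_left_mono mult_right_mono) auto
    finally show "s ^ 3 * L2_norm L (S s g) \<le> C * L2_norm L f + e" by simp
  qed
  then show ?thesis using C by (intro exI[of _ C] conjI allI impI)
qed


section \<open>Closedness of the generator and regularity at positive times\<close>

lemma generates_unique:
  assumes "generates f g" "generates f h" shows "AE x in leb L. g x = h x"
proof -
  note l = generates_L2[OF assms(1)] generates_L2[OF assms(2)]
  have "((\<lambda>h'. L2_norm L (\<lambda>x. quot h' f g x) + L2_norm L (\<lambda>x. quot h' f h x)) \<longlongrightarrow> 0 + 0) (at_right 0)"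
    using assms unfolding in_generator_def by (intro tendsto_add) auto
  moreover have "\<forall>\<^sub>F h' in at_right 0. L2_norm L (\<lambda>x. g x - h x) \<le> L2_norm L (\<lambda>x. quot h' f g x) + L2_norm L (\<lambda>x. quot h' f h x)"
  proof (rule eventually_at_right_less[THEN eventually_mono])
    fix h' :: real assume h': "0 < h'"
    have "(\<lambda>x. quot h' f h x - quot h' f g x) = (\<lambda>x. g x - h x)" by (simp add: fun_eq_iff)
    then have "L2_norm L (\<lambda>x. g x - h x) = L2_norm L (\<lambda>x. quot h' f h x - quot h' f g x)" by simp
    also have "\<dots> \<le> L2_norm L (\<lambda>x. quot h' f h x) + L2_norm L (\<lambda>x. quot h' f g x)"
      by (intro L2_norm_triangle_sub quot_L2 h' l)
    finally show "L2_norm L (\<lambda>x. g x - h x) \<le> L2_norm L (\<lambda>x. quot h' f g x) + L2_norm L (\<lambda>x. quot h' f h x)" by simp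
  qed
  ultimately have "L2_norm L (\<lambda>x. g x - h x) \<le> 0 + 0"
    by (intro tendsto_le[OF _ _ tendsto_const]) auto
  then have "L2_norm L (\<lambda>x. g x - h x) = 0" using L2_norm_nonneg[of L "\<lambda>x. g x - h x"] by linarith
  then have "AE x in leb L. g x - h x = 0" by (intro L2_norm_eq_0_AE L2_diff l)
  then show ?thesis by simp
qed

lemma generates_AE:
  assumes "generates f g" "f' \<in> L2 L" "AE x in leb L. f x = f' x" shows "generates f' g"
proof -
  note l = generates_L2[OF assms(1)]
  have "\<forall>\<^sub>F h in at_right 0. L2_norm L (\<lambda>x. quot h f g x) = L2_norm L (\<lambda>x. quot h f' g x)"
  proof (rule eventually_at_right_less[THEN eventually_mono])
    fix h :: real assume h: "0 < h"
    have "AE x in leb L. S h f x = S h f' x"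
      by (rule bounded_operator_AE[OF S_bounded_operator l(1) assms(2,3)]) (use h in simp)
    then have "AE x in leb L. quot h f g x = quot h f' g x" using assms(3) by eventually_elim simp
    then show "L2_norm L (\<lambda>x. quot h f g x) = L2_norm L (\<lambda>x. quot h f' g x)"
      by (intro L2_norm_cong_AE L2_measurable quot_L2 h l assms(2))
  qed
  moreover have "((\<lambda>h. L2_norm L (\<lambda>x. quot h f g x)) \<longlongrightarrow> 0) (at_right 0)" using assms(1) by (simp add: in_generator_def)
  ultimately have "((\<lambda>h. L2_norm L (\<lambda>x. quot h f' g x)) \<longlongrightarrow> 0) (at_right 0)"
    by (rule Lim_transform_eventually[rotated])
  then show ?thesis using assms(2) l by (simp add: in_generator_def)
qed

lemma quot_diff_norm:
  assumes "0 < h" "f \<in> L2 L" "g \<in> L2 L" "f' \<in> L2 L" "g' \<in> L2 L"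
  shows "L2_norm L (\<lambda>x. quot h (\<lambda>x. f x - f' x) (\<lambda>x. g x - g' x) x) = L2_norm L (\<lambda>x. quot h f g x - quot h f' g' x)"
proof (rule L2_norm_cong_AE)
  have "bounded_operator L (S h)" using assms(1) by (intro S_bounded_operator) simp
  from bounded_operator_diff[OF this assms(2,4)]
  show "AE x in leb L. quot h (\<lambda>x. f x - f' x) (\<lambda>x. g x - g' x) x = quot h f g x - quot h f' g' x"
    by eventually_elim (simp add: diff_divide_distrib)
qed (intro L2_measurable quot_L2 L2_diff assms)+

lemma generates_diff:
  assumes "generates f g" "generates f' g'" shows "generates (\<lambda>x. f x - f' x) (\<lambda>x. g x - g' x)"
proof -
  note l = generates_L2[OF assms(1)] generates_L2[OF assms(2)]
  have "((\<lambda>h. L2_norm L (\<lambda>x. quot h f g x) + L2_norm L (\<lambda>x. quot h f' g' x)) \<longlongrightarrow> 0 + 0) (at_right 0)"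
    using assms unfolding in_generator_def by (intro tendsto_add) auto
  then have "((\<lambda>h. L2_norm L (\<lambda>x. quot h f g x) + L2_norm L (\<lambda>x. quot h f' g' x)) \<longlongrightarrow> 0) (at_right 0)" by simp
  moreover have "\<forall>\<^sub>F h in at_right 0. norm (L2_norm L (\<lambda>x. quot h (\<lambda>x. f x - f' x) (\<lambda>x. g x - g' x) x)) \<le> L2_norm L (\<lambda>x. quot h f g x) + L2_norm L (\<lambda>x. quot h f' g' x)"
  proof (rule eventually_at_right_less[THEN eventually_mono])
    fix h :: real assume h: "0 < h"
    have "L2_norm L (\<lambda>x. quot h f g x - quot h f' g' x) \<le> L2_norm L (\<lambda>x. quot h f g x) + L2_norm L (\<lambda>x. quot h f' g' x)"
      by (intro L2_norm_triangle_sub quot_L2 h l)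
    then show "norm (L2_norm L (\<lambda>x. quot h (\<lambda>x. f x - f' x) (\<lambda>x. g x - g' x) x)) \<le> L2_norm L (\<lambda>x. quot h f g x) + L2_norm L (\<lambda>x. quot h f' g' x)"
      unfolding quot_diff_norm[OF h l] by simp
  qed
  ultimately have "((\<lambda>h. L2_norm L (\<lambda>x. quot h (\<lambda>x. f x - f' x) (\<lambda>x. g x - g' x) x)) \<longlongrightarrow> 0) (at_right 0)"
    by (rule Lim_null_comparison[rotated])
  then show ?thesis using L2_diff[OF l(1) l(3)] L2_diff[OF l(2) l(4)] by (simp add: in_generator_def)
qed

text \<open>A mean value inequality for \<open>S(s)f - sg\<close>, obtained by testing with its own increment \<open>\<eta>\<close>.\<close>

lemma quot_le:
  assumes fg: "generates f g" and h: "0 < h"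
  obtains s where "0 < s" "s < h" "L2_norm L (\<lambda>x. quot h f g x) \<le> L2_norm L (\<lambda>x. S s g x - g x)"
proof -
  note l = generates_L2[OF fg]
  let ?B = "\<lambda>f g. LINT x|leb L. f x \<bullet> g x"
  interpret bform L ?B 1 by (rule bform_plain)
  define \<eta> where "\<eta> x = (S h f x - S 0 f x) - of_real h * g x" for x
  have SL: "S h f \<in> L2 L" "S 0 f \<in> L2 L" using h l by (auto intro: S_L2)
  have hg: "(\<lambda>x. of_real h * g x) \<in> L2 L" by (intro L2_scale l)
  have \<eta>: "\<eta> \<in> L2 L" unfolding \<eta>_def[abs_def] by (intro L2_diff SL hg)
  have c: "has_L2_deriv L (\<lambda>s. \<eta>) (\<lambda>x. 0) s {0..h}" for s
    by (simp add: has_L2_deriv_def L2_norm_zero)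
  have z: "?B (\<lambda>x. 0) k = 0" for k by simp
  have d: "((\<lambda>s. ?B (S s f) \<eta> - s * ?B g \<eta>) has_real_derivative (?B (S s g) \<eta> - ?B g \<eta>)) (at s within {0..h})" if s: "s \<in> {0..h}" for s
  proof -
    have "((\<lambda>s. ?B (S s f) \<eta>) has_real_derivative (?B (S s g) \<eta> + ?B (\<lambda>x. 0) (S s f))) (at s within {0..h})"
      by (rule deriv[OF S_L2[OF _ l(1)] s S_L2[OF _ l(2)] \<eta> L2_const S_has_L2_deriv[OF fg s] c]) (use s in auto)
    moreover have "((\<lambda>s. s * ?B g \<eta>) has_real_derivative ?B g \<eta>) (at s within {0..h})"
      by (auto intro!: derivative_eq_intros)
    ultimately show ?thesis using DERIV_diff z by fastforce
  qed
  obtain s where s: "0 < s" "s < h" and e: "(?B (S h f) \<eta> - h * ?B g \<eta>) - (?B (S 0 f) \<eta> - 0 * ?B g \<eta>) = (h - 0) * (?B (S s g) \<eta> - ?B g \<eta>)"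
    by (rule DERIV_le_imp[OF h d])
  have Sg: "S s g \<in> L2 L" using s l by (intro S_L2) auto
  have "?B \<eta> \<eta> = ?B (\<lambda>x. (S h f x - S 0 f x) - of_real h * g x) \<eta>" by (simp only: \<eta>_def)
  also have "\<dots> = ?B (S h f) \<eta> - ?B (S 0 f) \<eta> - h * ?B g \<eta>"
    using B_diff[OF L2_diff[OF SL] hg \<eta>] B_diff[OF SL \<eta>] B_scale[of h g \<eta>] by simp
  also have "\<dots> = h * ?B (\<lambda>x. S s g x - g x) \<eta>"
    unfolding B_diff[OF Sg l(2) \<eta>] using e by (simp add: algebra_simps)
  also have "\<dots> \<le> h * (L2_norm L (\<lambda>x. S s g x - g x) * L2_norm L \<eta>)"
    using h LINT_inner_le[OF L2_diff[OF Sg l(2)] \<eta>] by (intro mult_left_mono) auto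
  finally have "L2_norm L \<eta> * L2_norm L \<eta> \<le> (h * L2_norm L (\<lambda>x. S s g x - g x)) * L2_norm L \<eta>"
    by (simp add: LINT_inner_self power2_eq_square mult_ac)
  then have n: "L2_norm L \<eta> \<le> h * L2_norm L (\<lambda>x. S s g x - g x)"
    using h L2_norm_nonneg[of L \<eta>] by (cases "L2_norm L \<eta> = 0") auto
  have "L2_norm L (\<lambda>x. quot h f g x) = L2_norm L (\<lambda>x. of_real (1 / h) * \<eta> x)"
  proof (rule L2_norm_cong_AE)
    show "AE x in leb L. quot h f g x = of_real (1 / h) * \<eta> x"
      using S_0[OF l(1)] by eventually_elim (use h in \<open>simp add: \<eta>_def field_simps\<close>)
  qed (intro L2_measurable quot_L2 h l L2_scale \<eta>)+
  also have "\<dots> = L2_norm L \<eta> / h" using h by (simp add: L2_norm_scale del: of_real_divide)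
  also have "\<dots> \<le> L2_norm L (\<lambda>x. S s g x - g x)" using n h by (simp add: field_simps)
  finally show thesis by (rule that[OF s])
qed

text \<open>By \<open>quot_le\<close> the error of the quotient of \<open>f n\<close> at step
  \<open>h\<close> is at most \<open>|S(s) (g n) - g n|\<close> for some \<open>s < h\<close>, which
  is small uniformly in \<open>n\<close> up to the distance of \<open>g n\<close> from
  \<open>G\<close>. Hence \<open>n\<close> may tend to infinity for fixed \<open>h\<close>, and
  \<open>h\<close> to 0 afterwards.\<close>

lemma generates_closed:
  assumes gen: "\<And>n::nat. generates (f n) (g n)" and F: "F \<in> L2 L" "G \<in> L2 L"
    and f: "(\<lambda>n. L2_norm L (\<lambda>x. f n x - F x)) \<longlonglongrightarrow> 0" and g: "(\<lambda>n. L2_norm L (\<lambda>x. g n x - G x)) \<longlonglongrightarrow> 0"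
  shows "generates F G"
proof -
  have l: "f n \<in> L2 L" "g n \<in> L2 L" for n using generates_L2[OF gen] by auto
  have le: "L2_norm L (\<lambda>x. quot h F G x) \<le> e" if b: "\<And>s. 0 < s \<Longrightarrow> s < b \<Longrightarrow> L2_norm L (\<lambda>x. S s G x - G x) \<le> e" and h: "0 < h" "h < b" for b e h
  proof -
    \<comment> \<open>Replacing \<open>g n\<close> by \<open>G\<close> costs two distances in
      \<open>S s (g n) - g n\<close> and one more in the quotient; replacing \<open>f n\<close> by
      \<open>F\<close> costs \<open>2 / h\<close> times their distance.\<close>
    let ?r = "\<lambda>n. e + 3 * L2_norm L (\<lambda>x. g n x - G x) + 2 / h * L2_norm L (\<lambda>x. f n x - F x)"
    have "L2_norm L (\<lambda>x. quot h F G x) \<le> ?r n" for n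
    proof -
      obtain s where s: "0 < s" "s < h" "L2_norm L (\<lambda>x. quot h (f n) (g n) x) \<le> L2_norm L (\<lambda>x. S s (g n) x - g n x)"
        using quot_le[OF gen h(1)] by blast
      have s0: "0 \<le> s" using s by simp
      have sL: "S s (g n) \<in> L2 L" "S s G \<in> L2 L" by (intro S_L2 s0 l F)+
      have 1: "L2_norm L (\<lambda>x. S s (g n) x - g n x) \<le> e + 2 * L2_norm L (\<lambda>x. g n x - G x)"
      proof -
        have "L2_norm L (\<lambda>x. S s (g n) x - S s G x) \<le> L2_norm L (\<lambda>x. g n x - G x)"
          unfolding bounded_operator_diff_norm[OF S_bounded_operator[OF s0] l(2) F(2)]
          by (intro S_contraction s0 L2_diff l F)
        moreover have "L2_norm L (\<lambda>x. S s G x - G x) \<le> e" using b s h by simp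
        ultimately show ?thesis
          using L2_norm_triangle_diff[OF sL l(2)[of n]] L2_norm_triangle_diff[OF sL(2) F(2) l(2)[of n]] L2_norm_minus_commute[of L G "g n"]
          by linarith
      qed
      have 2: "L2_norm L (\<lambda>x. quot h (\<lambda>x. f n x - F x) (\<lambda>x. g n x - G x) x) \<le> 2 / h * L2_norm L (\<lambda>x. f n x - F x) + L2_norm L (\<lambda>x. g n x - G x)"
      proof -
        let ?u = "\<lambda>x. f n x - F x" and ?v = "\<lambda>x. g n x - G x"
        have uv: "?u \<in> L2 L" "?v \<in> L2 L" by (intro L2_diff l F)+
        have Su: "S h ?u \<in> L2 L" using h uv by (intro S_L2) auto
        have "L2_norm L (\<lambda>x. quot h ?u ?v x) \<le> L2_norm L (\<lambda>x. (S h ?u x - ?u x) / of_real h) + L2_norm L ?v"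
          using L2_norm_triangle_sub[OF _ uv(2), of "\<lambda>x. (S h ?u x - ?u x) / of_real h"] L2_scale[OF L2_diff[OF Su uv(1)], of "1 / of_real h"] by simp
        also have "L2_norm L (\<lambda>x. (S h ?u x - ?u x) / of_real h) = L2_norm L (\<lambda>x. S h ?u x - ?u x) / h"
          using L2_norm_scale[of L "1 / of_real h" "\<lambda>x. S h ?u x - ?u x"] h by (simp add: norm_divide)
        also have "\<dots> \<le> (L2_norm L (S h ?u) + L2_norm L ?u) / h"
          using h by (intro divide_right_mono L2_norm_triangle_sub Su uv) auto
        also have "\<dots> \<le> (L2_norm L ?u + L2_norm L ?u) / h"
          using h by (intro divide_right_mono add_right_mono S_contraction uv) auto
        finally show ?thesis by simp
      qed
      have "L2_norm L (\<lambda>x. quot h F G x) \<le> L2_norm L (\<lambda>x. quot h (f n) (g n) x) + L2_norm L (\<lambda>x. quot h (f n) (g n) x - quot h F G x)"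
        using L2_norm_diff_ge[OF quot_L2[OF h(1) l(1,2)] quot_L2[OF h(1) F], of n n] by linarith
      then show ?thesis using 1 2 s(3) unfolding quot_diff_norm[OF h(1) l(1) l(2) F] by linarith
    qed
    moreover have "?r \<longlonglongrightarrow> e + 3 * 0 + 2 / h * 0" by (intro tendsto_intros f g)
    ultimately show ?thesis by (intro LIMSEQ_le_const[of ?r e]) auto
  qed
  have "((\<lambda>h. L2_norm L (\<lambda>x. quot h F G x)) \<longlongrightarrow> 0) (at_right 0)"
  proof (rule tendstoI)
    fix e :: real assume e: "0 < e"
    have "\<forall>\<^sub>F s in at_right 0. L2_norm L (\<lambda>x. S s G x - G x) < e / 2"
      using order_tendstoD(2)[OF S_right_continuous[OF F(2)], of "e / 2"] e by simp
    then obtain b where b: "0 < b" "\<And>s. 0 < s \<Longrightarrow> s < b \<Longrightarrow> L2_norm L (\<lambda>x. S s G x - G x) < e / 2"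
      unfolding eventually_at_right_field by blast
    have "L2_norm L (\<lambda>x. quot h F G x) < e" if "0 < h" "h < b" for h
      using le[of b "e / 2" h] b(2) that e by fastforce
    then show "\<forall>\<^sub>F h in at_right 0. dist (L2_norm L (\<lambda>x. quot h F G x)) 0 < e"
      unfolding eventually_at_right_field using b(1) by (auto intro!: exI[of _ b])
  qed
  then show ?thesis using F by (simp add: in_generator_def)
qed

text \<open>Test functions tend to \<open>f\<close> geometrically; the smoothing bound makes their
  images under \<open>A S(t1)\<close> a Cauchy sequence, and closedness identifies the limit. That
  bound is for times up to 1, whence \<open>t1 = min t 1\<close>; the remaining time preserves the
  domain.\<close>

theorem S_regularizes:
  assumes f: "f \<in> L2 L" and t: "0 < t" obtains g where "generates (S t f) g"
proof -
  obtain C where C: "0 \<le> C" and sm: "\<forall>f g k s. generates f g \<longrightarrow> generates g k \<longrightarrow> 0 < s \<longrightarrow> s \<le> 1 \<longrightarrow> s ^ 3 * L2_norm L (S s g) \<le> C * L2_norm L f"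
    using smoothing by (elim exE conjE) (rule that)
  define t1 where "t1 = min t 1"
  have t1: "0 < t1" "t1 \<le> 1" "t1 \<le> t" "0 \<le> t1" using t by (auto simp: t1_def)
  \<comment> \<open>Tuned so that \<open>C * (e (Suc n) + e n) / t1 ^ 3\<close> is at most
    \<open>(1/2) ^ n\<close>, the rate that \<open>L2_complete\<close> asks for.\<close>
  define e where "e n = t1 ^ 3 * (1/2) ^ n / (2 * (C + 1))" for n :: nat
  have e: "0 < e n" for n using t1 C by (simp add: e_def)
  obtain \<phi> where \<phi>: "\<And>n::nat. ctest L (\<phi> n)" "\<And>n. L2_norm L (\<lambda>x. \<phi> n x - f x) < e n"
    by (rule L2_seq[OF L f e], rule that, assumption+)
  have "\<exists>g. generates (\<phi> n) g \<and> ctest L g" for n using ctest_generates[OF \<phi>(1)[of n]] by metis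
  then obtain g where g: "\<And>n. generates (\<phi> n) (g n)" "\<And>n. ctest L (g n)" by metis
  have "\<exists>k. generates (g n) k" for n using ctest_generates[OF g(2)[of n]] by metis
  then obtain k where k: "\<And>n. generates (g n) (k n)" by metis
  have l: "\<phi> n \<in> L2 L" "g n \<in> L2 L" for n using \<phi>(1) g(2) by (auto intro: ctest_L2)
  note b = S_bounded_operator[OF t1(4)]
  have "L2_norm L (\<lambda>x. S t1 (g (Suc n)) x - S t1 (g n) x) \<le> (1/2) ^ n" for n
  proof -
    have "t1 ^ 3 * L2_norm L (S t1 (\<lambda>x. g (Suc n) x - g n x)) \<le> C * L2_norm L (\<lambda>x. \<phi> (Suc n) x - \<phi> n x)"
      by (rule sm[rule_format, OF generates_diff[OF g(1) g(1)] generates_diff[OF k k] t1(1,2)])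
    also have "\<dots> \<le> C * (e (Suc n) + e n)"
      using L2_norm_triangle_diff[OF l(1) f l(1), of "Suc n" n] \<phi>(2)[of n] \<phi>(2)[of "Suc n"] C L2_norm_minus_commute[of L "\<phi> n" f]
      by (intro mult_left_mono) auto
    also have "\<dots> \<le> (C + 1) * (2 * e n)"
    proof (rule mult_mono)
      have "e (Suc n) = e n / 2" by (simp add: e_def)
      then show "e (Suc n) + e n \<le> 2 * e n" using e[of n] by simp
    qed (use C e[of n] e[of "Suc n"] in auto)
    also have "\<dots> = t1 ^ 3 * (1/2) ^ n"
    proof -
      have "(C + 1) * (2 * (X / (2 * (C + 1)))) = X" for X using C by (simp add: field_simps)
      then show ?thesis unfolding e_def .
    qed
    finally have "L2_norm L (S t1 (\<lambda>x. g (Suc n) x - g n x)) \<le> (1/2) ^ n" using t1 by simp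
    then show ?thesis unfolding bounded_operator_diff_norm[OF b l(2) l(2)] .
  qed
  from L2_complete[of "\<lambda>n. S t1 (g n)", OF S_L2[OF t1(4) l(2)] this less_imp_le[OF L]]
  obtain y where y: "y \<in> L2 L" "\<And>n. L2_norm L (\<lambda>x. S t1 (g n) x - y x) \<le> 2 * (1/2) ^ n" by metis
  have "generates (S t1 f) y"
  proof (rule generates_closed[OF generates_S[OF g(1) t1(4)] S_L2[OF t1(4) f] y(1)])
    have lim: "(\<lambda>n. c * (1/2::real) ^ n) \<longlonglongrightarrow> 0" for c
      using tendsto_mult[OF tendsto_const LIMSEQ_realpow_zero[of "1/2::real"], of c] by simp
    show "(\<lambda>n. L2_norm L (\<lambda>x. S t1 (g n) x - y x)) \<longlonglongrightarrow> 0"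
      by (rule tendsto_zero_le[OF lim L2_norm_nonneg y(2)])
    have "L2_norm L (\<lambda>x. S t1 (\<phi> n) x - S t1 f x) \<le> t1 ^ 3 / (2 * (C + 1)) * (1/2) ^ n" for n
    proof -
      have "L2_norm L (\<lambda>x. S t1 (\<phi> n) x - S t1 f x) \<le> L2_norm L (\<lambda>x. \<phi> n x - f x)"
        unfolding bounded_operator_diff_norm[OF b l(1) f] by (intro S_contraction t1 L2_diff l f)
      also have "\<dots> \<le> e n" using \<phi>(2)[of n] by simp
      finally show ?thesis by (simp add: e_def)
    qed
    then show "(\<lambda>n. L2_norm L (\<lambda>x. S t1 (\<phi> n) x - S t1 f x)) \<longlonglongrightarrow> 0"
      by (rule tendsto_zero_le[OF lim L2_norm_nonneg])
  qed
  then have "generates (S (t - t1) (S t1 f)) (S (t - t1) y)" using t1 by (intro generates_S) auto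
  then have "generates (S t f) (S (t - t1) y)"
    by (rule generates_AE) (use S_add[of "t - t1" t1 f] t1 t f in \<open>auto intro: S_L2\<close>)
  then show thesis by (rule that)
qed

text \<open>With the later time written as the earlier one plus \<open>|s - t|\<close>,
  contractivity reduces continuity from either side to right continuity at 0 of the orbit of
  \<open>f\<close>.\<close>

lemma S_continuous:
  assumes f: "f \<in> L2 L" and t: "0 \<le> t"
  shows "((\<lambda>s. L2_norm L (\<lambda>x. S s f x - S t f x)) \<longlongrightarrow> 0) (at t within {0..})"
proof (rule Lim_null_comparison)
  let ?G = "\<lambda>h. L2_norm L (\<lambda>x. S h f x - f x)"
  have abs: "filterlim (\<lambda>s. \<bar>s - t\<bar>) (at_right 0) (at t within {0..})"
    unfolding filterlim_at
  proof
    have "((\<lambda>s. \<bar>s - t\<bar>) \<longlongrightarrow> \<bar>t - t\<bar>) (at t within {0..})" by (intro tendsto_intros)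
    then show "((\<lambda>s. \<bar>s - t\<bar>) \<longlongrightarrow> 0) (at t within {0..})" by simp
    show "\<forall>\<^sub>F s in at t within {0..}. \<bar>s - t\<bar> \<in> {0<..} \<and> \<bar>s - t\<bar> \<noteq> 0"
      by (auto simp: eventually_at_filter)
  qed
  show "((\<lambda>s. ?G \<bar>s - t\<bar>) \<longlongrightarrow> 0) (at t within {0..})"
    by (rule filterlim_compose[OF S_right_continuous[OF f] abs])
  have le: "L2_norm L (\<lambda>x. S (a + h) f x - S a f x) \<le> ?G h" if a: "0 \<le> a" "0 \<le> h" for a h
  proof -
    have "L2_norm L (\<lambda>x. S (a + h) f x - S a f x) = L2_norm L (\<lambda>x. S a (S h f) x - S a f x)"
    proof (rule L2_norm_cong_AE)
      show "AE x in leb L. S (a + h) f x - S a f x = S a (S h f) x - S a f x"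
        using S_add[OF a f] by eventually_elim simp
    qed (intro L2_measurable L2_diff S_L2[OF _ S_L2[OF a(2) f]] S_L2[OF _ f] add_nonneg_nonneg a)+
    also have "\<dots> = L2_norm L (S a (\<lambda>x. S h f x - f x))"
      by (rule bounded_operator_diff_norm[OF S_bounded_operator[OF a(1)] S_L2[OF a(2) f] f])
    also have "\<dots> \<le> ?G h" by (intro S_contraction a L2_diff S_L2 f)
    finally show ?thesis .
  qed
  show "\<forall>\<^sub>F s in at t within {0..}. norm (L2_norm L (\<lambda>x. S s f x - S t f x)) \<le> ?G \<bar>s - t\<bar>"
  proof (rule eventually_at_filter[THEN iffD2], rule always_eventually, intro allI impI)
    fix s assume s: "s \<noteq> t" "s \<in> {0..}"
    show "norm (L2_norm L (\<lambda>x. S s f x - S t f x)) \<le> ?G \<bar>s - t\<bar>"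
    proof (cases "t \<le> s")
      case True
      then show ?thesis using le[of t "s - t"] t by simp
    next
      case False
      then show ?thesis using le[of s "t - s"] s L2_norm_minus_commute[of L "S t f" "S s f"] by simp
    qed
  qed
qed

end

subsection \<open>Volterra operators\<close>

lemma LINT_cut_right:
  fixes h :: "real \<Rightarrow> 'b::euclidean_space"
  assumes "x \<in> {0..L}"
  shows "(LINT y|leb L. (if x < y then h y else 0)) = (LINT y|lebesgue_on {x<..<L}. h y)"
proof -
  have "(LINT y|leb L. (if x < y then h y else 0)) = (LINT y|lebesgue. (if y \<in> {0<..<L} then (if x < y then h y else 0) else 0))"
    by (rule Lebesgue_Measure.integral_restrict_UNIV[symmetric]) simp
  also have "\<dots> = (LINT y|lebesgue. (if y \<in> {x<..<L} then h y else 0))"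
    by (rule Bochner_Integration.integral_cong) (use assms in auto)
  also have "\<dots> = (LINT y|lebesgue_on {x<..<L}. h y)"
    by (rule Lebesgue_Measure.integral_restrict_UNIV) simp
  finally show ?thesis .
qed

lemma cut_right_integrable:
  fixes h :: "real \<Rightarrow> real"
  assumes "integrable (leb L) h" "x \<in> {0..L}"
  shows "integrable (leb L) (\<lambda>y. if x < y then h y else 0)"
proof -
  have "{x<..<L} = {x<..<L} \<inter> {0<..<L}" using assms(2) by auto
  then have "{x<..<L} \<in> sets (leb L)" by (subst sets_restrict_space_iff) (use assms(2) in auto)
  from integrable_mult_indicator[OF this assms(1)] show ?thesis
    by (rule Bochner_Integration.integrable_cong[THEN iffD1, rotated 2]) (auto simp: indicator_def)
qed

section \<open>The triangle carrying the kernel\<close>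

abbreviation closed_Delta :: "real \<Rightarrow> (real \<times> real) set" where
  "closed_Delta L \<equiv> {(x, y). 0 \<le> x \<and> x \<le> y \<and> y \<le> L}"

lemma closure_Delta_xy:
  assumes L: "0 < L" shows "closure (Delta_xy L) = closed_Delta L"
proof
  have "closed_Delta L = {p. 0 \<le> fst p} \<inter> {p. fst p \<le> snd p} \<inter> {p. snd p \<le> L}" by auto
  moreover have "closed ({p::real \<times> real. 0 \<le> fst p} \<inter> {p. fst p \<le> snd p} \<inter> {p. snd p \<le> L})"
    by (intro closed_Int closed_Collect_le continuous_intros)
  ultimately have "closed (closed_Delta L)" by (simp only:)
  moreover have "Delta_xy L \<subseteq> closed_Delta L" unfolding Delta_xy_def by auto
  ultimately show "closure (Delta_xy L) \<subseteq> closed_Delta L" by (intro closure_minimal)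
  show "closed_Delta L \<subseteq> closure (Delta_xy L)"
  proof clarify
    fix x y assume xy: "0 \<le> x" "x \<le> y" "y \<le> L"
    define e where "e n = inverse (real (Suc n))" for n
    have e: "0 < e n" "e n \<le> 1" for n by (auto simp: e_def inverse_le_1_iff)
    have lim: "e \<longlonglongrightarrow> 0" unfolding e_def[abs_def] by (rule LIMSEQ_inverse_real_of_nat)
    \<comment> \<open>Moves the given point slightly towards the interior point
      \<open>(L/3, 2L/3)\<close>.\<close>
    let ?p = "\<lambda>n. ((1 - e n) * x + e n * (L / 3), (1 - e n) * y + e n * (2 * L / 3))"
    have "?p n \<in> Delta_xy L" for n
    proof -
      have 1: "0 \<le> (1 - e n) * x" "(1 - e n) * x \<le> (1 - e n) * y" "(1 - e n) * y \<le> (1 - e n) * L"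
        using e[of n] xy by (simp_all add: mult_left_mono)
      have 2: "0 < e n * (L / 3)" "e n * (L / 3) < e n * (2 * L / 3)" "e n * (2 * L / 3) < e n * L"
        using e[of n] L by simp_all
      have 3: "(1 - e n) * L + e n * L = L" by (simp add: algebra_simps)
      have "0 < (1 - e n) * x + e n * (L / 3)" "(1 - e n) * x + e n * (L / 3) < (1 - e n) * y + e n * (2 * L / 3)"
        "(1 - e n) * y + e n * (2 * L / 3) < L" "(1 - e n) * x + e n * (L / 3) < L"
        using 1 2 3 by linarith+
      then show ?thesis unfolding Delta_xy_def by (simp only: mem_Collect_eq prod.case simp_thms)
    qed
    moreover have "?p \<longlonglongrightarrow> ((1 - 0) * x + 0 * (L / 3), (1 - 0) * y + 0 * (2 * L / 3))"
      by (intro tendsto_Pair tendsto_add tendsto_mult tendsto_diff tendsto_const lim)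
    moreover have "((1 - 0) * x + 0 * (L / 3), (1 - 0) * y + 0 * (2 * L / 3)) = (x, y)" by simp
    ultimately show "(x, y) \<in> closure (Delta_xy L)"
      unfolding closure_sequential by (intro exI[of _ ?p] conjI allI) (simp_all only:)
  qed
qed

lemma open_Delta_xy: "open (Delta_xy L)"
proof -
  have "Delta_xy L = {p. 0 < fst p} \<inter> {p. fst p < L} \<inter> {p. fst p < snd p} \<inter> {p. snd p < L}"
    by (auto simp: Delta_xy_def)
  moreover have "open \<dots>" by (intro open_Int open_Collect_less continuous_intros)
  ultimately show ?thesis by simp
qed

lemma continuous_triangle_section:
  assumes "continuous_on (closed_Delta L) (\<lambda>p. q (fst p) (snd p))"
  shows "0 \<le> x \<Longrightarrow> continuous_on {x..L} (q x)" "y \<le> L \<Longrightarrow> continuous_on {0..y} (\<lambda>x. q x y)"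
proof -
  assume "0 \<le> x"
  then show "continuous_on {x..L} (q x)"
    using continuous_on_compose[of "{x..L}" "Pair x", OF _ continuous_on_subset[OF assms]]
    by (simp add: comp_def continuous_on_Pair image_subset_iff)
next
  assume "y \<le> L"
  then show "continuous_on {0..y} (\<lambda>x. q x y)"
    using continuous_on_compose[of "{0..y}" "\<lambda>x. (x, y)", OF _ continuous_on_subset[OF assms]]
    by (simp add: comp_def continuous_on_Pair image_subset_iff)
qed

text \<open>One constant \<open>M\<close> will serve for the kernel and for its derivative in
  \<open>x\<close>; \<open>M \<ge> 1\<close> permits division by the rate \<open>2 * M\<close> of
  the exponential weight.\<close>

locale volterra =
  fixes L M :: real and q :: "real \<Rightarrow> real \<Rightarrow> complex"
  assumes L: "0 < L" and M: "1 \<le> M"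
    and cont: "continuous_on (closed_Delta L) (\<lambda>p. q (fst p) (snd p))"
    and bound: "\<And>x y. 0 \<le> x \<Longrightarrow> x \<le> y \<Longrightarrow> y \<le> L \<Longrightarrow> cmod (q x y) \<le> M"
begin

definition cut :: "real \<Rightarrow> real \<Rightarrow> complex" where
  "cut x y = (if x < y then q x y else 0)"

definition Vol :: "(real \<Rightarrow> complex) \<Rightarrow> real \<Rightarrow> complex" where
  "Vol \<phi> x = (LINT y|leb L. cut x y * \<phi> y)"

lemma cut_measurable: assumes x: "x \<in> {0..L}" shows "cut x \<in> borel_measurable (leb L)"
proof -
  have "q x \<in> borel_measurable (lebesgue_on {x<..<L})"
    by (rule continuous_imp_measurable_on_sets_lebesgue)
      (use x in \<open>auto intro: continuous_on_subset[OF continuous_triangle_section(1)[OF cont]]\<close>)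
  then have "(\<lambda>y. if y \<in> {x<..<L} then q x y else 0) \<in> borel_measurable lebesgue"
    by (rule borel_measurable_if_I) simp
  then have "(\<lambda>y. if y \<in> {x<..<L} then q x y else 0) \<in> borel_measurable (leb L)"
    by (rule measurable_restrict_space1)
  then show ?thesis by (rule measurable_cong[THEN iffD1, rotated]) (auto simp: cut_def)
qed

lemma cut_bound: "x \<in> {0..L} \<Longrightarrow> y \<in> {0<..<L} \<Longrightarrow> cmod (cut x y) \<le> M"
  using bound[of x y] M by (auto simp: cut_def)

lemma cut_mult_L2:
  assumes x: "x \<in> {0..L}" and \<phi>: "\<phi> \<in> L2 L" shows "(\<lambda>y. cut x y * \<phi> y) \<in> L2 L" "cut x \<in> L2 L"
proof -
  show "(\<lambda>y. cut x y * \<phi> y) \<in> L2 L"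
    using L2_mult_bounded(1)[OF \<phi> cut_measurable[OF x] cut_bound[OF x]] by (simp add: mult.commute)
  show "cut x \<in> L2 L" by (rule L2_bounded(1)[OF cut_measurable[OF x], of M]) (use L x in \<open>auto intro!: AE_I2 cut_bound\<close>)
qed

lemma Vol_integrable: "x \<in> {0..L} \<Longrightarrow> \<phi> \<in> L2 L \<Longrightarrow> integrable (leb L) (\<lambda>y. cut x y * \<phi> y)"
  by (intro L2_integrable cut_mult_L2)

lemma Vol_le: assumes x: "x \<in> {0..L}" and \<phi>: "\<phi> \<in> L2 L" shows "cmod (Vol \<phi> x) \<le> M * sqrt L * L2_norm L \<phi>"
proof -
  have "cmod (Vol \<phi> x) \<le> L2_norm L (cut x) * L2_norm L \<phi>"
    unfolding Vol_def by (rule L2_mult_le[OF cut_mult_L2(2)[OF x \<phi>] \<phi>])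
  also have "L2_norm L (cut x) \<le> M * sqrt L"
    by (rule L2_bounded(2)[OF cut_measurable[OF x]]) (use L M x in \<open>auto intro!: AE_I2 cut_bound\<close>)
  finally show ?thesis by (simp add: mult_right_mono)
qed

text \<open>Stated for arbitrary kernels \<open>c n\<close> bounded by \<open>M\<close>, because it
  is applied to \<open>cut\<close> at points converging to \<open>x\<close> and again to difference
  quotients of \<open>cut\<close>.\<close>

lemma Vol_dominated:
  assumes \<phi>: "\<phi> \<in> L2 L" and c: "\<And>n::nat. c n \<in> borel_measurable (leb L)" "d \<in> borel_measurable (leb L)"
    and b: "\<And>n y. y \<in> {0<..<L} \<Longrightarrow> cmod (c n y) \<le> M" and lim: "AE y in leb L. (\<lambda>n. c n y) \<longlonglongrightarrow> d y"
  shows "(\<lambda>n. LINT y|leb L. c n y * \<phi> y) \<longlonglongrightarrow> (LINT y|leb L. d y * \<phi> y)"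
proof (rule integral_dominated_convergence[where w = "\<lambda>y. M * cmod (\<phi> y)"])
  note [measurable] = L2_measurable[OF \<phi>] c
  show "(\<lambda>y. d y * \<phi> y) \<in> borel_measurable (leb L)" "(\<lambda>y. c n y * \<phi> y) \<in> borel_measurable (leb L)" for n by measurable
  show "integrable (leb L) (\<lambda>y. M * cmod (\<phi> y))" using L2_integrable[OF \<phi>] by simp
  show "AE y in leb L. (\<lambda>n. c n y * \<phi> y) \<longlonglongrightarrow> d y * \<phi> y"
    using lim by eventually_elim (rule tendsto_mult_right)
  show "AE y in leb L. norm (c n y * \<phi> y) \<le> M * cmod (\<phi> y)" for n
    using b by (intro AE_I2) (simp add: norm_mult mult_right_mono)
qed

text \<open>The truncation may jump across the diagonal, so the single point \<open>y = x\<close> is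
  left out; it is a null set for the integral.\<close>

lemma cut_tendsto:
  assumes s: "\<And>n::nat. s n \<in> {0..L}" "s \<longlonglongrightarrow> x" and x: "x \<in> {0..L}" and y: "y \<in> {0<..<L}" "y \<noteq> x"
  shows "(\<lambda>n. cut (s n) y) \<longlonglongrightarrow> cut x y"
proof (cases "x < y")
  case True
  have ev: "\<forall>\<^sub>F n in sequentially. s n < y" using order_tendstoD(2)[OF s(2) True] .
  have "continuous_on {0..y} (\<lambda>x. q x y)" using continuous_triangle_section(2)[OF cont] y by simp
  then have "(\<lambda>n. q (s n) y) \<longlonglongrightarrow> q x y"
    by (rule continuous_on_tendsto_compose[OF _ s(2)]) (use True x s(1) ev in \<open>auto elim!: eventually_mono\<close>)
  moreover have "\<forall>\<^sub>F n in sequentially. q (s n) y = cut (s n) y" using ev by eventually_elim (simp add: cut_def)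
  ultimately have "(\<lambda>n. cut (s n) y) \<longlonglongrightarrow> q x y" by (rule Lim_transform_eventually)
  then show ?thesis using True by (simp add: cut_def)
next
  case False
  then have "\<forall>\<^sub>F n in sequentially. y < s n" using order_tendstoD(1)[OF s(2), of y] y by simp
  then have "\<forall>\<^sub>F n in sequentially. cut (s n) y = 0" by eventually_elim (simp add: cut_def)
  then show ?thesis using False by (simp add: cut_def tendsto_eventually)
qed

lemma AE_neq: "AE y in leb L. y \<noteq> x"
proof -
  have "AE y in lebesgue. y \<notin> {x}" by (rule AE_not_in) (simp flip: negligible_iff_null_sets)
  then have "AE y in lebesgue. y \<in> {0<..<L} \<longrightarrow> y \<noteq> x" by eventually_elim simp
  then show ?thesis by (subst AE_restrict_space_iff) auto
qed

lemma Vol_continuous: assumes \<phi>: "\<phi> \<in> L2 L" shows "continuous_on {0..L} (Vol \<phi>)"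
  unfolding continuous_on_sequentially
proof (intro allI ballI impI)
  fix s x assume x: "x \<in> {0..L}" and s: "(\<forall>n. s n \<in> {0..L}) \<and> s \<longlonglongrightarrow> x"
  have s': "\<And>n. s n \<in> {0..L}" "s \<longlonglongrightarrow> x" using s by auto
  have "AE y in leb L. (\<lambda>n. cut (s n) y) \<longlonglongrightarrow> cut x y"
    using AE_neq[of x] AE_space by eventually_elim (rule cut_tendsto[OF s' x], auto)
  then show "(Vol \<phi> \<circ> s) \<longlonglongrightarrow> Vol \<phi> x"
    unfolding Vol_def comp_def by (intro Vol_dominated \<phi> cut_measurable s' x cut_bound) auto
qed

lemma Vol_L2: "\<phi> \<in> L2 L \<Longrightarrow> Vol \<phi> \<in> L2 L"
  by (rule continuous_L2[OF Vol_continuous])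

lemma Vol_norm_le: assumes \<phi>: "\<phi> \<in> L2 L" shows "L2_norm L (Vol \<phi>) \<le> M * L * L2_norm L \<phi>"
proof -
  have "L2_norm L (Vol \<phi>) \<le> M * sqrt L * L2_norm L \<phi> * sqrt L"
    by (rule L2_bounded(2)[OF L2_measurable[OF Vol_L2[OF \<phi>]]]) (use L M \<phi> in \<open>auto intro!: AE_I2 Vol_le\<close>)
  also have "\<dots> = M * (sqrt L * sqrt L) * L2_norm L \<phi>" by (simp only: mult_ac)
  finally show ?thesis using L by simp
qed

lemma Vol_diff:
  assumes "\<phi> \<in> L2 L" "\<psi> \<in> L2 L" "x \<in> {0..L}" shows "Vol (\<lambda>y. \<phi> y - \<psi> y) x = Vol \<phi> x - Vol \<psi> x"
  unfolding Vol_def right_diff_distrib by (intro Bochner_Integration.integral_diff Vol_integrable assms)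

lemma Vol_add:
  assumes "\<phi> \<in> L2 L" "\<psi> \<in> L2 L" "x \<in> {0..L}" shows "Vol (\<lambda>y. \<phi> y + \<psi> y) x = Vol \<phi> x + Vol \<psi> x"
  unfolding Vol_def distrib_left by (intro Bochner_Integration.integral_add Vol_integrable assms)

lemma Vol_scale: "Vol (\<lambda>y. c * \<phi> y) x = c * Vol \<phi> x"
proof -
  have "Vol (\<lambda>y. c * \<phi> y) x = (LINT y|leb L. c * (cut x y * \<phi> y))" unfolding Vol_def by (simp add: mult_ac)
  then show ?thesis by (simp add: Vol_def)
qed

lemma Vol_cong_AE:
  assumes "\<phi> \<in> L2 L" "\<psi> \<in> L2 L" "AE y in leb L. \<phi> y = \<psi> y" "x \<in> {0..L}" shows "Vol \<phi> x = Vol \<psi> x"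
  unfolding Vol_def
proof (rule integral_cong_AE)
  show "AE y in leb L. cut x y * \<phi> y = cut x y * \<psi> y" using assms(3) by eventually_elim simp
qed (intro borel_measurable_integrable Vol_integrable assms)+

lemma Upsilon_eq_Vol: assumes "x \<in> {0..L}" shows "Upsilon L q \<phi> x = Vol \<phi> x"
proof -
  have "Vol \<phi> x = (LINT y|leb L. (if x < y then q x y * \<phi> y else 0))"
    unfolding Vol_def cut_def by (rule Bochner_Integration.integral_cong) auto
  then show ?thesis unfolding Upsilon_def LINT_cut_right[OF assms] by simp
qed

text \<open>With the weight \<open>exp(-2Mx)\<close> the Volterra operator halves every bound.\<close>

lemma Vol_weighted:
  assumes \<phi>: "\<phi> \<in> L2 L" and x: "x \<in> {0..L}" and A: "0 \<le> A" "\<And>y. y \<in> {0<..<L} \<Longrightarrow> cmod (\<phi> y) \<le> A * exp (- (2 * M * y))"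
  shows "cmod (Vol \<phi> x) \<le> A / 2 * exp (- (2 * M * x))"
proof -
  let ?e = "\<lambda>y. exp (- (2 * M * y))"
  have "cmod (Vol \<phi> x) \<le> (LINT y|leb L. cmod (cut x y * \<phi> y))" unfolding Vol_def by (rule integral_norm_bound)
  also have "\<dots> \<le> (LINT y|leb L. (if x < y then M * A * ?e y else 0))"
  proof (rule integral_mono_AE)
    show "integrable (leb L) (\<lambda>y. cmod (cut x y * \<phi> y))" using Vol_integrable[OF x \<phi>] by simp
    have "(\<lambda>y. complex_of_real (M * A * ?e y)) \<in> L2 L" by (intro continuous_L2 continuous_intros)
    from integrable_Re[OF L2_integrable[OF this]] have "integrable (leb L) (\<lambda>y. M * A * ?e y)" by simp
    from cut_right_integrable[OF this x]
    show "integrable (leb L) (\<lambda>y. if x < y then M * A * ?e y else 0)" .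
    show "AE y in leb L. cmod (cut x y * \<phi> y) \<le> (if x < y then M * A * ?e y else 0)"
    proof (rule AE_I2)
      fix y assume y: "y \<in> space (leb L)"
      then show "cmod (cut x y * \<phi> y) \<le> (if x < y then M * A * ?e y else 0)"
        using mult_mono[OF cut_bound[OF x, of y] A(2)[of y]] M A(1) by (auto simp: norm_mult cut_def mult_ac)
    qed
  qed
  also have "\<dots> = (LINT y|lebesgue_on {x<..<L}. M * A * ?e y)" by (rule LINT_cut_right[OF x])
  also have "\<dots> = M * A * ((?e x - ?e L) / (2 * M))"
  proof -
    have "((\<lambda>y. ?e y) has_integral (- ?e L / (2 * M) - (- ?e x / (2 * M)))) {x..L}"
      by (rule fundamental_theorem_of_calculus)
        (use x M in \<open>auto intro!: derivative_eq_intros simp flip: has_real_derivative_iff_has_vector_derivative\<close>)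
    then have "((\<lambda>y. ?e y) has_integral ((?e x - ?e L) / (2 * M))) {x<..<L}"
      by (simp only: has_integral_Icc_iff_Ioo) (simp add: diff_divide_distrib)
    then have h: "((\<lambda>y. M * A * ?e y) has_integral (M * A * ((?e x - ?e L) / (2 * M)))) {x<..<L}" by (rule has_integral_mult_right)
    have i: "integrable (lebesgue_on {x<..<L}) (\<lambda>y. M * A * ?e y)"
    proof -
      have "(\<lambda>y. M * A * ?e y) absolutely_integrable_on {x..L}"
        by (intro absolutely_integrable_continuous_real continuous_intros)
      then have "(\<lambda>y. M * A * ?e y) absolutely_integrable_on {x<..<L}"
        by (rule set_integrable_subset) auto
      then show ?thesis by (rule absolutely_integrable_imp_integrable) simp
    qed
    have "(LINT y|lebesgue_on {x<..<L}. M * A * ?e y) = integral {x<..<L} (\<lambda>y. M * A * ?e y)"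
      by (rule lebesgue_integral_eq_integral[OF i]) simp
    then show ?thesis unfolding integral_unique[OF h] .
  qed
  also have "\<dots> \<le> A / 2 * ?e x" using M A(1) by (simp add: field_simps)
  finally show ?thesis .
qed


text \<open>A fixed point of \<open>Vol\<close> inherits the halved bound from itself over and over,
  so in the weighted norm it is at most \<open>c * (1/2) ^ n\<close> for every
  \<open>n\<close>.\<close>

lemma Vol_contract:
  assumes \<phi>: "\<phi> \<in> L2 L" and fix1: "\<And>x. x \<in> {0..L} \<Longrightarrow> Vol \<phi> x = \<phi> x" and x: "x \<in> {0..L}"
  shows "\<phi> x = 0"
proof -
  \<comment> \<open>The factor \<open>exp (2 * M * L)\<close> compensates the smallest value of the
    weight on \<open>[0, L]\<close>, so that \<open>Vol_le\<close> starts the induction.\<close>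
  define c where "c = M * sqrt L * L2_norm L \<phi> * exp (2 * M * L)"
  have c: "0 \<le> c" using M L by (simp add: c_def)
  have b: "cmod (\<phi> x) \<le> c * (1/2) ^ n * exp (- (2 * M * x))" if "x \<in> {0..L}" for n x
    using that
  proof (induction n arbitrary: x)
    case (0 x)
    have "cmod (\<phi> x) \<le> M * sqrt L * L2_norm L \<phi> * 1" using Vol_le[OF 0 \<phi>] fix1[OF 0] by simp
    also have "\<dots> \<le> M * sqrt L * L2_norm L \<phi> * exp (2 * M * (L - x))"
      using M L 0 by (intro mult_left_mono) auto
    also have "\<dots> = c * exp (- (2 * M * x))"
      by (simp add: c_def right_diff_distrib exp_diff exp_minus divide_inverse mult_ac)
    finally show ?case by simp
  next
    case (Suc n x)
    have "cmod (Vol \<phi> x) \<le> c * (1/2) ^ n / 2 * exp (- (2 * M * x))"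
      by (rule Vol_weighted[OF \<phi> Suc.prems]) (use c Suc.IH in auto)
    then show ?case using fix1[OF Suc.prems] by simp
  qed
  have "(\<lambda>n. c * (1/2::real) ^ n * exp (- (2 * M * x))) \<longlonglongrightarrow> c * 0 * exp (- (2 * M * x))"
    by (rule tendsto_mult_right[OF tendsto_mult_left[OF LIMSEQ_realpow_zero]]) auto
  then have "cmod (\<phi> x) \<le> c * 0 * exp (- (2 * M * x))"
    by (rule LIMSEQ_le_const) (use b[OF x] in auto)
  then show ?thesis by simp
qed

text \<open>\<phi> satisfies the fixed point equation only almost everywhere;
  \<open>Vol \<phi>\<close> satisfies it at every point of \<open>[0, L]\<close>, as
  \<open>Vol_contract\<close> demands.\<close>

lemma I_minus_Vol_inj:
  assumes \<phi>: "\<phi> \<in> L2 L" and ae: "AE x in leb L. \<phi> x - Vol \<phi> x = 0"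
  shows "AE x in leb L. \<phi> x = 0"
proof -
  have V: "Vol \<phi> \<in> L2 L" by (rule Vol_L2[OF \<phi>])
  have e: "AE x in leb L. \<phi> x = Vol \<phi> x" using ae by eventually_elim simp
  have "Vol (Vol \<phi>) x = Vol \<phi> x" if "x \<in> {0..L}" for x
    by (rule Vol_cong_AE[OF \<phi> V e that, symmetric])
  then have z: "Vol \<phi> x = 0" if "x \<in> {0..L}" for x using Vol_contract[OF V _ that] by blast
  show ?thesis using e AE_space by eventually_elim (simp add: z)
qed

text \<open>The Neumann series is summed from \<open>Vol f\<close> on, since \<open>f\<close> itself
  has no pointwise bound. From there it converges uniformly, and the solution is \<open>f\<close>
  plus the sum.\<close>

lemma I_minus_Vol_surj:
  assumes f: "f \<in> L2 L"
  obtains \<phi> where "\<phi> \<in> L2 L" "AE x in leb L. \<phi> x - Vol \<phi> x = f x"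
    "L2_norm L \<phi> \<le> (1 + 2 * M * L * exp (2 * M * L)) * L2_norm L f"
proof -
  define c where "c = M * sqrt L * L2_norm L f * exp (2 * M * L)"
  have c: "0 \<le> c" using M L by (simp add: c_def)
  define \<psi> where "\<psi> = rec_nat (Vol f) (\<lambda>n. Vol)"
  have \<psi>0: "\<psi> 0 = Vol f" and \<psi>S: "\<psi> (Suc n) = Vol (\<psi> n)" for n by (simp_all add: \<psi>_def)
  have l: "\<psi> n \<in> L2 L" for n by (induction n) (simp_all add: \<psi>0 \<psi>S Vol_L2 f)
  have b: "cmod (\<psi> n x) \<le> c * (1/2) ^ n * exp (- (2 * M * x))" if "x \<in> {0..L}" for n x
    using that
  proof (induction n arbitrary: x)
    case (0 x)
    have "cmod (Vol f x) \<le> M * sqrt L * L2_norm L f * 1" using Vol_le[OF 0 f] by simp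
    also have "\<dots> \<le> M * sqrt L * L2_norm L f * exp (2 * M * (L - x))"
      using M L 0 by (intro mult_left_mono) auto
    also have "\<dots> = c * exp (- (2 * M * x))"
      by (simp add: c_def right_diff_distrib exp_diff exp_minus divide_inverse mult_ac)
    finally show ?case by (simp add: \<psi>0)
  next
    case (Suc n x)
    have "cmod (Vol (\<psi> n) x) \<le> c * (1/2) ^ n / 2 * exp (- (2 * M * x))"
      by (rule Vol_weighted[OF l Suc.prems]) (use c Suc.IH in auto)
    then show ?case by (simp add: \<psi>S)
  qed
  have b': "cmod (\<psi> n x) \<le> c * (1/2) ^ n" if x: "x \<in> {0..L}" for n x
  proof -
    have "c * (1/2) ^ n * exp (- (2 * M * x)) \<le> c * (1/2) ^ n * 1"
      using c M x by (intro mult_left_mono) auto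
    then show ?thesis using b[OF x, of n] by simp
  qed
  have geo: "summable (\<lambda>n. c * (1/2::real) ^ n)" by (intro summable_mult summable_geometric) simp
  have sm: "summable (\<lambda>n. cmod (\<psi> n x))" if "x \<in> {0..L}" for x
    by (rule summable_comparison_test'[OF geo, of 0]) (use b'[OF that] in simp)
  define \<theta> where "\<theta> x = (\<Sum>n. \<psi> n x)" for x
  have \<theta>b: "cmod (\<theta> x) \<le> 2 * c" if x: "x \<in> {0..L}" for x
  proof -
    have "cmod (\<theta> x) \<le> (\<Sum>n. cmod (\<psi> n x))" unfolding \<theta>_def by (rule summable_norm[OF sm[OF x]])
    also have "\<dots> \<le> (\<Sum>n. c * (1/2) ^ n)" by (rule suminf_le[OF b'[OF x] sm[OF x] geo])
    also have "\<dots> = 2 * c" using suminf_mult[of "\<lambda>n. (1/2::real) ^ n" c] suminf_geometric[of "1/2::real"] by (simp add: summable_geometric)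
    finally show ?thesis .
  qed
  have \<theta>m: "\<theta> \<in> borel_measurable (leb L)"
    unfolding \<theta>_def[abs_def] by (intro borel_measurable_suminf L2_measurable l)
  have \<theta>: "\<theta> \<in> L2 L" "L2_norm L \<theta> \<le> 2 * c * sqrt L"
    using L2_bounded[OF \<theta>m, of "2 * c"] L c AE_I2[of "leb L" "\<lambda>x. cmod (\<theta> x) \<le> 2 * c"] \<theta>b by auto
  \<comment> \<open>The geometric bound allows \<open>Vol\<close> to be applied term by term, which
    shifts the series by one.\<close>
  have V\<theta>: "Vol \<theta> x = (\<Sum>n. \<psi> (Suc n) x)" if x: "x \<in> {0..L}" for x
  proof -
    have "(\<Sum>n. LINT y|leb L. cut x y * \<psi> n y) = (LINT y|leb L. (\<Sum>n. cut x y * \<psi> n y))"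
    proof (rule integral_suminf[symmetric])
      show "integrable (leb L) (\<lambda>y. cut x y * \<psi> n y)" for n by (rule Vol_integrable[OF x l])
      show "AE y in leb L. summable (\<lambda>n. norm (cut x y * \<psi> n y))"
        using sm by (intro AE_I2) (auto simp: norm_mult intro!: summable_mult)
      show "summable (\<lambda>n. LINT y|leb L. norm (cut x y * \<psi> n y))"
      proof (rule summable_comparison_test'[of "\<lambda>n. (M * L) * (c * (1/2) ^ n)" 0])
        show "summable (\<lambda>n. (M * L) * (c * (1/2::real) ^ n))" by (intro summable_mult geo)
        fix n
        interpret finite_measure "leb L" by (rule finite_measure_leb)
        have "(LINT y|leb L. norm (cut x y * \<psi> n y)) \<le> (LINT y|leb L. M * (c * (1/2) ^ n))"
        proof (rule integral_mono)
          show "norm (cut x y * \<psi> n y) \<le> M * (c * (1/2) ^ n)" if "y \<in> space (leb L)" for y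
            using mult_mono[OF cut_bound[OF x, of y] b'[of y n]] M that by (simp add: norm_mult)
        qed (use Vol_integrable[OF x l] in auto)
        also have "\<dots> = (M * L) * (c * (1/2) ^ n)" using L by (simp add: measure_restrict_space)
        finally show "norm (LINT y|leb L. norm (cut x y * \<psi> n y)) \<le> (M * L) * (c * (1/2) ^ n)" by simp
      qed
    qed
    also have "(\<Sum>n. LINT y|leb L. cut x y * \<psi> n y) = (\<Sum>n. \<psi> (Suc n) x)" by (simp only: \<psi>S Vol_def)
    also have "(LINT y|leb L. (\<Sum>n. cut x y * \<psi> n y)) = Vol \<theta> x"
      unfolding Vol_def \<theta>_def
      by (intro Bochner_Integration.integral_cong refl suminf_mult summable_norm_cancel[OF sm]) auto
    finally show ?thesis by simp
  qed
  have eq: "\<theta> x = Vol f x + Vol \<theta> x" if x: "x \<in> {0..L}" for x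
    using suminf_split_head[OF summable_norm_cancel[OF sm[OF x]]] V\<theta>[OF x] by (simp add: \<theta>_def \<psi>0)
  show thesis
  proof (rule that)
    show "(\<lambda>x. f x + \<theta> x) \<in> L2 L" by (intro L2_add f \<theta>)
    show "AE x in leb L. f x + \<theta> x - Vol (\<lambda>x. f x + \<theta> x) x = f x"
      using eq by (intro AE_I2) (simp add: Vol_add[OF f \<theta>(1)])
    have "L2_norm L (\<lambda>x. f x + \<theta> x) \<le> L2_norm L f + 2 * c * sqrt L"
      using L2_norm_triangle[OF f \<theta>(1)] \<theta>(2) by linarith
    also have "2 * c * sqrt L = 2 * M * (sqrt L * sqrt L) * exp (2 * M * L) * L2_norm L f" by (simp only: c_def mult_ac)
    also have "\<dots> = 2 * M * L * exp (2 * M * L) * L2_norm L f" using L by simp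
    finally show "L2_norm L (\<lambda>x. f x + \<theta> x) \<le> (1 + 2 * M * L * exp (2 * M * L)) * L2_norm L f" by (simp add: distrib_right)
  qed
qed

section \<open>The inverse of the transformation, its norm, and the Hilbert-Schmidt bound\<close>

lemma I_minus_Upsilon_AE: "(AE x in leb L. I_minus_Upsilon L q \<phi> x = f x) \<longleftrightarrow> (AE x in leb L. \<phi> x - Vol \<phi> x = f x)"
  by (rule AE_cong) (simp add: I_minus_Upsilon_def Upsilon_eq_Vol)

abbreviation inv_V :: "(real \<Rightarrow> complex) \<Rightarrow> real \<Rightarrow> complex" where
  "inv_V \<equiv> inv_I_minus_Upsilon L q"

lemma inv_V:
  assumes f: "f \<in> L2 L"
  shows "inv_V f \<in> L2 L" "AE x in leb L. inv_V f x - Vol (inv_V f) x = f x"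
proof -
  obtain \<phi> where "\<phi> \<in> L2 L" "AE x in leb L. \<phi> x - Vol \<phi> x = f x" by (rule I_minus_Vol_surj[OF f])
  then have "\<phi> \<in> L2 L \<and> (AE x in leb L. I_minus_Upsilon L q \<phi> x = f x)" by (simp add: I_minus_Upsilon_AE)
  from someI[of "\<lambda>\<phi>. \<phi> \<in> L2 L \<and> (AE x in leb L. I_minus_Upsilon L q \<phi> x = f x)", OF this, folded inv_I_minus_Upsilon_def]
  show "inv_V f \<in> L2 L" "AE x in leb L. inv_V f x - Vol (inv_V f) x = f x"
    using I_minus_Upsilon_AE[of "inv_V f" f] by auto
qed

lemma inv_V_unique:
  assumes "\<phi> \<in> L2 L" "\<psi> \<in> L2 L" "AE x in leb L. \<phi> x - Vol \<phi> x = f x" "AE x in leb L. \<psi> x - Vol \<psi> x = f x"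
  shows "AE x in leb L. \<phi> x = \<psi> x"
proof -
  have "AE x in leb L. (\<phi> x - \<psi> x) - Vol (\<lambda>x. \<phi> x - \<psi> x) x = 0"
    using assms(3,4) AE_space
    by eventually_elim (simp add: Vol_diff[OF assms(1,2)] algebra_simps)
  from I_minus_Vol_inj[OF L2_diff[OF assms(1,2)] this] show ?thesis by simp
qed

text \<open>The inverse is chosen separately for each argument, so it is linear only almost
  everywhere, as a consequence of uniqueness.\<close>

lemma inv_V_comb:
  assumes f: "f \<in> L2 L" "g \<in> L2 L"
  shows "AE x in leb L. inv_V (\<lambda>x. f x - c * g x) x = inv_V f x - c * inv_V g x"
proof (rule inv_V_unique)
  note i = inv_V[OF f(1)] inv_V[OF f(2)]
  show "inv_V (\<lambda>x. f x - c * g x) \<in> L2 L" "AE x in leb L. inv_V (\<lambda>x. f x - c * g x) x - Vol (inv_V (\<lambda>x. f x - c * g x)) x = f x - c * g x"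
    by (intro inv_V L2_diff L2_scale f)+
  show "(\<lambda>x. inv_V f x - c * inv_V g x) \<in> L2 L" by (intro L2_diff L2_scale i)
  show "AE x in leb L. inv_V f x - c * inv_V g x - Vol (\<lambda>x. inv_V f x - c * inv_V g x) x = f x - c * g x"
    using i(2,4) AE_space
    by eventually_elim (simp add: Vol_diff[OF i(1) L2_scale[OF i(3)]] Vol_scale algebra_simps)
qed

lemma inv_V_bounded: "\<exists>C\<ge>0. \<forall>f\<in>L2 L. L2_norm L (inv_V f) \<le> C * L2_norm L f"
proof (intro exI[of _ "1 + 2 * M * L * exp (2 * M * L)"] conjI ballI)
  show "0 \<le> 1 + 2 * M * L * exp (2 * M * L)" using M L by (intro add_nonneg_nonneg mult_nonneg_nonneg) auto
  fix f assume f: "f \<in> L2 L"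
  obtain \<phi> where \<phi>: "\<phi> \<in> L2 L" "AE x in leb L. \<phi> x - Vol \<phi> x = f x" "L2_norm L \<phi> \<le> (1 + 2 * M * L * exp (2 * M * L)) * L2_norm L f"
    by (rule I_minus_Vol_surj[OF f])
  note i = inv_V[OF f]
  have "L2_norm L (inv_V f) = L2_norm L \<phi>"
    by (rule L2_norm_cong_AE[OF L2_measurable[OF i(1)] L2_measurable[OF \<phi>(1)] inv_V_unique[OF i(1) \<phi>(1) i(2) \<phi>(2)]])
  then show "L2_norm L (inv_V f) \<le> (1 + 2 * M * L * exp (2 * M * L)) * L2_norm L f" using \<phi>(3) by simp
qed

text \<open>A supremum of reals says nothing before the set is known to be bounded, which the
  explicit constant of the Neumann series ensures. General \<open>f\<close> follows by
  normalisation, and norm 0 separately.\<close>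

lemma op_norm_inv_V:
  shows "0 \<le> op_norm L inv_V" "\<And>f. f \<in> L2 L \<Longrightarrow> L2_norm L (inv_V f) \<le> op_norm L inv_V * L2_norm L f"
proof -
  obtain C where C: "0 \<le> C" "\<And>f. f \<in> L2 L \<Longrightarrow> L2_norm L (inv_V f) \<le> C * L2_norm L f" using inv_V_bounded by metis
  let ?B = "{f \<in> L2 L. L2_norm L f \<le> 1}"
  have bdd: "bdd_above ((\<lambda>f. L2_norm L (inv_V f)) ` ?B)"
  proof (rule bdd_aboveI2)
    fix f assume f: "f \<in> ?B"
    then have "L2_norm L (inv_V f) \<le> C * L2_norm L f" using C by auto
    also have "\<dots> \<le> C * 1" using f C by (intro mult_left_mono) auto
    finally show "L2_norm L (inv_V f) \<le> C" by simp
  qed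
  have le: "L2_norm L (inv_V f) \<le> op_norm L inv_V" if "f \<in> L2 L" "L2_norm L f \<le> 1" for f
    unfolding op_norm_def using that by (intro cSUP_upper bdd) auto
  have "L2_norm L (inv_V (\<lambda>x. 0)) \<le> op_norm L inv_V" by (rule le) (auto simp: L2_norm_zero)
  then show "0 \<le> op_norm L inv_V" using L2_norm_nonneg order_trans by blast
  fix f assume f: "f \<in> L2 L"
  show "L2_norm L (inv_V f) \<le> op_norm L inv_V * L2_norm L f"
  proof (cases "L2_norm L f = 0")
    case True then show ?thesis using C(2)[OF f] by simp
  next
    case False
    then have pos: "0 < L2_norm L f" using L2_norm_nonneg[of L f] by linarith
    define c where "c = L2_norm L f"
    let ?g = "\<lambda>x. of_real (1 / c) * f x"
    have g: "?g \<in> L2 L" by (intro L2_scale f)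
    have gn: "L2_norm L ?g = 1" using pos by (simp add: L2_norm_scale c_def del: of_real_divide)
    have "AE x in leb L. inv_V f x = of_real c * inv_V ?g x"
    proof (rule inv_V_unique[OF inv_V(1)[OF f] L2_scale[OF inv_V(1)[OF g]] inv_V(2)[OF f]])
      show "AE x in leb L. of_real c * inv_V ?g x - Vol (\<lambda>x. of_real c * inv_V ?g x) x = f x"
        using inv_V(2)[OF g]
      proof eventually_elim
        case (elim x)
        have "of_real c * inv_V ?g x - Vol (\<lambda>x. of_real c * inv_V ?g x) x = of_real c * (inv_V ?g x - Vol (inv_V ?g) x)"
          by (simp only: Vol_scale right_diff_distrib)
        also have "\<dots> = f x" unfolding elim using pos by (simp add: c_def)
        finally show ?case .
      qed
    qed
    then have "L2_norm L (inv_V f) = L2_norm L (\<lambda>x. of_real c * inv_V ?g x)"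
      by (intro L2_norm_cong_AE L2_measurable inv_V f L2_scale g)
    also have "\<dots> = c * L2_norm L (inv_V ?g)" using pos by (simp add: L2_norm_scale c_def)
    also have "\<dots> \<le> c * op_norm L inv_V" using le[OF g] gn pos by (intro mult_left_mono) (auto simp: c_def)
    finally show ?thesis by (simp add: c_def mult.commute)
  qed
qed

text \<open>Cauchy-Schwarz in \<open>y\<close> for each \<open>x\<close>, then Fubini for the
  squared kernel. Fubini is applied to the Borel product measure while the norms refer to Lebesgue
  measure, so the Borel measurable kernel is moved from one to the other and back.\<close>

lemma Vol_Hilbert_Schmidt:
  assumes \<phi>: "\<phi> \<in> L2 L"
  shows "L2_norm L (Vol \<phi>) \<le> sqrt (LINT p|lebesgue_on (Delta_xy L). (cmod (q (fst p) (snd p)))\<^sup>2) * L2_norm L \<phi>"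
proof -
  let ?k = "\<lambda>p. indicator (Delta_xy L) p *\<^sub>R (cmod (q (fst p) (snd p)))\<^sup>2 :: real"
  have D: "Delta_xy L \<in> sets borel" by (rule borel_open[OF open_Delta_xy])
  have sub: "Delta_xy L \<subseteq> closed_Delta L" by (auto simp: Delta_xy_def)
  have "bounded (Delta_xy L)"
    by (rule bounded_subset[of "cbox (0, 0) (L, L)"]) (auto simp: Delta_xy_def)
  then have fin: "emeasure lborel (Delta_xy L) < \<infinity>" by (rule emeasure_bounded_finite)
  have m: "?k \<in> borel_measurable borel"
    by (intro borel_measurable_continuous_on_indicator D continuous_intros continuous_on_subset[OF cont sub])
  have i: "integrable lborel ?k"
  proof (rule integrableI_bounded_set[where A = "Delta_xy L" and B = "M\<^sup>2"])
    show "AE p in lborel. p \<in> Delta_xy L \<longrightarrow> norm (?k p) \<le> M\<^sup>2"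
      using bound by (intro AE_I2) (auto simp: Delta_xy_def power_mono)
  qed (use D m fin in auto)
  let ?J = "\<lambda>x. LINT y|lborel. ?k (x, y)"
  have i': "integrable (lborel \<Otimes>\<^sub>M lborel) ?k" using i by (simp add: lborel_prod)
  have J: "integrable lborel ?J" using lborel_pair.integrable_fst'[OF i'] .
  have Jx: "?J x = (if x \<in> {0<..<L} then (L2_norm L (cut x))\<^sup>2 else 0)" for x
  proof -
    have "(\<lambda>y. ?k (x, y)) \<in> borel_measurable borel" using m by (rule measurable_compose[rotated]) (simp add: borel_prod[symmetric])
    then have "?J x = (LINT y|lebesgue. ?k (x, y))" by (simp add: integral_completion)
    also have "\<dots> = (LINT y|lebesgue. (if y \<in> {0<..<L} then (if x \<in> {0<..<L} then (cmod (cut x y))\<^sup>2 else 0) else 0))"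
      by (rule Bochner_Integration.integral_cong) (auto simp: Delta_xy_def indicator_def cut_def)
    also have "\<dots> = (LINT y|leb L. (if x \<in> {0<..<L} then (cmod (cut x y))\<^sup>2 else 0))"
      by (rule Lebesgue_Measure.integral_restrict_UNIV) simp
    finally show ?thesis using L2_norm_power2[of L "cut x"] by auto
  qed
  have "(LINT p|lebesgue_on (Delta_xy L). (cmod (q (fst p) (snd p)))\<^sup>2)
      = (LINT p|lebesgue. (if p \<in> Delta_xy L then (cmod (q (fst p) (snd p)))\<^sup>2 else 0))"
    by (rule Lebesgue_Measure.integral_restrict_UNIV[symmetric]) (use D in simp)
  also have "\<dots> = (LINT p|lebesgue. ?k p)"
    by (rule Bochner_Integration.integral_cong) (auto simp: indicator_def)
  also have "\<dots> = (LINT p|lborel. ?k p)" using m by (simp add: integral_completion)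
  also have "\<dots> = (LINT x|lborel. ?J x)" using lborel_pair.integral_fst'[OF i'] by (simp add: lborel_prod)
  also have "\<dots> = (LINT x|lebesgue. ?J x)" using J by (simp add: integral_completion)
  also have "\<dots> = (LINT x|leb L. (L2_norm L (cut x))\<^sup>2)"
    unfolding Jx by (rule Lebesgue_Measure.integral_restrict_UNIV) simp
  finally have HS: "(LINT p|lebesgue_on (Delta_xy L). (cmod (q (fst p) (snd p)))\<^sup>2) = (LINT x|leb L. (L2_norm L (cut x))\<^sup>2)" .
  have "integrable lebesgue ?J" using J by (simp add: integrable_completion)
  then have Ji: "integrable (leb L) (\<lambda>x. (L2_norm L (cut x))\<^sup>2)"
    unfolding Jx using Lebesgue_Measure.integrable_restrict_UNIV[of "{0<..<L}" "\<lambda>x. (L2_norm L (cut x))\<^sup>2"] by simp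
  have "(L2_norm L (Vol \<phi>))\<^sup>2 = (LINT x|leb L. (cmod (Vol \<phi> x))\<^sup>2)" by (rule L2_norm_power2)
  also have "\<dots> \<le> (LINT x|leb L. (L2_norm L (cut x))\<^sup>2 * (L2_norm L \<phi>)\<^sup>2)"
  proof (rule integral_mono)
    show "integrable (leb L) (\<lambda>x. (cmod (Vol \<phi> x))\<^sup>2)" by (rule L2_square_integrable[OF Vol_L2[OF \<phi>]])
    show "integrable (leb L) (\<lambda>x. (L2_norm L (cut x))\<^sup>2 * (L2_norm L \<phi>)\<^sup>2)" using Ji by simp
    fix x assume "x \<in> space (leb L)"
    then have "cmod (Vol \<phi> x) \<le> L2_norm L (cut x) * L2_norm L \<phi>"
      unfolding Vol_def by (intro L2_mult_le cut_mult_L2(2)[OF _ \<phi>] \<phi>) auto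
    then show "(cmod (Vol \<phi> x))\<^sup>2 \<le> (L2_norm L (cut x))\<^sup>2 * (L2_norm L \<phi>)\<^sup>2"
      unfolding power_mult_distrib[symmetric] by (rule power_mono) simp
  qed
  also have "\<dots> = (LINT x|leb L. (L2_norm L (cut x))\<^sup>2) * (L2_norm L \<phi>)\<^sup>2" by simp
  finally have "sqrt ((L2_norm L (Vol \<phi>))\<^sup>2) \<le> sqrt ((LINT x|leb L. (L2_norm L (cut x))\<^sup>2) * (L2_norm L \<phi>)\<^sup>2)"
    by (rule real_sqrt_le_mono)
  then show ?thesis unfolding HS real_sqrt_mult real_sqrt_abs by (simp add: L2_norm_nonneg)
qed

end

section \<open>Differentiation of Volterra integrals\<close>

lemma has_vector_derivative_quotient:
  "(f has_vector_derivative d) (at x within S) \<longleftrightarrow> ((\<lambda>\<xi>. (f \<xi> - f x) /\<^sub>R (\<xi> - x)) \<longlongrightarrow> d) (at x within S)"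
proof -
  have eq: "norm (f \<xi> - f x - (\<xi> - x) *\<^sub>R d) / norm (\<xi> - x) = norm ((f \<xi> - f x) /\<^sub>R (\<xi> - x) - d)" if "\<xi> \<noteq> x" for \<xi>
  proof -
    have "(f \<xi> - f x) /\<^sub>R (\<xi> - x) - d = (f \<xi> - f x - (\<xi> - x) *\<^sub>R d) /\<^sub>R (\<xi> - x)"
      using that by (simp add: scaleR_diff_right)
    then show ?thesis by (simp add: divide_inverse mult.commute)
  qed
  have "(f has_vector_derivative d) (at x within S) \<longleftrightarrow>
      ((\<lambda>\<xi>. norm (f \<xi> - f x - (\<xi> - x) *\<^sub>R d) / norm (\<xi> - x)) \<longlongrightarrow> 0) (at x within S)"
    unfolding has_vector_derivative_def has_derivative_iff_norm by (simp add: bounded_linear_scaleR_left)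
  also have "\<dots> \<longleftrightarrow> ((\<lambda>\<xi>. norm ((f \<xi> - f x) /\<^sub>R (\<xi> - x) - d)) \<longlongrightarrow> 0) (at x within S)"
    by (rule tendsto_cong, unfold eventually_at_filter, rule always_eventually) (use eq in auto)
  finally show ?thesis by (simp only: tendsto_norm_zero_iff LIM_zero_iff)
qed

text \<open>The kernel vanishes on the diagonal, so \<open>Vol \<phi>\<close> is differentiable even if \<open>\<phi>\<close> is only in \<open>L\<^sup>2\<close>.\<close>

locale volterra_C1 = volterra + dx: volterra L M qx for qx +
  assumes diag: "\<And>x. x \<in> {0..L} \<Longrightarrow> q x x = 0"
    and deriv: "\<And>x y. 0 < x \<Longrightarrow> x < y \<Longrightarrow> y < L \<Longrightarrow> ((\<lambda>\<xi>. q \<xi> y) has_vector_derivative qx x y) (at x)"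
begin

text \<open>The derivative is given at interior points only. Each section is the primitive of the
  continuous \<open>qx\<close> and is therefore differentiable within \<open>{0..y}\<close> up to
  both ends.\<close>

lemma section_deriv:
  assumes y: "0 < y" "y < L" and x: "x \<in> {0..y}"
  shows "((\<lambda>\<xi>. q \<xi> y) has_vector_derivative qx x y) (at x within {0..y})"
proof -
  have c: "continuous_on {0..y} (\<lambda>x. q x y)" "continuous_on {0..y} (\<lambda>x. qx x y)"
    using continuous_triangle_section(2)[OF cont] continuous_triangle_section(2)[OF dx.cont] y by auto
  have i: "q \<xi> y = q 0 y + integral {0..\<xi>} (\<lambda>x. qx x y)" if "\<xi> \<in> {0..y}" for \<xi>
  proof -
    have "((\<lambda>x. qx x y) has_integral (q \<xi> y - q 0 y)) {0..\<xi>}"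
      by (rule fundamental_theorem_of_calculus_interior)
        (use that y in \<open>auto intro!: deriv continuous_on_subset[OF c(1)]\<close>)
    then show ?thesis by (simp add: integral_unique)
  qed
  have "((\<lambda>\<xi>. q 0 y + integral {0..\<xi>} (\<lambda>x. qx x y)) has_vector_derivative 0 + qx x y) (at x within {0..y})"
    by (intro has_vector_derivative_add has_vector_derivative_const integral_has_vector_derivative c x)
  then have "((\<lambda>\<xi>. q 0 y + integral {0..\<xi>} (\<lambda>x. qx x y)) has_vector_derivative qx x y) (at x within {0..y})" by simp
  from has_vector_derivative_transform[OF x i this] show ?thesis .
qed

text \<open>The vanishing on the diagonal removes the jump of the truncation, which would make
  difference quotients unbounded. The estimate is what dominates these quotients in
  \<open>Vol_ac\<close>.\<close>

lemma cut_Lipschitz: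
  assumes y: "0 < y" "y < L" and x: "0 \<le> x" "x \<le> x'"
  shows "cmod (cut x' y - cut x y) \<le> M * (x' - x)"
proof -
  have base: "cmod (q b y - q a y) \<le> M * (b - a)" if "0 \<le> a" "a \<le> b" "b \<le> y" for a b
  proof -
    have "norm (q b y - q a y) \<le> M * norm (b - a)"
    proof (rule differentiable_bound[of "{a..b}" "\<lambda>x. q x y" "\<lambda>x h. h *\<^sub>R qx x y"])
      show "((\<lambda>x. q x y) has_derivative (\<lambda>h. h *\<^sub>R qx x y)) (at x within {a..b})" if "x \<in> {a..b}" for x
        unfolding has_vector_derivative_def[symmetric]
        by (rule has_vector_derivative_within_subset[OF section_deriv[OF y]]) (use that \<open>0 \<le> a\<close> \<open>b \<le> y\<close> in auto)
      show "onorm (\<lambda>h. h *\<^sub>R qx x y) \<le> M" if "x \<in> {a..b}" for x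
        using dx.bound[of x y] that \<open>0 \<le> a\<close> \<open>b \<le> y\<close> y M by (intro onorm_bound) (auto simp: mult.commute[of M] mult_left_mono)
    qed (use that in auto)
    then show ?thesis using that by simp
  qed
  have m: "0 \<le> M * (x' - x)" using M x by simp
  consider "x' < y" | "x < y" "y \<le> x'" | "y \<le> x" using x by linarith
  then show ?thesis
  proof cases
    case 1 then show ?thesis using base[of x x'] x by (simp add: cut_def)
  next
    case 2
    \<comment> \<open>The truncated kernel is 0 at \<open>x'\<close>, and so is
      \<open>q y y\<close>; the increment is thus one along the section up to the diagonal.\<close>
    have "cmod (q y y - q x y) \<le> M * (y - x)" using base[of x y] 2 x by simp
    also have "\<dots> \<le> M * (x' - x)" using 2 M by (intro mult_left_mono) auto
    finally show ?thesis using 2 diag[of y] y by (simp add: cut_def)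
  next
    case 3 then show ?thesis using m x by (simp add: cut_def)
  qed
qed

lemma cut_quotient_tendsto:
  assumes s: "\<And>n::nat. s n \<in> {0..L} - {x}" "s \<longlonglongrightarrow> x" and x: "x \<in> {0..L}" and y: "y \<in> {0<..<L}" "y \<noteq> x"
  shows "(\<lambda>n. (cut (s n) y - cut x y) / of_real (s n - x)) \<longlonglongrightarrow> dx.cut x y"
proof (cases "x < y")
  case True
  have ev: "\<forall>\<^sub>F n in sequentially. s n < y" using order_tendstoD(2)[OF s(2) True] .
  have "((\<lambda>\<xi>. q \<xi> y) has_vector_derivative qx x y) (at x within {0..y})" using section_deriv[of y x] y x True by auto
  then have lim: "((\<lambda>\<xi>. (q \<xi> y - q x y) /\<^sub>R (\<xi> - x)) \<longlongrightarrow> qx x y) (at x within {0..y})"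
    by (simp only: has_vector_derivative_quotient)
  have "filterlim s (at x within {0..y}) sequentially"
    unfolding filterlim_at using s ev by (auto elim!: eventually_mono)
  from filterlim_compose[OF lim this]
  have "(\<lambda>n. (q (s n) y - q x y) /\<^sub>R (s n - x)) \<longlonglongrightarrow> qx x y" .
  moreover have "\<forall>\<^sub>F n in sequentially. (q (s n) y - q x y) /\<^sub>R (s n - x) = (cut (s n) y - cut x y) / of_real (s n - x)"
    using ev by eventually_elim (use True in \<open>simp add: cut_def scaleR_conv_of_real divide_inverse mult.commute\<close>)
  ultimately have "(\<lambda>n. (cut (s n) y - cut x y) / of_real (s n - x)) \<longlonglongrightarrow> qx x y" by (rule Lim_transform_eventually)
  then show ?thesis using True by (simp add: dx.cut_def)
next
  case False
  then have "\<forall>\<^sub>F n in sequentially. y < s n" using order_tendstoD(1)[OF s(2), of y] y by simp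
  then have "\<forall>\<^sub>F n in sequentially. (cut (s n) y - cut x y) / of_real (s n - x) = 0"
    by eventually_elim (use False in \<open>simp add: cut_def\<close>)
  then show ?thesis using False by (simp add: dx.cut_def tendsto_eventually)
qed

theorem Vol_ac:
  assumes \<phi>: "\<phi> \<in> L2 L" shows "ac L (Vol \<phi>) (dx.Vol \<phi>)"
proof (rule ac_C1)
  show "continuous_on {0..L} (dx.Vol \<phi>)" by (rule dx.Vol_continuous[OF \<phi>])
  fix x assume x: "x \<in> {0..L}"
  have "((\<lambda>\<xi>. (Vol \<phi> \<xi> - Vol \<phi> x) /\<^sub>R (\<xi> - x)) \<longlongrightarrow> dx.Vol \<phi> x) (at x within {0..L})"
    unfolding tendsto_at_iff_sequentially
  proof (intro allI impI)
    fix s assume s: "\<forall>n. s n \<in> {0..L} - {x}" "s \<longlonglongrightarrow> x"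
    let ?c = "\<lambda>n y. (cut (s n) y - cut x y) / of_real (s n - x)"
    have sL: "s n \<in> {0..L}" "s n \<noteq> x" for n using s(1) by auto
    have "(\<lambda>n. LINT y|leb L. ?c n y * \<phi> y) \<longlonglongrightarrow> (LINT y|leb L. dx.cut x y * \<phi> y)"
    proof (rule Vol_dominated[OF \<phi>])
      show "?c n \<in> borel_measurable (leb L)" for n
        using cut_measurable[OF x] cut_measurable[OF sL(1)] by simp
      show "dx.cut x \<in> borel_measurable (leb L)" by (rule dx.cut_measurable[OF x])
      show "cmod (?c n y) \<le> M" if y: "y \<in> {0<..<L}" for n y
      proof -
        have "cmod (cut (s n) y - cut x y) \<le> M * \<bar>s n - x\<bar>"
          using cut_Lipschitz[of y x "s n"] cut_Lipschitz[of y "s n" x] y x sL(1)[of n]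
          by (cases "x \<le> s n") (auto simp: norm_minus_commute)
        then show ?thesis using sL(2)[of n] by (simp add: norm_divide divide_le_eq flip: of_real_diff)
      qed
      show "AE y in leb L. (\<lambda>n. ?c n y) \<longlonglongrightarrow> dx.cut x y"
        using AE_neq[of x] AE_space by eventually_elim (rule cut_quotient_tendsto[OF _ s(2) x], use s in auto)
    qed
    moreover have "(LINT y|leb L. ?c n y * \<phi> y) = (Vol \<phi> (s n) - Vol \<phi> x) /\<^sub>R (s n - x)" for n
    proof -
      have "(LINT y|leb L. ?c n y * \<phi> y) = (LINT y|leb L. (cut (s n) y * \<phi> y - cut x y * \<phi> y) / of_real (s n - x))"
        by (intro Bochner_Integration.integral_cong refl) (simp add: field_simps)
      also have "\<dots> = (LINT y|leb L. cut (s n) y * \<phi> y - cut x y * \<phi> y) / of_real (s n - x)" by simp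
      also have "(LINT y|leb L. cut (s n) y * \<phi> y - cut x y * \<phi> y) = Vol \<phi> (s n) - Vol \<phi> x"
        unfolding Vol_def by (intro Bochner_Integration.integral_diff Vol_integrable sL x \<phi>)
      finally show ?thesis by (simp add: scaleR_conv_of_real divide_inverse mult.commute)
    qed
    ultimately show "((\<lambda>\<xi>. (Vol \<phi> \<xi> - Vol \<phi> x) /\<^sub>R (\<xi> - x)) \<circ> s) \<longlonglongrightarrow> dx.Vol \<phi> x"
      by (simp add: comp_def dx.Vol_def)
  qed
  then show "(Vol \<phi> has_vector_derivative dx.Vol \<phi> x) (at x within {0..L})"
    by (simp only: has_vector_derivative_quotient)
qed

end

text \<open>Smoothness up to the boundary makes the kernel and its \<open>x\<close>-derivative
  continuous, hence bounded, on the compact closed triangle; \<open>M\<close> is a common bound,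
  raised to at least 1.\<close>

lemma backstepping_kernel_volterra_C1:
  assumes L: "0 < L" and bk: "backstepping_kernel L a d r ell"
  obtains M ellx where "volterra_C1 L M ell ellx"
proof -
  obtain D where D: "smooth_with_partials (closure (Delta_xy L)) (\<lambda>(x, y). ell x y) D" and diag: "\<forall>x\<in>{0..L}. ell x x = 0"
    using bk unfolding backstepping_kernel_def by blast
  have D0: "D 0 0 (x, y) = ell x y" if "(x, y) \<in> closed_Delta L" for x y
    using D that unfolding smooth_with_partials_def closure_Delta_xy[OF L] by auto
  have c: "continuous_on (closed_Delta L) (D i j)" for i j
    using D unfolding smooth_with_partials_def closure_Delta_xy[OF L] by auto
  have der: "((\<lambda>\<xi>. D 0 0 (\<xi>, y)) has_vector_derivative D 1 0 (x, y)) (at x)" if "(x, y) \<in> Delta_xy L" for x y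
  proof -
    have "(x, y) \<in> interior (closure (Delta_xy L))"
      using that interior_maximal[OF closure_subset open_Delta_xy] by blast
    then show ?thesis using D unfolding smooth_with_partials_def by auto
  qed
  have "bounded (closed_Delta L)"
    by (rule bounded_subset[of "cbox (0, 0) (L, L)"]) auto
  then have "compact (closed_Delta L)"
    using closed_closure[of "Delta_xy L"] unfolding closure_Delta_xy[OF L] by (simp add: compact_eq_bounded_closed)
  then have "bounded (D i j ` closed_Delta L)" for i j by (intro compact_imp_bounded compact_continuous_image c)
  then have bd: "\<exists>m. \<forall>p\<in>closed_Delta L. cmod (D i j p) \<le> m" for i j by (simp only: bounded_iff ball_simps)
  obtain m0 where m0: "\<forall>p\<in>closed_Delta L. cmod (D 0 0 p) \<le> m0" using bd by iprover
  obtain m1 where m1: "\<forall>p\<in>closed_Delta L. cmod (D 1 0 p) \<le> m1" using bd by iprover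
  define M where "M = max 1 (max m0 m1)"
  have cell: "continuous_on (closed_Delta L) (\<lambda>p. ell (fst p) (snd p))"
    using c[of 0 0] by (rule continuous_on_eq) (use D0 in auto)
  have "volterra_C1 L M ell (\<lambda>x y. D 1 0 (x, y))"
  proof (unfold_locales)
    show "continuous_on (closed_Delta L) (\<lambda>p. D 1 0 (fst p, snd p))" using c[of 1 0] by simp
    show "cmod (ell x y) \<le> M" if "0 \<le> x" "x \<le> y" "y \<le> L" for x y
      using bspec[OF m0, of "(x, y)"] D0[of x y] that by (auto simp: M_def)
    show "cmod (D 1 0 (x, y)) \<le> M" if "0 \<le> x" "x \<le> y" "y \<le> L" for x y
      using bspec[OF m1, of "(x, y)"] that by (auto simp: M_def)
    show "((\<lambda>\<xi>. ell \<xi> y) has_vector_derivative D 1 0 (x, y)) (at x)" if "0 < x" "x < y" "y < L" for x y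
      by (rule has_vector_derivative_transform_within_open[OF der, of _ _ "{0<..<y}"])
        (use that in \<open>auto intro!: D0 simp: Delta_xy_def\<close>)
  qed (use L diag cell in \<open>auto simp: M_def\<close>)
  then show thesis by (rule that)
qed

subsection \<open>Orbits of the semigroup\<close>

lemma eventually_pos: "0 < t \<Longrightarrow> \<forall>\<^sub>F s in at (t::real). 0 < s"
  by (rule order_tendstoD(1)[OF tendsto_ident_at])

lemma square_tendsto_zero:
  fixes f :: "real \<Rightarrow> real"
  assumes "((\<lambda>s. (f s)\<^sup>2) \<longlongrightarrow> 0) F" shows "(f \<longlongrightarrow> 0) F"
  using tendsto_real_sqrt[OF assms] by (simp add: tendsto_rabs_zero_iff)

lemma filterlim_minus_within: "filterlim (\<lambda>s. s - \<epsilon>) (at (t - \<epsilon>) within {0..T - \<epsilon>}) (at t within {\<epsilon>..T::real})"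
  "filterlim (\<lambda>s. s - \<epsilon>) (at (t - \<epsilon>) within {0..}) (at t within {\<epsilon>..})"
  unfolding filterlim_at by (auto intro!: tendsto_intros simp: eventually_at_filter)

lemma at_within_ge: "\<epsilon> < t \<Longrightarrow> at t within {\<epsilon>..} = at (t::real)"
  by (rule at_within_interior) simp

lemma continuous_measurable_leb:
  fixes f :: "real \<Rightarrow> 'b::euclidean_space"
  assumes "\<And>t. 0 < t \<Longrightarrow> isCont f t" shows "f \<in> borel_measurable (leb T)"
  by (rule continuous_imp_measurable_on_sets_lebesgue)
    (use assms in \<open>auto intro: continuous_at_imp_continuous_on\<close>)

lemma L2_norm_isCont:
  fixes t :: real
  assumes "\<And>s. 0 < s \<Longrightarrow> g s \<in> L2 L" "0 < t" "((\<lambda>s. L2_norm L (\<lambda>x. g s x - g t x)) \<longlongrightarrow> 0) (at t)"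
  shows "isCont (\<lambda>s. L2_norm L (g s)) t"
proof -
  have "((\<lambda>s. L2_norm L (g s) - L2_norm L (g t)) \<longlongrightarrow> 0) (at t)"
  proof (rule Lim_null_comparison[OF _ assms(3)])
    have "\<forall>\<^sub>F s in at t. 0 < s"
      by (rule eventually_pos[OF assms(2)])
    then show "\<forall>\<^sub>F s in at t. norm (L2_norm L (g s) - L2_norm L (g t)) \<le> L2_norm L (\<lambda>x. g s x - g t x)"
      by eventually_elim (use L2_norm_diff_ge assms(1,2) in auto)
  qed
  then show ?thesis unfolding isCont_def by (simp only: LIM_zero_iff)
qed

text \<open>For each \<open>t > 0\<close>, \<open>z t\<close> is the image of \<open>S t w\<close>
  under \<open>A\<close>, and \<open>p0 t\<close> to \<open>p3 t\<close> represent
  \<open>S t w\<close> and its derivatives, chosen time by time. The choice brings no regularity in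
  \<open>t\<close>; that is recovered from the estimates for differences.\<close>

locale kdv_orbit = kdv_semigroup +
  fixes w :: "real \<Rightarrow> complex" and z p0 p1 p2 p3 :: "real \<Rightarrow> real \<Rightarrow> complex"
  assumes w: "w \<in> L2 L"
    and gen_z: "\<And>t. 0 < t \<Longrightarrow> generates (S t w) (z t)"
    and rep: "\<And>t. 0 < t \<Longrightarrow> dom_rep (p0 t) (p1 t) (p2 t) (p3 t)"
    and S_p0: "\<And>t. 0 < t \<Longrightarrow> AE x in leb L. S t w x = p0 t x"
    and z_Ap: "\<And>t. 0 < t \<Longrightarrow> AE x in leb L. z t x = Ap (p1 t) (p2 t) (p3 t) x"
    and B1_le: "\<And>t. 0 < t \<Longrightarrow> B1 (z t) (S t w) \<le> - \<beta> / 2 * (cmod (p1 t 0))\<^sup>2 - \<beta> * (L2_norm L (p1 t))\<^sup>2 + K * (L2_norm L (S t w))\<^sup>2"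
begin

lemma z_L2: "0 < t \<Longrightarrow> z t \<in> L2 L"
  by (rule generates_L2(2)[OF gen_z])

lemma S_w_L2: "0 \<le> t \<Longrightarrow> S t w \<in> L2 L"
  by (rule S_L2[OF _ w])

text \<open>Restarting at a time \<epsilon> > 0 puts the initial value into the domain, so the orbit
  of \<open>w\<close> inherits what is known for orbits starting there.\<close>

lemma S_w_split:
  assumes "0 < \<epsilon>" "\<epsilon> \<le> t"
  shows "AE x in leb L. S t w x = S (t - \<epsilon>) (S \<epsilon> w) x" "AE x in leb L. z t x = S (t - \<epsilon>) (z \<epsilon>) x"
proof -
  show e: "AE x in leb L. S t w x = S (t - \<epsilon>) (S \<epsilon> w) x" using S_add[of "t - \<epsilon>" \<epsilon> w] assms w by simp
  have "generates (S (t - \<epsilon>) (S \<epsilon> w)) (S (t - \<epsilon>) (z \<epsilon>))"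
    using assms by (intro generates_S gen_z) auto
  then have "generates (S t w) (S (t - \<epsilon>) (z \<epsilon>))"
    by (rule generates_AE) (use assms e S_w_L2[of t] in auto)
  then show "AE x in leb L. z t x = S (t - \<epsilon>) (z \<epsilon>) x"
    using generates_unique[OF gen_z] assms by auto
qed

lemma z_continuous:
  assumes t: "0 < t" shows "((\<lambda>s. L2_norm L (\<lambda>x. z s x - z t x)) \<longlongrightarrow> 0) (at t)"
proof -
  define \<epsilon> where "\<epsilon> = t / 2"
  have \<epsilon>: "0 < \<epsilon>" "\<epsilon> < t" using t by (auto simp: \<epsilon>_def)
  note z\<epsilon> = z_L2[OF \<epsilon>(1)]
  have "((\<lambda>s. L2_norm L (\<lambda>x. S (s - \<epsilon>) (z \<epsilon>) x - S (t - \<epsilon>) (z \<epsilon>) x)) \<longlongrightarrow> 0) (at t within {\<epsilon>..})"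
    by (rule filterlim_compose[OF S_continuous[OF z\<epsilon>] filterlim_minus_within(2)]) (use \<epsilon> in simp)
  moreover have "\<forall>\<^sub>F s in at t within {\<epsilon>..}. L2_norm L (\<lambda>x. S (s - \<epsilon>) (z \<epsilon>) x - S (t - \<epsilon>) (z \<epsilon>) x) = L2_norm L (\<lambda>x. z s x - z t x)"
    unfolding eventually_at_filter
  proof (intro always_eventually allI impI)
    fix s assume "s \<in> {\<epsilon>..}"
    then have s: "\<epsilon> \<le> s" by simp
    show "L2_norm L (\<lambda>x. S (s - \<epsilon>) (z \<epsilon>) x - S (t - \<epsilon>) (z \<epsilon>) x) = L2_norm L (\<lambda>x. z s x - z t x)"
    proof (rule L2_norm_cong_AE)
      show "AE x in leb L. S (s - \<epsilon>) (z \<epsilon>) x - S (t - \<epsilon>) (z \<epsilon>) x = z s x - z t x"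
        using S_w_split(2)[OF \<epsilon>(1) s] S_w_split(2)[OF \<epsilon>(1) less_imp_le[OF \<epsilon>(2)]] by eventually_elim simp
    qed (intro L2_measurable L2_diff z_L2 S_L2 z\<epsilon>; use s \<epsilon> in simp)+
  qed
  ultimately have "((\<lambda>s. L2_norm L (\<lambda>x. z s x - z t x)) \<longlongrightarrow> 0) (at t within {\<epsilon>..})" by (rule Lim_transform_eventually)
  then show ?thesis by (simp only: at_within_ge[OF \<epsilon>(2)])
qed

lemma S_w_continuous:
  assumes t: "0 < t" shows "((\<lambda>s. L2_norm L (\<lambda>x. S s w x - S t w x)) \<longlongrightarrow> 0) (at t)"
  using S_continuous[OF w, of t] t by (simp add: at_within_ge)

text \<open>The domain is linear: the difference of two points of the orbit is again a
  \<open>dom_rep\<close>, to which \<open>H1_bound\<close> and \<open>trace_bound\<close>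
  apply.\<close>

lemma p_diff_le:
  assumes "0 < s" "0 < t"
  shows "\<beta> * (L2_norm L (\<lambda>x. p1 s x - p1 t x))\<^sup>2 \<le> K * (L2_norm L (\<lambda>x. S s w x - S t w x))\<^sup>2
        + (1 + L) * L2_norm L (\<lambda>x. z s x - z t x) * L2_norm L (\<lambda>x. S s w x - S t w x)"
    "\<beta> / 2 * (cmod (p1 s 0 - p1 t 0))\<^sup>2 \<le> L2_norm L (\<lambda>x. z s x - z t x) * L2_norm L (\<lambda>x. S s w x - S t w x)"
proof -
  note d = dom_rep_diff[OF rep[OF assms(1)] rep[OF assms(2)]]
  note l = dom_rep_L2[OF d(1)]
  have "AE x in leb L. p0 s x - p0 t x = S s w x - S t w x"
    using S_p0[OF assms(1)] S_p0[OF assms(2)] by eventually_elim simp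
  then have n0: "L2_norm L (\<lambda>x. p0 s x - p0 t x) = L2_norm L (\<lambda>x. S s w x - S t w x)"
    by (rule L2_norm_cong_AE[rotated 2]) (intro L2_measurable l L2_diff S_w_L2; use assms in simp)+
  have "AE x in leb L. Ap (\<lambda>x. p1 s x - p1 t x) (\<lambda>x. p2 s x - p2 t x) (\<lambda>x. p3 s x - p3 t x) x = z s x - z t x"
    using z_Ap[OF assms(1)] z_Ap[OF assms(2)] by eventually_elim (simp only: d(2))
  then have nA: "L2_norm L (Ap (\<lambda>x. p1 s x - p1 t x) (\<lambda>x. p2 s x - p2 t x) (\<lambda>x. p3 s x - p3 t x)) = L2_norm L (\<lambda>x. z s x - z t x)"
    by (rule L2_norm_cong_AE[rotated 2]) (intro L2_measurable l L2_diff z_L2 assms)+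
  show "\<beta> * (L2_norm L (\<lambda>x. p1 s x - p1 t x))\<^sup>2 \<le> K * (L2_norm L (\<lambda>x. S s w x - S t w x))\<^sup>2
        + (1 + L) * L2_norm L (\<lambda>x. z s x - z t x) * L2_norm L (\<lambda>x. S s w x - S t w x)"
    using H1_bound[OF d(1)] by (simp only: n0 nA)
  show "\<beta> / 2 * (cmod (p1 s 0 - p1 t 0))\<^sup>2 \<le> L2_norm L (\<lambda>x. z s x - z t x) * L2_norm L (\<lambda>x. S s w x - S t w x)"
    using trace_bound[OF d(1)] by (simp only: n0 nA)
qed

lemma p1_continuous:
  assumes t: "0 < t"
  shows "((\<lambda>s. L2_norm L (\<lambda>x. p1 s x - p1 t x)) \<longlongrightarrow> 0) (at t)" "isCont (\<lambda>s. p1 s 0) t"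
proof -
  let ?a = "\<lambda>s. L2_norm L (\<lambda>x. S s w x - S t w x)" and ?b = "\<lambda>s. L2_norm L (\<lambda>x. z s x - z t x)"
  have "((\<lambda>s. (K * (?a s)\<^sup>2 + (1 + L) * ?b s * ?a s) / \<beta>) \<longlongrightarrow> (K * 0\<^sup>2 + (1 + L) * 0 * 0) / \<beta>) (at t)"
    by (intro tendsto_intros S_w_continuous z_continuous t) (use \<beta> in simp)
  then have "((\<lambda>s. (K * (?a s)\<^sup>2 + (1 + L) * ?b s * ?a s) / \<beta>) \<longlongrightarrow> 0) (at t)" by simp
  then have "((\<lambda>s. (L2_norm L (\<lambda>x. p1 s x - p1 t x))\<^sup>2) \<longlongrightarrow> 0) (at t)"
  proof (rule Lim_null_comparison[rotated])
    show "\<forall>\<^sub>F s in at t. norm ((L2_norm L (\<lambda>x. p1 s x - p1 t x))\<^sup>2) \<le> (K * (?a s)\<^sup>2 + (1 + L) * ?b s * ?a s) / \<beta>"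
      using eventually_pos[OF t] by eventually_elim (use p_diff_le(1) t \<beta> in \<open>simp add: le_divide_eq mult.commute[of _ \<beta>]\<close>)
  qed
  then show "((\<lambda>s. L2_norm L (\<lambda>x. p1 s x - p1 t x)) \<longlongrightarrow> 0) (at t)" by (rule square_tendsto_zero)
  have "((\<lambda>s. ?b s * ?a s / (\<beta> / 2)) \<longlongrightarrow> 0 * 0 / (\<beta> / 2)) (at t)"
    by (intro tendsto_intros S_w_continuous z_continuous t) (use \<beta> in simp)
  then have "((\<lambda>s. ?b s * ?a s / (\<beta> / 2)) \<longlongrightarrow> 0) (at t)" by simp
  then have "((\<lambda>s. (cmod (p1 s 0 - p1 t 0))\<^sup>2) \<longlongrightarrow> 0) (at t)"
  proof (rule Lim_null_comparison[rotated])
    show "\<forall>\<^sub>F s in at t. norm ((cmod (p1 s 0 - p1 t 0))\<^sup>2) \<le> ?b s * ?a s / (\<beta> / 2)"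
      using eventually_pos[OF t]
    proof eventually_elim
      case (elim s)
      then show ?case using p_diff_le(2)[OF elim t] \<beta> by (simp add: le_divide_eq mult.commute[of _ \<beta>])
    qed
  qed
  then have "((\<lambda>s. cmod (p1 s 0 - p1 t 0)) \<longlongrightarrow> 0) (at t)" by (rule square_tendsto_zero)
  then show "isCont (\<lambda>s. p1 s 0) t" unfolding isCont_def by (simp only: tendsto_norm_zero_iff LIM_zero_iff)
qed

lemma p1_L2: "0 < t \<Longrightarrow> p1 t \<in> L2 L"
  by (rule dom_rep_L2(2)[OF rep])

section \<open>Kato's integral bound along an orbit\<close>

definition dissipation :: "real \<Rightarrow> real" where
  "dissipation t = \<beta> / 2 * (cmod (p1 t 0))\<^sup>2 + \<beta> * (L2_norm L (p1 t))\<^sup>2"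

lemma dissipation_isCont: "0 < t \<Longrightarrow> isCont dissipation t"
  unfolding dissipation_def[abs_def]
  by (intro continuous_intros p1_continuous(2) L2_norm_isCont[OF p1_L2 _ p1_continuous(1)])

lemma dissipation_nonneg: "0 \<le> dissipation t"
  using \<beta> by (simp add: dissipation_def)

lemma S_w_deriv:
  assumes \<epsilon>: "0 < \<epsilon>" and t: "t \<in> {\<epsilon>..T}"
  shows "has_L2_deriv L (\<lambda>s. S s w) (z t) t {\<epsilon>..T}"
proof -
  let ?w = "S \<epsilon> w" and ?d = "S (t - \<epsilon>) (z \<epsilon>)"
  have "has_L2_deriv L (\<lambda>s. S s ?w) ?d (t - \<epsilon>) {0..T - \<epsilon>}"
    by (rule S_has_L2_deriv[OF gen_z[OF \<epsilon>]]) (use t in auto)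
  from filterlim_compose[OF this[unfolded has_L2_deriv_def] filterlim_minus_within(1)]
  have "((\<lambda>s. L2_norm L (\<lambda>x. (S (s - \<epsilon>) ?w x - S (t - \<epsilon>) ?w x) / of_real (s - \<epsilon> - (t - \<epsilon>)) - ?d x)) \<longlongrightarrow> 0) (at t within {\<epsilon>..T})" .
  moreover have "\<forall>\<^sub>F s in at t within {\<epsilon>..T}. L2_norm L (\<lambda>x. (S (s - \<epsilon>) ?w x - S (t - \<epsilon>) ?w x) / of_real (s - \<epsilon> - (t - \<epsilon>)) - ?d x)
      = L2_norm L (\<lambda>x. (S s w x - S t w x) / of_real (s - t) - z t x)"
    unfolding eventually_at_filter
  proof (intro always_eventually allI impI)
    fix s assume "s \<in> {\<epsilon>..T}"
    then have s: "\<epsilon> \<le> s" by simp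
    have t': "\<epsilon> \<le> t" using t by simp
    have q: "(\<lambda>x. (f x - g x) / c - d x) \<in> L2 L" if "f \<in> L2 L" "g \<in> L2 L" "d \<in> L2 L" for f g d c
      using L2_diff[OF L2_scale[OF L2_diff[OF that(1,2)], of "inverse c"] that(3)] by (simp add: divide_inverse mult.commute)
    show "L2_norm L (\<lambda>x. (S (s - \<epsilon>) ?w x - S (t - \<epsilon>) ?w x) / of_real (s - \<epsilon> - (t - \<epsilon>)) - ?d x)
      = L2_norm L (\<lambda>x. (S s w x - S t w x) / of_real (s - t) - z t x)"
    proof (rule L2_norm_cong_AE)
      show "AE x in leb L. (S (s - \<epsilon>) ?w x - S (t - \<epsilon>) ?w x) / of_real (s - \<epsilon> - (t - \<epsilon>)) - ?d x = (S s w x - S t w x) / of_real (s - t) - z t x"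
        using S_w_split(1)[OF \<epsilon> s] S_w_split[OF \<epsilon> t'] by eventually_elim simp
    qed (intro L2_measurable q z_L2 S_L2 w; use s t' \<epsilon> in simp)+
  qed
  ultimately show ?thesis unfolding has_L2_deriv_def by (rule Lim_transform_eventually)
qed

text \<open>Half the weighted energy plus the dissipation spent so far grows at a rate of at most
  \<open>K |w|^2\<close>. The orbit is known to be differentiable only at positive times; hence the
  start at \<epsilon>, with a bound that does not depend on \<epsilon>.\<close>

lemma dissipation_integral_le:
  assumes \<epsilon>: "0 < \<epsilon>" "\<epsilon> < T"
  shows "integral {\<epsilon>..T} dissipation \<le> ((1 + L) / 2 + K * T) * (L2_norm L w)\<^sup>2"
proof -
  interpret B1: bform L B1 "1 + L" by (rule bform_B1)
  let ?E = "\<lambda>t. B1 (S t w) (S t w)" and ?N = "(L2_norm L w)\<^sup>2"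
  \<comment> \<open>With the admissible growth subtracted, the derivative is nonpositive at every
    time, in particular at the intermediate time that compares \<open>?F T\<close> with
    \<open>?F \<epsilon>\<close>.\<close>
  let ?F = "\<lambda>t. integral {\<epsilon>..t} dissipation + ?E t / 2 - K * ?N * t"
  have c: "continuous_on {\<epsilon>..T} dissipation"
    using \<epsilon> by (intro continuous_at_imp_continuous_on ballI dissipation_isCont) auto
  have "(?F has_real_derivative dissipation t + (B1 (z t) (S t w) + B1 (z t) (S t w)) / 2 - K * ?N) (at t within {\<epsilon>..T})"
    if t: "t \<in> {\<epsilon>..T}" for t
  proof -
    have "((\<lambda>t. integral {\<epsilon>..t} dissipation) has_real_derivative dissipation t) (at t within {\<epsilon>..T})"
      using integral_has_vector_derivative[OF c t] by (simp add: has_real_derivative_iff_has_vector_derivative)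
    moreover have "(?E has_real_derivative B1 (z t) (S t w) + B1 (z t) (S t w)) (at t within {\<epsilon>..T})"
      by (rule B1.deriv) (use t \<epsilon> in \<open>auto intro!: S_w_L2 z_L2 S_w_deriv\<close>)
    ultimately show ?thesis by (auto intro!: derivative_eq_intros)
  qed
  from DERIV_le_imp[OF \<epsilon>(2) this] obtain t where t: "\<epsilon> < t" "t < T"
    "?F T - ?F \<epsilon> = (T - \<epsilon>) * (dissipation t + (B1 (z t) (S t w) + B1 (z t) (S t w)) / 2 - K * ?N)" .
  have "L2_norm L (S s w) \<le> L2_norm L w" if "0 \<le> s" for s by (rule S_contraction[OF that w])
  then have S: "(L2_norm L (S s w))\<^sup>2 \<le> ?N" if "0 \<le> s" for s using that by (intro power_mono) auto
  have "dissipation t + (B1 (z t) (S t w) + B1 (z t) (S t w)) / 2 - K * ?N \<le> 0" (is "?X \<le> 0")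
    using B1_le[of t] mult_left_mono[OF S[of t] K_nonneg] t \<epsilon> unfolding dissipation_def by simp
  then have "(T - \<epsilon>) * ?X \<le> 0" using \<epsilon> by (intro mult_nonneg_nonpos) simp_all
  then have "?F T \<le> ?F \<epsilon>" unfolding t(3)[symmetric] by simp
  then have "integral {\<epsilon>..T} dissipation \<le> ?E \<epsilon> / 2 - ?E T / 2 + K * ?N * T - K * ?N * \<epsilon>" by simp
  moreover have "?E \<epsilon> \<le> (1 + L) * ?N"
  proof -
    have "?E \<epsilon> \<le> (1 + L) * (L2_norm L (S \<epsilon> w))\<^sup>2"
      using B1.B_le[of "S \<epsilon> w" "S \<epsilon> w"] S_w_L2[of \<epsilon>] \<epsilon> by (simp add: power2_eq_square mult.assoc)
    also have "\<dots> \<le> (1 + L) * ?N" using L \<epsilon> by (intro mult_left_mono S) auto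
    finally show ?thesis .
  qed
  moreover have "0 \<le> ?E T" by (rule B1_nonneg)
  moreover have "0 \<le> K * ?N * \<epsilon>" using K_nonneg \<epsilon> by simp
  moreover have "((1 + L) / 2 + K * T) * ?N = (1 + L) * ?N / 2 + K * ?N * T"
    by (simp add: field_simps)
  ultimately show ?thesis by linarith
qed

text \<open>Monotone convergence as the starting time tends to 0: the dissipation is nonnegative and
  the bound uniform.\<close>

lemma dissipation_integrable:
  assumes T: "0 < T" shows "integrable (leb T) dissipation"
proof -
  \<comment> \<open>\<open>n + 2\<close> keeps the starting time strictly below \<open>T\<close>
    already for \<open>n = 0\<close>.\<close>
  define \<epsilon> where "\<epsilon> n = T / real (n + 2)" for n
  have \<epsilon>: "0 < \<epsilon> n" "\<epsilon> n < T" for n using T by (auto simp: \<epsilon>_def divide_less_eq)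
  have dec: "\<epsilon> n \<le> \<epsilon> m" if "m \<le> n" for m n using T that by (auto simp: \<epsilon>_def intro!: divide_left_mono)
  have "(\<lambda>n. T / real (n + 2)) \<longlonglongrightarrow> 0"
    using LIMSEQ_ignore_initial_segment[OF lim_const_over_n[of T], of 2] by simp
  then have lim: "\<epsilon> \<longlonglongrightarrow> 0" by (simp add: \<epsilon>_def[abs_def])
  let ?f = "\<lambda>n t. if \<epsilon> n < t then dissipation t else 0"
  let ?C = "((1 + L) / 2 + K * T) * (L2_norm L w)\<^sup>2"
  have int: "integrable (leb T) (?f n)" for n
  proof -
    have "continuous_on {\<epsilon> n..} dissipation"
      using \<epsilon>(1)[of n] by (intro continuous_at_imp_continuous_on ballI dissipation_isCont) auto
    \<comment> \<open>Freezing the argument at \<open>\<epsilon> n\<close> gives a function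
      continuous on \<open>{0..T}\<close>, although the dissipation may be unbounded near 0.\<close>
    moreover have "continuous_on {0..T} (max (\<epsilon> n))" by (intro continuous_intros)
    ultimately have "continuous_on {0..T} (\<lambda>t. dissipation (max (\<epsilon> n) t))" by (rule continuous_on_compose2) auto
    then have "continuous_on {0..T} (\<lambda>t. complex_of_real (dissipation (max (\<epsilon> n) t)))" by (rule continuous_on_of_real)
    from integrable_Re[OF L2_integrable[OF continuous_L2[OF this]]]
    have "integrable (leb T) (\<lambda>t. dissipation (max (\<epsilon> n) t))" by simp
    from cut_right_integrable[OF this, of "\<epsilon> n"] \<epsilon>[of n]
    have "integrable (leb T) (\<lambda>t. if \<epsilon> n < t then dissipation (max (\<epsilon> n) t) else 0)" by auto
    then show ?thesis by (rule Bochner_Integration.integrable_cong[THEN iffD1, rotated 2]) auto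
  qed
  have le: "(LINT t|leb T. ?f n t) \<le> ?C" for n
  proof -
    have c: "continuous_on {\<epsilon> n..T} dissipation"
      using \<epsilon>(1)[of n] by (intro continuous_at_imp_continuous_on ballI dissipation_isCont) auto
    then have "dissipation absolutely_integrable_on {\<epsilon> n..T}" by (rule absolutely_integrable_continuous_real)
    then have "dissipation absolutely_integrable_on {\<epsilon> n<..<T}" by (rule set_integrable_subset) auto
    then have i: "integrable (lebesgue_on {\<epsilon> n<..<T}) dissipation" by (rule absolutely_integrable_imp_integrable) simp
    have "(LINT t|leb T. ?f n t) = (LINT t|lebesgue_on {\<epsilon> n<..<T}. dissipation t)"
      by (rule LINT_cut_right) (use \<epsilon>[of n] in auto)
    also have "\<dots> = integral {\<epsilon> n<..<T} dissipation" by (rule lebesgue_integral_eq_integral[OF i]) simp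
    also have "\<dots> = integral {\<epsilon> n..T} dissipation" by (rule integral_open_interval_real[symmetric])
    also have "\<dots> \<le> ?C" by (rule dissipation_integral_le[OF \<epsilon>])
    finally show ?thesis .
  qed
  have mono: "?f m t \<le> ?f n t" if "m \<le> n" for m n t
    using dec[OF that] dissipation_nonneg[of t] by auto
  have inc: "incseq (\<lambda>n. LINT t|leb T. ?f n t)"
    by (intro incseq_SucI integral_mono int mono) simp
  obtain I where I: "(\<lambda>n. LINT t|leb T. ?f n t) \<longlonglongrightarrow> I" "\<forall>n. (LINT t|leb T. ?f n t) \<le> I"
    by (rule incseq_convergent[OF inc allI[OF le]])
  show ?thesis
  proof (rule integrable_monotone_convergence[OF int _ _ I(1)])
    show "AE t in leb T. mono (\<lambda>n. ?f n t)" using mono by (intro AE_I2 monoI) auto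
    show "AE t in leb T. (\<lambda>n. ?f n t) \<longlonglongrightarrow> dissipation t"
    proof (rule AE_I2)
      fix t assume "t \<in> space (leb T)"
      then have "\<forall>\<^sub>F n in sequentially. \<epsilon> n < t" using order_tendstoD(2)[OF lim, of t] by simp
      then have "\<forall>\<^sub>F n in sequentially. ?f n t = dissipation t" by eventually_elim simp
      then show "(\<lambda>n. ?f n t) \<longlonglongrightarrow> dissipation t" by (rule tendsto_eventually)
    qed
    show "dissipation \<in> borel_measurable (leb T)" by (rule continuous_measurable_leb[OF dissipation_isCont])
  qed
qed

end

text \<open>Regularisation supplies the data at each positive time, and choice assembles them into
  functions of \<open>t\<close>.\<close>

lemma (in kdv_semigroup) orbit_exists:
  assumes w: "w \<in> L2 L"
  obtains z p0 p1 p2 p3 where "kdv_orbit L \<alpha> \<beta> \<delta> S w z p0 p1 p2 p3"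
proof -
  define Q where "Q t z p0 p1 p2 p3 \<longleftrightarrow> generates (S t w) z \<and> dom_rep p0 p1 p2 p3 \<and> (AE x in leb L. S t w x = p0 x) \<and>
      (AE x in leb L. z x = Ap p1 p2 p3 x) \<and>
      B1 z (S t w) \<le> - \<beta> / 2 * (cmod (p1 0))\<^sup>2 - \<beta> * (L2_norm L p1)\<^sup>2 + K * (L2_norm L (S t w))\<^sup>2" for t z p0 p1 p2 p3
  have "\<forall>t. \<exists>z p0 p1 p2 p3. 0 < t \<longrightarrow> Q t z p0 p1 p2 p3"
  proof
    fix t
    show "\<exists>z p0 p1 p2 p3. 0 < t \<longrightarrow> Q t z p0 p1 p2 p3"
    proof (cases "0 < t")
      case True
      obtain z where z: "generates (S t w) z" by (rule S_regularizes[OF w True])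
      show ?thesis by (rule generates_inner[OF z]) (use z in \<open>unfold Q_def, blast\<close>)
    qed simp
  qed
  then obtain z p0 p1 p2 p3 where "\<forall>t. 0 < t \<longrightarrow> Q t (z t) (p0 t) (p1 t) (p2 t) (p3 t)"
    unfolding choice_iff by (elim exE) (rule that)
  note * = this[unfolded Q_def]
  have "kdv_orbit L \<alpha> \<beta> \<delta> S w z p0 p1 p2 p3"
    by (intro kdv_orbit.intro kdv_semigroup_axioms kdv_orbit_axioms.intro w) (use * in \<open>blast+\<close>)
  then show thesis by (rule that)
qed

subsection \<open>The closed loop\<close>

text \<open>\<open>H1_norm\<close> refers to the chosen \<open>wderiv\<close>; uniqueness of weak
  derivatives lets the derivative of any absolutely continuous representative compute it.\<close>

lemma H1_norm_ac:
  assumes L: "0 < L" and F: "ac L F g" and f: "f \<in> L2 L" "AE x in leb L. f x = F x"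
  shows "f \<in> sobolev L 1" "H1_norm L f = sqrt ((L2_norm L f)\<^sup>2 + (L2_norm L g)\<^sup>2)"
proof -
  note g = ac_L2[OF F] ac_weak_deriv[OF L F f]
  have "\<exists>g\<in>L2 L. weak_deriv L j f g" if "j \<le> 1" for j
  proof -
    have "j = 0 \<or> j = 1" using that by linarith
    then show ?thesis using f(1) g weak_deriv_0 by blast
  qed
  then show "f \<in> sobolev L 1" using f(1) unfolding sobolev_def by blast
  have "L2_norm L (wderiv L 1 f) = L2_norm L g"
    by (rule L2_norm_cong_AE[OF L2_measurable[OF wderivI(1)[OF g]] L2_measurable[OF g(1)] wderiv_AE[OF L g]])
  then show "H1_norm L f = sqrt ((L2_norm L f)\<^sup>2 + (L2_norm L g)\<^sup>2)" unfolding H1_norm_def by simp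
qed

locale closed_loop = kdv_orbit L \<alpha> \<beta> \<delta> S w z p0 p1 p2 p3 + V: volterra_C1 L M q qx
  for L \<alpha> \<beta> \<delta> S w z p0 p1 p2 p3 M q qx +
  fixes r :: real
  assumes r: "0 \<le> r"
begin

abbreviation decay :: "real \<Rightarrow> complex" where
  "decay t \<equiv> of_real (exp (- r * t))"

definition u :: "real \<Rightarrow> real \<Rightarrow> complex" where
  "u t = inv_I_minus_Upsilon L q (\<lambda>x. decay t * S t w x)"

lemma cmod_decay: "0 \<le> t \<Longrightarrow> cmod (decay t) \<le> 1" "cmod (decay t) = exp (- r * t)"
  using r by (auto simp: mult_nonneg_nonneg)

lemma decay_diff_le:
  assumes "f \<in> L2 L" "g \<in> L2 L" "0 \<le> s"
  shows "L2_norm L (\<lambda>x. decay s * f x - decay t * g x) \<le> L2_norm L (\<lambda>x. f x - g x) + cmod (decay s - decay t) * L2_norm L g"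
proof -
  have "L2_norm L (\<lambda>x. decay s * f x - decay t * g x) = L2_norm L (\<lambda>x. decay s * (f x - g x) + (decay s - decay t) * g x)"
    by (simp add: algebra_simps)
  also have "\<dots> \<le> L2_norm L (\<lambda>x. decay s * (f x - g x)) + L2_norm L (\<lambda>x. (decay s - decay t) * g x)"
    by (intro L2_norm_triangle L2_scale L2_diff assms)
  also have "\<dots> = cmod (decay s) * L2_norm L (\<lambda>x. f x - g x) + cmod (decay s - decay t) * L2_norm L g"
    by (simp only: L2_norm_scale)
  also have "cmod (decay s) * L2_norm L (\<lambda>x. f x - g x) \<le> 1 * L2_norm L (\<lambda>x. f x - g x)"
    by (intro mult_right_mono cmod_decay assms) simp
  finally show ?thesis by simp
qed

lemma decay_tendsto: "((\<lambda>s. cmod (decay s - decay t)) \<longlongrightarrow> 0) (at t within X)"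
proof -
  have "((\<lambda>s. cmod (decay s - decay t)) \<longlongrightarrow> cmod (decay t - decay t)) (at t within X)"
    by (intro tendsto_intros)
  then show ?thesis by simp
qed

lemma source_L2: "0 \<le> t \<Longrightarrow> (\<lambda>x. decay t * S t w x) \<in> L2 L"
  by (intro L2_scale S_w_L2)

lemma u_L2: "0 \<le> t \<Longrightarrow> u t \<in> L2 L"
  unfolding u_def by (intro V.inv_V source_L2)

lemma u_eq: "0 \<le> t \<Longrightarrow> AE x in leb L. u t x - V.Vol (u t) x = decay t * S t w x"
  unfolding u_def by (intro V.inv_V source_L2)

lemma u_le: assumes t: "0 \<le> t" shows "L2_norm L (u t) \<le> op_norm L (inv_I_minus_Upsilon L q) * (exp (- r * t) * L2_norm L w)"
proof -
  have "L2_norm L (u t) \<le> op_norm L (inv_I_minus_Upsilon L q) * L2_norm L (\<lambda>x. decay t * S t w x)"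
    unfolding u_def by (intro V.op_norm_inv_V source_L2 t)
  also have "L2_norm L (\<lambda>x. decay t * S t w x) \<le> exp (- r * t) * L2_norm L w"
    unfolding L2_norm_scale cmod_decay(2) by (intro mult_left_mono S_contraction t w) simp
  finally show ?thesis using V.op_norm_inv_V(1) by (simp add: mult_left_mono)
qed

definition C where "C = op_norm L (inv_I_minus_Upsilon L q) * L2_norm L w"

lemma C_nonneg: "0 \<le> C"
  unfolding C_def by (intro mult_nonneg_nonneg V.op_norm_inv_V(1)) simp

lemma u_le_C: assumes t: "0 \<le> t" shows "L2_norm L (u t) \<le> C"
proof -
  have "exp (- r * t) * L2_norm L w \<le> 1 * L2_norm L w" using r t by (intro mult_right_mono) auto
  then have "op_norm L (inv_I_minus_Upsilon L q) * (exp (- r * t) * L2_norm L w) \<le> C"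
    unfolding C_def by (intro mult_left_mono V.op_norm_inv_V(1)) simp
  then show ?thesis using u_le[OF t] by linarith
qed

lemma u_diff_le:
  assumes "0 \<le> s" "0 \<le> t"
  shows "L2_norm L (\<lambda>x. u s x - u t x)
    \<le> op_norm L (inv_I_minus_Upsilon L q) * (L2_norm L (\<lambda>x. S s w x - S t w x) + cmod (decay s - decay t) * L2_norm L (S t w))"
proof -
  have "L2_norm L (\<lambda>x. u s x - u t x) = L2_norm L (inv_I_minus_Upsilon L q (\<lambda>x. decay s * S s w x - decay t * S t w x))"
  proof (rule L2_norm_cong_AE)
    show "AE x in leb L. u s x - u t x = inv_I_minus_Upsilon L q (\<lambda>x. decay s * S s w x - decay t * S t w x) x"
      using V.inv_V_comb[OF source_L2[OF assms(1)] source_L2[OF assms(2)], of 1] unfolding u_def by eventually_elim simp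
  qed (intro L2_measurable L2_diff u_L2 V.inv_V source_L2 assms)+
  also have "\<dots> \<le> op_norm L (inv_I_minus_Upsilon L q) * L2_norm L (\<lambda>x. decay s * S s w x - decay t * S t w x)"
    by (intro V.op_norm_inv_V L2_diff source_L2 assms)
  also have "L2_norm L (\<lambda>x. decay s * S s w x - decay t * S t w x)
      \<le> L2_norm L (\<lambda>x. S s w x - S t w x) + cmod (decay s - decay t) * L2_norm L (S t w)"
    by (intro decay_diff_le S_w_L2 assms)
  finally show ?thesis using V.op_norm_inv_V(1) by (simp add: mult_left_mono)
qed

lemma u_tendsto:
  assumes t: "0 \<le> t" shows "((\<lambda>s. L2_norm L (\<lambda>x. u s x - u t x)) \<longlongrightarrow> 0) (at t within {0..})"
proof (rule Lim_null_comparison)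
  let ?b = "\<lambda>s. op_norm L (inv_I_minus_Upsilon L q) * (L2_norm L (\<lambda>x. S s w x - S t w x) + cmod (decay s - decay t) * L2_norm L (S t w))"
  show "\<forall>\<^sub>F s in at t within {0..}. norm (L2_norm L (\<lambda>x. u s x - u t x)) \<le> ?b s"
    unfolding eventually_at_filter by (intro always_eventually allI impI) (use u_diff_le t in auto)
  have "(?b \<longlongrightarrow> op_norm L (inv_I_minus_Upsilon L q) * (0 + 0 * L2_norm L (S t w))) (at t within {0..})"
    by (intro tendsto_intros S_continuous w t decay_tendsto)
  then show "(?b \<longlongrightarrow> 0) (at t within {0..})" by simp
qed

lemma u_tendsto_at: "0 < t \<Longrightarrow> ((\<lambda>s. L2_norm L (\<lambda>x. u s x - u t x)) \<longlongrightarrow> 0) (at t)"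
  using u_tendsto[of t] by (simp add: at_within_ge)

text \<open>The continuous representative of \<open>u t\<close>, read off from
  \<open>u = w + Vol u\<close> with \<open>p0\<close> standing for the orbit; \<open>U'\<close> is
  its derivative by \<open>Vol_ac\<close>.\<close>

definition U :: "real \<Rightarrow> real \<Rightarrow> complex" where
  "U t x = decay t * p0 t x + V.Vol (u t) x"

definition U' :: "real \<Rightarrow> real \<Rightarrow> complex" where
  "U' t x = decay t * p1 t x + V.dx.Vol (u t) x"

lemma p0_ac: "0 < t \<Longrightarrow> ac L (p0 t) (p1 t)" and p1_ac: "0 < t \<Longrightarrow> ac L (p1 t) (p2 t)" and p0_0: "0 < t \<Longrightarrow> p0 t 0 = 0"
  using rep[unfolded dom_rep_def] by simp_all

lemma U_ac: "0 < t \<Longrightarrow> ac L (U t) (U' t)"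
  unfolding U_def[abs_def] U'_def[abs_def] by (intro ac_add ac_scale p0_ac V.Vol_ac u_L2 less_imp_le)

lemma u_U: assumes t: "0 < t" shows "AE x in leb L. u t x = U t x"
  using u_eq[OF less_imp_le[OF t]] S_p0[OF t] by eventually_elim (simp add: U_def algebra_simps)

lemma U'_continuous: "0 < t \<Longrightarrow> continuous_on {0..L} (U' t)"
  unfolding U'_def[abs_def] by (intro continuous_intros ac_continuous[OF p1_ac] V.dx.Vol_continuous u_L2 less_imp_le)

lemma U'_L2: "0 < t \<Longrightarrow> U' t \<in> L2 L"
  by (rule continuous_L2[OF U'_continuous])

lemma u_weak_deriv: "0 < t \<Longrightarrow> weak_deriv L 1 (u t) (U' t)"
  by (rule ac_weak_deriv[OF L U_ac u_L2 u_U]) simp_all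

text \<open>The orbit contributes \<open>p0 t 0 = 0\<close>, and at \<open>x = 0\<close> the
  truncation leaves the kernel untouched on \<open>(0, L)\<close>.\<close>

lemma u_trace: assumes t: "0 < t" shows "has_trace L (u t) 0 (feedback L q u t)"
proof (rule has_traceI[OF ac_continuous[OF U_ac[OF t]] u_U[OF t]])
  have "V.Vol (u t) 0 = feedback L q u t"
    unfolding V.Vol_def feedback_def by (rule Bochner_Integration.integral_cong) (auto simp: V.cut_def)
  then show "U t 0 = feedback L q u t" by (simp add: U_def p0_0[OF t])
qed

lemma u_derivative_trace: "0 < t \<Longrightarrow> has_trace L (U' t) 0 (U' t 0)"
  by (rule has_traceI[OF U'_continuous]) auto

text \<open>The two bounds yield continuity in time of the derivative in \<open>L2\<close> and of
  its trace. The Volterra part needs only the \<open>L2\<close> distance of \<open>u s\<close> and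
  \<open>u t\<close>, even for the trace, since it is bounded pointwise by it.\<close>

lemma U'_diff:
  assumes "0 < s" "0 < t"
  shows "L2_norm L (\<lambda>x. U' s x - U' t x) \<le> L2_norm L (\<lambda>x. p1 s x - p1 t x) + cmod (decay s - decay t) * L2_norm L (p1 t)
      + M * L * L2_norm L (\<lambda>x. u s x - u t x)"
    "cmod (U' s 0 - U' t 0) \<le> cmod (decay s * p1 s 0 - decay t * p1 t 0) + M * sqrt L * L2_norm L (\<lambda>x. u s x - u t x)"
proof -
  note u = u_L2[OF less_imp_le[OF assms(1)]] u_L2[OF less_imp_le[OF assms(2)]]
  let ?d = "\<lambda>x. u s x - u t x"
  note ud = L2_diff[OF u]
  have eq: "U' s x - U' t x = (decay s * p1 s x - decay t * p1 t x) + V.dx.Vol ?d x" if "x \<in> {0..L}" for x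
    unfolding U'_def V.dx.Vol_diff[OF u that] by simp
  have pd: "(\<lambda>x. decay s * p1 s x - decay t * p1 t x) \<in> L2 L" by (intro L2_diff L2_scale p1_L2 assms)
  have "L2_norm L (\<lambda>x. U' s x - U' t x) = L2_norm L (\<lambda>x. (decay s * p1 s x - decay t * p1 t x) + V.dx.Vol ?d x)"
    by (intro L2_norm_cong_AE L2_measurable L2_diff[OF U'_L2[OF assms(1)] U'_L2[OF assms(2)]] L2_add pd V.dx.Vol_L2 ud AE_I2 eq) simp
  also have "\<dots> \<le> L2_norm L (\<lambda>x. decay s * p1 s x - decay t * p1 t x) + L2_norm L (V.dx.Vol ?d)"
    by (intro L2_norm_triangle pd V.dx.Vol_L2 ud)
  also have "L2_norm L (\<lambda>x. decay s * p1 s x - decay t * p1 t x)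
      \<le> L2_norm L (\<lambda>x. p1 s x - p1 t x) + cmod (decay s - decay t) * L2_norm L (p1 t)"
    by (rule decay_diff_le) (use assms p1_L2 in auto)
  also have "L2_norm L (V.dx.Vol ?d) \<le> M * L * L2_norm L ?d" by (rule V.dx.Vol_norm_le[OF ud])
  finally show "L2_norm L (\<lambda>x. U' s x - U' t x) \<le> L2_norm L (\<lambda>x. p1 s x - p1 t x) + cmod (decay s - decay t) * L2_norm L (p1 t)
      + M * L * L2_norm L ?d" by simp
  have z: "0 \<in> {0..L}" using L by simp
  show "cmod (U' s 0 - U' t 0) \<le> cmod (decay s * p1 s 0 - decay t * p1 t 0) + M * sqrt L * L2_norm L ?d"
    unfolding eq[OF z] using norm_triangle_ineq[of "decay s * p1 s 0 - decay t * p1 t 0" "V.dx.Vol ?d 0"] V.dx.Vol_le[OF z ud] by linarith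
qed

lemma U'_tendsto:
  assumes t: "0 < t"
  shows "((\<lambda>s. L2_norm L (\<lambda>x. U' s x - U' t x)) \<longlongrightarrow> 0) (at t)" "isCont (\<lambda>s. U' s 0) t"
proof -
  show "((\<lambda>s. L2_norm L (\<lambda>x. U' s x - U' t x)) \<longlongrightarrow> 0) (at t)"
  proof (rule Lim_null_comparison)
    let ?b = "\<lambda>s. L2_norm L (\<lambda>x. p1 s x - p1 t x) + cmod (decay s - decay t) * L2_norm L (p1 t)
      + M * L * L2_norm L (\<lambda>x. u s x - u t x)"
    show "\<forall>\<^sub>F s in at t. norm (L2_norm L (\<lambda>x. U' s x - U' t x)) \<le> ?b s"
      using eventually_pos[OF t]
    proof eventually_elim
      case (elim s) then show ?case using U'_diff(1)[OF elim t] by simp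
    qed
    have "(?b \<longlongrightarrow> 0 + 0 * L2_norm L (p1 t) + M * L * 0) (at t)"
      by (intro tendsto_intros p1_continuous decay_tendsto u_tendsto_at t)
    then show "(?b \<longlongrightarrow> 0) (at t)" by simp
  qed
  have "((\<lambda>s. U' s 0 - U' t 0) \<longlongrightarrow> 0) (at t)"
  proof (rule Lim_null_comparison)
    let ?b = "\<lambda>s. cmod (decay s * p1 s 0 - decay t * p1 t 0) + M * sqrt L * L2_norm L (\<lambda>x. u s x - u t x)"
    show "\<forall>\<^sub>F s in at t. norm (U' s 0 - U' t 0) \<le> ?b s"
      using eventually_pos[OF t] by eventually_elim (rule U'_diff(2)[OF _ t])
    have "(?b \<longlongrightarrow> cmod (decay t * p1 t 0 - decay t * p1 t 0) + M * sqrt L * 0) (at t)"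
      by (intro tendsto_intros u_tendsto_at t isContD[OF p1_continuous(2)])
    then show "(?b \<longlongrightarrow> 0) (at t)" by simp
  qed
  then show "isCont (\<lambda>s. U' s 0) t" unfolding isCont_def by (simp only: LIM_zero_iff)
qed

lemma U'_le:
  assumes t: "0 < t"
  shows "L2_norm L (U' t) \<le> L2_norm L (p1 t) + M * L * C" "cmod (U' t 0) \<le> cmod (p1 t 0) + M * sqrt L * C"
proof -
  note ut = u_L2[OF less_imp_le[OF t]]
  have uc: "L2_norm L (u t) \<le> C" using u_le_C t by simp
  have "L2_norm L (U' t) \<le> L2_norm L (\<lambda>x. decay t * p1 t x) + L2_norm L (V.dx.Vol (u t))"
    unfolding U'_def[abs_def] by (intro L2_norm_triangle L2_scale p1_L2 t V.dx.Vol_L2 ut)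
  also have "L2_norm L (\<lambda>x. decay t * p1 t x) \<le> 1 * L2_norm L (p1 t)"
    unfolding L2_norm_scale by (intro mult_right_mono cmod_decay) (use t in auto)
  also have "L2_norm L (V.dx.Vol (u t)) \<le> M * L * L2_norm L (u t)" by (rule V.dx.Vol_norm_le[OF ut])
  also have "\<dots> \<le> M * L * C" using uc V.M L by (intro mult_left_mono) auto
  finally show "L2_norm L (U' t) \<le> L2_norm L (p1 t) + M * L * C" by simp
  have "cmod (U' t 0) \<le> cmod (decay t * p1 t 0) + cmod (V.dx.Vol (u t) 0)"
    unfolding U'_def by (rule norm_triangle_ineq)
  also have "cmod (decay t * p1 t 0) \<le> 1 * cmod (p1 t 0)"
    unfolding norm_mult by (intro mult_right_mono cmod_decay) (use t in auto)
  also have "cmod (V.dx.Vol (u t) 0) \<le> M * sqrt L * L2_norm L (u t)" by (rule V.dx.Vol_le[OF _ ut]) (use L in simp)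
  also have "\<dots> \<le> M * sqrt L * C" using uc V.M L by (intro mult_left_mono) auto
  finally show "cmod (U' t 0) \<le> cmod (p1 t 0) + M * sqrt L * C" by simp
qed

text \<open>Serves the trace of the derivative, the norm of the derivative and the norm of
  \<open>u\<close>. Each is continuous for \<open>t > 0\<close>, hence measurable, and bounded by a
  share of the dissipation, possibly none, plus a constant.\<close>

lemma square_integrable_by_dissipation:
  assumes T: "0 < T" and f: "\<And>t. 0 < t \<Longrightarrow> isCont f t" and c: "0 < c"
    and le: "\<And>t. 0 < t \<Longrightarrow> 0 \<le> f t \<and> f t \<le> a t + b" "\<And>t. c * (a t)\<^sup>2 \<le> dissipation t"
  shows "integrable (leb T) (\<lambda>t. (f t)\<^sup>2)"
proof (rule Bochner_Integration.integrable_bound)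
  interpret finite_measure "leb T" by (rule finite_measure_leb)
  show "integrable (leb T) (\<lambda>t. 2 / c * dissipation t + 2 * b\<^sup>2)"
    using dissipation_integrable[OF T] by simp
  show "(\<lambda>t. (f t)\<^sup>2) \<in> borel_measurable (leb T)"
    by (intro continuous_measurable_leb continuous_intros f)
  show "AE t in leb T. norm ((f t)\<^sup>2) \<le> norm (2 / c * dissipation t + 2 * b\<^sup>2)"
  proof (rule AE_I2)
    fix t assume "t \<in> space (leb T)"
    then have t: "0 < t" by simp
    have "(f t)\<^sup>2 \<le> (a t + b)\<^sup>2" using le(1)[OF t] by (intro power_mono) auto
    also have "\<dots> \<le> 2 * (a t)\<^sup>2 + 2 * b\<^sup>2" using sum_squares_ge_zero[of "a t - b" 0] by (simp add: power2_eq_square algebra_simps)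
    also have "(a t)\<^sup>2 \<le> dissipation t / c" using le(2)[of t] c by (simp add: le_divide_eq mult.commute)
    finally have "(f t)\<^sup>2 \<le> 2 / c * dissipation t + 2 * b\<^sup>2" by simp
    then show "norm ((f t)\<^sup>2) \<le> norm (2 / c * dissipation t + 2 * b\<^sup>2)" by simp
  qed
qed

lemma U'_0_L2: assumes T: "0 < T" shows "(\<lambda>t. U' t 0) \<in> L2 T"
proof -
  have "integrable (leb T) (\<lambda>t. (cmod (U' t 0))\<^sup>2)"
    by (rule square_integrable_by_dissipation[OF T, of _ "\<beta> / 2" "\<lambda>t. cmod (p1 t 0)" "M * sqrt L * C"])
      (use \<beta> U'_le(2) in \<open>auto simp: dissipation_def intro!: continuous_intros U'_tendsto\<close>)
  moreover have "(\<lambda>t. U' t 0) \<in> borel_measurable (leb T)" by (rule continuous_measurable_leb[OF U'_tendsto(2)])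
  ultimately show ?thesis by (simp add: L2_def)
qed

lemma u_H1:
  assumes t: "0 < t"
  shows "u t \<in> sobolev L 1" "(H1_norm L (u t))\<^sup>2 = (L2_norm L (u t))\<^sup>2 + (L2_norm L (U' t))\<^sup>2"
  using H1_norm_ac[OF L U_ac[OF t] u_L2 u_U[OF t]] t by simp_all

lemma u_H1_diff:
  assumes "0 < s" "0 < t"
  shows "H1_norm L (\<lambda>x. u s x - u t x) = sqrt ((L2_norm L (\<lambda>x. u s x - u t x))\<^sup>2 + (L2_norm L (\<lambda>x. U' s x - U' t x))\<^sup>2)"
proof (rule H1_norm_ac(2)[OF L ac_diff[OF U_ac[OF assms(1)] U_ac[OF assms(2)]]])
  show "(\<lambda>x. u s x - u t x) \<in> L2 L" using assms by (intro L2_diff u_L2) auto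
  show "AE x in leb L. u s x - u t x = U s x - U t x"
    using u_U[OF assms(1)] u_U[OF assms(2)] by eventually_elim simp
qed

lemma u_H1_continuous:
  assumes t: "0 < t" shows "isCont (\<lambda>s. H1_norm L (\<lambda>x. u s x - u t x)) t" "H1_norm L (\<lambda>x. u t x - u t x) = 0"
proof -
  show 0: "H1_norm L (\<lambda>x. u t x - u t x) = 0" unfolding u_H1_diff[OF t t] by (simp add: L2_norm_zero)
  have "((\<lambda>s. sqrt ((L2_norm L (\<lambda>x. u s x - u t x))\<^sup>2 + (L2_norm L (\<lambda>x. U' s x - U' t x))\<^sup>2)) \<longlongrightarrow> sqrt (0\<^sup>2 + 0\<^sup>2)) (at t)"
    by (intro tendsto_intros u_tendsto_at U'_tendsto t)
  moreover have "\<forall>\<^sub>F s in at t. sqrt ((L2_norm L (\<lambda>x. u s x - u t x))\<^sup>2 + (L2_norm L (\<lambda>x. U' s x - U' t x))\<^sup>2) = H1_norm L (\<lambda>x. u s x - u t x)"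
    using eventually_pos[OF t] by eventually_elim (rule u_H1_diff[OF _ t, symmetric])
  ultimately have "((\<lambda>s. H1_norm L (\<lambda>x. u s x - u t x)) \<longlongrightarrow> sqrt (0\<^sup>2 + 0\<^sup>2)) (at t)" by (rule Lim_transform_eventually)
  then show "isCont (\<lambda>s. H1_norm L (\<lambda>x. u s x - u t x)) t" unfolding isCont_def 0 by simp
qed

text \<open>Sampling times for the Bochner approximation: \<open>u\<close> is continuous into
  \<open>H\<^sup>1\<close> at positive times, so sampling it gives simple functions converging to
  it. Rounding up keeps the samples away from time 0, where \<open>u\<close> need not be in
  \<open>H\<^sup>1\<close>; the value \<open>T\<close> outside \<open>(0, T)\<close> is there
  because \<open>L2_H1\<close> wants all values of the simple functions in
  \<open>sobolev L 1\<close>.\<close>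

definition grid :: "real \<Rightarrow> nat \<Rightarrow> real \<Rightarrow> real" where
  "grid T n t = (if t \<in> {0<..<T} then T * (real_of_int \<lfloor>real (Suc n) * t / T\<rfloor> + 1) / real (Suc n) else T)"

lemma grid:
  assumes T: "0 < T"
  shows "0 < grid T n t" "t \<in> {0<..<T} \<Longrightarrow> \<bar>grid T n t - t\<bar> \<le> T / real (Suc n)" "simple_function (leb T) (grid T n)"
proof -
  let ?m = "real (Suc n)"
  show "0 < grid T n t"
  proof (cases "t \<in> {0<..<T}")
    case True
    then have "0 \<le> \<lfloor>?m * t / T\<rfloor>" using T by simp
    then have "0 < real_of_int \<lfloor>?m * t / T\<rfloor> + 1" by linarith
    then have "0 < T * (real_of_int \<lfloor>?m * t / T\<rfloor> + 1) / ?m" using T by (intro divide_pos_pos mult_pos_pos) auto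
    then show ?thesis using True by (simp only: grid_def if_True)
  qed (use T in \<open>auto simp: grid_def\<close>)
  show "\<bar>grid T n t - t\<bar> \<le> T / ?m" if t: "t \<in> {0<..<T}"
  proof -
    let ?k = "real_of_int \<lfloor>?m * t / T\<rfloor>"
    have k: "?k \<le> ?m * t / T" "?m * t / T < ?k + 1" by linarith+
    have e: "grid T n t - t = T / ?m * (?k + 1 - ?m * t / T)"
    proof -
      have "T * (k + 1) / m - t = T / m * (k + 1 - m * t / T)" if "m \<noteq> 0" for k m :: real
        using that T by (simp add: field_simps)
      from this[of ?m ?k] show ?thesis using t by (simp add: grid_def)
    qed
    have "T / ?m * (?k + 1 - ?m * t / T) \<le> T / ?m * 1" using k T by (intro mult_left_mono) auto
    moreover have "0 \<le> T / ?m * (?k + 1 - ?m * t / T)" using k T by (intro mult_nonneg_nonneg) auto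
    ultimately show ?thesis unfolding e by linarith
  qed
  have "grid T n ` space (leb T) \<subseteq> (\<lambda>k. T * (real_of_int k + 1) / ?m) ` {0..int (Suc n)}"
  proof clarify
    fix t assume "t \<in> space (leb T)"
    then have t: "t \<in> {0<..<T}" by simp
    have "?m * t / T \<le> ?m" using t T by (simp add: divide_le_eq)
    then have "\<lfloor>?m * t / T\<rfloor> \<le> int (Suc n)" by linarith
    moreover have "0 \<le> \<lfloor>?m * t / T\<rfloor>" using t by simp
    ultimately show "grid T n t \<in> (\<lambda>k. T * (real_of_int k + 1) / ?m) ` {0..int (Suc n)}" using t by (auto simp: grid_def)
  qed
  then have "finite (grid T n ` space (leb T))" by (rule finite_subset) simp
  moreover have "grid T n \<in> borel_measurable (leb T)"
  proof -
    have id: "(\<lambda>t. t) \<in> borel_measurable (leb T)"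
      by (rule continuous_imp_measurable_on_sets_lebesgue) (auto intro: continuous_intros)
    have "(\<lambda>t. T * (real_of_int \<lfloor>?m * t / T\<rfloor> + 1) / ?m) \<in> borel_measurable (leb T)"
      by (rule measurable_compose[OF id]) measurable
    then show ?thesis by (rule measurable_cong[THEN iffD1, rotated]) (auto simp: grid_def)
  qed
  ultimately show "simple_function (leb T) (grid T n)" by (simp add: simple_function_borel_measurable)
qed

lemma grid_tendsto:
  assumes T: "0 < T" and t: "t \<in> {0<..<T}" shows "(\<lambda>n. grid T n t) \<longlonglongrightarrow> t"
proof -
  have "(\<lambda>n. grid T n t - t) \<longlonglongrightarrow> 0"
  proof (rule Lim_null_comparison)
    show "\<forall>\<^sub>F n in sequentially. norm (grid T n t - t) \<le> T / real (Suc n)" using grid(2)[OF T t] by simp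
    show "(\<lambda>n. T / real (Suc n)) \<longlonglongrightarrow> 0" using LIMSEQ_Suc[OF lim_const_over_n[of T]] by simp
  qed
  then show ?thesis by (simp only: LIM_zero_iff)
qed

theorem u_C_L2: "u \<in> C_L2 T L"
proof -
  have "u t \<in> L2 L \<and> ((\<lambda>\<tau>. L2_norm L (\<lambda>x. u \<tau> x - u t x)) \<longlongrightarrow> 0) (at t within {0..T})" if "t \<in> {0..T}" for t
    using that by (intro conjI u_L2 tendsto_within_subset[OF u_tendsto]) auto
  then show ?thesis by (simp add: C_L2_def)
qed

theorem u_L2_H1: assumes T: "0 < T" shows "u \<in> L2_H1 T L"
  unfolding L2_H1_def mem_Collect_eq
proof (intro conjI exI[of _ "\<lambda>n t. u (grid T n t)"] allI)
  show "AE t in leb T. u t \<in> sobolev L 1" by (rule AE_I2) (use u_H1 in simp)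
  show "simple_function (leb T) (\<lambda>t. u (grid T n t))" for n
    using simple_function_compose[OF grid(3)[OF T], of u n] by (simp add: comp_def)
  show "u (grid T n t) \<in> sobolev L 1" for n t by (intro u_H1 grid T)
  show "AE t in leb T. (\<lambda>n. H1_norm L (\<lambda>x. u (grid T n t) x - u t x)) \<longlonglongrightarrow> 0"
  proof (rule AE_I2)
    fix t assume "t \<in> space (leb T)"
    then have t: "0 < t" "t \<in> {0<..<T}" by auto
    from isCont_tendsto_compose[OF u_H1_continuous(1)[OF t(1)] grid_tendsto[OF T t(2)]]
    show "(\<lambda>n. H1_norm L (\<lambda>x. u (grid T n t) x - u t x)) \<longlonglongrightarrow> 0" unfolding u_H1_continuous(2)[OF t(1)] .
  qed
  have U: "integrable (leb T) (\<lambda>t. (L2_norm L (U' t))\<^sup>2)"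
    by (rule square_integrable_by_dissipation[OF T, of _ \<beta> "\<lambda>t. L2_norm L (p1 t)" "M * L * C"])
      (use \<beta> U'_le(1) in \<open>auto simp: dissipation_def intro!: L2_norm_isCont U'_L2 U'_tendsto\<close>)
  \<comment> \<open>\<open>u\<close> is bounded in \<open>L2\<close>, so its share of the
    dissipation is taken to be 0.\<close>
  have "integrable (leb T) (\<lambda>t. (L2_norm L (u t))\<^sup>2)"
    by (rule square_integrable_by_dissipation[OF T, of _ \<beta> "\<lambda>t. 0" C])
      (use \<beta> u_le_C dissipation_nonneg in \<open>auto intro!: L2_norm_isCont u_L2 u_tendsto_at\<close>)
  from Bochner_Integration.integrable_add[OF this U]
  show "integrable (leb T) (\<lambda>t. (H1_norm L (u t))\<^sup>2)"
    by (rule Bochner_Integration.integrable_cong[THEN iffD1, rotated 2]) (auto simp: u_H1(2))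
qed

end

theorem theorem1p7:
  fixes L T \<alpha> \<beta> \<delta> r :: real
    and u0 :: "real \<Rightarrow> complex"
    and ell :: "real \<Rightarrow> real \<Rightarrow> complex"
    and S :: "real \<Rightarrow> (real \<Rightarrow> complex) \<Rightarrow> real \<Rightarrow> complex"
  assumes "L > 0" and "T > 0" and "\<beta> > 0" and "r > 0" and "\<delta> \<ge> 0"
    and "u0 \<in> L2 L"
    and "backstepping_kernel L (\<alpha> / \<beta>) (\<delta> / \<beta>) (r / \<beta>) ell"
    and "semigroup_generated_by_A L \<alpha> \<beta> \<delta> S"
  shows "c_kernel L ell \<ge> 0 \<and>
    (\<exists>u. mild_solution L r S ell {0..} u0 u \<and>
       (\<forall>v. mild_solution L r S ell {0..T} u0 v \<longrightarrow>
          (\<forall>t\<in>{0..T}. AE x in leb L. v t x = u t x)) \<and>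
       u \<in> C_L2 T L \<and> u \<in> L2_H1 T L \<and>
       (AE t in leb T. has_trace L (u t) 0 (feedback L ell u t)) \<and>
       (\<exists>h\<in>L2 T. AE t in leb T.
          \<exists>v\<in>L2 L. weak_deriv L 1 (u t) v \<and> has_trace L v 0 (h t)) \<and>
       (\<forall>t\<ge>0. L2_norm L (u t) \<le> c_kernel L ell * L2_norm L u0 * exp (- r * t)))"
proof -
  obtain M ellx where V: "volterra_C1 L M ell ellx"
    by (rule backstepping_kernel_volterra_C1[OF assms(1,7)])
  interpret V: volterra_C1 L M ell ellx by (rule V)
  interpret kdv_semigroup L \<alpha> \<beta> \<delta> S using assms by unfold_locales auto
  define w where "w = I_minus_Upsilon L ell u0"
  have w_eq: "w x = u0 x - V.Vol u0 x" if "x \<in> {0<..<L}" for x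
    using that by (simp add: w_def I_minus_Upsilon_def V.Upsilon_eq_Vol)
  have d: "(\<lambda>x. u0 x - V.Vol u0 x) \<in> L2 L" by (intro L2_diff V.Vol_L2 assms(6))
  have wm: "w \<in> borel_measurable (leb L)"
    using L2_measurable[OF d] by (rule measurable_cong[THEN iffD1, rotated]) (simp add: w_eq)
  have w: "w \<in> L2 L" by (rule L2_bound(1)[OF d wm, of 1]) (auto intro!: AE_I2 simp: w_eq)
  let ?N = "op_norm L (inv_I_minus_Upsilon L ell)"
  let ?H = "sqrt (LINT p|lebesgue_on (Delta_xy L). (cmod (ell (fst p) (snd p)))\<^sup>2)"
  have H: "0 \<le> ?H" by (simp add: integral_nonneg_AE)
  \<comment> \<open>The origin of the second factor of \<open>c_kernel\<close>; the first, the norm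
    of the inverse, enters through \<open>cl.u_le\<close>.\<close>
  have wn: "L2_norm L w \<le> (1 + ?H) * L2_norm L u0"
  proof -
    have "L2_norm L w = L2_norm L (\<lambda>x. u0 x - V.Vol u0 x)"
      by (rule L2_norm_cong_AE[OF wm L2_measurable[OF d]]) (auto intro!: AE_I2 simp: w_eq)
    also have "\<dots> \<le> L2_norm L u0 + L2_norm L (V.Vol u0)" by (intro L2_norm_triangle_sub V.Vol_L2 assms(6))
    also have "L2_norm L (V.Vol u0) \<le> ?H * L2_norm L u0" by (rule V.Vol_Hilbert_Schmidt[OF assms(6)])
    finally show ?thesis by (simp add: distrib_right)
  qed
  obtain z p0 p1 p2 p3 where orbit: "kdv_orbit L \<alpha> \<beta> \<delta> S w z p0 p1 p2 p3" by (rule orbit_exists[OF w])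
  interpret cl: closed_loop L \<alpha> \<beta> \<delta> S w z p0 p1 p2 p3 M ell ellx r
    using assms(4) by (intro closed_loop.intro orbit V closed_loop_axioms.intro) simp
  have mild: "mild_solution L r S ell {0..} u0 cl.u"
    unfolding mild_solution_def w_def[symmetric] V.I_minus_Upsilon_AE using cl.u_L2 cl.u_eq by simp
  show ?thesis
  proof (intro conjI exI[of _ cl.u])
    show "c_kernel L ell \<ge> 0" unfolding c_kernel_def using V.op_norm_inv_V(1) H by simp
    show "mild_solution L r S ell {0..} u0 cl.u" by (rule mild)
    \<comment> \<open>At each time both functions solve the same equation for
      \<open>I - \<Upsilon>\<close>, so uniqueness is its injectivity, one time at a time.\<close>
    show "\<forall>v. mild_solution L r S ell {0..T} u0 v \<longrightarrow> (\<forall>t\<in>{0..T}. AE x in leb L. v t x = cl.u t x)"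
    proof (intro allI impI ballI)
      fix v t assume v: "mild_solution L r S ell {0..T} u0 v" and t: "t \<in> {0..T}"
      have "v t \<in> L2 L" "AE x in leb L. v t x - V.Vol (v t) x = of_real (exp (- r * t)) * S t w x"
        using v t unfolding mild_solution_def w_def[symmetric] V.I_minus_Upsilon_AE by auto
      then show "AE x in leb L. v t x = cl.u t x"
        using V.inv_V_unique[of "v t" "cl.u t" "\<lambda>x. of_real (exp (- r * t)) * S t w x"] cl.u_L2[of t] cl.u_eq[of t] t by auto
    qed
    show "cl.u \<in> C_L2 T L" by (rule cl.u_C_L2)
    show "cl.u \<in> L2_H1 T L" by (rule cl.u_L2_H1[OF assms(2)])
    show "AE t in leb T. has_trace L (cl.u t) 0 (feedback L ell cl.u t)"
      by (rule AE_I2) (auto intro: cl.u_trace)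
    \<comment> \<open>The witness is the value at 0 of \<open>U'\<close>, the derivative that is
      continuous up to the boundary.\<close>
    show "\<exists>h\<in>L2 T. AE t in leb T. \<exists>v\<in>L2 L. weak_deriv L 1 (cl.u t) v \<and> has_trace L v 0 (h t)"
    proof (rule bexI[OF AE_I2 cl.U'_0_L2[OF assms(2)]])
      fix t assume "t \<in> space (leb T)"
      then have "0 < t" by simp
      then show "\<exists>v\<in>L2 L. weak_deriv L 1 (cl.u t) v \<and> has_trace L v 0 (cl.U' t 0)"
        using cl.U'_L2 cl.u_weak_deriv cl.u_derivative_trace by blast
    qed
    show "\<forall>t\<ge>0. L2_norm L (cl.u t) \<le> c_kernel L ell * L2_norm L u0 * exp (- r * t)"
    proof (intro allI impI)
      fix t :: real assume t: "0 \<le> t"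
      have "L2_norm L (cl.u t) \<le> ?N * (exp (- r * t) * L2_norm L w)" by (rule cl.u_le[OF t])
      also have "\<dots> \<le> ?N * (exp (- r * t) * ((1 + ?H) * L2_norm L u0))"
        by (intro mult_left_mono wn V.op_norm_inv_V(1)) simp
      also have "\<dots> = c_kernel L ell * L2_norm L u0 * exp (- r * t)" by (simp only: c_kernel_def mult_ac)
      finally show "L2_norm L (cl.u t) \<le> c_kernel L ell * L2_norm L u0 * exp (- r * t)" .
    qed
  qed
qed

end
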